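(* Let $\mathcal Q$ be a collection of homogeneous complete geodesic metric spaces (each of cardinality at most continuum). Then the following hold. (1) There exists a universal $\mathcal Q$-tree. (2) Every $\mathcal Q$-tree of cardinality at most continuum embeds isometrically into a universal $\mathcal Q$-tree. (3) Every two universal $\mathcal Q$-trees are isometric.
   Context: A metric space is homogeneous if its isometry group acts transitively on it; it is geodesic if any two points are joined by a geodesic. Open intervals are written $]a,b[$. Tree-graded spaces. Let $S$ be a complete geodesic metric space and $\mathcal P$ a collection of closed geodesic non-empty subsets, called pieces. $S$ is tree-graded with respect to $\mathcal P$ if $(T_1)$ every two different pieces have at most one common point, and $(T_2)$ every non-trivial simple geodesic triangle (a simple loop composed of three geodesics) in $S$ is contained in one piece. $\mathcal P$ may be empty. $\mathcal Q$-trees. A $\mathcal Q$-tree is a geodesic metric space $S$ that is tree-graded with respect to a (fixed) collection of pieces each of which is isometric to an element of $\mathcal Q$. Isometric elements of $\mathcal Q$ are identified. Canonical isometries. For every $Q\in\mathcal Q$ fix a set $D(Q)$ of orbit representatives of the diagonal action of $\mathrm{Isom}(Q)$ on $Q\times Q$ and a set $E(Q)$ of orbit representatives of the action of $\mathrm{Isom}(Q)$ on $Q$. For every piece $P$ of a $\mathcal Q$-tree and $(x,y)\in P\times P$ (resp. $x\in P$) choose $Q\in\mathcal Q$ and an isometry $\iota:P\to Q$ with $(\iota(x),\iota(y))\in D(Q)$ (resp. $\iota(x)\in E(Q)$); this is the canonical isometry associated to $(P,x,y)$ (resp. $(P,x)$). If the canonical isometry associated to $(P,x)$ maps $P$ to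 $Q$ and $x$ to $y\in E(Q)$, then $P$ is called a $(Q,y)$-piece at $x$. Types. A $\mathcal Q$-type is a pair $(U,f)$ where $U=\bigsqcup_{\alpha\in A}]a_\alpha,b_\alpha[\subset ]0,\infty[$ is a (possibly empty) disjoint union of bounded intervals with $a_\alpha,b_\alpha>0$, and $f$ assigns to each interval $]a_\alpha,b_\alpha[$ a pair $(p,q)\in D(Q)$ for some $Q\in\mathcal Q$ with $\mathrm{dist}(p,q)=b_\alpha-a_\alpha$. An initial subtype of $(U,f)$ is $(U_0,f_0)$ with $U_0=U\cap]0,r[$ for some $r>0$, $r\notin U$, and $f_0=f|_{U_0}$. Two $\mathcal Q$-types are equivalent if they have equal initial subtypes corresponding to the same $r>0$. Let $\Theta$ be the set of all equivalence classes of $\mathcal Q$-types. Limit components. Let $s$ be a point of a $\mathcal Q$-tree $S$, $C$ a connected component of $S\setminus\{s\}$, and $\gamma:[0,r]\to C\cup\{s\}$ any (nontrivial) geodesic parameterized by length with $\gamma(0)=s$. If there is a piece $P$ such that $P\cap\gamma$ is a nontrivial initial subsegment of $\gamma$, then $C$ is a non-limit component; otherwise $C$ is a limit component. For a limit component, let $U=\bigsqcup_{\alpha}]a_\alpha,b_\alpha[$, where the segments $\gamma([a_\alpha,b_\alpha])=P_\alpha\cap\gamma$ are all the intersections of $\gamma$ with pieces $P_\alpha$ that meet $\gamma$ in more than one point, and let $f(]a_\alpha,b_\alpha[)=(\iota(\gamma(a_\alpha)),\iota(\gamma(b_\alpha)))$, with $\iota$ the canonical isometry associated to $(P_\alpha,\gamma(a_\alpha),\gamma(b_\alpha))$.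 The type of $C$ is the equivalence class of $(U,f)$. These notions do not depend on the choice of $\gamma$. Universal $\mathcal Q$-trees. A $\mathcal Q$-tree $S$ is universal if: (a) $S$ is complete; (b) for any $s\in S$ and any $\theta\in\Theta$ there are exactly continuum limit connected components of $S\setminus\{s\}$ of type $\theta$; (c) for any $s\in S$, any $Q\in\mathcal Q$ not reduced to a single point and any $x\in E(Q)$ there are exactly continuum $(Q,x)$-pieces of $S$ at $s$. *)

theory Defs
  imports "HOL-Analysis.Analysis"
begin

section \<open>Isometries, homogeneous spaces, geodesics\<close>

definition isometric_embedding :: "'a metric \<Rightarrow> 'b metric \<Rightarrow> ('a \<Rightarrow> 'b) \<Rightarrow> bool" where
  "isometric_embedding m m' f \<longleftrightarrow>
     f \<in> mspace m \<rightarrow> mspace m' \<and>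
     (\<forall>x\<in>mspace m. \<forall>y\<in>mspace m. mdist m' (f x) (f y) = mdist m x y)"

definition isometry :: "'a metric \<Rightarrow> 'b metric \<Rightarrow> ('a \<Rightarrow> 'b) \<Rightarrow> bool" where
  "isometry m m' f \<longleftrightarrow> isometric_embedding m m' f \<and> f ` mspace m = mspace m'"

definition isometric :: "'a metric \<Rightarrow> 'b metric \<Rightarrow> bool" where
  "isometric m m' \<longleftrightarrow> (\<exists>f. isometry m m' f)"

definition homogeneous :: "'a metric \<Rightarrow> bool" where
  "homogeneous m \<longleftrightarrow> (\<forall>x\<in>mspace m. \<forall>y\<in>mspace m. \<exists>g. isometry m m g \<and> g x = y)"

definition geodesic :: "'a metric \<Rightarrow> (real \<Rightarrow> 'a) \<Rightarrow> real \<Rightarrow> real \<Rightarrow> bool" where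
  "geodesic m \<gamma> u v \<longleftrightarrow>
     u \<le> v \<and> \<gamma> ` {u..v} \<subseteq> mspace m \<and>
     (\<forall>s\<in>{u..v}. \<forall>t\<in>{u..v}. mdist m (\<gamma> s) (\<gamma> t) = \<bar>s - t\<bar>)"

definition geodesic_space :: "'a metric \<Rightarrow> bool" where
  "geodesic_space m \<longleftrightarrow>
     (\<forall>x\<in>mspace m. \<forall>y\<in>mspace m. \<exists>\<gamma> r. geodesic m \<gamma> 0 r \<and> \<gamma> 0 = x \<and> \<gamma> r = y)"


section \<open>Tree-graded spaces\<close>

text \<open>The image of a simple loop that is a concatenation of three geodesics. Since the loop is
  parameterized injectively on an interval of positive length, the triangle is non-trivial. A side
  may be a single point, which covers simple loops made of two geodesics; these are also obtained
  from three non-degenerate geodesics by subdividing a side.\<close>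

definition nontrivial_simple_geodesic_triangle :: "'a metric \<Rightarrow> 'a set \<Rightarrow> bool" where
  "nontrivial_simple_geodesic_triangle S T \<longleftrightarrow>
     (\<exists>c u v l. 0 < l \<and> geodesic S c 0 u \<and> geodesic S c u v \<and> geodesic S c v l \<and>
        c l = c 0 \<and> inj_on c {0..<l} \<and> T = c ` {0..l})"

definition tree_graded :: "'a metric \<Rightarrow> 'a set set \<Rightarrow> bool" where
  "tree_graded S \<P> \<longleftrightarrow>
     mcomplete_of S \<and> geodesic_space S \<and>
     (\<forall>P\<in>\<P>. closedin (mtopology_of S) P \<and> geodesic_space (submetric S P) \<and> P \<noteq> {}) \<and>
     (\<forall>P\<in>\<P>. \<forall>P'\<in>\<P>. P \<noteq> P' \<longrightarrow> (\<forall>x\<in>P \<inter> P'. \<forall>y\<in>P \<inter> P'. x = y)) \<and>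
     (\<forall>T. nontrivial_simple_geodesic_triangle S T \<longrightarrow> (\<exists>P\<in>\<P>. T \<subseteq> P))"

text \<open>Spaces of type \<open>'a metric\<close> may have empty carrier, so non-emptiness is explicit here.\<close>

definition Q_tree :: "'q metric set \<Rightarrow> 'a metric \<Rightarrow> 'a set set \<Rightarrow> bool" where
  "Q_tree \<Q> S \<P> \<longleftrightarrow>
     mspace S \<noteq> {} \<and> geodesic_space S \<and> tree_graded S \<P> \<and>
     (\<forall>P\<in>\<P>. \<exists>Q\<in>\<Q>. isometric (submetric S P) Q)"


section \<open>Canonical isometries\<close>

text \<open>Isometric elements of \<open>\<Q>\<close> are identified by fixing a set \<open>R\<close> of representatives of the
  isometry classes; \<open>D\<close> and \<open>E\<close> are used on \<open>R\<close> only.\<close>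

definition isometry_class_reps :: "'q metric set \<Rightarrow> 'q metric set \<Rightarrow> bool" where
  "isometry_class_reps \<Q> R \<longleftrightarrow> R \<subseteq> \<Q> \<and> (\<forall>Q\<in>\<Q>. \<exists>!Q'. Q' \<in> R \<and> isometric Q Q')"

definition point_orbit_reps :: "'q metric \<Rightarrow> 'q set \<Rightarrow> bool" where
  "point_orbit_reps Q A \<longleftrightarrow>
     A \<subseteq> mspace Q \<and>
     (\<forall>x\<in>mspace Q. \<exists>!x'. x' \<in> A \<and> (\<exists>g. isometry Q Q g \<and> g x = x'))"

definition pair_orbit_reps :: "'q metric \<Rightarrow> ('q \<times> 'q) set \<Rightarrow> bool" where
  "pair_orbit_reps Q A \<longleftrightarrow>
     A \<subseteq> mspace Q \<times> mspace Q \<and>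
     (\<forall>x\<in>mspace Q. \<forall>y\<in>mspace Q.
        \<exists>!z. z \<in> A \<and> (\<exists>g. isometry Q Q g \<and> (g x, g y) = z))"

definition canonical_choices ::
    "'q metric set \<Rightarrow> 'q metric set \<Rightarrow> ('q metric \<Rightarrow> ('q \<times> 'q) set) \<Rightarrow> ('q metric \<Rightarrow> 'q set) \<Rightarrow> bool"
  where
  "canonical_choices \<Q> R D E \<longleftrightarrow>
     isometry_class_reps \<Q> R \<and> (\<forall>Q\<in>R. pair_orbit_reps Q (D Q) \<and> point_orbit_reps Q (E Q))"

text \<open>A canonical isometry is given together with its target space.\<close>

definition canonical_isometry_pair ::
    "'q metric set \<Rightarrow> ('q metric \<Rightarrow> ('q \<times> 'q) set) \<Rightarrow> 'a metric \<Rightarrow> 'a set \<Rightarrow> 'a \<Rightarrow> 'a \<Rightarrow>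
     'q metric \<times> ('a \<Rightarrow> 'q)" where
  "canonical_isometry_pair R D S P x y =
     (SOME (Q, \<iota>). Q \<in> R \<and> isometry (submetric S P) Q \<iota> \<and> (\<iota> x, \<iota> y) \<in> D Q)"

definition canonical_isometry_point ::
    "'q metric set \<Rightarrow> ('q metric \<Rightarrow> 'q set) \<Rightarrow> 'a metric \<Rightarrow> 'a set \<Rightarrow> 'a \<Rightarrow>
     'q metric \<times> ('a \<Rightarrow> 'q)" where
  "canonical_isometry_point R E S P x =
     (SOME (Q, \<iota>). Q \<in> R \<and> isometry (submetric S P) Q \<iota> \<and> \<iota> x \<in> E Q)"

definition piece_at ::
    "'q metric set \<Rightarrow> ('q metric \<Rightarrow> 'q set) \<Rightarrow> 'a metric \<Rightarrow> 'a set set \<Rightarrow>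
     'q metric \<Rightarrow> 'q \<Rightarrow> 'a \<Rightarrow> 'a set \<Rightarrow> bool" where
  "piece_at R E S \<P> Q y x P \<longleftrightarrow>
     P \<in> \<P> \<and> x \<in> P \<and>
     (case canonical_isometry_point R E S P x of (Q', \<iota>) \<Rightarrow> Q' = Q \<and> \<iota> x = y)"


section \<open>Types\<close>

text \<open>The family of intervals of a type is the domain of the map \<open>f\<close>, an interval being given by its
  pair of endpoints. The values of \<open>f\<close> are pairs \<open>(p, q) \<in> D Q\<close> tagged with \<open>Q\<close>, because the
  carriers of different spaces in \<open>R\<close> may overlap.\<close>

type_synonym 'q qtype = "real set \<times> (real \<times> real \<rightharpoonup> 'q metric \<times> 'q \<times> 'q)"

definition Q_types ::
    "'q metric set \<Rightarrow> ('q metric \<Rightarrow> ('q \<times> 'q) set) \<Rightarrow> 'q qtype set" where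
  "Q_types R D =
     {(U, f).
        U = (\<Union>(a, b)\<in>dom f. {a<..<b}) \<and>
        disjoint_family_on (\<lambda>(a, b). {a<..<b}) (dom f) \<and>
        (\<forall>(a, b)\<in>dom f. 0 < a \<and> a < b) \<and>
        (\<forall>a b Q p q. f (a, b) = Some (Q, p, q) \<longrightarrow>
           Q \<in> R \<and> (p, q) \<in> D Q \<and> mdist Q p q = b - a)}"

text \<open>This is meant for \<open>r > 0\<close> and \<open>r \<notin> U\<close>; then the intervals contained in \<open>]0,r[\<close> are those
  with right endpoint at most \<open>r\<close>.\<close>

definition initial_subtype :: "real \<Rightarrow> 'q qtype \<Rightarrow> 'q qtype" where
  "initial_subtype r = (\<lambda>(U, f). (U \<inter> {0<..<r}, f |` {(a, b). b \<le> r}))"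

definition equivalent_types ::
    "'q metric set \<Rightarrow> ('q metric \<Rightarrow> ('q \<times> 'q) set) \<Rightarrow> ('q qtype \<times> 'q qtype) set" where
  "equivalent_types R D =
     {(\<tau>, \<tau>'). \<tau> \<in> Q_types R D \<and> \<tau>' \<in> Q_types R D \<and>
        (\<exists>r>0. r \<notin> fst \<tau> \<and> r \<notin> fst \<tau>' \<and> initial_subtype r \<tau> = initial_subtype r \<tau>')}"

definition type_classes ::
    "'q metric set \<Rightarrow> ('q metric \<Rightarrow> ('q \<times> 'q) set) \<Rightarrow> 'q qtype set set" where
  "type_classes R D = Q_types R D // equivalent_types R D"


section \<open>Limit components\<close>

definition components_at :: "'a metric \<Rightarrow> 'a \<Rightarrow> 'a set set" where
  "components_at S s = connected_components_of (subtopology (mtopology_of S) (mspace S - {s}))"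

definition geodesic_into :: "'a metric \<Rightarrow> 'a \<Rightarrow> 'a set \<Rightarrow> (real \<Rightarrow> 'a) \<Rightarrow> real \<Rightarrow> bool" where
  "geodesic_into S s C \<gamma> r \<longleftrightarrow>
     0 < r \<and> geodesic S \<gamma> 0 r \<and> \<gamma> 0 = s \<and> \<gamma> ` {0..r} \<subseteq> insert s C"

text \<open>Whether a component is a limit component, and the type of a limit component, do not depend on
  the geodesic into it; the definitions below quantify existentially over this geodesic.\<close>

definition non_limit_component :: "'a metric \<Rightarrow> 'a set set \<Rightarrow> 'a \<Rightarrow> 'a set \<Rightarrow> bool" where
  "non_limit_component S \<P> s C \<longleftrightarrow>
     C \<in> components_at S s \<and>
     (\<exists>\<gamma> r. geodesic_into S s C \<gamma> r \<and>
        (\<exists>P\<in>\<P>. \<exists>t. 0 < t \<and> t \<le> r \<and> P \<inter> \<gamma> ` {0..r} = \<gamma> ` {0..t}))"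

definition limit_component :: "'a metric \<Rightarrow> 'a set set \<Rightarrow> 'a \<Rightarrow> 'a set \<Rightarrow> bool" where
  "limit_component S \<P> s C \<longleftrightarrow>
     C \<in> components_at S s \<and> \<not> non_limit_component S \<P> s C"

definition cut_out_by :: "(real \<Rightarrow> 'a) \<Rightarrow> real \<Rightarrow> real \<Rightarrow> real \<Rightarrow> 'a set \<Rightarrow> bool" where
  "cut_out_by \<gamma> r a b P \<longleftrightarrow>
     0 \<le> a \<and> a < b \<and> b \<le> r \<and> P \<inter> \<gamma> ` {0..r} = \<gamma> ` {a..b}"

definition geodesic_type ::
    "'q metric set \<Rightarrow> ('q metric \<Rightarrow> ('q \<times> 'q) set) \<Rightarrow> 'a metric \<Rightarrow> 'a set set \<Rightarrow>
     (real \<Rightarrow> 'a) \<Rightarrow> real \<Rightarrow> 'q qtype" where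
  "geodesic_type R D S \<P> \<gamma> r =
     (let f = (\<lambda>(a, b).
            if \<exists>P\<in>\<P>. cut_out_by \<gamma> r a b P
            then let P = (THE P. P \<in> \<P> \<and> cut_out_by \<gamma> r a b P);
                     (Q, \<iota>) = canonical_isometry_pair R D S P (\<gamma> a) (\<gamma> b)
                 in Some (Q, \<iota> (\<gamma> a), \<iota> (\<gamma> b))
            else None)
      in (\<Union>(a, b)\<in>dom f. {a<..<b}, f))"

definition limit_component_of_type ::
    "'q metric set \<Rightarrow> ('q metric \<Rightarrow> ('q \<times> 'q) set) \<Rightarrow> 'a metric \<Rightarrow> 'a set set \<Rightarrow>
     'a \<Rightarrow> 'q qtype set \<Rightarrow> 'a set \<Rightarrow> bool" where
  "limit_component_of_type R D S \<P> s \<theta> C \<longleftrightarrow>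
     limit_component S \<P> s C \<and>
     (\<exists>\<gamma> r. geodesic_into S s C \<gamma> r \<and>
        \<theta> = equivalent_types R D `` {geodesic_type R D S \<P> \<gamma> r})"


section \<open>Universal trees\<close>

definition universal_Q_tree ::
    "'q metric set \<Rightarrow> 'q metric set \<Rightarrow> ('q metric \<Rightarrow> ('q \<times> 'q) set) \<Rightarrow> ('q metric \<Rightarrow> 'q set) \<Rightarrow>
     'a metric \<Rightarrow> 'a set set \<Rightarrow> bool" where
  "universal_Q_tree \<Q> R D E S \<P> \<longleftrightarrow>
     Q_tree \<Q> S \<P> \<and>
     mcomplete_of S \<and>
     (\<forall>s\<in>mspace S. \<forall>\<theta>\<in>type_classes R D.
        {C. limit_component_of_type R D S \<P> s \<theta> C} \<approx> (UNIV :: real set)) \<and>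
     (\<forall>s\<in>mspace S. \<forall>Q\<in>R. (\<nexists>z. mspace Q = {z}) \<longrightarrow>
        (\<forall>x\<in>E Q. {P. piece_at R E S \<P> Q x s P} \<approx> (UNIV :: real set)))"

text \<open>HOL cannot quantify existentially over types, so a universal tree is asserted to exist on a
  concrete type built from the point type \<open>'q\<close> of the given spaces. A universal tree has at most
  \<open>max(c, |R|)\<close> to the power \<open>\<aleph>\<^sub>0\<close> points, where \<open>c\<close> is the continuum, and every set of this
  cardinality injects into the type below; so existence is the same as existence on some type.\<close>

type_synonym 'q tree_point = "(real \<times> 'q \<times> 'q metric) list set"

end

theory Submission
  imports Defs
begin

text \<open>The proof is local: everything is expressed by the directions in which one can leave a point
  \<open>x\<close>. Two points lie in the same direction at \<open>x\<close> if geodesics from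
  \<open>x\<close> to them share a point other than \<open>x\<close>, or if both leave \<open>x\<close> inside
  one and the same piece. Points in different directions are separated by \<open>x\<close>
  (\<open>betw_if_not_same_dir\<close>). A direction either belongs to exactly one piece through
  \<open>x\<close>, or it is a limit direction, and then it is a limit component of the complement of
  \<open>x\<close> (\<open>limit_component_iff\<close>). The kind of a direction is the isometry class of its
  piece or the type of its component. As the spaces in \<open>\<Q>\<close> are homogeneous, \<open>E Q\<close>
  has at most one point, so a \<open>\<Q>\<close>-tree is universal iff it is complete and has exactly
  continuum many directions of every kind at every point (\<open>universal_iff_rich\<close>).

  Embedding and uniqueness are one back-and-forth argument. Consider partial isometries between two
  \<open>\<Q>\<close>-trees whose domain and range are subtrees, such that every point is fresh (at most two
  directions at it are used on either side) or full (all directions at it are used). At a fresh point the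
  unused directions on the two sides can be matched kind by kind by counting, since finitely many are removed
  from at most, respectively exactly, continuum many. Two directions of the same kind contain isometric
  initial parts: two isometric pieces, or the hulls of two geodesics of the same type, where isometries of the
  crossed pieces are glued (\<open>branch_exists\<close>). Gluing such branches for all unused directions
  makes the point full (\<open>extend_at_point\<close>). A maximal partial isometry therefore has only full
  points and is closed under limits, and a closed subtree that is full at each of its points is the whole
  tree, because a point outside would reach it through an unused direction
  (\<open>untouched_direction\<close>).

  Existence is by an explicit model. Its points are words: instructions for walking from a base point along a
  geodesic, in the form of entries that tile a real interval \<open>[0, \<rho>)\<close>. A piece entry crosses
  a copy of some \<open>Q\<close> from its origin to a point \<open>y\<close>; a plain entry occupies a single
  moment and starts a limit direction. Every entry carries a real number \<open>c\<close> which tells apart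
  continuum many directions of one kind. A word is required to be tame: after a plain entry with number
  \<open>c\<close> it proceeds for a while as some \<open>\<Q>\<close>-type prescribes, with the number
  \<open>c\<close> kept. So at a word the limit directions leading away from the base correspond to pairs of a
  type and a number, and the pieces leading away to pairs of a space and a number; only the direction back to
  the base is extra. The distance of two words is the sum of their heights minus twice the height at which
  they separate, with a correction when they separate inside a common piece. That this is a tree-graded space
  is deduced from a criterion for families of sets with gates (\<open>gated_family\<close>) that avoids
  topological arguments about loops: locally each side of a loop lies in a piece, and pieces that are adjacent
  along the loop coincide.\<close>

abbreviation (input) iff_ascii (infixr "<->" 25) where "A <-> B \<equiv> (A = (B::bool))"

section \<open>Betweenness and geodesics\<close>

definition betw :: "'a metric => 'a => 'a => 'a => bool" where
 "betw m x u y <-> x : mspace m & u : mspace m & y : mspace m &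
   mdist m x u + mdist m u y = mdist m x y"

lemma mdist_self [simp]: "x : mspace m ==> mdist m x x = 0"
 by simp

lemma betw_mspace: "betw m x u y ==> x : mspace m & u : mspace m & y : mspace m"
 by (simp add: betw_def)

lemma betw_sym: "betw m x u y ==> betw m y u x"
 by (simp add: betw_def mdist_commute add.commute)

lemma betw_ends: "x : mspace m ==> y : mspace m ==> betw m x x y & betw m x y y"
 by (simp add: betw_def)

lemma betw_trans:
 assumes "betw m x u y" "betw m x v u"
 shows "betw m x v y" "betw m v u y"
proof -
 have "mdist m x y <= mdist m x v + mdist m v y" "mdist m v y <= mdist m v u + mdist m u y"
  using assms by (auto simp: betw_def intro: mdist_triangle)
 thus "betw m x v y" "betw m v u y" using assms by (auto simp: betw_def)
qed

lemma betw_trans_right: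
 assumes "betw m x u y" "betw m u v y"
 shows "betw m x v y" "betw m x u v"
 using betw_trans[OF betw_sym[OF assms(1)] betw_sym[OF assms(2)]] by (auto intro: betw_sym)

lemma betw_antisym:
 assumes "betw m x u v" "betw m x v u"
 shows "u = v"
proof -
 have "mdist m u v = 0"
  using assms[unfolded betw_def] mdist_nonneg[of m u v] mdist_commute[of m v u] by linarith
 thus ?thesis using assms by (simp add: betw_def)
qed

lemma betw_self:
 assumes "betw m x u x"
 shows "u = x"
proof -
 show ?thesis using assms mdist_nonneg[of m u x] betw_def mdist_commute[of m u x] by (auto simp: betw_def mdist_commute[of m u x])
qed

definition geo :: "'a metric => (real => 'a) => real => 'a => 'a => bool" where
 "geo m g l x y <-> geodesic m g 0 l & g 0 = x & g l = y"

lemma geoD: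
 assumes "geo m g l x y"
 shows "0 <= l" "g 0 = x" "g l = y" "x : mspace m" "y : mspace m" "mdist m x y = l"
  "!!t. 0 <= t ==> t <= l ==> g t : mspace m"
  "!!s t. 0 <= s ==> s <= l ==> 0 <= t ==> t <= l ==> mdist m (g s) (g t) = \<bar>s - t\<bar>"
proof -
 show 0: "0 <= l" "g 0 = x" "g l = y" using assms by (auto simp: geo_def geodesic_def)
 show 1: "g t : mspace m" if "0 <= t" "t <= l" for t
  using assms that by (auto simp: geo_def geodesic_def)
 show 2: "mdist m (g s) (g t) = \<bar>s - t\<bar>" if "0 <= s" "s <= l" "0 <= t" "t <= l" for s t
  using assms that by (auto simp: geo_def geodesic_def)
 show "x : mspace m" "y : mspace m" using 1[of 0] 1[of l] 0 by auto
 show "mdist m x y = l" using 2[of 0 l] 0 by auto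
qed

lemma geoI:
 assumes "0 <= l" "g 0 = x" "g l = y"
  and "!!t. 0 <= t ==> t <= l ==> g t : mspace m"
  and "!!s t. 0 <= s ==> s <= t ==> t <= l ==> mdist m (g s) (g t) = t - s"
 shows "geo m g l x y"
proof -
 have "mdist m (g s) (g t) = \<bar>s - t\<bar>" if "0 <= s" "s <= l" "0 <= t" "t <= l" for s t
  using assms(5)[of s t] assms(5)[of t s] that by (cases "s <= t") (auto simp: mdist_commute)
 thus ?thesis using assms by (auto simp: geo_def geodesic_def)
qed

lemma geo_inj: "geo m g l x y ==> 0 <= s ==> s <= l ==> 0 <= t ==> t <= l ==> g s = g t ==> s = t"
 using geoD(8)[of m g l x y s t] geoD(7)[of m g l x y t] by auto

lemma geo_rev: "geo m g l x y ==> geo m (%t. g (l - t)) l y x"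
 by (rule geoI) (simp_all add: geoD(1) geoD(2)[of m g l x y] geoD(3)[of m g l x y]
   geoD(7)[of m g l x y] geoD(8)[of m g l x y])

lemma geo_sub:
 assumes "geo m g l x y" "0 <= a" "a <= b" "b <= l"
 shows "geo m (%t. g (a + t)) (b - a) (g a) (g b)"
 by (rule geoI) (use assms in \<open>auto simp: geoD(7,8)[OF assms(1)]\<close>)

lemma geo_take:
 assumes "geo m g l x y" "0 <= b" "b <= l"
 shows "geo m g b x (g b)"
 using geo_sub[OF assms(1), of 0 b] assms geoD(2)[OF assms(1)] by simp

lemma geo_concat:
 assumes g: "geo m g l x u" and h: "geo m h k u y" and b: "betw m x u y"
 shows "geo m (%t. if t <= l then g t else h (t - l)) (l + k) x y"
proof (rule geoI)
 note G = geoD[OF g] and H = geoD[OF h]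
 show "0 <= l + k" using G H by auto
 show "(if 0 <= l then g 0 else h (0 - l)) = x" using G by auto
 show "(if l + k <= l then g (l + k) else h (l + k - l)) = y" using G H by (cases "k = 0") auto
 show "(if t <= l then g t else h (t - l)) : mspace m" if "0 <= t" "t <= l + k" for t
  using that G(7) H(7) by auto
 show "mdist m (if s <= l then g s else h (s - l)) (if t <= l then g t else h (t - l)) = t - s"
  if st: "0 <= s" "s <= t" "t <= l + k" for s t
 proof (cases "s <= l & ~ t <= l")
  case True
  have a: "mdist m x (g s) = s" "mdist m (g s) u = l - s"
   using G(8)[of 0 s] G(8)[of s l] G True st by auto
  have "mdist m x y = l + k" using b G(6) H(6) by (simp add: betw_def)
  moreover have "mdist m x y <= mdist m x (g s) + mdist m (g s) y" 
   "mdist m (g s) y <= mdist m (g s) (h (t-l)) + mdist m (h (t-l)) y"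
   "mdist m (g s) (h (t-l)) <= mdist m (g s) u + mdist m u (h (t-l))" using True st G(7) H(7) G(4,5) H(5) by (auto intro: mdist_triangle)
  ultimately show ?thesis using a True H(8)[of 0 "t-l"] H(8)[of "t-l" k] H st by auto
 next
  case False
  thus ?thesis using st G(8)[of s t] H(8)[of "s-l" "t-l"] by auto
 qed
qed

lemma geo_betw:
 assumes "geo m g l x y" "0 <= r" "r <= s" "s <= t" "t <= l"
 shows "betw m (g r) (g s) (g t)"
 using assms by (auto simp: betw_def geoD(7,8)[OF assms(1)])

lemma geo_betw_ends:
 assumes "geo m g l x y" "0 <= s" "s <= l"
 shows "betw m x (g s) y"
 using geo_betw[OF assms(1), of 0 s l] assms geoD(2,3)[OF assms(1)] by auto

lemma geodesic_space_geo:
 assumes "geodesic_space m" "x : mspace m" "y : mspace m"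
 obtains g where "geo m g (mdist m x y) x y"
proof -
 obtain g r where "geodesic m g 0 r" "g 0 = x" "g r = y"
  using assms unfolding geodesic_space_def by blast
 hence "geo m g r x y" by (simp add: geo_def)
 moreover from geoD(6)[OF this] have "r = mdist m x y" by simp
 ultimately show ?thesis using that by blast
qed

lemma geo_through:
 assumes "geodesic_space m" "betw m x u y"
 obtains g where "geo m g (mdist m x y) x y" "g (mdist m x u) = u"
proof -
 obtain g h where gh: "geo m g (mdist m x u) x u" "geo m h (mdist m u y) u y" using geodesic_space_geo[OF assms(1)] assms betw_def by metis
 have "mdist m x u + mdist m u y = mdist m x y" using assms by (simp add: betw_def)
 thus ?thesis using geo_concat[OF gh assms(2)] that geoD(3)[OF gh(1)] by auto
qed

lemma geo_continuous:
 assumes "geo m g l x y"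
 shows "continuous_map (top_of_set {0..l}) (mtopology_of m) g"
proof -
 interpret Metric_space "mspace m" "mdist m" by simp
 have "EX U. openin (top_of_set {0..l}) U & t : U & (ALL s:U. g s : mball (g t) e)"
  if "t : {0..l}" "e > 0" for t e
  using that geoD(7,8)[OF assms] by (intro exI[of _ "{0..l} Int ball t e"]) (auto simp: dist_real_def)
 hence "continuous_map (top_of_set {0..l}) mtopology g"
  using geoD(7)[OF assms] unfolding continuous_map_to_metric by (auto simp: image_subset_iff)
 thus ?thesis by (simp add: mtopology_of_def)
qed

lemma geo_closed_vimage:
 assumes "geo m g l x y" "closedin (mtopology_of m) P"
 shows "compact {t : {0..l}. g t : P}"
proof -
 have "closed {t : {0..l}. g t : P}" using closedin_continuous_map_preimage[OF geo_continuous[OF assms(1)] assms(2)] closedin_closed_trans by fastforce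
 moreover have "bounded {t : {0..l}. g t : P}" by (rule bounded_subset[of "{0..l}"]) auto
 ultimately show ?thesis by (simp add: compact_eq_bounded_closed)
qed

lemma geo_first_point:
 assumes "geo m g l x y" "closedin (mtopology_of m) P" "y : P"
 obtains t where "0 <= t" "t <= l" "g t : P" "!!s. 0 <= s ==> s < t ==> g s ~: P"
proof -
 have ne: "{t : {0..l}. g t : P} ~= {}" using assms(3) geoD[OF assms(1)] by auto
 obtain t where t: "t : {t : {0..l}. g t : P}" "ALL s:{t : {0..l}. g t : P}. t <= s"
  using compact_attains_inf[OF geo_closed_vimage[OF assms(1,2)] ne] by auto
 show ?thesis by (rule that[of t]) (use t in force)+
qed

lemma geo_last_point:
 assumes "geo m g l x y" "closedin (mtopology_of m) P" "x : P"
 obtains t where "0 <= t" "t <= l" "g t : P" "!!s. t < s ==> s <= l ==> g s ~: P"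
proof -
 obtain t where t: "0 <= t" "t <= l" "g (l - t) : P" "!!s. 0 <= s ==> s < t ==> g (l - s) ~: P"
  using geo_first_point[OF geo_rev[OF assms(1)] assms(2,3)] by blast
 show ?thesis
 proof (rule that[of "l - t"])
  show "g s ~: P" if "l - t < s" "s <= l" for s using t(4)[of "l - s"] that by auto
 qed (use t(1-3) in auto)
qed

lemma closed_real_by_approx:
 fixes A :: "real set"
 assumes "!!t. ALL e>0. EX s:A. \<bar>s - t\<bar> < e ==> t : A"
 shows "closed A"
proof -
 have "x : A" if "x : closure A" for x
  by (rule assms) (use that in \<open>unfold closure_approachable dist_real_def\<close>)
 hence "closure A <= A" by blast
 thus ?thesis by (simp add: closure_subset_eq)
qed

lemma geo_agree_compact:
 assumes "geo m g l x y" "geo m h k x' y'"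
 shows "compact {t : {0..min l k}. g t = h t}"
proof -
 have "closed {t : {0..min l k}. g t = h t}"
 proof (rule closed_real_by_approx)
  fix t assume A0: "ALL e>0. EX s:{t : {0..min l k}. g t = h t}. \<bar>s - t\<bar> < e"
  hence A: "EX s:{t : {0..min l k}. g t = h t}. \<bar>s - t\<bar> < e" if "e > 0" for e using that by blast
  have t: "t : {0..min l k}"
  proof (rule ccontr)
   assume "t ~: {0..min l k}"
   hence "max (-t) (t - min l k) > 0" by auto
   from A[OF this] show False by auto
  qed
  have M: "g t : mspace m" "h t : mspace m" using t geoD(7)[OF assms(1)] geoD(7)[OF assms(2)] by auto
  have "mdist m (g t) (h t) <= e" if "e > 0" for e
  proof -
   obtain s where s: "s : {0..min l k}" "g s = h s" "\<bar>s - t\<bar> < e/2"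
    using A[of "e/2"] \<open>e > 0\<close> by force
   show ?thesis using mdist_triangle[of "g t" m "g s" "h t"] s M geoD(7)[OF assms(1), of s] t geoD(8)[OF assms(1), of t s] geoD(8)[OF assms(2), of s t] by (auto simp: abs_minus_commute)
  qed
  thus "t : {t : {0..min l k}. g t = h t}" using field_le_epsilon[of "mdist m (g t) (h t)" 0] antisym M t by fastforce
 qed
 moreover have "bounded {t : {0..min l k}. g t = h t}"
  by (rule bounded_subset[of "{0..min l k}"]) auto
 ultimately show ?thesis by (simp add: compact_eq_bounded_closed)
qed

lemma geo_images_meet_compact:
 assumes "geo m g l x y" "geo m h k x' y'"
 shows "compact {t : {0..l}. g t : h ` {0..k}}"
proof (rule geo_closed_vimage[OF assms(1)])
 have "compactin (mtopology_of m) (h ` {0..k})"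
  by (rule image_compactin[OF _ geo_continuous[OF assms(2)]]) (simp add: compactin_subtopology)
 moreover have "Hausdorff_space (mtopology_of m)"
  by (metis Metric_space.Hausdorff_space_mtopology Metric_space_mspace_mdist mtopology_of_def)
 ultimately show "closedin (mtopology_of m) (h ` {0..k})" by (rule compactin_imp_closedin[rotated])
qed

text \<open>Connectedness of an interval: a relation that is symmetric, transitive and holds locally relates the two end
  points.\<close>
lemma interval_chain:
 fixes p q :: real
 assumes "p <= q"
  and sym: "!!s t. s : {p..q} ==> t : {p..q} ==> E s t ==> E t s"
  and trans: "!!r s t. r : {p..q} ==> s : {p..q} ==> t : {p..q} ==> E r s ==> E s t ==> E r t"
  and loc: "!!s. s : {p..q} ==> EX e>0. ALL t:{p..q}. \<bar>t - s\<bar> < e --> E s t"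
 shows "E p q"
proof (rule connected_equivalence_relation[of "{p..q}" p q E])
 show "EX T. openin (top_of_set {p..q}) T & a : T & (ALL x:T. E a x)" if "a : {p..q}" for a
 proof -
  obtain e where e: "e > 0" "ALL t:{p..q}. \<bar>t - a\<bar> < e --> E a t" using loc[OF \<open>a : {p..q}\<close>] by blast
  have "ALL x:{p..q} Int ball a e. E a x"
  proof
   fix x assume "x : {p..q} Int ball a e"
   hence "x : {p..q}" "\<bar>x - a\<bar> < e" by (auto simp: dist_real_def)
   thus "E a x" using e by blast
  qed
  moreover have "openin (top_of_set {p..q}) ({p..q} Int ball a e)" by (simp add: openin_open_Int)
  moreover have "a : {p..q} Int ball a e" using that \<open>e > 0\<close> by simp
  ultimately show ?thesis by blast
 qed
 show "connected {p..q}" by (rule connected_Icc)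
 show "p : {p..q}" "q : {p..q}" using \<open>p <= q\<close> by auto
 show "E y x" if "E x y" "x : {p..q}" "y : {p..q}" for x y by (rule sym[OF that(2,3,1)])
 show "E x z" if "E x y" "E y z" "x : {p..q}" "y : {p..q}" "z : {p..q}" for x y z
  by (rule trans[OF that(3,4,5,1,2)])
qed

section \<open>Gates and directions in tree-graded spaces\<close>

definition gate :: "'a metric => 'a set => 'a => 'a" where
 "gate S P x = (THE p. p : P & (ALL q:P. betw S x p q))"

text \<open>Neither alternative alone is transitive: two geodesics that start inside the same piece need not share an
  initial part, and in a direction that is in no piece there is no piece to refer to.\<close>
definition same_dir :: "'a metric => 'a set set => 'a => 'a => 'a => bool" where
 "same_dir S \<P> x y z <-> x : mspace S & y : mspace S & z : mspace S & y ~= x & z ~= x &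
   ((EX w. w ~= x & betw S x w y & betw S x w z) |
   (EX P:\<P>. x : P & gate S P y ~= x & gate S P z ~= x))"

lemma gate_eqI:
 assumes "p : P" "!!q. q : P ==> betw S x p q"
 shows "gate S P x = p"
 unfolding gate_def
proof (rule the_equality)
 show "p : P & (ALL q:P. betw S x p q)" using assms by blast
 fix p' assume "p' : P & (ALL q:P. betw S x p' q)"
 hence "betw S x p' p" "betw S x p p'" using assms by blast+
 thus "p' = p" by (rule betw_antisym)
qed

lemma gate_of_member:
 assumes "x : P" "P <= mspace S"
 shows "gate S P x = x"
using gate_eqI assms(1) betw_ends assms by fastforce

lemma geo_dist:
 assumes "geo m g l x y" "0 <= s" "s <= l"
 shows "mdist m x (g s) = s" "mdist m (g s) y = l - s"
proof -
 have "mdist m (g 0) (g s) = \<bar>0 - s\<bar>" "mdist m (g s) (g l) = \<bar>s - l\<bar>"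
  by (rule geoD(8)[OF assms(1)]; use assms(2,3) in linarith)+
 thus "mdist m x (g s) = s" "mdist m (g s) y = l - s"
  unfolding geoD(2,3)[OF assms(1)] using assms(2,3) by linarith+
qed

locale tree_graded_space =
 fixes S :: "'a metric" and \<P> :: "'a set set"
 assumes tg: "tree_graded S \<P>"
begin

abbreviation "d \<equiv> mdist S"
abbreviation "M \<equiv> mspace S"

lemma complete_S: "mcomplete_of S"
 and geodesic_S: "geodesic_space S"
 and pieces: "ALL P:\<P>. closedin (mtopology_of S) P & geodesic_space (submetric S P) & P ~= {}"
 and piece_unique': "ALL P:\<P>. ALL P':\<P>. P ~= P' --> (ALL x:P Int P'. ALL y:P Int P'. x = y)"
 and triangle_piece': "ALL T. nontrivial_simple_geodesic_triangle S T --> (EX P:\<P>. T <= P)"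
 by (rule tg[unfolded tree_graded_def, THEN conjunct1]
   tg[unfolded tree_graded_def, THEN conjunct2, THEN conjunct1]
   tg[unfolded tree_graded_def, THEN conjunct2, THEN conjunct2, THEN conjunct1]
   tg[unfolded tree_graded_def, THEN conjunct2, THEN conjunct2, THEN conjunct2, THEN conjunct1]
   tg[unfolded tree_graded_def, THEN conjunct2, THEN conjunct2, THEN conjunct2, THEN conjunct2])+

lemma piece_closed: "P : \<P> ==> closedin (mtopology_of S) P"
 by (rule bspec[OF pieces, THEN conjunct1])

lemma piece_subset: "P : \<P> ==> P <= M"
 using closedin_subset[OF piece_closed, of P] by simp

lemma piece_mem: "P : \<P> ==> x : P ==> x : M"
 by (rule subsetD[OF piece_subset])

lemma piece_nonempty: "P : \<P> ==> P ~= {}"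
 by (rule bspec[OF pieces, THEN conjunct2, THEN conjunct2])

lemma piece_unique:
 assumes "P : \<P>" "P' : \<P>" "x : P" "x : P'" "y : P" "y : P'" "x ~= y"
 shows "P = P'"
proof (rule ccontr)
 assume "P ~= P'"
 with piece_unique' assms(1,2) have "ALL x:P Int P'. ALL y:P Int P'. x = y" by simp
 thus False using assms(3-) by simp
qed

lemma triangle_piece: "nontrivial_simple_geodesic_triangle S T ==> EX P:\<P>. T <= P"
 using triangle_piece' by simp

lemma piece_geo:
 assumes P: "P : \<P>" and xy: "x : P" "y : P"
 obtains g where "geo S g (d x y) x y" "!!t. 0 <= t ==> t <= d x y ==> g t : P"
proof -
 note sp = bspec[OF pieces P, THEN conjunct2, THEN conjunct1]
 obtain g where g: "geo (submetric S P) g (d x y) x y"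
  using geodesic_space_geo[OF sp, of x y] xy piece_mem[OF P] by auto
 have "geo S g (d x y) x y"
 proof (rule geoI)
  show "0 <= d x y" "g 0 = x" "g (d x y) = y" using geoD(1-3)[OF g] by simp_all
  show "g t : M" if "0 <= t" "t <= d x y" for t using geoD(7)[OF g that] by simp
  show "d (g s) (g t) = t - s" if "0 <= s" "s <= t" "t <= d x y" for s t
   using geoD(8)[OF g, of s t] that by simp
 qed
 moreover have "g t : P" if "0 <= t" "t <= d x y" for t using geoD(7)[OF g that] by simp
 ultimately show ?thesis using that by blast
qed

text \<open>The three sides, run through one after another, form a single loop parameterized by
  \<open>[0, a + b + c]\<close>; the hypotheses say that they meet in the corners only, which makes this loop
  injective.\<close>
lemma simple_triangle_piece:
 assumes g1: "geo S g1 a A B" and g2: "geo S g2 b B C" and g3: "geo S g3 c C A"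
  and AB: "A ~= B" and BC: "B ~= C" and CA: "C ~= A"
  and I12: "!!s t. 0 <= s ==> s <= a ==> 0 <= t ==> t <= b ==> g1 s = g2 t ==> g1 s = B"
  and I23: "!!s t. 0 <= s ==> s <= b ==> 0 <= t ==> t <= c ==> g2 s = g3 t ==> g2 s = C"
  and I31: "!!s t. 0 <= s ==> s <= c ==> 0 <= t ==> t <= a ==> g3 s = g1 t ==> g3 s = A"
 shows "EX P:\<P>. g1 ` {0..a} <= P & g2 ` {0..b} <= P & g3 ` {0..c} <= P"
proof -
 define f where "f t = (if t <= a then g1 t else if t <= a + b then g2 (t - a) else g3 (t - a - b))" for t
 note G1 = geoD[OF g1] and G2 = geoD[OF g2] and G3 = geoD[OF g3]
 have pos: "a > 0" "b > 0" "c > 0"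
  using AB BC CA G1(1,2,3) G2(1,2,3) G3(1,2,3) by (metis less_eq_real_def)+
 have f1: "f t = g1 t" if "t <= a" for t using that by (simp add: f_def)
 have f2: "f t = g2 (t - a)" if "a <= t" "t <= a + b" for t
  using that G1(3) G2(2) by (cases "t = a") (auto simp: f_def)
 have f3: "f t = g3 (t - a - b)" if "a + b <= t" for t
  using that G2(3) G3(2) pos by (cases "t = a + b") (auto simp: f_def)
 have e1: "geodesic S f 0 a"
  unfolding geodesic_def using pos f1 G1(7,8) by auto
 have e2: "geodesic S f a (a + b)"
  unfolding geodesic_def
 using pos f2 G2(7) G2(8) by auto
 have e3: "geodesic S f (a + b) (a + b + c)"
  unfolding geodesic_def
 using pos f3 G3(7) G3(8) by auto
 have ne: "f s ~= f t" if st: "0 <= s" "s < t" "t < a + b + c" for s t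
 proof
  assume eq: "f s = f t"
  consider "t <= a" | "s <= a" "a < t" "t <= a + b" | "s <= a" "a + b < t"
   | "a <= s" "t <= a + b" | "a < s" "s <= a + b" "a + b < t" | "a + b <= s"
   using st by linarith
  thus False
  proof cases
   case 1
   thus False using eq f1 geo_inj[OF g1, of s t] st by auto
  next
   case 2
   hence "g1 s = g2 (t - a)" using eq f1 f2 by auto
   thus False using I12[of s "t - a"] 2 st geo_inj[OF g2, of 0 "t - a"] G2(1,2) by auto
  next
   case 3
   hence "g3 (t - a - b) = g1 s" using eq f1 f3 by auto
   thus False using I31[of "t - a - b" s] 3 st geo_inj[OF g3, of "t - a - b" c] G3(1,3) by auto
  next
   case 4
   thus False using eq f2 geo_inj[OF g2, of "s - a" "t - a"] st by auto
  next
   case 5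
   hence "g2 (s - a) = g3 (t - a - b)" using eq f2 f3 by auto
   thus False using I23[of "s - a" "t - a - b"] 5 st geo_inj[OF g3, of 0 "t - a - b"] G3(1,2) by auto
  next
   case 6
   thus False using eq f3 geo_inj[OF g3, of "s - a - b" "t - a - b"] st by auto
  qed
 qed
 have "inj_on f {0..<a + b + c}"
 proof (rule inj_onI)
  fix s t assume "s : {0..<a + b + c}" "t : {0..<a + b + c}" "f s = f t"
  thus "s = t" using ne[of s t] ne[of t s] by (cases s t rule: linorder_cases) auto
 qed
 moreover have "f (a + b + c) = f 0" using f3[of "a + b + c"] f1[of 0] G3(3) G1(2) pos by auto
 ultimately have "nontrivial_simple_geodesic_triangle S (f ` {0..a + b + c})"
  unfolding nontrivial_simple_geodesic_triangle_def using e1 e2 e3 pos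
  by (intro exI[of _ f] exI[of _ a] exI[of _ "a + b"] exI[of _ "a + b + c"]) auto
 from triangle_piece[OF this] obtain P where P: "P : \<P>" "f ` {0..a + b + c} <= P" by blast
 have fP: "f t : P" if "0 <= t" "t <= a + b + c" for t using P(2) that by (auto simp: image_subset_iff)
 have "g1 ` {0..a} <= P"
 using fP f1 pos by fastforce
 moreover have "g2 ` {0..b} <= P"
 proof (rule image_subsetI)
  fix t assume "t : {0..b}" thus "g2 t : P" using fP[of "a + t"] f2[of "a + t"] pos by simp
 qed
 moreover have "g3 ` {0..c} <= P"
 proof (rule image_subsetI)
  fix t assume "t : {0..c}"
  thus "g3 t : P" using fP[of "a + b + t"] f3[of "a + b + t"] pos by simp
 qed
 ultimately show ?thesis using P(1) by blast
qed

text \<open>A common point of two geodesics from \<open>x\<close> is reached by both at its distance from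
  \<open>x\<close>.\<close>
lemma geo_meet_time:
 assumes "geo S g l x y" "geo S h k x z" "0 <= s" "s <= l" "0 <= t" "t <= k" "g s = h t"
 shows "s = t"
 using geo_dist(1)[OF assms(1,3,4)] geo_dist(1)[OF assms(2,5,6)] assms(7) by simp

text \<open>A bigon is a triangle with the midpoint of one of its sides as third corner.\<close>
lemma bigon_piece:
 assumes g: "geo S g L x y" and h: "geo S h L x y" and "L > 0"
  and ne: "!!t. 0 < t ==> t < L ==> g t ~= h t"
 shows "EX P:\<P>. g ` {0..L} <= P & h ` {0..L} <= P"
proof -
 note G = geoD[OF g] and H = geoD[OF h]
 let ?m = "L / 2"
 have g1: "geo S g ?m x (g ?m)" by (rule geo_take[OF g]) (use \<open>L > 0\<close> in auto)
 have g2: "geo S (%t. g (?m + t)) ?m (g ?m) y"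
  using geo_sub[OF g, of ?m L] \<open>L > 0\<close> G(3) by auto
 have g3: "geo S (%t. h (L - t)) L y x" by (rule geo_rev[OF h])
 have inj: "s = t" if "g s = g t" "0 <= s" "s <= L" "0 <= t" "t <= L" for s t
  using geo_inj[OF g] that by blast
 have same: "s = t & (s = 0 | s = L)" if "g s = h t" "0 <= s" "s <= L" "0 <= t" "t <= L" for s t
  using geo_meet_time[OF g h that(2-5,1)] ne[of s] that by force
 have "EX P:\<P>. g ` {0..?m} <= P & (%t. g (?m + t)) ` {0..?m} <= P & (%t. h (L - t)) ` {0..L} <= P"
 proof (rule simple_triangle_piece[OF g1 g2 g3])
  show "x ~= g ?m" using inj[of 0 ?m] G(2) \<open>L > 0\<close> by auto
  show "g ?m ~= y" using inj[of ?m L] G(3) \<open>L > 0\<close> by auto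
  show "y ~= x" using inj[of 0 L] G(2,3) \<open>L > 0\<close> by auto
  show "g s = g ?m" if "0 <= s" "s <= ?m" "0 <= t" "t <= ?m" "g s = g (?m + t)" for s t
   using inj[of s "?m + t"] that by auto
  show "g (?m + s) = y" if "0 <= s" "s <= ?m" "0 <= t" "t <= L" "g (?m + s) = h (L - t)" for s t
   using same[of "?m + s" "L - t"] that \<open>L > 0\<close> G(3) by auto
  show "h (L - s) = x" if "0 <= s" "s <= L" "0 <= t" "t <= ?m" "h (L - s) = g t" for s t
   using same[of t "L - s"] that \<open>L > 0\<close> G(2) by auto
 qed
 then obtain P where P: "P : \<P>" "g ` {0..?m} <= P" "(%t. g (?m + t)) ` {0..?m} <= P"
  "(%t. h (L - t)) ` {0..L} <= P" by blast
 have "g ` {0..L} <= P"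
 proof (rule image_subsetI)
  fix t assume t: "t : {0..L}"
  show "g t : P"
  proof (cases "t <= ?m")
   case True thus ?thesis using t by (intro subsetD[OF P(2)] imageI) simp
  next
   case False
   hence "(%t. g (?m + t)) (t - ?m) : P" using t by (intro subsetD[OF P(3)] imageI) simp
   thus ?thesis by simp
  qed
 qed
 moreover have "h ` {0..L} <= P"
 proof (rule image_subsetI)
  fix t assume "t : {0..L}"
  hence "(%t. h (L - t)) (L - t) : P" by (intro subsetD[OF P(4)] imageI) simp
  thus "h t : P" by simp
 qed
 ultimately show ?thesis by (intro bexI[OF _ P(1)] conjI)
qed

text \<open>If the entry points differ, go back from them to the last common point of the two geodesics: this point and
  the two entry points are the corners of a simple triangle whose third side lies in \<open>P\<close>. The
  piece containing the triangle shares two points with \<open>P\<close> and hence equals \<open>P\<close>, but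
  the corner opposite to that side is not in \<open>P\<close>.\<close>
lemma entry_points_agree:
 assumes P: "P : \<P>" and g: "geo S g l x q" and h: "geo S h k x r"
  and u: "0 <= u" "u <= l" "g u : P" "!!s. 0 <= s ==> s < u ==> g s ~: P"
  and v: "0 <= v" "v <= k" "h v : P" "!!s. 0 <= s ==> s < v ==> h s ~: P"
 shows "g u = h v"
proof (rule ccontr)
 assume neq: "g u ~= h v"
 note G = geoD[OF g] and H = geoD[OF h]
 note g' = geo_take[OF g u(1,2)] and h' = geo_take[OF h v(1,2)]
 let ?Z = "{t : {0..min u v}. g t = h t}"
 have "?Z ~= {}" using G(2) H(2) u(1) v(1) by auto
 from compact_attains_sup[OF geo_agree_compact[OF g' h'] this]
 obtain t0 where "t0 : ?Z" and t0': "ALL t:?Z. t <= t0" by blast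
 hence t0: "0 <= t0" "t0 <= u" "t0 <= v" "g t0 = h t0" "ALL t:?Z. t <= t0" by simp_all
 have "t0 ~= u"
 using t0(1-4) u(1,3) v(4) t0 u t0(4) neq by fastforce
 moreover have "t0 ~= v"
 using t0(1-4) v(1,3) u(4) t0 v t0(4) neq by fastforce
 ultimately have lt: "t0 < u" "t0 < v" using t0(2,3) by simp_all
 obtain \<sigma> where \<sigma>: "geo S \<sigma> (d (g u) (h v)) (g u) (h v)" "!!t. 0 <= t ==> t <= d (g u) (h v) ==> \<sigma> t : P"
  using piece_geo[OF P u(3) v(3)] by metis
 have g1: "geo S (%t. g (t0 + t)) (u - t0) (g t0) (g u)" using geo_sub[OF g t0(1,2) u(2)] .
 have h1: "geo S (%t. h (t0 + (v - t0 - t))) (v - t0) (h v) (h t0)"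
  using geo_rev[OF geo_sub[OF h t0(1,3) v(2)]] .
 have z: "g t0 ~: P" using u(4)[OF t0(1) lt(1)] .
 have "EX P':\<P>. (%t. g (t0 + t)) ` {0..u - t0} <= P' & \<sigma> ` {0..d (g u) (h v)} <= P' &
   (%t. h (t0 + (v - t0 - t))) ` {0..v - t0} <= P'"
 proof (rule simple_triangle_piece[OF g1 \<sigma>(1) h1[folded t0(4)]])
  show "g t0 ~= g u" "h v ~= g t0" "g u ~= h v" using z u(3) v(3) neq by metis+
  show "g (t0 + s) = g u" if "0 <= s" "s <= u - t0" "0 <= t" "t <= d (g u) (h v)" "g (t0 + s) = \<sigma> t" for s t
  proof -
   have "~ t0 + s < u" using u(4)[of "t0 + s"] \<sigma>(2)[OF that(3,4)] that(1,5) t0(1) by auto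
   hence "t0 + s = u" using that(2) by simp
   thus ?thesis by simp
  qed
  show "\<sigma> s = h v" if "0 <= s" "s <= d (g u) (h v)" "0 <= t" "t <= v - t0" "\<sigma> s = h (t0 + (v - t0 - t))" for s t
  proof -
   have "~ t > 0" using v(4)[of "t0 + (v - t0 - t)"] \<sigma>(2)[OF that(1,2)] that(4,5) t0(1) by auto
   thus ?thesis using that(3) that(5) by simp
  qed
  show "h (t0 + (v - t0 - s)) = g t0"
   if "0 <= s" "s <= v - t0" "0 <= t" "t <= u - t0" "h (t0 + (v - t0 - s)) = g (t0 + t)" for s t
  proof -
   have "t0 + t = t0 + (v - t0 - s)"
    by (rule geo_meet_time[OF g' h']) (use that t0(1) in simp_all)
   hence "t0 + t <= t0" using that t0(1) t0(5) by simp
   thus ?thesis using that by simp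
  qed
 qed
 then obtain P' where P': "P' : \<P>" and sub: "(%t. g (t0 + t)) ` {0..u - t0} <= P'"
   "\<sigma> ` {0..d (g u) (h v)} <= P'" by blast
 have "\<sigma> 0 : P'" "\<sigma> (d (g u) (h v)) : P'" by (rule subsetD[OF sub(2)], simp)+
 hence "P' = P" using geoD(2,3)[OF \<sigma>(1)] piece_unique[OF P' P _ u(3) _ v(3) neq] by simp_all
 moreover have "(%t. g (t0 + t)) 0 : P'" using lt by (intro subsetD[OF sub(1)] imageI) simp
 ultimately show False using z by simp
qed

text \<open>The common entry point of all geodesics from \<open>x\<close> to points of \<open>P\<close>.\<close>
lemma gate_exists:
 assumes P: "P : \<P>" and x: "x : M"
 shows "EX p:P. ALL q:P. ALL g. geo S g (d x q) x q --> (EX t. 0 <= t & t <= d x q & g t = p & (ALL s. 0 <= s & s < t --> g s ~: P))"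
proof -
 obtain q0 where q0: "q0 : P" using piece_nonempty[OF P] by blast
 obtain g0 where g0: "geo S g0 (d x q0) x q0" using geodesic_space_geo[OF geodesic_S x piece_mem[OF P q0]] by metis
 obtain u where u: "0 <= u" "u <= d x q0" "g0 u : P" "!!s. 0 <= s ==> s < u ==> g0 s ~: P"
  using geo_first_point[OF g0 piece_closed[OF P] q0] by blast
 show ?thesis
 proof (rule bexI[OF _ u(3)], intro ballI allI impI)
  fix q g assume q: "q : P" and g: "geo S g (d x q) x q"
  obtain v where v: "0 <= v" "v <= d x q" "g v : P" "!!s. 0 <= s ==> s < v ==> g s ~: P"
   using geo_first_point[OF g piece_closed[OF P] q] by blast
  show "EX t. 0 <= t & t <= d x q & g t = g0 u & (ALL s. 0 <= s & s < t --> g s ~: P)" using entry_points_agree[OF P g0 g u v] v by auto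
 qed
qed

lemma gate:
 assumes P: "P : \<P>" and x: "x : M"
 shows gate_mem: "gate S P x : P"
  and gate_betw: "!!q. q : P ==> betw S x (gate S P x) q"
  and gate_entry: "!!q g. q : P ==> geo S g (d x q) x q ==> g (d x (gate S P x)) = gate S P x"
proof -
 obtain p where p: "p : P" and pg: "ALL q:P. ALL g. geo S g (d x q) x q -->
   (EX t. 0 <= t & t <= d x q & g t = p & (ALL s. 0 <= s & s < t --> g s ~: P))"
  using gate_exists[OF P x] by blast
 have b: "betw S x p q" if q: "q : P" for q
 proof -
  obtain g where g: "geo S g (d x q) x q" using geodesic_space_geo[OF geodesic_S x piece_mem[OF P q]] by metis
  then obtain t where t: "0 <= t" "t <= d x q" "g t = p" using pg q by blast
  thus ?thesis using geo_betw_ends[OF g t(1,2)] by simp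
 qed
 have e: "gate S P x = p" by (rule gate_eqI[OF p b])
 show "gate S P x : P" using e p by simp
 show "betw S x (gate S P x) q" if "q : P" for q using b e that by simp
 show "g (d x (gate S P x)) = gate S P x" if q: "q : P" and g: "geo S g (d x q) x q" for q g
 proof -
  obtain t where t: "0 <= t" "t <= d x q" "g t = p" using pg q g by blast
  show ?thesis using geoD(8)[OF g, of 0 t] geoD(2)[OF g] t e by simp
 qed
qed

lemma gate_in_M: "P : \<P> ==> x : M ==> gate S P x : M"
 using gate_mem piece_mem by blast

lemma gate_self: "P : \<P> ==> x : P ==> gate S P x = x"
 by (rule gate_of_member) (auto simp: piece_subset)

text \<open>The gate of \<open>u\<close> in \<open>P\<close> lies between \<open>u\<close> and both \<open>p\<close> and
  \<open>q\<close>, so a detour from the gate to \<open>u\<close> would be run through twice.\<close>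
lemma piece_convex:
 assumes P: "P : \<P>" "p : P" "q : P" and b: "betw S p u q"
 shows "u : P"
proof -
 have u: "u : M" using b by (simp add: betw_def)
 let ?g = "gate S P u"
 have "betw S u ?g p" "betw S u ?g q" using gate_betw[OF P(1) u] P by auto
 moreover have "d p q <= d p ?g + d ?g q"
  using gate_in_M[OF P(1) u] piece_mem[OF P(1)] P by (intro mdist_triangle) auto
 ultimately have "d u ?g = 0"
  using b[unfolded betw_def] mdist_nonneg[of S u ?g] mdist_commute[of S p u] mdist_commute[of S p ?g]
  unfolding betw_def by linarith
 thus ?thesis using u gate_in_M[OF P(1) u] gate_mem[OF P(1) u] by simp
qed

lemma gate_pass:
 assumes P: "P : \<P>" "q : P" and b: "betw S x w q"
 shows "betw S x w (gate S P x) | betw S (gate S P x) w q"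
proof -
 obtain g where g: "geo S g (d x q) x q" "g (d x w) = w" using geo_through[OF geodesic_S b] by metis
 have x: "x : M" using b by (simp add: betw_def)
 let ?p = "gate S P x"
 have "d x ?p <= d x q" 
  using gate_betw[OF P(1) x P(2), unfolded betw_def] mdist_nonneg[of S ?p q] by linarith
 moreover have "d x w <= d x q" using b[unfolded betw_def] mdist_nonneg[of S w q] by linarith
 ultimately show ?thesis using geo_betw[OF g(1), of 0 "d x w" "d x ?p"] geo_betw[OF g(1), of "d x ?p" "d x w" "d x q"] g(2) geoD(2,3)[OF g(1)] gate_entry[OF P(1) x P(2) g(1)] by fastforce
qed

abbreviation "sdir \<equiv> same_dir S \<P>"

lemma same_dir_sym: "sdir x y z ==> sdir x z y"
 unfolding same_dir_def by blast

lemma same_dir_refl: "x : M ==> y : M ==> y ~= x ==> sdir x y y"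
 unfolding same_dir_def using betw_ends[of x S y] by blast

lemma same_dirI_betw:
 assumes "w ~= x" "betw S x w y" "betw S x w z"
 shows "sdir x y z"
using assms betw_self same_dir_def betw_mspace assms(2) assms(3) by metis

lemma same_dirI_piece:
 assumes "P : \<P>" "x : P" "y : M" "z : M" "gate S P y ~= x" "gate S P z ~= x"
 shows "sdir x y z"
using assms gate_self piece_mem same_dir_def by fastforce

lemma same_dirI_line: "w ~= x ==> betw S x w y ==> sdir x w y"
 using same_dirI_betw[of w x w y] betw_mspace[of S x w y] betw_ends[of x S w] by blast

lemma same_dirE:
 assumes "sdir x y z"
 obtains w where "w ~= x" "betw S x w y" "betw S x w z"
 | P where "P : \<P>" "x : P" "gate S P y ~= x" "gate S P z ~= x"
 using assms unfolding same_dir_def by blast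

lemma same_dir_mem: "sdir x y z ==> x : M & y : M & z : M & y ~= x & z ~= x"
 unfolding same_dir_def by blast

lemma gate_neI:
 assumes "P : \<P>" "x : P" "w : P" "w ~= x" "betw S x w y"
 shows "gate S P y ~= x"
using gate_betw assms(1) assms betw_mspace assms(5) betw_antisym betw_sym by metis

text \<open>Points in different directions at \<open>x\<close> are separated by \<open>x\<close>: otherwise a geodesic between
 them together with geodesics from \<open>x\<close> contains a simple triangle at \<open>x\<close>.\<close>

lemma betw_if_not_same_dir:
 assumes M: "x : M" "y : M" "z : M" and ns: "~ sdir x y z"
 shows "betw S y x z"
proof (cases "y = x | z = x")
 case True
 thus ?thesis using M betw_ends by metis
next
 case False
 obtain \<alpha> where a: "geo S \<alpha> (d x y) x y" using geodesic_space_geo[OF geodesic_S M(1,2)] by metis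
 obtain \<beta> where b: "geo S \<beta> (d x z) x z" using geodesic_space_geo[OF geodesic_S M(1,3)] by metis
 obtain \<sigma> where s: "geo S \<sigma> (d y z) y z" using geodesic_space_geo[OF geodesic_S M(2,3)] by metis
 have ab: "\<alpha> u = x" if "\<alpha> u = \<beta> v" "0 <= u" "u <= d x y" "0 <= v" "v <= d x z" for u v
  using same_dirI_betw[of "\<alpha> u" x y z] ns geo_betw_ends[OF a that(2,3)] geo_betw_ends[OF b that(4,5)] that(1)
  by metis
 have "{t : {0..d y z}. \<sigma> t : \<alpha> ` {0..d x y}} ~= {}"
  using geoD(2)[OF s] geoD(3)[OF a] by (auto intro!: exI[of _ 0] image_eqI[of _ _ "d x y"])
 from compact_attains_sup[OF geo_images_meet_compact[OF s a] this]
 obtain s1 u1 where s1: "0 <= s1" "s1 <= d y z" "\<sigma> s1 = \<alpha> u1" "0 <= u1" "u1 <= d x y"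
  and max: "!!t u. 0 <= t ==> t <= d y z ==> \<sigma> t = \<alpha> u ==> 0 <= u ==> u <= d x y ==> t <= s1"
  by fastforce
 have s': "geo S (%t. \<sigma> (s1 + t)) (d y z - s1) (\<sigma> s1) z"
  using geo_sub[OF s s1(1,2)] geoD(3)[OF s] by auto
 have "{t : {0..d y z - s1}. (%t. \<sigma> (s1 + t)) t : \<beta> ` {0..d x z}} ~= {}"
  using geoD(3)[OF s'] geoD(3)[OF b] s1 by (auto intro!: exI[of _ "d y z - s1"] image_eqI[of _ _ "d x z"])
 from compact_attains_inf[OF geo_images_meet_compact[OF s' b] this]
 obtain s2 u2 where s2: "0 <= s2" "s2 <= d y z - s1" "\<sigma> (s1 + s2) = \<beta> u2" "0 <= u2" "u2 <= d x z"
  and min: "!!t u. 0 <= t ==> t <= d y z - s1 ==> \<sigma> (s1 + t) = \<beta> u ==> 0 <= u ==> u <= d x z ==> s2 <= t"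
  by fastforce
 show ?thesis
 proof (cases "\<sigma> s1 = x | \<sigma> (s1 + s2) = x")
  case True
  thus ?thesis using geo_betw_ends[OF s s1(1,2)] geo_betw_ends[OF s, of "s1 + s2"] s1 s2 by auto
 next
  case nx: False
  have "\<sigma> s1 ~= \<sigma> (s1 + s2)" using ab[of u1 u2] s1 s2 nx by metis
  have g1: "geo S \<alpha> u1 x (\<sigma> s1)" using geo_take[OF a s1(4,5)] s1(3) by simp
  have g2: "geo S (%t. \<sigma> (s1 + t)) s2 (\<sigma> s1) (\<sigma> (s1 + s2))" using geo_take[OF s' s2(1,2)] by simp
  have g3: "geo S (%t. \<beta> (u2 - t)) u2 (\<sigma> (s1 + s2)) x" using geo_rev[OF geo_take[OF b s2(4,5)]] s2(3) by simp
  have "EX P:\<P>. \<alpha> ` {0..u1} <= P & (%t. \<sigma> (s1 + t)) ` {0..s2} <= P & (%t. \<beta> (u2 - t)) ` {0..u2} <= P"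
  proof (rule simple_triangle_piece[OF g1 g2 g3])
   show "x ~= \<sigma> s1" "\<sigma> s1 ~= \<sigma> (s1 + s2)" "\<sigma> (s1 + s2) ~= x" using nx \<open>\<sigma> s1 ~= \<sigma> (s1 + s2)\<close> by auto
   show "\<alpha> s = \<sigma> s1" if "0 <= s" "s <= u1" "0 <= t" "t <= s2" "\<alpha> s = \<sigma> (s1 + t)" for s t
   proof -
    have "s1 + t <= s1" by (rule max[of _ s]) (use that s1 s2 in auto)
    thus ?thesis using that by auto
   qed
   show "\<sigma> (s1 + s) = \<sigma> (s1 + s2)" if "0 <= s" "s <= s2" "0 <= t" "t <= u2" "\<sigma> (s1 + s) = \<beta> (u2 - t)" for s t
   using min that s1 s2 by fastforce
   show "\<beta> (u2 - s) = x" if "0 <= s" "s <= u2" "0 <= t" "t <= u1" "\<beta> (u2 - s) = \<alpha> t" for s t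
    using ab[of t "u2 - s"] that s1 s2 by auto
  qed
  then obtain P where P: "P : \<P>" and sub: "\<alpha> ` {0..u1} <= P" "(%t. \<beta> (u2 - t)) ` {0..u2} <= P" by blast
  have "\<alpha> 0 : P" "\<alpha> u1 : P" by (rule subsetD[OF sub(1)], use s1(4) in simp)+
  moreover have "(%t. \<beta> (u2 - t)) 0 : P" by (rule subsetD[OF sub(2)], rule imageI) (use s2(4) in simp)
  ultimately have in_P: "x : P" "\<sigma> s1 : P" "\<sigma> (s1 + s2) : P" using geoD(2)[OF a] s1(3) s2(3) by simp_all
  have "gate S P y ~= x" 
   by (rule gate_neI[OF P in_P(1,2)]) (use nx geo_betw_ends[OF a s1(4,5)] s1(3) in auto)
  moreover have "gate S P z ~= x" 
   by (rule gate_neI[OF P in_P(1,3)]) (use nx geo_betw_ends[OF b s2(4,5)] s2(3) in auto)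
  ultimately show ?thesis using ns same_dirI_piece[OF P in_P(1) M(2,3)] by blast
 qed
qed

end

lemma mdist_pos:
 assumes "x : mspace m" "y : mspace m" "x ~= y"
 shows "0 < mdist m x y"
proof -
 show ?thesis using mdist_zero[OF assms(1,2)] assms(3) mdist_nonneg[of m x y] by linarith
qed

context tree_graded_space
begin

text \<open>Otherwise \<open>v\<close> and \<open>v'\<close> would be in the same direction at the gate of
  \<open>v\<close>, although \<open>v'\<close> is reached from there inside \<open>P\<close> at first and
  \<open>v\<close> outside.\<close>
lemma gates_differ:
 assumes P: "P : \<P>" and M: "v : M" "v' : M" and ne: "gate S P v ~= gate S P v'"
 shows "betw S v (gate S P v) v'" "betw S v (gate S P v') v'"
proof -
 have main: "betw S v (gate S P v) v'" if M: "v : M" "v' : M" and ne: "gate S P v ~= gate S P v'" for v v'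
 proof (cases "v = gate S P v")
  case True
  thus ?thesis using betw_ends[OF M] by simp
 next
  case False
  let ?p = "gate S P v" and ?p' = "gate S P v'"
  have p: "?p : P" "?p' : P" using gate_mem[OF P] M by auto
  have pM: "?p : M" "?p' : M" using p piece_mem[OF P] by auto
  have vp: "d v ?p + d ?p q = d v q" if "q : P" for q
   using gate_betw[OF P M(1) that] by (simp add: betw_def)
  have vp': "d v' ?p' + d ?p' q = d v' q" if "q : P" for q
   using gate_betw[OF P M(2) that] by (simp add: betw_def)
  have "~ sdir ?p v v'"
  proof
   assume "sdir ?p v v'"
   thus False
   proof (cases rule: same_dirE)
    case (1 w)
    have w: "w : M" using betw_mspace[OF 1(2)] by simp
    have e1: "d ?p w + d w v = d ?p v" and e2: "d ?p w + d w v' = d ?p v'"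
     using 1 by (auto simp: betw_def)
    have pp: "0 < d ?p ?p'" by (rule mdist_pos[OF pM ne])
    have tw: "d v ?p' <= d v w + d w ?p'" by (rule mdist_triangle) (use M w pM in auto)
    have "w ~: P" using vp[of w] e1 mdist_commute[of S w v] mdist_commute[of S ?p v] mdist_pos[OF pM(1) w 1(1)[symmetric]] by auto
    consider "betw S v' w ?p'" | "betw S ?p' w ?p"
     using gate_pass[OF P p(1) betw_sym[OF 1(3)]] by blast
    thus False
    proof cases
     case 1
     hence "d v' w + d w ?p' = d v' ?p'" by (simp add: betw_def)
     thus False using tw e1 e2 pp vp'[OF p(1)] mdist_commute[of S v w] mdist_commute[of S v ?p] mdist_commute[of S v' w] mdist_commute[of S v' ?p] mdist_commute[of S ?p ?p'] vp[OF p(2)] by linarith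
    next
     case 2
     thus False using piece_convex[OF P p(2,1)] \<open>w ~: P\<close> by blast
    qed
   next
    case (2 P1)
    have "P1 ~= P" using 2 by auto
    have q: "gate S P1 v' : P1" by (rule gate_mem[OF 2(1) M(2)])
    have b: "betw S v' (gate S P1 v') ?p" by (rule gate_betw[OF 2(1) M(2) 2(2)])
    have "gate S P1 v' ~: P" using piece_unique[OF 2(1) P 2(2) p(1) q] 2(4) \<open>P1 ~= P\<close> by metis
    moreover consider "betw S v' (gate S P1 v') ?p'" | "betw S ?p' (gate S P1 v') ?p"
     using gate_pass[OF P p(1) b] by blast
    hence "betw S v' (gate S P1 v') ?p'"
     using piece_convex[OF P p(2,1)] \<open>gate S P1 v' ~: P\<close> by blast
    hence "?p' : P1" using betw_trans(2)[OF gate_betw[OF P M(2) p(1)]] piece_convex[OF 2(1) q 2(2)] by blast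
    thus False using piece_unique[OF 2(1) P 2(2) p(1) _ p(2) ne] \<open>P1 ~= P\<close> by blast
   qed
  qed
  thus ?thesis by (rule betw_if_not_same_dir[OF pM(1) M])
 qed
 show "betw S v (gate S P v) v'" by (rule main[OF M ne])
 show "betw S v (gate S P v') v'" by (rule betw_sym[OF main[OF M(2,1) ne[symmetric]]])
qed

lemma gate_betw_ne:
 assumes P: "P : \<P>" "x : P" and z: "gate S P z ~= x" and w: "betw S x w z" "w ~= x"
 shows "gate S P w ~= x"
using w betw_def gates_differ(1) P(1) z betw_antisym betw_sym w(1) by metis

lemma gate_betw_ne':
 assumes P: "P : \<P>" "x : P" and w: "gate S P w ~= x" "betw S x w y"
 shows "gate S P y ~= x"
proof (rule gate_neI[OF P])
 have M: "w : M" using w by (auto simp: betw_def)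
 show "gate S P w : P" by (rule gate_mem[OF P(1) M])
 show "betw S x (gate S P w) y"
  using betw_trans(1)[OF w(2) betw_sym[OF gate_betw[OF P(1) M P(2)]]] .
qed (rule w)

lemma gate_of_other_piece:
 assumes "P : \<P>" "P' : \<P>" "P ~= P'" "x : P" "x : P'" "q : P"
 shows "gate S P' q = x"
proof (rule ccontr)
 assume ne: "gate S P' q ~= x"
 have q: "q : M" using piece_mem assms by blast
 show False using piece_convex[OF assms(1,6,4) gate_betw[OF assms(2) q assms(5)]] piece_unique[OF assms(1,2) assms(4,5) _ gate_mem[OF assms(2) q]] ne assms(3) by metis
qed

lemma piece_dir_unique:
 assumes P: "P : \<P>" "x : P" "gate S P z ~= x" and P': "P' : \<P>" "x : P'" "gate S P' z ~= x"
  and z: "z : M"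
 shows "P = P'"
proof (rule ccontr)
 assume "P ~= P'"
 have "gate S P' (gate S P z) = x"
  by (rule gate_of_other_piece[OF P(1) P'(1) \<open>P ~= P'\<close> P(2) P'(2) gate_mem[OF P(1) z]])
 thus False using gate_betw_ne[OF P'(1,2,3) betw_sym[OF gate_betw[OF P(1) z P(2)]] P(3)] by simp
qed

text \<open>If the two geodesics do not meet arbitrarily close to \<open>x\<close>, there is a first time at which they
  meet again, and up to this time they form a bigon.\<close>
lemma bigon_germ:
 assumes g: "geo S g L x y" and h: "geo S h L x y" and L: "L > 0"
 shows "(ALL e>0. EX t. 0 < t & t < e & t <= L & g t = h t) |
     (EX P:\<P>. EX e. 0 < e & e <= L & (ALL t. 0 <= t & t <= e --> g t : P & h t : P))"
proof (cases "ALL e>0. EX t. 0 < t & t < e & t <= L & g t = h t")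
 case False
 then obtain e where e: "e > 0" "!!t. 0 < t ==> t < e ==> t <= L ==> g t ~= h t" by blast
 let ?e = "min e L"
 have sg: "geo S (%t. g (?e + t)) (L - ?e) (g ?e) y" and sh: "geo S (%t. h (?e + t)) (L - ?e) (h ?e) y"
  using geo_sub[OF g, of ?e L] geo_sub[OF h, of ?e L] e(1) L geoD(3)[OF g] geoD(3)[OF h] by auto
 let ?Z = "{t : {0..min (L - ?e) (L - ?e)}. g (?e + t) = h (?e + t)}"
 have "?Z ~= {}" using geoD(3)[OF g] geoD(3)[OF h] e(1) L by auto
 from compact_attains_inf[OF geo_agree_compact[OF sg sh] this]
 obtain t1 where "t1 : ?Z" and min: "ALL t:?Z. t1 <= t" by blast
 hence t1: "0 <= t1" "t1 <= L - ?e" "g (?e + t1) = h (?e + t1)" by auto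
 let ?l = "?e + t1"
 have l: "0 < ?l" "?l <= L" "0 <= ?l" using t1 e(1) L by auto
 have ne: "g t ~= h t" if t: "0 < t" "t < ?l" for t
 proof (cases "t < ?e")
  case True
  thus ?thesis using e(2)[of t] t by simp
 next
  case False
  show ?thesis
  proof
   assume "g t = h t"
   hence "t1 <= t - ?e" using False t t1 min by simp
   thus False using t by simp
  qed
 qed
 obtain P where P: "P : \<P>" "g ` {0..?l} <= P" "h ` {0..?l} <= P" using bigon_piece[OF geo_take[OF g l(3,2)] geo_take[OF h l(3,2), folded t1(3)] l(1) ne] by blast
 have "g t : P & h t : P" if "0 <= t" "t <= ?l" for t
  using subsetD[OF P(2), of "g t"] subsetD[OF P(3), of "h t"] that by simp
 thus ?thesis using P(1) l(1,2) by blast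
qed blast

text \<open>The geodesics from \<open>x\<close> to \<open>z\<close> through \<open>w\<close> and through
  \<open>w'\<close> are compared by \<open>bigon_germ\<close>.\<close>
lemma two_common_points:
 assumes w: "w ~= x" "betw S x w z" and w': "w' ~= x" "betw S x w' z"
 shows "sdir x w w'"
proof -
 have M: "x : M" "w : M" "w' : M" "z : M" using w w' by (auto simp: betw_def)
 obtain \<alpha> where a: "geo S \<alpha> (d x z) x z" "\<alpha> (d x w) = w" using geo_through[OF geodesic_S w(2)] by metis
 obtain \<beta> where b: "geo S \<beta> (d x z) x z" "\<beta> (d x w') = w'" using geo_through[OF geodesic_S w'(2)] by metis
 have pos: "0 < d x w" "0 < d x w'"
  by (rule mdist_pos[OF M(1,2) w(1)[symmetric]], rule mdist_pos[OF M(1,3) w'(1)[symmetric]])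
 have le: "d x w <= d x z" "d x w' <= d x z"
  using w(2)[unfolded betw_def] w'(2)[unfolded betw_def] mdist_nonneg[of S w z] mdist_nonneg[of S w' z] by linarith+
 have aw: "betw S x (\<alpha> t) w" if "0 <= t" "t <= d x w" for t
  using geo_betw[OF a(1), of 0 t "d x w"] that le(1) a(2) geoD(2)[OF a(1)] by simp
 have bw: "betw S x (\<beta> t) w'" if "0 <= t" "t <= d x w'" for t
  using geo_betw[OF b(1), of 0 t "d x w'"] that le(2) b(2) geoD(2)[OF b(1)] by simp
 have ax: "\<alpha> t ~= x" if "0 < t" "t <= d x z" for t
  using geo_dist(1)[OF a(1), of t] that M(1) by auto
 have bx: "\<beta> t ~= x" if "0 < t" "t <= d x z" for t
  using geo_dist(1)[OF b(1), of t] that M(1) by auto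
 have "0 < d x z" using pos le by linarith
 from bigon_germ[OF a(1) b(1) this] consider
   t where "0 < t" "t < min (d x w) (d x w')" "\<alpha> t = \<beta> t"
  | P e where "P : \<P>" "0 < e" "e <= d x z" "!!t. 0 <= t ==> t <= e ==> \<alpha> t : P & \<beta> t : P"
  using pos by (metis min_less_iff_conj)
 thus ?thesis
 proof cases
  case 1
  hence t: "0 <= t" "t <= d x w" "t <= d x w'" by auto
  have "betw S x (\<alpha> t) w" "betw S x (\<alpha> t) w'" using aw[OF t(1,2)] bw[OF t(1,3)] 1(3) by auto
  moreover have "\<alpha> t ~= x" by (rule ax) (use 1 t le in linarith)+
  ultimately show ?thesis by (intro same_dirI_betw[of "\<alpha> t"])
 next
  case 2
  let ?t = "min e (min (d x w) (d x w'))"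
  have t: "0 <= ?t" "0 < ?t" "?t <= e" "?t <= d x w" "?t <= d x w'" "?t <= d x z" using 2 pos by auto
  have x: "x : P" using 2(4)[of 0] 2(2) geoD(2)[OF a(1)] by simp
  have "gate S P w ~= x"
   by (rule gate_neI[OF 2(1) x _ ax[OF t(2,6)] aw[OF t(1,4)]]) (use 2(4)[OF t(1,3)] in simp)
  moreover have "gate S P w' ~= x"
   by (rule gate_neI[OF 2(1) x _ bx[OF t(2,6)] bw[OF t(1,5)]]) (use 2(4)[OF t(1,3)] in simp)
  ultimately show ?thesis using same_dirI_piece[OF 2(1) x M(2,3)] by blast
 qed
qed

lemma same_dir_betw_left:
 assumes "sdir x w z" "betw S x w y"
 shows "sdir x y z"
 using assms(1)
proof (cases rule: same_dirE)
 case (1 v)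
 thus ?thesis using same_dirI_betw[OF 1(1) betw_trans(1)[OF assms(2) 1(2)]] by blast
next
 case (2 P)
 thus ?thesis
  using same_dirI_piece[OF 2(1,2) _ _ gate_betw_ne'[OF 2(1-3) assms(2)] 2(4)] assms(2)
   same_dir_mem[OF assms(1)] by (auto simp: betw_def)
qed

text \<open>The mixed cases, where one relation comes from a common point and the other from a piece, reduce to the fact
  that being outside the gate \<open>x\<close> of a piece is inherited along geodesics from \<open>x\<close>.\<close>
lemma same_dir_trans:
 assumes yz: "sdir x y z" and zv: "sdir x z v"
 shows "sdir x y v"
proof -
 have mixed: "sdir x y v" if w: "w ~= x" "betw S x w y" "betw S x w z"
  and P: "P : \<P>" "x : P" "gate S P z ~= x" "gate S P v ~= x" and M: "v : M" for y z v w P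
 proof -
  have "gate S P w ~= x" by (rule gate_betw_ne[OF P(1-3) w(3,1)])
  thus ?thesis using gate_betw_ne'[OF P(1,2) _ w(2)] same_dirI_piece[OF P(1,2)] P(4) M w(2) by (auto simp: betw_def)
 qed
 note Myz = same_dir_mem[OF yz] and Mzv = same_dir_mem[OF zv]
 from yz show ?thesis
 proof (cases rule: same_dirE)
  case (1 w)
  from zv show ?thesis
  proof (cases rule: same_dirE)
   case (1 w')
   have "sdir x w w'" by (rule two_common_points[OF \<open>w ~= x\<close> \<open>betw S x w z\<close> 1(1,2)])
   thus ?thesis using same_dir_betw_left[OF _ \<open>betw S x w y\<close>] same_dir_betw_left[OF same_dir_sym 1(3)] same_dir_sym by blast
  next
   case (2 P)
   show ?thesis by (rule mixed[OF 1 2]) (use Mzv in blast)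
  qed
 next
  case (2 P)
  from zv show ?thesis
  proof (cases rule: same_dirE)
   case (1 w')
   have "sdir x v y" by (rule mixed[OF 1(1,3,2) 2(1,2,4,3)]) (use Myz in blast)
   thus ?thesis by (rule same_dir_sym)
  next
   case (2 P')
   have "P = P'" by (rule piece_dir_unique[OF \<open>P : \<P>\<close> \<open>x : P\<close> \<open>gate S P z ~= x\<close> 2(1-3)]) (use Myz in blast)
   thus ?thesis using same_dirI_piece[OF 2(1,2)] Myz Mzv 2 \<open>gate S P y ~= x\<close> by blast
  qed
 qed
qed

text \<open>The relation is open in both arguments: a nearby point cannot be separated by \<open>x\<close>.\<close>

lemma same_dir_near:
 assumes "x : M" "y : M" "z : M" "y ~= x" "d y z < d y x"
 shows "sdir x y z"
proof (rule ccontr)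
 assume "~ sdir x y z"
 hence "d y x + d x z = d y z" using betw_if_not_same_dir assms(1-3) by (auto simp: betw_def)
 thus False using assms(5) mdist_nonneg[of S x z] by linarith
qed

lemma same_dir_geo:
 assumes g: "geo S g l u v" and st: "0 <= s" "s <= t" "t <= l" and x: "x : M"
  and ne: "!!r. s <= r ==> r <= t ==> g r ~= x"
 shows "sdir x (g s) (g t)"
proof (rule interval_chain[of s t "%r r'. sdir x (g r) (g r')"])
 have M: "g r : M" if "r : {s..t}" for r using geoD(7)[OF g, of r] that st by simp
 show "EX e>0. ALL r':{s..t}. \<bar>r' - r\<bar> < e --> sdir x (g r) (g r')" if r: "r : {s..t}" for r
 proof (intro exI conjI ballI impI)
  show "0 < d (g r) x" using mdist_pos[OF M[OF r] x] ne[of r] r by simp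
  fix r' assume r': "r' : {s..t}" "\<bar>r' - r\<bar> < d (g r) x"
  have "d (g r) (g r') = \<bar>r - r'\<bar>" by (rule geoD(8)[OF g]) (use r r' st in auto)
  thus "sdir x (g r) (g r')"
   using same_dir_near[OF x M[OF r] M[OF r'(1)] ne[of r]] r r'(2) by (simp add: abs_minus_commute)
 qed
qed (use st same_dir_sym same_dir_trans in blast)+

lemma same_dir_on_geo:
 assumes g: "geo S g l x y" and "0 < s" "s <= l" "0 < t" "t <= l"
 shows "sdir x (g s) (g t)"
proof -
 have *: "sdir x (g s) (g t)" if "0 < s" "s <= t" "t <= l" for s t
 proof (rule same_dirI_line)
  show "betw S x (g s) (g t)" using geo_betw[OF g, of 0 s t] geoD(2)[OF g] that by simp
  show "g s ~= x" using geo_dist(1)[OF g, of s] geoD(4)[OF g] that by auto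
 qed
 show ?thesis using *[of s t] *[of t s] same_dir_sym assms by (cases "s <= t") auto
qed

text \<open>If the relation comes from a common point \<open>w\<close>, each geodesic is compared by
  \<open>bigon_germ\<close> with one through \<open>w\<close>, and the latter two can be given the same
  initial part.\<close>
lemma germ_dichotomy:
 assumes g: "geo S g l x y" and h: "geo S h k x z" and yz: "sdir x y z"
 shows "(ALL e>0. EX t. 0 < t & t < e & t <= l & t <= k & g t = h t) |
     (EX P:\<P>. EX e>0. e <= l & e <= k & (ALL t. 0 <= t & t <= e --> g t : P & h t : P))"
proof -
 have pos: "l > 0" "k > 0"
  using same_dir_mem[OF yz] geoD(1,2,3)[OF g] geoD(1,2,3)[OF h] by (metis less_eq_real_def)+
 have in_piece: "EX e>0. e <= l & (ALL t. 0 <= t & t <= e --> g t : P)"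
  if P: "P : \<P>" "x : P" and g: "geo S g l x y" and ne: "gate S P y ~= x" for P g l y
 proof -
  have y: "y : M" and x: "x : M" using geoD(4,5)[OF g] by auto
  let ?p = "gate S P y"
  have dl: "d y x = l" using geoD(6)[OF g] mdist_commute[of S x y] by simp
  have "geo S (%t. g (l - t)) (d y x) y x" using geo_rev[OF g] dl by simp
  from gate_entry[OF P(1) y P(2) this] have e: "g (l - d y ?p) = ?p" .
  have pM: "?p : M" by (rule gate_in_M[OF P(1) y])
  have sum: "d y ?p + d ?p x = l" using gate_betw[OF P(1) y P(2)] dl by (simp add: betw_def)
  have "g t : P" if "0 <= t" "t <= d ?p x" for t
  proof (rule piece_convex[OF P gate_mem[OF P(1) y]])
   have "betw S (g 0) (g t) (g (l - d y ?p))"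
    by (rule geo_betw[OF g]) (use that sum mdist_nonneg[of S y ?p] in auto)
   thus "betw S x (g t) ?p" using e geoD(2)[OF g] by simp
  qed
  thus ?thesis using sum mdist_nonneg[of S y ?p] mdist_pos[OF pM x ne] by auto
 qed
 have both: ?thesis if P: "P : \<P>" "x : P" and ne: "gate S P y ~= x" "gate S P z ~= x" for P
 proof -
  obtain e1 where e1: "e1 > 0" "e1 <= l" "ALL t. 0 <= t & t <= e1 --> g t : P"
   using in_piece[OF P g ne(1)] by blast
  obtain e2 where e2: "e2 > 0" "e2 <= k" "ALL t. 0 <= t & t <= e2 --> h t : P"
   using in_piece[OF P h ne(2)] by blast
  show ?thesis
   by (rule disjI2, rule bexI[OF _ P(1)], rule exI[of _ "min e1 e2"]) (use e1 e2 in auto)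
 qed
 from yz show ?thesis
 proof (cases rule: same_dirE)
  case (2 P)
  thus ?thesis by (rule both)
 next
  case (1 w)
  have M: "x : M" "w : M" using betw_mspace[OF 1(2)] by auto
  obtain \<alpha> where a: "geo S \<alpha> (d x y) x y" "\<alpha> (d x w) = w" using geo_through[OF geodesic_S 1(2)] by metis
  obtain \<beta> where b: "geo S \<beta> (d x z) x z" "\<beta> (d x w) = w" using geo_through[OF geodesic_S 1(3)] by metis
  have l: "d x y = l" "d x z = k" using geoD(6)[OF g] geoD(6)[OF h] by auto
  have dw: "0 < d x w" by (rule mdist_pos[OF M 1(1)[symmetric]])
  have dwl: "d x w <= l" "d x w <= k"
   using 1(2,3)[unfolded betw_def] l mdist_nonneg[of S w y] mdist_nonneg[of S w z] by linarith+
  \<comment> \<open>replace the initial part of the second comparison geodesic by that of the first\<close>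
  have bwz: "betw S x w z" by (rule 1(3))
  define \<beta>' where "\<beta>' = (%t. if t <= d x w then \<alpha> t else \<beta> (d x w + (t - d x w)))"
  have b': "geo S \<beta>' k x z"
  proof -
   have "geo S \<alpha> (d x w) x w" using geo_take[OF a(1), of "d x w"] a(2) dw dwl l by simp
   moreover have "geo S (%t. \<beta> (d x w + t)) (k - d x w) w z"
    using geo_sub[OF b(1), of "d x w" k] b(2) dw dwl l geoD(3)[OF b(1)] by simp
   ultimately show ?thesis unfolding \<beta>'_def using geo_concat[of S \<alpha> "d x w" x w _ "k - d x w" z] bwz by fastforce
  qed
  have a': "geo S \<alpha> l x y" using a(1) l by simp
  have germP: ?thesis if P: "P : \<P>" and e: "0 < e" "e <= l" "e <= k" and gP: "g e : P" "h e : P" and xP: "x : P" for P e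
  proof (rule both[OF P xP])
   have "g e ~= x" using geo_dist(1)[OF g, of e] e M by auto
   thus "gate S P y ~= x" using gate_neI[OF P xP gP(1)] geo_betw_ends[OF g] e by auto
   have "h e ~= x" using geo_dist(1)[OF h, of e] e M by auto
   thus "gate S P z ~= x" using gate_neI[OF P xP gP(2)] geo_betw_ends[OF h] e by auto
  qed
  have piece1: ?thesis if P: "P : \<P>" and e: "0 < e" "e <= l" "ALL t. 0 <= t & t <= e --> g t : P & \<alpha> t : P" for P e
  proof (rule both[OF P])
   show xP: "x : P" using e(3)[rule_format, of 0] e(1) geoD(2)[OF g] by simp
   have "g e ~= x" using geo_dist(1)[OF g, of e] e(1,2) M by auto
   thus "gate S P y ~= x" using gate_neI[OF P xP, of "g e"] geo_betw_ends[OF g] e by auto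
   let ?t = "min e (d x w)"
   have t: "0 < ?t" "?t <= e" "?t <= d x w" using e dw by auto
   have "\<alpha> ?t ~= x" using geo_dist(1)[OF a', of ?t] t e(2) M by auto
   moreover have "\<alpha> ?t : P" using e(3) t by simp
   ultimately show "gate S P z ~= x" using gate_neI[OF P xP] betw_trans(1)[OF bwz] geo_betw[OF a', of 0 ?t "d x w"] t dwl geoD(2)[OF a'] a(2) by simp
  qed
  have piece2: ?thesis if P: "P : \<P>" and e: "0 < e" "e <= k" "ALL t. 0 <= t & t <= e --> h t : P & \<beta>' t : P" for P e
  proof (rule both[OF P])
   show xP: "x : P" using e(3)[rule_format, of 0] e(1) geoD(2)[OF h] by simp
   have "h e ~= x" using geo_dist(1)[OF h, of e] e(1,2) M by auto
   thus "gate S P z ~= x" using gate_neI[OF P xP, of "h e"] geo_betw_ends[OF h] e by auto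
   let ?t = "min e (d x w)"
   have t: "0 < ?t" "?t <= e" "?t <= d x w" using e dw by auto
   have "\<alpha> ?t ~= x" using geo_dist(1)[OF a', of ?t] t dwl M by auto
   moreover have "\<alpha> ?t : P" using e(3)[rule_format, of ?t] t by (simp add: \<beta>'_def)
   ultimately show "gate S P y ~= x" using gate_neI[OF P xP] betw_trans(1)[OF 1(2)] geo_betw[OF a', of 0 ?t "d x w"] t dwl geoD(2)[OF a'] a(2) by simp
  qed
  show ?thesis
  proof (cases "EX P:\<P>. EX e. 0 < e & e <= l & (ALL t. 0 <= t & t <= e --> g t : P & \<alpha> t : P)")
   case True
   thus ?thesis by (elim bexE exE conjE) (rule piece1)
  next
   case n1: False
   show ?thesis
   proof (cases "EX P:\<P>. EX e. 0 < e & e <= k & (ALL t. 0 <= t & t <= e --> h t : P & \<beta>' t : P)")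
    case True
    thus ?thesis by (elim bexE exE conjE) (rule piece2)
   next
    case n2: False
    have ga: "ALL e>0. EX t. 0 < t & t < e & t <= l & g t = \<alpha> t" 
     by (rule disjE[OF bigon_germ[OF g a' pos(1)]], assumption, erule notE[OF n1])
    have hb: "ALL e>0. EX t. 0 < t & t < e & t <= k & h t = \<beta>' t" 
     by (rule disjE[OF bigon_germ[OF h b' pos(2)]], assumption, erule notE[OF n2])
    \<comment> \<open>reroute both geodesics along \<open>\<alpha>\<close> so that they end at a common point\<close>
    obtain t1 where t1: "0 < t1" "t1 < d x w" "g t1 = \<alpha> t1" using ga dw by blast
    obtain t2 where t2: "0 < t2" "t2 < t1" "h t2 = \<beta>' t2" using hb t1 by blast
    have ht2: "h t2 = \<alpha> t2" using t1 t2 by (simp add: \<beta>'_def)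
    define h' where "h' = (%t. if t <= t2 then h t else \<alpha> (t2 + (t - t2)))"
    have h': "geo S h' t1 x (\<alpha> t1)"
    proof -
     have "geo S h t2 x (\<alpha> t2)" using geo_take[OF h, of t2] ht2 t1 t2 dwl by simp
     moreover have "geo S (%t. \<alpha> (t2 + t)) (t1 - t2) (\<alpha> t2) (\<alpha> t1)"
      using geo_sub[OF a', of t2 t1] t1 t2 dwl by simp
     moreover have "betw S x (\<alpha> t2) (\<alpha> t1)" using geo_betw[OF a', of 0 t2 t1] t1 t2 dwl geoD(2)[OF a'] by simp
     ultimately show ?thesis unfolding h'_def using geo_concat[of S h t2 x "\<alpha> t2" _ "t1 - t2" "\<alpha> t1"] by fastforce
    qed
    have g1: "geo S g t1 x (\<alpha> t1)" using geo_take[OF g, of t1] t1 dwl by simp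
    from bigon_germ[OF g1 h' t1(1)] show ?thesis
    proof
     assume *: "ALL e>0. EX t. 0 < t & t < e & t <= t1 & g t = h' t"
     have "EX t. 0 < t & t < e & t <= l & t <= k & g t = h t" if "e > 0" for e
     proof -
      have "0 < min e t2" using that t2(1) by simp
      then obtain t where t: "0 < t" "t < min e t2" "g t = h' t" using * by blast
      show ?thesis using t h'_def t1 t2 dwl by auto
     qed
     thus ?thesis by (intro disjI1 allI impI)
    next
     assume "EX P:\<P>. EX e. 0 < e & e <= t1 & (ALL t. 0 <= t & t <= e --> g t : P & h' t : P)"
     then obtain P e where P: "P : \<P>" "0 < e" "e <= t1" and eP: "ALL t. 0 <= t & t <= e --> g t : P & h' t : P"
      by (elim bexE exE conjE)
     let ?t = "min e t2"
     have t: "0 < ?t" "?t <= e" "?t <= t2" "0 <= ?t" using P t2 by auto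
     have "?t <= l" "?t <= k" using t(3) t1 t2 dwl by linarith+
     thus ?thesis using germP[OF P(1) t(1)] eP[rule_format, of ?t] eP[rule_format, of 0] t geoD(2)[OF g] P(2) h'_def by (auto simp: h'_def)
    qed
   qed
  qed
 qed
qed

end

section \<open>Isometries\<close>

lemma isometry_dist:
 "isometry m m' f ==> x : mspace m ==> y : mspace m ==> mdist m' (f x) (f y) = mdist m x y"
 unfolding isometry_def isometric_embedding_def by (elim conjE) simp

lemma isometry_mem: "isometry m m' f ==> x : mspace m ==> f x : mspace m'"
 unfolding isometry_def by (elim conjE) (simp add: set_eq_iff image_iff, metis)

lemma isometry_image: "isometry m m' f ==> f ` mspace m = mspace m'"
 unfolding isometry_def by (elim conjE)

lemma isometryI:
 assumes "f ` mspace m = mspace m'"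
  and "!!x y. x : mspace m ==> y : mspace m ==> mdist m' (f x) (f y) = mdist m x y"
 shows "isometry m m' f"
proof -
 have "f : mspace m \<rightarrow> mspace m'"
 proof (rule funcsetI)
  fix x assume "x : mspace m" thus "f x : mspace m'" using assms(1) by (metis imageI)
 qed
 thus ?thesis
  unfolding isometry_def isometric_embedding_def using assms by (intro conjI ballI)
qed

lemma isometry_inj: "isometry m m' f ==> inj_on f (mspace m)"
proof (rule inj_onI)
 fix x y assume f: "isometry m m' f" and M: "x : mspace m" "y : mspace m" and e: "f x = f y"
 have "mdist m x y = mdist m' (f x) (f y)" using isometry_dist[OF f M] by simp
 also have "\<dots> = 0" unfolding e by (rule mdist_self[OF isometry_mem[OF f M(2)]])
 finally show "x = y" using mdist_zero[OF M] by simp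
qed

lemma isometry_id: "isometry m m (%x. x)"
 by (rule isometryI) simp_all

lemma isometry_comp:
 assumes "isometry m m' f" "isometry m' m'' g"
 shows "isometry m m'' (g \<circ> f)"
proof (rule isometryI)
 show "(g \<circ> f) ` mspace m = mspace m''"
  unfolding image_comp[symmetric] isometry_image[OF assms(1)] isometry_image[OF assms(2)] ..
 show "mdist m'' ((g \<circ> f) x) ((g \<circ> f) y) = mdist m x y" if "x : mspace m" "y : mspace m" for x y
  using isometry_dist[OF assms(1) that] isometry_dist[OF assms(2), of "f x" "f y"]
   isometry_mem[OF assms(1)] that by simp
qed

lemma isometry_inv:
 assumes f: "isometry m m' f"
 shows "isometry m' m (inv_into (mspace m) f)"
proof (rule isometryI)
 have bij: "bij_betw f (mspace m) (mspace m')"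
  using isometry_inj[OF f] isometry_image[OF f] by (simp add: bij_betw_def)
 show im: "inv_into (mspace m) f ` mspace m' = mspace m"
  using bij_betw_inv_into[OF bij] by (simp add: bij_betw_def)
 show "mdist m (inv_into (mspace m) f x) (inv_into (mspace m) f y) = mdist m' x y"
  if "x : mspace m'" "y : mspace m'" for x y
 proof -
  have "inv_into (mspace m) f x : mspace m" "inv_into (mspace m) f y : mspace m"
   using im that by (metis imageI)+
  from isometry_dist[OF f this] show ?thesis
   using bij_betw_inv_into_right[OF bij that(1)] bij_betw_inv_into_right[OF bij that(2)] by simp
 qed
qed

lemma isometry_inv_apply: "isometry m m' f ==> x : mspace m ==> inv_into (mspace m) f (f x) = x"
 by (rule inv_into_f_f[OF isometry_inj])

lemma isometric_refl: "isometric m m"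
 unfolding isometric_def using isometry_id by blast

lemma isometric_sym: "isometric m m' ==> isometric m' m"
 unfolding isometric_def using isometry_inv by blast

lemma isometric_trans: "isometric m m' ==> isometric m' m'' ==> isometric m m''"
 unfolding isometric_def using isometry_comp by blast

section \<open>Directions and connected components\<close>

definition limit_dir :: "'a metric => 'a set set => 'a => 'a => bool" where
 "limit_dir S \<P> x y <-> x : mspace S & y : mspace S & y ~= x & (ALL P:\<P>. x : P --> gate S P y = x)"

context tree_graded_space
begin

lemma openin_same_dir: "openin (mtopology_of S) {z. sdir x y z}"
proof -
 interpret MS: Metric_space M d by simp
 have "EX r>0. MS.mball z r <= {z. sdir x y z}" if z: "sdir x y z" for z
 proof (intro exI conjI subsetI)
  have m: "x : M" "z : M" "z ~= x" using same_dir_mem[OF z] by auto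
  show "0 < d z x" by (rule mdist_pos[OF m(2,1,3)])
  fix z' assume "z' : MS.mball z (d z x)"
  hence "z' : M" "d z z' < d z x" by auto
  thus "z' : {z. sdir x y z}" using same_dir_near[OF m(1,2) _ m(3)] same_dir_trans[OF z] by simp
 qed
 moreover have "{z. sdir x y z} <= M" using same_dir_mem by blast
 ultimately have "openin MS.mtopology {z. sdir x y z}"
  unfolding MS.openin_mtopology by simp
 thus ?thesis by (simp add: mtopology_of_def)
qed

lemma same_dir_gate_ne:
 assumes yz: "sdir x y z" and P: "P : \<P>" "x : P" "gate S P z ~= x"
 shows "gate S P y ~= x"
 using yz
proof (cases rule: same_dirE)
 case (1 w)
 show ?thesis using gate_betw_ne[OF P 1(3,1)] by (rule gate_betw_ne'[OF P(1,2) _ 1(2)])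
next
 case (2 P')
 thus ?thesis using piece_dir_unique[OF 2(1,2,4) P] same_dir_mem[OF yz] by auto
qed

lemma limit_dir_same_dir: "limit_dir S \<P> x y ==> sdir x y z ==> limit_dir S \<P> x z"
 unfolding limit_dir_def using same_dir_gate_ne same_dir_mem by metis

abbreviation "punctured x \<equiv> subtopology (mtopology_of S) (M - {x})"

lemma geo_connected_component:
 assumes g: "geo S g l u v" and ne: "!!t. 0 <= t ==> t <= l ==> g t ~= x"
 shows "connected_component_of (punctured x) u v"
proof -
 have "connectedin (top_of_set {0..l}) {0..l}" by (simp add: connectedin_subtopology)
 hence "connectedin (mtopology_of S) (g ` {0..l})"
  by (rule connectedin_continuous_map_image[OF geo_continuous[OF g]])
 moreover have "g ` {0..l} <= M - {x}"
 using ne geoD(7) g by fastforce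
 ultimately have "connectedin (punctured x) (g ` {0..l})" by (simp add: connectedin_subtopology)
 moreover have "u : g ` {0..l}" using geoD(1,2)[OF g] by (intro image_eqI[of _ _ 0]) auto
 moreover have "v : g ` {0..l}" using geoD(1,3)[OF g] by (intro image_eqI[of _ _ l]) auto
 ultimately show ?thesis unfolding connected_component_of_def by blast
qed

text \<open>The classes of the relation are open and therefore unions of connected components of the punctured space.\<close>
lemma component_same_dir:
 assumes "connected_component_of (punctured x) y z" and x: "x : M"
 shows "sdir x y z"
proof (rule ccontr)
 assume n: "~ sdir x y z"
 obtain T where T: "connectedin (punctured x) T" "y : T" "z : T"
  using assms unfolding connected_component_of_def by blast
 have sub: "T <= M - {x}" using connectedin_subset_topspace[OF T(1)] by auto
 let ?A = "{z. sdir x y z}" and ?B = "\<Union>w\<in>{w. ~ sdir x y w}. {z. sdir x w z}"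
 have T': "connectedin (mtopology_of S) T" using T(1) by (simp add: connectedin_subtopology)
 have "openin (mtopology_of S) ?A" by (rule openin_same_dir)
 moreover have "openin (mtopology_of S) ?B" by (rule openin_Union) (use openin_same_dir in auto)
 moreover have "T <= ?A Un ?B"
 using sub x same_dir_refl by blast
 moreover have "?A Int ?B Int T = {}" using same_dir_trans same_dir_sym by blast
 moreover have "?A Int T ~= {}" using T(2) sub x same_dir_refl by auto
 moreover have "?B Int T ~= {}"
 using T(3) sub x same_dir_refl n by blast
 ultimately show False by (rule connectedinD[OF T'])
qed

text \<open>For a limit direction the two geodesics from \<open>x\<close> meet outside \<open>x\<close>, so that the end
  points are joined by geodesics that avoid \<open>x\<close>. In a piece this can fail, since \<open>x\<close>
  may separate the piece.\<close>
lemma limit_dir_component: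
 assumes l: "limit_dir S \<P> x y" and yz: "sdir x y z"
 shows "connected_component_of (punctured x) y z"
proof -
 obtain w where w: "w ~= x" "betw S x w y" "betw S x w z"
  using yz l unfolding limit_dir_def by (elim same_dirE) auto
 have *: "connected_component_of (punctured x) w y" if b: "betw S x w y" for y
 proof -
  have M: "x : M" "w : M" "y : M" using b by (auto simp: betw_def)
  obtain g where g: "geo S g (d w y) w y" using geodesic_space_geo[OF geodesic_S M(2,3)] by metis
  show ?thesis
  proof (rule geo_connected_component[OF g])
   fix t assume t: "0 <= t" "t <= d w y"
   have "betw S w (g t) y" by (rule geo_betw_ends[OF g t])
   thus "g t ~= x" using betw_trans_right(2)[OF b] betw_self[of S x w] w(1) by auto
  qed
 qed
 have "connected_component_of (punctured x) y w" using *[OF w(2)] connected_component_of_sym by metis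
 thus ?thesis using *[OF w(3)] connected_component_of_trans by metis
qed

lemma component_mem:
 assumes "C : components_at S x" "y : C" "x : M"
 shows "y : M" "y ~= x" "C = {z. connected_component_of (punctured x) y z}"
  "!!z. z : C ==> sdir x y z"
proof -
 have C: "C : connected_components_of (punctured x)" using assms(1) by (simp add: components_at_def)
 show "y : M" "y ~= x" using connected_components_of_subset[OF C] assms(2) by auto
 obtain u where "C = connected_component_of_set (punctured x) u"
  using C unfolding connected_components_of_def by blast
 hence u: "C = {z. connected_component_of (punctured x) u z}" by simp
 have uy: "connected_component_of (punctured x) u y" using u assms(2) by blast
 show eq: "C = {z. connected_component_of (punctured x) y z}"
  unfolding u using uy connected_component_of_trans connected_component_of_sym by (metis (full_types))
 show "sdir x y z" if "z : C" for z
  using that eq component_same_dir[OF _ assms(3)] by blast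
qed

lemma component_nonempty: "C : components_at S x ==> EX y. y : C"
 using nonempty_connected_components_of unfolding components_at_def by blast

lemma component_of_mem:
 assumes "y : M" "y ~= x"
 shows "{z. connected_component_of (punctured x) y z} : components_at S x"
proof -
 have "y : topspace (punctured x)" using assms by simp
 thus ?thesis unfolding components_at_def connected_components_of_def by blast
qed

lemma component_geodesic_into:
 assumes C: "C : components_at S x" "y : C" and g: "geo S g l x y"
 shows "geodesic_into S x C g l"
proof -
 have x: "x : M" using geoD(4)[OF g] .
 note c = component_mem[OF C x]
 have l: "0 < l" using geoD(6)[OF g] mdist_pos[OF x c(1)] c(2) by auto
 have "g t : C" if t: "0 < t" "t <= l" for t
 proof -
  have "geo S (%s. g (t + s)) (l - t) (g t) y" using geo_sub[OF g, of t l] t geoD(3)[OF g] by simp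
  hence "connected_component_of (punctured x) (g t) y"
  proof (rule geo_connected_component)
   fix s assume "0 <= s" "s <= l - t"
   hence "d x (g (t + s)) = t + s" using geo_dist(1)[OF g, of "t + s"] t by simp
   thus "g (t + s) ~= x" using x t \<open>0 <= s\<close> by auto
  qed
  thus ?thesis using connected_component_of_sym c(3) by fastforce
 qed
 hence "g ` {0..l} <= insert x C"
  using geoD(2)[OF g] by (intro image_subsetI) (metis atLeastAtMost_iff insert_iff less_eq_real_def)
 thus ?thesis using g l unfolding geodesic_into_def geo_def by blast
qed

lemma geodesic_intoD:
 assumes "geodesic_into S x C g r"
 shows "0 < r" "geo S g r x (g r)" "C : components_at S x ==> 0 < t ==> t <= r ==> g t : C"
proof -
 show r: "0 < r" and g: "geo S g r x (g r)" using assms by (auto simp: geodesic_into_def geo_def)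
 assume C: "C : components_at S x" and t: "0 < t" "t <= r"
 have "d x (g t) = t" using geo_dist(1)[OF g] t by simp
 hence "g t ~= x" using t geoD(4)[OF g] by auto
 moreover have "g t : insert x C" using assms t unfolding geodesic_into_def by (auto simp: image_subset_iff)
 ultimately show "g t : C" by blast
qed

lemma geo_pass_gates:
 assumes g: "geo S g l x z" and P: "P : \<P>" and ne: "gate S P x ~= gate S P z"
 shows "g (d x (gate S P x)) = gate S P x" "g (d x (gate S P z)) = gate S P z"
proof -
 have M: "x : M" "z : M" using geoD(4,5)[OF g] by auto
 have main: "EX t. 0 <= t & t <= l & g t = gate S P x" if g: "geo S g l x z" and ne: "gate S P x ~= gate S P z" for g l x z
 proof (rule ccontr)
  assume "~ ?thesis"
  hence no: "g t ~= gate S P x" if "0 <= t" "t <= l" for t using that by blast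
  have M: "x : M" "z : M" using geoD(4,5)[OF g] by auto
  have "sdir (gate S P x) (g 0) (g l)"
   by (rule same_dir_geo[OF g _ geoD(1)[OF g] _ gate_in_M[OF P M(1)] no]) auto
  hence "sdir (gate S P x) x z" using geoD(2,3)[OF g] by simp
  from same_dir_gate_ne[OF this P gate_mem[OF P M(1)]] show False using ne by simp
 qed
 obtain t where t: "0 <= t" "t <= l" "g t = gate S P x" using main[OF g ne] by blast
 thus "g (d x (gate S P x)) = gate S P x" using geo_dist(1)[OF g t(1,2)] by simp
 obtain s where s: "0 <= s" "s <= l" "g (l - s) = gate S P z" using main[OF geo_rev[OF g] ne[symmetric]] by blast
 show "g (d x (gate S P z)) = gate S P z" using geo_dist(1)[OF g, of "l - s"] s s(3) by simp
qed

lemma gates_dist: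
 assumes P: "P : \<P>" and M: "x : M" "z : M" and ne: "gate S P x ~= gate S P z"
 shows "0 <= d x (gate S P x)" "d x (gate S P x) < d x (gate S P z)" "d x (gate S P z) <= d x z"
proof -
 let ?p = "gate S P x" and ?q = "gate S P z"
 show "0 <= d x ?p" by simp
 have "0 < d ?p ?q" by (rule mdist_pos) (use gate_in_M[OF P] M ne in auto)
 thus "d x ?p < d x ?q" using gate_betw[OF P M(1) gate_mem[OF P M(2)]] betw_def by (simp add: betw_def)
 have "d x ?q + d ?q z = d x z" using gates_differ(2)[OF P M ne] by (simp add: betw_def)
 thus "d x ?q <= d x z" using mdist_nonneg[of S ?q z] by linarith
qed

text \<open>The part of a geodesic cut out by a piece depends on the end points only.\<close>

lemma cut_out_by_iff:
 assumes g: "geo S g l x z" and P: "P : \<P>"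
 shows "cut_out_by g l a b P <->
  gate S P x ~= gate S P z & a = d x (gate S P x) & b = d x (gate S P z)"
proof
 have M: "x : M" "z : M" and dl: "d x z = l" using geoD(4,5,6)[OF g] by auto
 let ?p = "gate S P x" and ?q = "gate S P z"
 have low: "d x ?p <= t" "t <= l - d z ?q" if t: "0 <= t" "t <= l" "g t : P" for t
 proof -
  have "d x ?p + d ?p (g t) = d x (g t)" "d z ?q + d ?q (g t) = d z (g t)"
   using gate_betw[OF P M(1) t(3)] gate_betw[OF P M(2) t(3)] by (auto simp: betw_def)
  thus "d x ?p <= t" "t <= l - d z ?q" using mdist_nonneg[of S ?p "g t"] mdist_nonneg[of S ?q "g t"] mdist_commute[of S z "g t"] geo_dist[OF g t(1,2)] by linarith+
 qed
 {
  assume c: "cut_out_by g l a b P"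
  hence ab: "0 <= a" "a < b" "b <= l" and eq: "P Int g ` {0..l} = g ` {a..b}" by (auto simp: cut_out_by_def)
  have in_P: "g t : P" if "a <= t" "t <= b" for t
  using that eq by auto
  have time: "a <= t & t <= b" if "0 <= t" "t <= l" "g t : P" for t
  proof -
   have "g t : g ` {a..b}" using eq that by auto
   then obtain s where "s : {a..b}" "g t = g s" by auto
   hence "t = s" using geo_inj[OF g that(1,2), of s] ab by auto
   thus ?thesis using \<open>s : {a..b}\<close> by auto
  qed
  have "d x (g b) = b" using geo_dist(1)[OF g, of b] ab by simp
  hence e: "g (d x ?p) = ?p" using gate_entry[OF P M(1), of "g b" g] in_P[of b] ab geo_take[OF g, of b] by simp
  have "d x ?p <= a" using low(1)[of a] in_P[of a] ab by simp
  moreover have "a <= d x ?p" using time[of "d x ?p"] e gate_mem[OF P M(1)] \<open>d x ?p <= a\<close> ab by simp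
  ultimately have a: "a = d x ?p" by simp
  have "d z (g a) = l - a" using geo_dist(2)[OF g, of a] ab mdist_commute[of S z "g a"] by simp
  hence e': "g (l - d z ?q) = ?q" using gate_entry[OF P M(2), of "g a" "%t. g (l - t)"] in_P[of a] ab geo_take[OF geo_rev[OF g], of "l - a"] by simp
  have "b <= l - d z ?q" using low(2)[of b] in_P[of b] ab by simp
  moreover have "l - d z ?q <= b"
   using time[of "l - d z ?q"] e' gate_mem[OF P M(2)] \<open>b <= l - d z ?q\<close> ab by simp
  ultimately have bq: "b = l - d z ?q" by simp
  have ga: "g a = ?p" and gb: "g b = ?q" using e e' a bq by simp_all
  have "b = d x ?q" using geo_dist(1)[OF g, of b] ab gb by simp
  moreover have "?p ~= ?q" using ga gb geo_inj[OF g, of a b] ab by auto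
  ultimately show "?p ~= ?q & a = d x ?p & b = d x ?q" using a by simp
 }
 {
  assume "?p ~= ?q & a = d x ?p & b = d x ?q"
  hence ne: "?p ~= ?q" and ab: "a = d x ?p" "b = d x ?q" by auto
  note e = geo_pass_gates[OF g P ne] and dd = gates_dist[OF P M ne]
  have ends: "g a : P" "g b : P" using e ab gate_mem[OF P] M by auto
  have "P Int g ` {0..l} = g ` {a..b}"
  proof (intro equalityI subsetI)
   fix y assume "y : P Int g ` {0..l}"
   then obtain t where t: "0 <= t" "t <= l" "y = g t" "g t : P" by auto
   show "y : g ` {a..b}" using low[OF t(1,2,4)] ab t(3) gates_differ(2)[OF P M ne] dl mdist_commute[of S z ?q] betw_def by (simp add: betw_def)
  next
   fix y assume "y : g ` {a..b}"
   then obtain t where t: "a <= t" "t <= b" "y = g t" by auto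
   have "betw S (g a) (g t) (g b)" by (rule geo_betw[OF g]) (use t ab dd dl in auto)
   hence "g t : P" by (rule piece_convex[OF P ends])
   moreover have "0 <= t" "t <= l" using t(1,2) ab dd dl by linarith+
   ultimately show "y : P Int g ` {0..l}" using t(3) by simp
  qed
  thus "cut_out_by g l a b P" unfolding cut_out_by_def using ab dd dl by simp
 }
qed

text \<open>Whether a component is a limit component may be tested on any of its points.\<close>
lemma non_limit_component_iff:
 assumes x: "x : M" and C: "C : components_at S x" and y: "y : C"
 shows "non_limit_component S \<P> x C <-> ~ limit_dir S \<P> x y"
proof
 note c = component_mem[OF C y x]
 assume "non_limit_component S \<P> x C"
 then obtain g r P t where g: "geodesic_into S x C g r" and P: "P : \<P>" and t: "0 < t" "t <= r"
  and eq: "P Int g ` {0..r} = g ` {0..t}" unfolding non_limit_component_def by blast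
 note gd = geodesic_intoD[OF g]
 have "g 0 : g ` {0..t}" "g t : g ` {0..t}" using t by simp_all
 hence "g 0 : P" "g t : P" unfolding eq[symmetric] by simp_all
 hence xP: "x : P" "g t : P" using geoD(2)[OF gd(2)] by auto
 have yt: "sdir x y (g t)" using gd(3)[OF C t] by (rule c(4))
 have "gate S P (g t) ~= x" using gate_self[OF P xP(2)] same_dir_mem[OF yt] by simp
 hence "gate S P y ~= x" by (rule same_dir_gate_ne[OF yt P xP(1)])
 thus "~ limit_dir S \<P> x y" unfolding limit_dir_def using P xP by blast
next
 note c = component_mem[OF C y x]
 assume "~ limit_dir S \<P> x y"
 then obtain P where P: "P : \<P>" "x : P" "gate S P y ~= x"
  unfolding limit_dir_def using x c(1,2) by blast
 obtain g where g: "geo S g (d x y) x y" using geodesic_space_geo[OF geodesic_S x c(1)] by metis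
 have gx: "gate S P x = x" by (rule gate_self[OF P(1,2)])
 have "cut_out_by g (d x y) 0 (d x (gate S P y)) P" using cut_out_by_iff[OF g P(1)] gx P(3) x by simp
 thus "non_limit_component S \<P> x C"
  unfolding non_limit_component_def cut_out_by_def
  using C component_geodesic_into[OF C y g] P(1) by blast
qed

lemma limit_component_iff:
 assumes x: "x : M"
 shows "limit_component S \<P> x C <-> (EX y. limit_dir S \<P> x y & C = {z. sdir x y z})"
proof
 assume "limit_component S \<P> x C"
 hence C: "C : components_at S x" and n: "~ non_limit_component S \<P> x C" by (auto simp: limit_component_def)
 obtain y where y: "y : C" using component_nonempty[OF C] by blast
 have l: "limit_dir S \<P> x y" using n non_limit_component_iff[OF x C y] by blast
 show "EX y. limit_dir S \<P> x y & C = {z. sdir x y z}" using component_mem(3,4)[OF C y x] limit_dir_component[OF l] l by blast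
next
 assume "EX y. limit_dir S \<P> x y & C = {z. sdir x y z}"
 then obtain y where l: "limit_dir S \<P> x y" and C: "C = {z. sdir x y z}" by blast
 have y: "y : M" "y ~= x" using l by (auto simp: limit_dir_def)
 have "C = {z. connected_component_of (punctured x) y z}"
  unfolding C using limit_dir_component[OF l] component_same_dir[OF _ x] by blast
 hence C': "C : components_at S x" using component_of_mem[OF y] by simp
 have "y : C" unfolding C using same_dir_refl[OF x y] by simp
 thus "limit_component S \<P> x C"
  unfolding limit_component_def using C' non_limit_component_iff[OF x C'] l by blast
qed

end

section \<open>Types of geodesics\<close>

locale Q_choices =
 fixes \<Q> R :: "'q metric set" and D :: "'q metric => ('q \<times> 'q) set" and E :: "'q metric => 'q set"
 assumes Q_spaces: "!!Q. Q : \<Q> ==>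
   homogeneous Q & mcomplete_of Q & geodesic_space Q & mspace Q \<lesssim> (UNIV :: real set)"
  and choices: "canonical_choices \<Q> R D E"
begin

lemma R_subset: "Q : R ==> Q : \<Q>"
 using choices unfolding canonical_choices_def isometry_class_reps_def by blast

lemma R_ex: "Q : \<Q> ==> EX Q'. Q' : R & isometric Q Q'"
 using choices unfolding canonical_choices_def isometry_class_reps_def by blast

lemma R_unique: "Q : R ==> Q' : R ==> isometric Q Q' ==> Q = Q'"
proof -
 assume Q: "Q : R" "Q' : R" "isometric Q Q'"
 have "EX! Q'. Q' : R & isometric Q Q'"
  using choices R_subset[OF Q(1)] unfolding canonical_choices_def isometry_class_reps_def by simp
 thus "Q = Q'" using Q isometric_refl[of Q] by (elim ex1E) metis
qed

lemma D_reps: "Q : R ==> pair_orbit_reps Q (D Q)"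
 and E_reps: "Q : R ==> point_orbit_reps Q (E Q)"
 using choices unfolding canonical_choices_def by simp_all

lemma D_mem: "Q : R ==> (p, q) : D Q ==> p : mspace Q & q : mspace Q"
 using D_reps unfolding pair_orbit_reps_def by blast

lemma D_ex:
 assumes "Q : R" "x : mspace Q" "y : mspace Q"
 shows "EX g. isometry Q Q g & (g x, g y) : D Q"
proof -
 have "EX! z. z : D Q & (EX g. isometry Q Q g & (g x, g y) = z)"
  using D_reps[OF assms(1)] assms(2,3) unfolding pair_orbit_reps_def by simp
 thus ?thesis by (elim ex1E) metis
qed

lemma D_unique:
 assumes Q: "Q : R" and pq: "(p, q) : D Q" "(p', q') : D Q" and g: "isometry Q Q g" "g p = p'" "g q = q'"
 shows "p = p'" "q = q'"
proof -
 have ex: "EX! z. z : D Q & (EX g. isometry Q Q g & (g p, g q) = z)"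
  using D_reps[OF Q] D_mem[OF Q pq(1)] unfolding pair_orbit_reps_def by simp
 have 1: "(p, q) : D Q & (EX g. isometry Q Q g & (g p, g q) = (p, q))" using pq isometry_id by blast
 have 2: "(p', q') : D Q & (EX g. isometry Q Q g & (g p, g q) = (p', q'))" using pq g by blast
 have "(p, q) = (p', q')" by (rule ex1E[OF ex]) (use 1 2 in metis)
 thus "p = p'" "q = q'" by simp_all
qed

lemma E_mem: "Q : R ==> e : E Q ==> e : mspace Q"
 using E_reps unfolding point_orbit_reps_def by blast

lemma E_ex: "Q : R ==> x : mspace Q ==> EX g. isometry Q Q g & g x : E Q"
 using E_reps unfolding point_orbit_reps_def by blast

lemma homogeneous_R:
 assumes "Q : R" "x : mspace Q" "y : mspace Q"
 obtains g where "isometry Q Q g" "g x = y"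
proof -
 have "homogeneous Q" using Q_spaces[OF R_subset[OF assms(1)]] by simp
 thus ?thesis using that assms(2,3) unfolding homogeneous_def by blast
qed

text \<open>Homogeneity leaves a single orbit of points.\<close>
lemma E_unique:
 assumes Q: "Q : R" and e: "e : E Q" "e' : E Q"
 shows "e = e'"
proof -
 obtain g where g: "isometry Q Q g" "g e = e'" using homogeneous_R[OF Q E_mem[OF Q e(1)] E_mem[OF Q e(2)]] .
 have ex: "EX! x'. x' : E Q & (EX g. isometry Q Q g & g e = x')"
  using E_reps[OF Q] E_mem[OF Q e(1)] unfolding point_orbit_reps_def by simp
 have 1: "e : E Q & (EX g. isometry Q Q g & g e = e)" using e isometry_id by blast
 have 2: "e' : E Q & (EX g. isometry Q Q g & g e = e')" using e g by blast
 show ?thesis by (rule ex1E[OF ex]) (use 1 2 in metis)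
qed

end

text \<open>The value of the type of a geodesic that crosses \<open>P\<close> from \<open>x\<close> to \<open>y\<close>,
  described without the choice of a canonical isometry.\<close>
definition pair_data :: "'q metric set => ('q metric => ('q \<times> 'q) set) => 'a metric => 'a set => 'a => 'a =>
   'q metric => 'q => 'q => bool" where
 "pair_data R D S P x y Q p q <->
   Q : R & (p, q) : D Q & (EX \<iota>. isometry (submetric S P) Q \<iota> & \<iota> x = p & \<iota> y = q)"

lemma mem_UN_intervals: "t : (\<Union>(a, b)\<in>X. {a<..<b}) <-> (EX a b. (a, b) : X & a < t & t < b)"
 for t :: real
by fastforce

lemma cut_out_times:
 assumes g: "geo m g l x z"
 shows "cut_out_by g l a b P <->
  0 <= a & a < b & b <= l & (ALL t. 0 <= t --> t <= l --> (g t : P <-> a <= t & t <= b))"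
proof (cases "0 <= a & a < b & b <= l")
 case ab: True
 have im: "g t : g ` {a..b} <-> a <= t & t <= b" if t: "0 <= t" "t <= l" for t
 proof
  assume "g t : g ` {a..b}"
  then obtain s where s: "g t = g s" "a <= s" "s <= b" by auto
  thus "a <= t & t <= b" using geo_inj[OF g t, of s] ab s by simp
 qed simp
 have "P Int g ` {0..l} = g ` {a..b} <-> (ALL t. 0 <= t --> t <= l --> (g t : P <-> g t : g ` {a..b}))"
 proof
  assume eq: "P Int g ` {0..l} = g ` {a..b}"
  show "ALL t. 0 <= t --> t <= l --> (g t : P <-> g t : g ` {a..b})"
   unfolding eq[symmetric] by simp
 next
  assume A: "ALL t. 0 <= t --> t <= l --> (g t : P <-> g t : g ` {a..b})"
  show "P Int g ` {0..l} = g ` {a..b}"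
  proof (intro equalityI subsetI)
   fix y assume "y : P Int g ` {0..l}"
   then obtain t where "0 <= t" "t <= l" "y = g t" "g t : P" by auto
   thus "y : g ` {a..b}" using A by simp
  next
   fix y assume y: "y : g ` {a..b}"
   then obtain t where t: "a <= t" "t <= b" "y = g t" by auto
   hence "0 <= t" "t <= l" using ab by auto
   thus "y : P Int g ` {0..l}" using A t(3) y by simp
  qed
 qed
 thus ?thesis unfolding cut_out_by_def using ab im by simp
qed (auto simp: cut_out_by_def)

lemma equiv_types_of_map:
 "initial_subtype r1 (initial_subtype r \<tau>) = initial_subtype r1 \<tau>" if "r1 <= r"
proof -
 obtain U f where \<tau>: "\<tau> = (U, f)" by fastforce
 have e1: "f |` {(a, b). b <= r} |` {(a, b). b <= r1} = f |` {(a, b). b <= r1}"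
  by (rule ext) (use that in \<open>auto simp: restrict_map_def\<close>)
 have e2: "{0<..<r} Int {0<..<r1} = {0<..<r1}" using that by auto
 show ?thesis by (simp only: \<tau> initial_subtype_def split_conv Int_assoc e1 e2)
qed

lemma Q_typesD:
 assumes "(U, f) : Q_types R D"
 shows "U = (\<Union>(a, b)\<in>dom f. {a<..<b})" "!!a b. (a, b) : dom f ==> 0 < a & a < b"
  "!!a b Q p q. f (a, b) = Some (Q, p, q) ==> Q : R & (p, q) : D Q & mdist Q p q = b - a"
  "!!a b a' b' t. (a, b) : dom f ==> (a', b') : dom f ==> a < t ==> t < b ==> a' < t ==> t < b' ==> a = a' & b = b'"
proof -
 show "U = (\<Union>(a, b)\<in>dom f. {a<..<b})" using assms unfolding Q_types_def by simp
 show "0 < a & a < b" if "(a, b) : dom f" for a b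
 proof -
  have "ALL (a, b):dom f. 0 < a & a < b" using assms unfolding Q_types_def by simp
  thus ?thesis using that by blast
 qed
 show "Q : R & (p, q) : D Q & mdist Q p q = b - a" if "f (a, b) = Some (Q, p, q)" for a b Q p q
 proof -
  have "ALL a b Q p q. f (a, b) = Some (Q, p, q) --> Q : R & (p, q) : D Q & mdist Q p q = b - a"
   using assms unfolding Q_types_def by simp
  thus ?thesis using that by simp
 qed
 show "a = a' & b = b'" if "(a, b) : dom f" "(a', b') : dom f" "a < t" "t < b" "a' < t" "t < b'" for a b a' b' t
 proof (rule ccontr)
  assume n: "~ (a = a' & b = b')"
  have "disjoint_family_on (%(a, b). {a<..<b}) (dom f)" using assms unfolding Q_types_def by simp
  from disjoint_family_onD[OF this that(1,2)] n have "{a<..<b} Int {a'<..<b'} = {}" by simp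
  thus False using that by simp
 qed
qed

text \<open>A left end of one interval in another one would make the two intervals overlap, so they would be equal.\<close>
lemma Q_types_left_end:
 assumes t: "(U, f) : Q_types R D" and ab: "(a, b) : dom f"
 shows "a ~: U"
proof
 assume "a : U"
 then obtain a' b' where ab': "(a', b') : dom f" "a' < a" "a < b'" unfolding Q_typesD(1)[OF t] mem_UN_intervals by blast
 let ?t = "(a + min b b') / 2"
 have "a < ?t" "?t < b" "a' < ?t" "?t < b'" using Q_typesD(2)[OF t ab] ab' by auto
 thus False using Q_typesD(4)[OF t ab ab'(1)] ab' by blast
qed

text \<open>If \<open>e\<close> is inside an interval, the left end of this interval is positive and free.\<close>
lemma Q_types_free:
 assumes t: "(U, f) : Q_types R D" and e: "0 < e"
 shows "EX r. 0 < r & r <= e & r ~: U"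
proof (cases "e : U")
 case True
 then obtain a b where ab: "(a, b) : dom f" "a < e" "e < b" unfolding Q_typesD(1)[OF t] mem_UN_intervals by blast
 thus ?thesis using Q_types_left_end[OF t ab(1)] Q_typesD(2)[OF t ab(1)] by (intro exI[of _ a]) simp
qed (use e in blast)

text \<open>For transitivity both pairs are restricted to the smaller of the two times.\<close>
lemma equiv_types: "equiv (Q_types R D) (equivalent_types R D)"
proof (rule equivI)
 show "equivalent_types R D <= Q_types R D \<times> Q_types R D" unfolding equivalent_types_def by auto
 show "refl_on (Q_types R D) (equivalent_types R D)"
 proof (rule refl_onI)
  fix \<tau> assume t: "\<tau> : Q_types R D"
  obtain U f where \<tau>: "\<tau> = (U, f)" by fastforce
  obtain r where "0 < r" "r ~: fst \<tau>" using Q_types_free[of U f R D 1] t \<tau> by auto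
  thus "(\<tau>, \<tau>) : equivalent_types R D" using t unfolding equivalent_types_def by auto
 qed
 show "sym (equivalent_types R D)"
 proof (rule symI)
  fix \<tau> \<tau>' assume "(\<tau>, \<tau>') : equivalent_types R D"
  thus "(\<tau>', \<tau>) : equivalent_types R D" unfolding equivalent_types_def by (auto simp: eq_commute)
 qed
 show "trans (equivalent_types R D)"
 proof (rule transI)
  fix \<tau>1 \<tau>2 \<tau>3 assume "(\<tau>1, \<tau>2) : equivalent_types R D" "(\<tau>2, \<tau>3) : equivalent_types R D"
  then obtain r s where t: "\<tau>1 : Q_types R D" "\<tau>3 : Q_types R D"
   and r: "r > 0" "r ~: fst \<tau>1" "r ~: fst \<tau>2" "initial_subtype r \<tau>1 = initial_subtype r \<tau>2"
   and s: "s > 0" "s ~: fst \<tau>2" "s ~: fst \<tau>3" "initial_subtype s \<tau>2 = initial_subtype s \<tau>3"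
   unfolding equivalent_types_def by auto
  have U: "fst \<tau>1 Int {0<..<r} = fst \<tau>2 Int {0<..<r}" "fst \<tau>2 Int {0<..<s} = fst \<tau>3 Int {0<..<s}"
   using r(4) s(4) unfolding initial_subtype_def by (auto split: prod.splits)
  let ?m = "min r s"
  have "initial_subtype ?m \<tau>1 = initial_subtype ?m \<tau>3"
   using equiv_types_of_map[of ?m r \<tau>1] equiv_types_of_map[of ?m r \<tau>2]
    equiv_types_of_map[of ?m s \<tau>2] equiv_types_of_map[of ?m s \<tau>3] r(4) s(4) by simp
  moreover have "?m ~: fst \<tau>1 & ?m ~: fst \<tau>3"
  proof (cases r s rule: linorder_cases)
   case less
   hence "r : {0<..<s}" using r by simp
   thus ?thesis using r U(2) less by fastforce
  next
   case equal
   thus ?thesis using r s by simp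
  next
   case greater
   hence "s : {0<..<r}" using s by simp
   thus ?thesis using s U(1) greater by fastforce
  qed
  moreover have "0 < ?m" using r s by simp
  ultimately show "(\<tau>1, \<tau>3) : equivalent_types R D" unfolding equivalent_types_def using t by blast
 qed
qed

locale Q_tree_space = tree_graded_space S \<P> + Q_choices \<Q> R D E
 for S :: "'a metric" and \<P> :: "'a set set"
  and \<Q> R :: "'q metric set" and D :: "'q metric => ('q \<times> 'q) set" and E :: "'q metric => 'q set" +
 assumes piece_isometric: "P : \<P> ==> EX Q:\<Q>. isometric (submetric S P) Q"
begin

abbreviation "gtype \<equiv> geodesic_type R D S \<P>"

lemma mspace_piece: "P : \<P> ==> mspace (submetric S P) = P"
 using piece_subset by auto

lemma piece_R: "P : \<P> ==> EX Q:R. isometric (submetric S P) Q"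
 using piece_isometric R_ex isometric_trans by metis

lemma pair_data_ex:
 assumes P: "P : \<P>" "x : P" "y : P"
 shows "EX Q \<iota>. Q : R & isometry (submetric S P) Q \<iota> & (\<iota> x, \<iota> y) : D Q"
proof -
 obtain Q \<iota> where Q: "Q : R" and i: "isometry (submetric S P) Q \<iota>"
  using piece_R[OF P(1)] unfolding isometric_def by blast
 have "\<iota> x : mspace Q" "\<iota> y : mspace Q" using isometry_mem[OF i] mspace_piece[OF P(1)] P by auto
 from D_ex[OF Q this] obtain g where "isometry Q Q g" "(g (\<iota> x), g (\<iota> y)) : D Q" by blast
 thus ?thesis using Q isometry_comp[OF i, of Q g] by (intro exI[of _ Q] exI[of _ "g \<circ> \<iota>"]) simp
qed

lemma pair_data_unique:
 assumes P: "P : \<P>" "x : P" "y : P"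
  and 1: "pair_data R D S P x y Q p q" and 2: "pair_data R D S P x y Q' p' q'"
 shows "Q = Q' & p = p' & q = q'"
proof -
 obtain i where i: "Q : R" "(p, q) : D Q" "isometry (submetric S P) Q i" "i x = p" "i y = q"
  using 1 unfolding pair_data_def by blast
 obtain j where j: "Q' : R" "(p', q') : D Q'" "isometry (submetric S P) Q' j" "j x = p'" "j y = q'"
  using 2 unfolding pair_data_def by blast
 let ?g = "j \<circ> inv_into P i"
 have iso: "isometry Q Q' ?g"
  using isometry_comp[OF isometry_inv[OF i(3)] j(3)] mspace_piece[OF P(1)] by simp
 have Q: "Q = Q'" by (rule R_unique[OF i(1) j(1)]) (use iso isometric_def in blast)
 have ap: "?g (i z) = j z" if "z : P" for z
  using isometry_inv_apply[OF i(3), unfolded mspace_piece[OF P(1)], OF that] by simp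
 have iso': "isometry Q Q ?g" and j2: "(p', q') : D Q" using iso j(2) Q by simp_all
 have "p = p'" "q = q'"
  by (rule D_unique[OF i(1,2) j2 iso'], use ap P(2,3) i(4,5) j(4,5) in metis, use ap P(2,3) i(4,5) j(4,5) in metis)+
 thus ?thesis using Q by simp
qed

lemma canonical_isometry_pair_data:
 assumes P: "P : \<P>" "x : P" "y : P" and c: "canonical_isometry_pair R D S P x y = (Q, \<iota>)"
 shows "pair_data R D S P x y Q (\<iota> x) (\<iota> y)"
proof -
 have "EX Qi. (case Qi of (Q, \<iota>) => Q : R & isometry (submetric S P) Q \<iota> & (\<iota> x, \<iota> y) : D Q)"
  using pair_data_ex[OF P] by auto
 from someI_ex[OF this] c have "Q : R & isometry (submetric S P) Q \<iota> & (\<iota> x, \<iota> y) : D Q"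
  unfolding canonical_isometry_pair_def by simp
 thus ?thesis unfolding pair_data_def by blast
qed

lemma cut_out_by_piece:
 assumes g: "geo S g l x z" and P: "P : \<P>" and c: "cut_out_by g l a b P"
 shows "g a : P" "g b : P" "0 <= a" "a < b" "b <= l" "g a = gate S P x" "g b = gate S P z"
proof -
 note ct = c[unfolded cut_out_times[OF g]]
 show "0 <= a" "a < b" "b <= l" "g a : P" "g b : P" using ct by simp_all
 have i: "gate S P x ~= gate S P z" "a = d x (gate S P x)" "b = d x (gate S P z)"
  using c unfolding cut_out_by_iff[OF g P] by auto
 show "g a = gate S P x" "g b = gate S P z" using geo_pass_gates[OF g P i(1)] i(2,3) by simp_all
qed

lemma cut_out_by_unique:
 assumes g: "geo S g l x z" and P: "P : \<P>" "cut_out_by g l a b P" and P': "P' : \<P>" "cut_out_by g l a b P'"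
 shows "P = P'"
proof -
 note c = cut_out_by_piece[OF g P] and c' = cut_out_by_piece[OF g P']
 show ?thesis using geo_inj[OF g, of a b] c piece_unique[OF P(1) P'(1)] c(1,2) c'(1,2) by auto
qed

lemma type_iff:
 assumes g: "geo S g l x z"
 shows "snd (gtype g l) (a, b) = Some (Q, p, q) <->
  (EX P:\<P>. cut_out_by g l a b P & pair_data R D S P (g a) (g b) Q p q)"
proof (cases "EX P:\<P>. cut_out_by g l a b P")
 case False
 thus ?thesis unfolding geodesic_type_def Let_def by auto
next
 case True
 then obtain P where P: "P : \<P>" "cut_out_by g l a b P" by blast
 have the: "(THE P. P : \<P> & cut_out_by g l a b P) = P"
  by (rule the_equality) (use P cut_out_by_unique[OF g] in auto)
 obtain Q0 i where c: "canonical_isometry_pair R D S P (g a) (g b) = (Q0, i)" by fastforce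
 note cp = cut_out_by_piece[OF g P]
 have val: "snd (gtype g l) (a, b) = Some (Q0, i (g a), i (g b))"
  unfolding geodesic_type_def Let_def using True the c by simp
 have pd: "pair_data R D S P (g a) (g b) Q0 (i (g a)) (i (g b))"
  by (rule canonical_isometry_pair_data[OF P(1) cp(1,2) c])
 show ?thesis
 proof
  assume "snd (gtype g l) (a, b) = Some (Q, p, q)"
  thus "EX P:\<P>. cut_out_by g l a b P & pair_data R D S P (g a) (g b) Q p q" using val pd P by auto
 next
  assume "EX P:\<P>. cut_out_by g l a b P & pair_data R D S P (g a) (g b) Q p q"
  then obtain P' where P': "P' : \<P>" "cut_out_by g l a b P'" "pair_data R D S P' (g a) (g b) Q p q" by blast
  show "snd (gtype g l) (a, b) = Some (Q, p, q)" using cut_out_by_unique[OF g P'(1,2) P] pair_data_unique[OF P(1) cp(1,2) pd] P'(3) val by simp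
 qed
qed

lemma type_dom:
 assumes g: "geo S g l x z"
 shows "(a, b) : dom (snd (gtype g l)) <-> (EX P:\<P>. cut_out_by g l a b P)"
proof
 assume "(a, b) : dom (snd (gtype g l))"
 then obtain y where "snd (gtype g l) (a, b) = Some y" by auto
 thus "EX P:\<P>. cut_out_by g l a b P" using type_iff[OF g] by (cases y) metis
next
 assume "EX P:\<P>. cut_out_by g l a b P"
 thus "(a, b) : dom (snd (gtype g l))"
  unfolding geodesic_type_def Let_def by (auto simp: dom_def split: prod.splits)
qed

lemma fst_type: "fst (gtype g l) = (\<Union>(a, b)\<in>dom (snd (gtype g l)). {a<..<b})"
 unfolding geodesic_type_def Let_def by simp

lemma fst_type_iff:
 assumes g: "geo S g l x z"
 shows "t : fst (gtype g l) <-> (EX P:\<P>. EX a b. cut_out_by g l a b P & a < t & t < b)"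
using fst_type mem_UN_intervals type_dom g by auto

lemma map_eqI:
 fixes f f' :: "real \<times> real \<rightharpoonup> 'q metric \<times> 'q \<times> 'q"
 assumes "!!a b Q p q. f (a, b) = Some (Q, p, q) <-> f' (a, b) = Some (Q, p, q)"
 shows "f = f'"
proof (rule ext)
 fix ab :: "real \<times> real"
 obtain a b where ab: "ab = (a, b)" by fastforce
 show "f ab = f' ab"
 proof (cases "f ab")
  case (Some y)
  obtain Q p q where "y = (Q, p, q)" using prod_cases3 by blast
  thus ?thesis using Some assms[of a b Q p q] ab by simp
 next
  case None
  show ?thesis
  proof (cases "f' ab")
   case (Some y)
   obtain Q p q where "y = (Q, p, q)" using prod_cases3 by blast
   thus ?thesis using Some assms[of a b Q p q] ab None by simp
  qed (use None in simp)
 qed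
qed

lemma type_eqI:
 assumes "snd (gtype g l) = snd (gtype g' l')"
 shows "gtype g l = gtype g' l'"
 using assms fst_type[of g l] fst_type[of g' l'] by (simp add: prod_eq_iff)

text \<open>Where a piece cuts a geodesic is determined by the gates of the two end points.\<close>
lemma type_endpoints:
 assumes g: "geo S g l x z" and g': "geo S g' l x z"
 shows "gtype g l = gtype g' l"
proof (rule type_eqI, rule map_eqI)
 fix a b Q p q
 have "cut_out_by g l a b P <-> cut_out_by g' l a b P" if "P : \<P>" for P
  unfolding cut_out_by_iff[OF g that] cut_out_by_iff[OF g' that] by blast
 moreover have "g a = g' a & g b = g' b" if "P : \<P>" "cut_out_by g l a b P" "cut_out_by g' l a b P" for P
  using cut_out_by_piece(6,7)[OF g that(1,2)] cut_out_by_piece(6,7)[OF g' that(1,3)] by simp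
 ultimately show "snd (gtype g l) (a, b) = Some (Q, p, q) <->
   snd (gtype g' l) (a, b) = Some (Q, p, q)"
  unfolding type_iff[OF g] type_iff[OF g'] by metis
qed

lemma two_points_cut:
 assumes g: "geo S g l x z" and P: "P : \<P>" and t: "0 <= s" "s < t" "t <= l" "g s : P" "g t : P"
 shows "EX a b. cut_out_by g l a b P & a <= s & t <= b"
proof -
 have M: "x : M" "z : M" and dl: "d x z = l" using geoD(4,5,6)[OF g] by auto
 let ?p = "gate S P x"
 have pM: "?p : M" by (rule gate_in_M[OF P M(1)])
 have "?p ~= gate S P z"
 proof
  assume eq: "?p = gate S P z"
  have zero: "g r = ?p" if r: "0 <= r" "r <= l" "g r : P" for r
  proof -
   have "d x ?p + d ?p (g r) = r" using gate_betw[OF P M(1) r(3)] geo_dist(1)[OF g r(1,2)] by (simp add: betw_def)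
   moreover have "d z ?p + d ?p (g r) = l - r"
    using gate_betw[OF P M(2) r(3)] geo_dist(2)[OF g r(1,2)] eq mdist_commute[of S z "g r"] by (simp add: betw_def)
   ultimately have "d ?p (g r) = 0" using dl mdist_commute[of S z ?p] mdist_nonneg[of S ?p "g r"] mdist_triangle[OF M(1) pM M(2)] by linarith
   thus ?thesis using mdist_zero[OF pM geoD(7)[OF g r(1,2)]] by simp
  qed
  show False using zero[of s] zero[of t] t geo_inj[OF g, of s t] by simp
 qed
 hence c: "cut_out_by g l (d x ?p) (d x (gate S P z)) P" using cut_out_by_iff[OF g P] by blast
 moreover from c[unfolded cut_out_times[OF g]] have "d x ?p <= s" "t <= d x (gate S P z)" using t by auto
 ultimately show ?thesis by blast
qed

text \<open>A time that is not inside a crossing cuts no crossing in two.\<close>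
lemma cut_out_by_restrict:
 assumes g: "geo S g l x z" and r: "0 < r" "r <= l" "r ~: fst (gtype g l)" and P: "P : \<P>"
 shows "cut_out_by g r a b P <-> cut_out_by g l a b P & b <= r"
proof -
 have gr: "geo S g r x (g r)" by (rule geo_take[OF g]) (use r in auto)
 show ?thesis
 proof
  assume "cut_out_by g r a b P"
  hence ct: "0 <= a" "a < b" "b <= r" and tm: "ALL t. 0 <= t --> t <= r --> (g t : P <-> a <= t & t <= b)"
   unfolding cut_out_times[OF gr] by auto
  obtain a' b' where c': "cut_out_by g l a' b' P" "a' <= a" "b <= b'" using tm ct two_points_cut[OF g P ct(1,2)] ct(3) r(2) by auto
  have ct': "0 <= a'" "a' < b'" "b' <= l" and tm': "ALL t. 0 <= t --> t <= l --> (g t : P <-> a' <= t & t <= b')"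
   using c'(1) unfolding cut_out_times[OF g] by auto
  have "a <= a'" using tm' ct' tm c'(2) ct by auto
  hence a: "a' = a" using c'(2) by simp
  have "~ (a' < r & r < b')" using r(3) c'(1) P unfolding fst_type_iff[OF g] by blast
  hence "b' <= r" using a ct by linarith
  hence "g b' : P" "0 <= b'" using tm' ct' by auto
  hence "b' <= b" using tm \<open>b' <= r\<close> by blast
  thus "cut_out_by g l a b P & b <= r" using a c' ct by simp
 next
  assume "cut_out_by g l a b P & b <= r"
  thus "cut_out_by g r a b P" unfolding cut_out_times[OF g] cut_out_times[OF gr] using r by auto
 qed
qed

lemma type_restrict:
 assumes g: "geo S g l x z" and r: "0 < r" "r <= l" "r ~: fst (gtype g l)"
 shows "gtype g r = initial_subtype r (gtype g l)"
proof (rule prod_eqI)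
 have gr: "geo S g r x (g r)" by (rule geo_take[OF g]) (use r in auto)
 show "snd (gtype g r) = snd (initial_subtype r (gtype g l))"
 proof (rule map_eqI)
  fix a b Q p q
  have "snd (initial_subtype r (gtype g l)) = snd (gtype g l) |` {(a, b). b <= r}"
   unfolding initial_subtype_def by (simp add: case_prod_beta)
  hence "snd (initial_subtype r (gtype g l)) (a, b) = Some (Q, p, q) <->
   b <= r & snd (gtype g l) (a, b) = Some (Q, p, q)"
   by (simp add: restrict_map_def)
  thus "snd (gtype g r) (a, b) = Some (Q, p, q) <->
   snd (initial_subtype r (gtype g l)) (a, b) = Some (Q, p, q)"
   unfolding type_iff[OF g] type_iff[OF gr] using cut_out_by_restrict[OF g r] by blast
 qed
 show "fst (gtype g r) = fst (initial_subtype r (gtype g l))"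
 proof (rule set_eqI)
  fix t
  have "fst (initial_subtype r (gtype g l)) = fst (gtype g l) Int {0<..<r}"
   unfolding initial_subtype_def by (simp add: case_prod_beta)
  moreover have "t : fst (gtype g r) <-> t : fst (gtype g l) & 0 < t & t < r"
  proof
   assume "t : fst (gtype g r)"
   then obtain P a b where P: "P : \<P>" "cut_out_by g r a b P" "a < t" "t < b" unfolding fst_type_iff[OF gr] by blast
   hence "cut_out_by g l a b P" "b <= r" using cut_out_by_restrict[OF g r P(1)] by auto
   moreover have "0 <= a" using P(2) by (simp add: cut_out_by_def)
   ultimately show "t : fst (gtype g l) & 0 < t & t < r"
    unfolding fst_type_iff[OF g] using P by auto
  next
   assume A: "t : fst (gtype g l) & 0 < t & t < r"
   then obtain P a b where P: "P : \<P>" "cut_out_by g l a b P" "a < t" "t < b" unfolding fst_type_iff[OF g] by blast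
   have "~ (a < r & r < b)" using r(3) P unfolding fst_type_iff[OF g] by blast
   hence "b <= r" using A P by linarith
   thus "t : fst (gtype g r)"
    unfolding fst_type_iff[OF gr] using P cut_out_by_restrict[OF g r P(1)] by blast
  qed
  ultimately show "t : fst (gtype g r) <-> t : fst (initial_subtype r (gtype g l))"
   by simp
 qed
qed

lemma end_not_in_type: "geo S g l x z ==> l ~: fst (gtype g l)"
 unfolding fst_type_iff cut_out_by_def by (intro notI, elim bexE exE conjE) simp

lemma limit_type_in_Q_types:
 assumes g: "geo S g l x z" and lim: "limit_dir S \<P> x z"
 shows "gtype g l : Q_types R D"
proof -
 let ?f = "snd (gtype g l)"
 have pos: "0 < a" if c: "cut_out_by g l a b P" and P: "P : \<P>" for a b P
 proof (rule ccontr)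
  assume "~ 0 < a"
  note cp = cut_out_by_piece[OF g P c]
  hence "gate S P x = x" using \<open>~ 0 < a\<close> geoD(2)[OF g] cp by simp
  hence "x : P" using gate_mem[OF P, of x] geoD(4)[OF g] by simp
  hence "gate S P z = x" using lim P unfolding limit_dir_def by blast
  moreover have "gate S P x ~= gate S P z" using c unfolding cut_out_by_iff[OF g P] by blast
  ultimately show False using \<open>gate S P x = x\<close> by simp
 qed
 have "disjoint_family_on (%(a, b). {a<..<b}) (dom ?f)"
  unfolding disjoint_family_on_def
 proof (intro ballI impI)
  fix i j assume i: "i : dom ?f" and j: "j : dom ?f" and ij: "i ~= j"
  obtain a b a' b' where ab: "i = (a, b)" "j = (a', b')" by fastforce
  obtain P where P: "P : \<P>" "cut_out_by g l a b P" using i ab type_dom[OF g] by auto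
  obtain P' where P': "P' : \<P>" "cut_out_by g l a' b' P'" using j ab type_dom[OF g] by auto
  have ne: "P ~= P'"
  using P(2) P'(2) cut_out_by_iff g P(1) ij ab by metis
  have "{a<..<b} Int {a'<..<b'} = {}"
  proof (rule ccontr)
   assume "{a<..<b} Int {a'<..<b'} ~= {}"
   then obtain t where "t : {a<..<b} Int {a'<..<b'}" by blast
   hence t: "a < t" "t < b" "a' < t" "t < b'" by simp_all
   let ?s = "max a a'"
   note ct = P(2)[unfolded cut_out_times[OF g]] and ct' = P'(2)[unfolded cut_out_times[OF g]]
   have "g t : P" "g t : P'" "g ?s : P" "g ?s : P'" "g t ~= g ?s"
    using ct ct' t geo_inj[OF g, of t ?s] by auto
   thus False using piece_unique[OF P(1) P'(1)] ne by blast
  qed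
  thus "(case i of (a, b) => {a<..<b}) Int (case j of (a, b) => {a<..<b}) = {}" using ab by simp
 qed
 moreover have "ALL (a, b):dom ?f. 0 < a & a < b"
 proof (intro ballI)
  fix i assume i: "i : dom ?f"
  obtain a b where ab: "i = (a, b)" by fastforce
  obtain P where P: "P : \<P>" "cut_out_by g l a b P" using i ab type_dom[OF g] by auto
  show "case i of (a, b) => 0 < a & a < b" using pos[OF P(2,1)] P(2) ab by (simp add: cut_out_by_def)
 qed
 moreover have "Q : R & (p, q) : D Q & mdist Q p q = b - a" if f: "?f (a, b) = Some (Q, p, q)" for a b Q p q
 proof -
  obtain P where P: "P : \<P>" "cut_out_by g l a b P" and pd: "pair_data R D S P (g a) (g b) Q p q"
   using f type_iff[OF g] by blast
  note cp = cut_out_by_piece[OF g P]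
  obtain i where i: "Q : R" "(p, q) : D Q" "isometry (submetric S P) Q i" "i (g a) = p" "i (g b) = q"
   using pd unfolding pair_data_def by blast
  show ?thesis using isometry_dist[OF i(3), unfolded mspace_piece[OF P(1)], OF cp(1,2)] i(4,5) i geoD(8)[OF g, of a b] cp by simp
 qed
 ultimately show ?thesis unfolding Q_types_def using fst_type[of g l] by (simp add: case_prod_beta)
qed

text \<open>The geodesics meet arbitrarily close to \<open>x\<close>. A common point may lie inside a crossed piece, but
  then one moves back to the point where that piece is entered, which is its gate and thus common as well; up
  to there the types agree.\<close>
lemma limit_type_indep:
 assumes g: "geo S g l x z" and h: "geo S h k x y" and lim: "limit_dir S \<P> x z" and zy: "sdir x z y"
 shows "(gtype g l, gtype h k) : equivalent_types R D"
proof -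
 let ?U = "fst (gtype g l)" and ?V = "fst (gtype h k)"
 have lim': "limit_dir S \<P> x y" by (rule limit_dir_same_dir[OF lim zy])
 have x: "x : M" using geoD(4)[OF g] .
 have pos: "l > 0" "k > 0"
  using same_dir_mem[OF zy] geoD(1,2,3)[OF g] geoD(1,2,3)[OF h] by (metis less_eq_real_def)+
 from germ_dichotomy[OF g h zy] obtain t where t: "0 < t" "t <= l" "t <= k" "g t = h t"
 proof
  assume "ALL e>0. EX t. 0 < t & t < e & t <= l & t <= k & g t = h t"
  thus ?thesis using that zero_less_one by blast
 next
  assume "EX P:\<P>. EX e>0. e <= l & e <= k & (ALL t. 0 <= t & t <= e --> g t : P & h t : P)"
  then obtain P e where P: "P : \<P>" "0 < e" "e <= l" "ALL t. 0 <= t & t <= e --> g t : P & h t : P" by blast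
  have "x : P" using P(4)[rule_format, of 0] P(2) geoD(2)[OF g] by simp
  moreover have "g e : P" "g e ~= x" using P geo_dist(1)[OF g, of e] x by auto
  moreover have "betw S x (g e) z" using geo_betw_ends[OF g, of e] P by simp
  ultimately have "gate S P z ~= x" by (intro gate_neI[OF P(1)])
  thus ?thesis using lim P(1) \<open>x : P\<close> unfolding limit_dir_def by blast
 qed
 \<comment> \<open>if the common point lies inside a piece crossed by one geodesic, move back to the gate\<close>
 have move_back: "EX s. 0 < s & s <= l & s <= k & g s = h s & s ~: fst (gtype g l) & s ~: fst (gtype h k)"
  if g: "geo S g l x z" and h: "geo S h k x y" and lim: "limit_dir S \<P> x z" and lim': "limit_dir S \<P> x y"
   and t: "0 < t" "t <= l" "t <= k" "g t = h t"
   and tU: "t : fst (gtype g l)" for g h l k z y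
 proof -
  have tau: "(fst (gtype g l), snd (gtype g l)) : Q_types R D"
   "(fst (gtype h k), snd (gtype h k)) : Q_types R D"
   using limit_type_in_Q_types[OF g lim] limit_type_in_Q_types[OF h lim'] by simp_all
  obtain P a b where P: "P : \<P>" "cut_out_by g l a b P" "a < t" "t < b" using tU unfolding fst_type_iff[OF g] by blast
  note cp = cut_out_by_piece[OF g P(1,2)]
  have ab: "(a, b) : dom (snd (gtype g l))" using type_dom[OF g] P by blast
  have a0: "0 < a" using Q_typesD(2)[OF tau(1) ab] by simp
  have gt: "g t : P" using t(1,2) P(3,4) P(2)[unfolded cut_out_times[OF g]] by simp
  have "d x (g t) = t" using geo_dist(1)[OF g, of t] t by simp
  hence "h (d x (gate S P x)) = gate S P x" using gate_entry[OF P(1) x gt, of h] geo_take[OF h, of t] t by simp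
  moreover have "d x (gate S P x) = a" using P(2) unfolding cut_out_by_iff[OF g P(1)] by simp
  ultimately have ha: "h a = g a" using cp by simp
  obtain a' b' where c': "cut_out_by h k a' b' P" "a' <= a" "t <= b'"
   using two_points_cut[OF h P(1) cp(3) P(3) t(3)] ha t(4) gt cp(1) by auto
  have "a' = d x (gate S P x)" using c'(1) unfolding cut_out_by_iff[OF h P(1)] by simp
  hence "(a, b') : dom (snd (gtype h k))" using \<open>d x (gate S P x) = a\<close> type_dom[OF h] P(1) c'(1) by blast
  hence "a ~: fst (gtype h k)" by (rule Q_types_left_end[OF tau(2)])
  thus ?thesis using a0 ha P(3) t Q_types_left_end[OF tau(1) ab] by auto
 qed
 have "EX s. 0 < s & s <= l & s <= k & g s = h s & s ~: ?U & s ~: ?V"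
 using move_back g h lim lim' t t(1,3,2) t(4) by metis
 then obtain s where s: "0 < s" "s <= l" "s <= k" "g s = h s" "s ~: ?U" "s ~: ?V" by blast
 have "geo S g s x (g s)" "geo S h s x (g s)" using geo_take[OF g, of s] geo_take[OF h, of s] s by simp_all
 hence "initial_subtype s (gtype g l) = initial_subtype s (gtype h k)" using type_endpoints type_restrict[OF g s(1,2,5)] type_restrict[OF h s(1,3,6)] by metis
 thus ?thesis unfolding equivalent_types_def
  using limit_type_in_Q_types[OF g lim] limit_type_in_Q_types[OF h lim'] s by auto
qed

definition dir_type :: "'a => 'a => 'q qtype set" where
 "dir_type x y = equivalent_types R D `` {gtype (SOME g. geo S g (d x y) x y) (d x y)}"

lemma dir_type_eq:
 assumes g: "geo S g l x z" and lim: "limit_dir S \<P> x y" and yz: "sdir x y z"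
 shows "equivalent_types R D `` {gtype g l} = dir_type x y"
proof -
 have M: "x : M" "y : M" using lim by (auto simp: limit_dir_def)
 let ?h = "SOME g. geo S g (d x y) x y"
 have "EX g. geo S g (d x y) x y" using geodesic_space_geo[OF geodesic_S M] by metis
 hence "geo S ?h (d x y) x y" by (rule someI_ex)
 from limit_type_indep[OF this g lim yz] show ?thesis
  unfolding dir_type_def using equiv_class_eq[OF equiv_types] by metis
qed

lemma dir_type_mem:
 assumes lim: "limit_dir S \<P> x y"
 shows "dir_type x y : type_classes R D"
proof -
 have M: "x : M" "y : M" using lim by (auto simp: limit_dir_def)
 obtain g where g: "geo S g (d x y) x y" using geodesic_space_geo[OF geodesic_S M] by metis
 have "sdir x y y" using lim same_dir_refl unfolding limit_dir_def by blast
 from dir_type_eq[OF g lim this] limit_type_in_Q_types[OF g lim] show ?thesis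
  unfolding type_classes_def by (metis quotientI)
qed

lemma limit_component_of_type_iff:
 assumes x: "x : M"
 shows "limit_component_of_type R D S \<P> x \<theta> C <->
  (EX y. limit_dir S \<P> x y & C = {z. sdir x y z} & \<theta> = dir_type x y)"
proof
 assume A: "limit_component_of_type R D S \<P> x \<theta> C"
 hence lc: "limit_component S \<P> x C" by (simp add: limit_component_of_type_def)
 obtain g r where gi: "geodesic_into S x C g r" and th: "\<theta> = equivalent_types R D `` {gtype g r}"
  using A by (auto simp: limit_component_of_type_def)
 obtain y where y: "limit_dir S \<P> x y" "C = {z. sdir x y z}" using lc limit_component_iff[OF x] by blast
 note gd = geodesic_intoD[OF gi]
 have "C : components_at S x" using lc by (simp add: limit_component_def)
 hence "sdir x y (g r)" using gd(3)[of r] gd(1) y(2) by blast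
 from dir_type_eq[OF gd(2) y(1) this] show "EX y. limit_dir S \<P> x y & C = {z. sdir x y z} & \<theta> = dir_type x y"
  using y th by blast
next
 assume "EX y. limit_dir S \<P> x y & C = {z. sdir x y z} & \<theta> = dir_type x y"
 then obtain y where y: "limit_dir S \<P> x y" "C = {z. sdir x y z}" "\<theta> = dir_type x y" by blast
 have M: "y : M" "y ~= x" using y(1) by (auto simp: limit_dir_def)
 obtain g where g: "geo S g (d x y) x y" using geodesic_space_geo[OF geodesic_S x M(1)] by metis
 have yy: "sdir x y y" by (rule same_dir_refl[OF x M])
 have lc: "limit_component S \<P> x C" using y limit_component_iff[OF x] by blast
 hence C: "C : components_at S x" by (simp add: limit_component_def)
 have "y : C" using y(2) yy by simp
 hence "geodesic_into S x C g (d x y)" by (rule component_geodesic_into[OF C _ g])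
 thus "limit_component_of_type R D S \<P> x \<theta> C"
  unfolding limit_component_of_type_def using lc dir_type_eq[OF g y(1) yy] y(3) by metis
qed

end

section \<open>Subtrees\<close>

text \<open>In place of convexity it is required that points outside do not separate the set; in this form the condition
  is inherited by unions and by adding limit points. A subtree contains every piece that it meets in two
  points.\<close>
definition subtree :: "'a metric => 'a set set => 'a set => bool" where
 "subtree S \<P> A <-> A <= mspace S &
   (ALL x:mspace S. x ~: A --> (ALL a:A. ALL a':A. same_dir S \<P> x a a')) &
   (ALL P:\<P>. ALL p:A Int P. ALL q:A Int P. p ~= q --> P <= A)"

text \<open>At most two of the directions at \<open>x\<close> are met by \<open>A\<close>. This is the situation at a
  point in the interior of a path.\<close>
definition fresh :: "'a metric => 'a set set => 'a set => 'a => bool" where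
 "fresh S \<P> A x <-> (ALL a:A - {x}. ALL b:A - {x}. ALL c:A - {x}.
   same_dir S \<P> x a b | same_dir S \<P> x a c | same_dir S \<P> x b c)"

definition full :: "'a metric => 'a set set => 'a set => 'a => bool" where
 "full S \<P> A x <-> (ALL z:mspace S. z ~= x --> (EX a:A. same_dir S \<P> x z a))"

lemma subtreeI:
 assumes "A <= mspace S"
  and "!!x a a'. x : mspace S ==> x ~: A ==> a : A ==> a' : A ==> same_dir S \<P> x a a'"
  and "!!P p q. P : \<P> ==> p : A ==> p : P ==> q : A ==> q : P ==> p ~= q ==> P <= A"
 shows "subtree S \<P> A"
 unfolding subtree_def
using assms(1) assms(2) assms(3) by blast

lemma subtreeD:
 assumes "subtree S \<P> A"
 shows "A <= mspace S"
  "!!x a a'. x : mspace S ==> x ~: A ==> a : A ==> a' : A ==> same_dir S \<P> x a a'"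
  "!!P p q. P : \<P> ==> p : A ==> p : P ==> q : A ==> q : P ==> p ~= q ==> P <= A"
proof -
 note a = assms[unfolded subtree_def]
 show "A <= mspace S" using a by (elim conjE)
 show "same_dir S \<P> x a a'" if "x : mspace S" "x ~: A" "a : A" "a' : A" for x a a'
  using a[THEN conjunct2, THEN conjunct1] that by simp
 show "P <= A" if "P : \<P>" "p : A" "p : P" "q : A" "q : P" "p ~= q" for P p q
  using a[THEN conjunct2, THEN conjunct2, rule_format, of P p q] that by simp
qed

context tree_graded_space
begin

lemma subtree_gates:
 assumes A: "subtree S \<P> A" and P: "P : \<P>" and a: "a : A" "a' : A" and ne: "gate S P a ~= gate S P a'"
 shows "gate S P a : A" "P <= A"
proof -
 have *: "gate S P a : A" if a: "a : A" "a' : A" and ne: "gate S P a ~= gate S P a'" for a a'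
 proof (rule ccontr)
  assume n: "gate S P a ~: A"
  have aM: "a : M" using subtreeD(1)[OF A] a by auto
  have "sdir (gate S P a) a a'" by (rule subtreeD(2)[OF A gate_in_M[OF P aM] n a])
  from same_dir_gate_ne[OF this P gate_mem[OF P aM]] ne show False by simp
 qed
 show g: "gate S P a : A" by (rule *[OF a ne])
 have M: "a : M" "a' : M" using subtreeD(1)[OF A] a by auto
 show "P <= A"
  by (rule subtreeD(3)[OF A P g gate_mem[OF P M(1)] *[OF a(2,1) ne[symmetric]] gate_mem[OF P M(2)] ne])
qed

lemma subtree_convex:
 assumes A: "subtree S \<P> A" and a: "a : A" "a' : A" and b: "betw S a u a'"
 shows "u : A"
proof (rule ccontr)
 assume n: "u ~: A"
 have M: "a : M" "u : M" "a' : M" using b by (auto simp: betw_def)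
 have no: False if w: "w ~= u" "betw S u w a" "betw S u w a'" for w
 using betw_trans(2) b betw_sym w(2) betw_antisym w(3) w(1) by metis
 have "sdir u a a'" by (rule subtreeD(2)[OF A M(2) n a])
 thus False
 proof (cases rule: same_dirE)
  case (1 w)
  thus False by (rule no)
 next
  case (2 P)
  show False
  proof (cases "gate S P a = gate S P a'")
   case True
   show False
    by (rule no[OF 2(3) betw_sym[OF gate_betw[OF 2(1) M(1) 2(2)]]])
     (use betw_sym[OF gate_betw[OF 2(1) M(3) 2(2)]] True in simp)
  next
   case False
   from subtree_gates(2)[OF A 2(1) a False] show False using 2(2) n by blast
  qed
 qed
qed

lemma subtree_singleton: "x : M ==> subtree S \<P> {x}"
 by (rule subtreeI) (auto intro: same_dir_refl)

lemma piece_same_dir: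
 assumes P: "P : \<P>" "p : P" "q : P" and x: "x : M" "x ~: P"
 shows "sdir x p q"
proof -
 obtain g where g: "geo S g (d p q) p q" "!!t. 0 <= t ==> t <= d p q ==> g t : P"
  using piece_geo[OF P] by metis
 have "g t ~= x" if "0 <= t" "t <= d p q" for t using g(2)[OF that] x(2) by auto
 from same_dir_geo[OF g(1) order_refl mdist_nonneg order_refl x(1) this]
 show ?thesis using geoD(2,3)[OF g(1)] by simp
qed

lemma subtree_piece: "P : \<P> ==> subtree S \<P> P"
proof (rule subtreeI)
 assume P: "P : \<P>"
 show "P <= M" by (rule piece_subset[OF P])
 show "sdir x a a'" if "x : M" "x ~: P" "a : P" "a' : P" for x a a'
  using piece_same_dir[OF P] that by blast
 show "P' <= P" if "P' : \<P>" "p : P" "p : P'" "q : P" "q : P'" "p ~= q" for P' p q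
  using piece_unique[OF P that(1)] that(2-) by blast
qed

text \<open>A wedge of subtrees at \<open>x\<close> in different directions: a geodesic from one of them to another
  passes through \<open>x\<close>.\<close>
lemma subtree_Union:
 assumes sub: "!!A. A : \<A> ==> subtree S \<P> A" and x: "!!A. A : \<A> ==> x : A"
  and sep: "!!A B a b. A : \<A> ==> B : \<A> ==> A ~= B ==> a : A ==> a ~= x ==> b : B ==> b ~= x ==> ~ sdir x a b"
 shows "subtree S \<P> (\<Union>\<A>)"
proof (rule subtreeI)
 show "\<Union>\<A> <= M" using subtreeD(1)[OF sub] by blast
 show "sdir y a a'" if y: "y : M" "y ~: \<Union>\<A>" and a: "a : \<Union>\<A>" "a' : \<Union>\<A>" for y a a'
 proof -
  obtain A A' where A: "A : \<A>" "a : A" "A' : \<A>" "a' : A'" using a by blast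
  have "sdir y a x" by (rule subtreeD(2)[OF sub[OF A(1)] y(1) _ A(2) x[OF A(1)]]) (use y A in blast)
  moreover have "sdir y x a'" by (rule subtreeD(2)[OF sub[OF A(3)] y(1) _ x[OF A(3)] A(4)]) (use y A in blast)
  ultimately show ?thesis by (rule same_dir_trans)
 qed
 show "P <= \<Union>\<A>" if P: "P : \<P>" and p: "p : \<Union>\<A>" "p : P" and q: "q : \<Union>\<A>" "q : P" and ne: "p ~= q" for P p q
 proof -
  obtain A B where A: "A : \<A>" "p : A" and B: "B : \<A>" "q : B" using p q by blast
  have one: "P <= \<Union>\<A>" if "C : \<A>" "p : C" "q : C" for C
   using subtreeD(3)[OF sub[OF that(1)] P that(2) p(2) that(3) q(2) ne] that(1) by blast
  show ?thesis
  proof (cases "A = B | p = x | q = x")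
   case True
   thus ?thesis using one[of A] one[of B] x[OF A(1)] x[OF B(1)] A B by blast
  next
   case False
   have n: "~ sdir x p q" using sep[OF A(1) B(1) _ A(2) _ B(2)] False by blast
   have xM: "x : M" using x[OF A(1)] subtreeD(1)[OF sub[OF A(1)]] by blast
   have M: "p : M" "q : M" using piece_mem[OF P] p q by auto
   have xP: "x : P" using betw_if_not_same_dir[OF xM M n] by (rule piece_convex[OF P p(2) q(2)])
   have "sdir x p q"
    by (rule same_dirI_piece[OF P xP M]) (use gate_self[OF P] p q False in auto)
   thus ?thesis using n by simp
  qed
 qed
qed

lemma subtree_chain_Union:
 assumes sub: "!!A. A : \<A> ==> subtree S \<P> A"
  and ch: "!!a b. a : \<Union>\<A> ==> b : \<Union>\<A> ==> EX C:\<A>. a : C & b : C"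
 shows "subtree S \<P> (\<Union>\<A>)"
proof (rule subtreeI)
 show "\<Union>\<A> <= M" using subtreeD(1)[OF sub] by blast
 show "sdir y a a'" if y: "y : M" "y ~: \<Union>\<A>" and a: "a : \<Union>\<A>" "a' : \<Union>\<A>" for y a a'
 proof -
  obtain C where C: "C : \<A>" "a : C" "a' : C" using ch[OF a] by blast
  show ?thesis by (rule subtreeD(2)[OF sub[OF C(1)] y(1) _ C(2,3)]) (use y C in blast)
 qed
 show "P <= \<Union>\<A>" if P: "P : \<P>" and p: "p : \<Union>\<A>" "p : P" and q: "q : \<Union>\<A>" "q : P" and ne: "p ~= q" for P p q
 proof -
  obtain C where C: "C : \<A>" "p : C" "q : C" using ch[OF p(1) q(1)] by blast
  show ?thesis using subtreeD(3)[OF sub[OF C(1)] P C(2) p(2) C(3) q(2) ne] C(1) by blast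
 qed
qed

lemma gate_near:
 assumes P: "P : \<P>" and p: "p : P" and a: "a : M"
 shows "d p (gate S P a) <= d a p"
proof -
 have "d a (gate S P a) + d (gate S P a) p = d a p" using gate_betw[OF P a p] by (simp add: betw_def)
 thus ?thesis using mdist_nonneg[of S a "gate S P a"] mdist_commute[of S p "gate S P a"] by linarith
qed

lemma near_same_dir:
 assumes "y : M" "x : M" "x ~= y" "a : M" "d x a < d x y"
 shows "sdir y x a"
 by (rule same_dir_near) (use assms in auto)

text \<open>Outside points see \<open>x\<close> in the same direction as nearby points of \<open>A\<close>. If a piece
  contains \<open>x\<close> and a point \<open>q\<close> of \<open>A\<close>, points of \<open>A\<close> close
  to \<open>x\<close> have a gate different from \<open>q\<close>, so \<open>A\<close> contains two gates and
  hence the piece.\<close>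
lemma subtree_insert_limit:
 assumes A: "subtree S \<P> A" and x: "x : M" and lim: "!!e. e > 0 ==> EX a:A. d x a < e"
 shows "subtree S \<P> (insert x A)"
proof (rule subtreeI)
 have AM: "a : M" if "a : A" for a using subtreeD(1)[OF A] that by blast
 show "insert x A <= M" using subtreeD(1)[OF A] x by blast
 have xa: "sdir y x a" if y: "y : M" "y ~: insert x A" and a: "a : A" for y a
 proof -
  obtain b where b: "b : A" "d x b < d x y" using lim[of "d x y"] mdist_pos[OF x y(1)] y(2) by blast
  have "sdir y x b" by (rule near_same_dir[OF y(1) x _ AM[OF b(1)] b(2)]) (use y in blast)
  moreover have "sdir y b a" by (rule subtreeD(2)[OF A y(1) _ b(1) a]) (use y in blast)
  ultimately show ?thesis by (rule same_dir_trans)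
 qed
 show "sdir y a a'" if y: "y : M" "y ~: insert x A" and a: "a : insert x A" "a' : insert x A" for y a a'
 proof (cases "a = x"; cases "a' = x")
  assume "a = x" "a' = x" thus ?thesis using same_dir_refl[OF y(1) x] y(2) by blast
 next
  assume "a = x" "a' ~= x" thus ?thesis using xa[OF y] a by blast
 next
  assume "a ~= x" "a' = x" thus ?thesis using same_dir_sym[OF xa[OF y]] a by blast
 next
  assume "a ~= x" "a' ~= x" thus ?thesis using subtreeD(2)[OF A y(1)] y(2) a by blast
 qed
 have key: "P <= insert x A" if P: "P : \<P>" "x : P" and q: "q : A" "q : P" and ne: "x ~= q" for P q
 proof -
  obtain a where a: "a : A" "d x a < d x q" using lim[of "d x q"] mdist_pos[OF x AM[OF q(1)] ne] by blast
  have "gate S P a ~= gate S P q" using gate_near[OF P AM[OF a(1)]] a(2) mdist_commute[of S x a] gate_self[OF P(1) q(2)] by auto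
  from subtree_gates(2)[OF A P(1) a(1) q(1) this] show ?thesis by blast
 qed
 show "P <= insert x A" if P: "P : \<P>" and p: "p : insert x A" "p : P" and q: "q : insert x A" "q : P" and ne: "p ~= q" for P p q
 proof (cases "p = x | q = x")
  case True
  thus ?thesis
  using q p ne key P q(2) p(2) by blast
 next
  case False
  thus ?thesis using subtreeD(3)[OF A P _ p(2) _ q(2) ne] p q by blast
 qed
qed

text \<open>From a point \<open>w \<noteq> x\<close> one sees \<open>x\<close> in the same direction as the points of
  \<open>A\<close> close to \<open>x\<close>.\<close>
lemma fresh_insert_limit:
 assumes fr: "fresh S \<P> A w" and A: "A <= M" and w: "w : M" and x: "x : M" and lim: "!!e. e > 0 ==> EX a:A. d x a < e"
 shows "fresh S \<P> (insert x A) w"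
proof -
 have rep: "EX b:A - {w}. sdir w a b" if a: "a : insert x A - {w}" for a
 proof (cases "a = x")
  case True
  hence xw: "x ~= w" using a by blast
  obtain b where b: "b : A" "d x b < d x w" using lim[of "d x w"] mdist_pos[OF x w xw] by blast
  have "sdir w x b" by (rule near_same_dir[OF w x xw _ b(2)]) (use b A in blast)
  thus ?thesis using b True same_dir_mem by blast
 next
  case False
  thus ?thesis using a same_dir_refl[OF w] A by blast
 qed
 show ?thesis unfolding fresh_def
 proof (intro ballI)
  fix a b c assume "a : insert x A - {w}" "b : insert x A - {w}" "c : insert x A - {w}"
  then obtain a' b' c' where r: "a' : A - {w}" "b' : A - {w}" "c' : A - {w}"
   "sdir w a a'" "sdir w b b'" "sdir w c c'" using rep by meson
  have "sdir w a' b' | sdir w a' c' | sdir w b' c'"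
   using fr r(1-3) unfolding fresh_def by blast
  thus "sdir w a b | sdir w a c | sdir w b c"
   using r(4-6) same_dir_trans same_dir_sym by meson
 qed
qed

lemma fresh_if_one_dir:
 assumes "!!a. a : A ==> a ~= x ==> sdir x a u | sdir x a v"
 shows "fresh S \<P> A x"
 unfolding fresh_def
proof (intro ballI)
 fix a b c assume "a : A - {x}" "b : A - {x}" "c : A - {x}"
 hence "sdir x a u | sdir x a v" "sdir x b u | sdir x b v"
  "sdir x c u | sdir x c v" using assms by auto
 thus "sdir x a b | sdir x a c | sdir x b c"
  using same_dir_trans same_dir_sym by meson
qed

text \<open>Freshness depends on the directions that are met only.\<close>
lemma fresh_reduce:
 assumes fr: "fresh S \<P> A x" and B: "!!b. b : B ==> b ~= x ==> EX a:A. sdir x b a"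
 shows "fresh S \<P> B x"
 unfolding fresh_def
proof (intro ballI)
 fix a b c assume abc: "a : B - {x}" "b : B - {x}" "c : B - {x}"
 obtain a' where a': "a' : A" "sdir x a a'" using B[of a] abc(1) by blast
 obtain b' where b': "b' : A" "sdir x b b'" using B[of b] abc(2) by blast
 obtain c' where c': "c' : A" "sdir x c c'" using B[of c] abc(3) by blast
 note r = a'(1) b'(1) c'(1) a'(2) b'(2) c'(2)
 have ne: "a' ~= x" "b' ~= x" "c' ~= x" using same_dir_mem[OF r(4)] same_dir_mem[OF r(5)] same_dir_mem[OF r(6)] by auto
 have "sdir x a' b' | sdir x a' c' | sdir x b' c'"
  using fr r(1-3) ne unfolding fresh_def by blast
 thus "sdir x a b | sdir x a c | sdir x b c"
  using r(4-6) same_dir_trans same_dir_sym by meson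
qed

text \<open>This happens at the last point \<open>x\<close> in \<open>A\<close> of a geodesic from \<open>a0\<close> to
  \<open>y\<close>: by \<open>germ_dichotomy\<close> a geodesic from \<open>x\<close> into \<open>A\<close> in
  the same direction would share a later point with it, or both would start inside a piece, which would then
  be contained in \<open>A\<close>.\<close>
lemma untouched_direction:
 assumes A: "subtree S \<P> A" and cl: "closedin (mtopology_of S) A" and a0: "a0 : A" and y: "y : M" "y ~: A"
 shows "EX x:A. ALL a:A. ~ sdir x y a"
proof -
 have AM: "a : M" if "a : A" for a using subtreeD(1)[OF A] that by blast
 obtain g where g: "geo S g (d a0 y) a0 y" using geodesic_space_geo[OF geodesic_S AM[OF a0] y(1)] by metis
 obtain t where t: "0 <= t" "t <= d a0 y" "g t : A" and last: "!!s. t < s ==> s <= d a0 y ==> g s ~: A"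
  using geo_last_point[OF g cl a0] by blast
 let ?x = "g t"
 have tl: "t < d a0 y" using t geoD(3)[OF g] y(2) by (cases "t = d a0 y") auto
 define h where "h = (%s. g (t + s))"
 let ?l = "d a0 y - t"
 have h: "geo S h ?l ?x y" unfolding h_def using geo_sub[OF g t(1,2)] geoD(3)[OF g] by simp
 have hA: "h s ~: A" if "0 < s" "s <= ?l" for s unfolding h_def by (rule last) (use that in auto)
 have "~ sdir ?x y a" if a: "a : A" for a
 proof
  assume sd: "sdir ?x y a"
  have aM: "a : M" by (rule AM[OF a])
  obtain k where k: "geo S k (d ?x a) ?x a" using geodesic_space_geo[OF geodesic_S AM[OF t(3)] aM] by metis
  have kA: "k s : A" if "0 <= s" "s <= d ?x a" for s
   by (rule subtree_convex[OF A t(3) a geo_betw_ends[OF k that]])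
  from germ_dichotomy[OF h k sd] show False
  proof
   assume "ALL e>0. EX s. 0 < s & s < e & s <= ?l & s <= d ?x a & h s = k s"
   then obtain s where s: "0 < s" "s <= ?l" "s <= d ?x a" "h s = k s" using zero_less_one by blast
   have "k s : A" by (rule kA) (use s in auto)
   thus False using hA[OF s(1,2)] s(4) by simp
  next
   assume "EX P:\<P>. EX e>0. e <= ?l & e <= d ?x a & (ALL t. 0 <= t & t <= e --> h t : P & k t : P)"
   then obtain P e where P: "P : \<P>" and e: "0 < e" "e <= ?l" "e <= d ?x a"
    and in_P: "ALL t. 0 <= t & t <= e --> h t : P & k t : P" by blast
   have kk: "k 0 : P" "k e : P" "h e : P" using in_P e(1) by auto
   have "k 0 : A" "k e : A" by (rule kA, use e in auto)+
   hence "P <= A" using subtreeD(3)[OF A P] kk geo_inj[OF k, of 0 e] e by auto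
   thus False using kk(3) hA[OF e(1,2)] by blast
  qed
 qed
 thus ?thesis using t(3) by blast
qed

end

context Q_tree_space
begin

section \<open>The hull of a geodesic\<close>

definition cell :: "(real => 'a) => real => real => real => 'a => bool" where
 "cell g l a b n <->
   (a = b & 0 <= a & a <= l & a ~: fst (gtype g l) & n = g a) |
   (EX P:\<P>. cut_out_by g l a b P & n : P)"

text \<open>The geodesic together with all pieces that it crosses: the smallest subtree that contains it. A
  \<open>cell\<close> is one of the crossed pieces or a single point outside them, and \<open>a\<close>,
  \<open>b\<close> are the times at which it is entered and left.\<close>
definition hull_of :: "(real => 'a) => real => 'a set" where
 "hull_of g l = {n. EX a b. cell g l a b n}"

lemma cell_bounds: "cell g l a b n ==> 0 <= a & a <= b & b <= l"
 unfolding cell_def cut_out_by_def by auto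

context
 fixes g l x z assumes g: "geo S g l x z"
begin

lemma cell_mem: "cell g l a b n ==> n : M"
 unfolding cell_def using geoD(7)[OF g] piece_mem by blast

lemma cell_geo: "0 <= t ==> t <= l ==> EX a b. cell g l a b (g t) & a <= t & t <= b"
proof (cases "t : fst (gtype g l)")
 case True
 then obtain P a b where P: "P : \<P>" "cut_out_by g l a b P" "a < t" "t < b" unfolding fst_type_iff[OF g] by blast
 hence "g t : P" using P(2)[unfolded cut_out_times[OF g]] by auto
 hence "cell g l a b (g t)" unfolding cell_def using P by blast
 thus ?thesis using P(3,4) less_imp_le by blast
next
 case False
 assume "0 <= t" "t <= l"
 hence "cell g l t t (g t)" unfolding cell_def using False by blast
 thus ?thesis by blast
qed

text \<open>Different pieces share at most one point, so they cannot be crossed during overlapping times.\<close>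
lemma cells_order:
 assumes n: "cell g l a b n" and n': "cell g l a' b' n'"
 shows "(a = a' & b = b') | b <= a' | b' <= a"
proof (rule ccontr)
 assume no: "~ ?thesis"
 hence lt: "a' < b" "a < b'" by auto
 show False
 proof (cases "a = b | a' = b'")
  case True
  then consider "a = b" "a < b'" "a' < a" | "a' = b'" "a < a'" "a' < b" using lt by auto
  thus False
  proof cases
   case 1
   then obtain P' where "P' : \<P>" "cut_out_by g l a' b' P'" using n' unfolding cell_def by auto
   hence "a : fst (gtype g l)" unfolding fst_type_iff[OF g] using 1 by blast
   thus False using n 1 unfolding cell_def cut_out_by_def by blast
  next
   case 2
   then obtain P where "P : \<P>" "cut_out_by g l a b P" using n unfolding cell_def by auto
   hence "a' : fst (gtype g l)" unfolding fst_type_iff[OF g] using 2 by blast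
   thus False using n' 2 unfolding cell_def cut_out_by_def by blast
  qed
 next
  case False
  then obtain P P' where P: "P : \<P>" "cut_out_by g l a b P" and P': "P' : \<P>" "cut_out_by g l a' b' P'"
   using n n' unfolding cell_def by blast
  let ?s = "max a a'" and ?t = "min b b'"
  note ct = P(2)[unfolded cut_out_times[OF g]] and ct' = P'(2)[unfolded cut_out_times[OF g]]
  have st: "0 <= ?s" "?s < ?t" "?t <= l" using ct ct' lt by auto
  have "g ?s : P" "g ?s : P'" "g ?t : P" "g ?t : P'" using ct ct' st by auto
  moreover have "g ?s ~= g ?t"
  proof
   assume eq: "g ?s = g ?t"
   have "?s = ?t" by (rule geo_inj[OF g _ _ _ _ eq]) (use st in linarith)+
   thus False using st(2) by linarith
  qed
  ultimately have "P = P'" using piece_unique[OF P(1) P'(1)] by blast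
  hence "cut_out_by g l a' b' P" using P'(2) by simp
  hence "a = a'" "b = b'" using P(2) unfolding cut_out_by_iff[OF g P(1)] by simp_all
  thus False using no by simp
 qed
qed

lemma gate_along:
 assumes P: "P : \<P>" "cut_out_by g l a b P"
 shows "b <= t ==> t <= l ==> gate S P (g t) = g b" "0 <= t ==> t <= a ==> gate S P (g t) = g a"
proof -
 note ct = P(2)[unfolded cut_out_times[OF g]]
 show "gate S P (g t) = g b" if t: "b <= t" "t <= l"
 proof -
  have gt: "geo S g t x (g t)" by (rule geo_take[OF g]) (use t ct in auto)
  have "cut_out_by g t a b P" unfolding cut_out_times[OF gt] using ct t by auto
  from cut_out_by_piece(7)[OF gt P(1) this] show ?thesis by simp
 qed
 show "gate S P (g t) = g a" if t: "0 <= t" "t <= a"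
 proof -
  have gt: "geo S (%s. g (t + s)) (l - t) (g t) z" using geo_sub[OF g t(1), of l] geoD(3)[OF g] t ct by auto
  have "cut_out_by (%s. g (t + s)) (l - t) (a - t) (b - t) P" unfolding cut_out_times[OF gt] using ct t by auto
  from cut_out_by_piece(6)[OF gt P(1) this] show ?thesis by simp
 qed
qed

lemma cell_gate:
 assumes P: "P : \<P>" "cut_out_by g l a b P" and n: "cell g l a' b' n"
 shows "b <= a' ==> gate S P n = g b" "b' <= a ==> gate S P n = g a"
proof -
 note bd = cell_bounds[OF n]
 have other: "gate S P n = gate S P (g s)" if P': "P' : \<P>" "cut_out_by g l a' b' P'" "n : P'" and s: "s = a' | s = b'" and ne: "P ~= P'" for P' s
 proof (rule ccontr)
  assume d: "gate S P n ~= gate S P (g s)"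
  have gs: "g s : P'" using cut_out_by_piece(1,2)[OF g P'(1,2)] s by auto
  have M: "n : M" "g s : M" using piece_mem[OF P'(1)] P'(3) gs by auto
  show False using piece_convex[OF P'(1,3) gs] gates_differ[OF P(1) M d] piece_unique[OF P(1) P'(1)] gate_mem[OF P(1)] M d ne by blast
 qed
 show "gate S P n = g b" if "b <= a'"
 proof (cases "a' = b' & n = g a'")
  case True
  thus ?thesis using gate_along(1)[OF P that] bd by simp
 next
  case False
  then obtain P' where P': "P' : \<P>" "cut_out_by g l a' b' P'" "n : P'" using n unfolding cell_def by blast
  have "P ~= P'"
  proof
   assume "P = P'"
   hence "a = a'" using P(2) P'(2) unfolding cut_out_by_iff[OF g P(1)] cut_out_by_iff[OF g P'(1)] by simp
   thus False using that P(2) unfolding cut_out_by_def by simp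
  qed
  thus ?thesis using other[OF P'] gate_along(1)[OF P that] bd by fastforce
 qed
 show "gate S P n = g a" if "b' <= a"
 proof (cases "a' = b' & n = g a'")
  case True
  thus ?thesis using gate_along(2)[OF P _ that] bd by simp
 next
  case False
  then obtain P' where P': "P' : \<P>" "cut_out_by g l a' b' P'" "n : P'" using n unfolding cell_def by blast
  have "P ~= P'"
  proof
   assume "P = P'"
   hence "b = b'" using P(2) P'(2) unfolding cut_out_by_iff[OF g P(1)] cut_out_by_iff[OF g P'(1)] by simp
   thus False using that P(2) unfolding cut_out_by_def by simp
  qed
  thus ?thesis using other[OF P'] gate_along(2)[OF P _ that] bd by fastforce
 qed
qed

lemma cells_betw:
 assumes n: "cell g l a b n" and n': "cell g l a' b' n'" and le: "b <= a'"
 shows "betw S n (g b) n'" "betw S n (g a') n'" "betw S (g b) (g a') n'" "betw S n (g b) (g a')"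
proof -
 note bd = cell_bounds[OF n] and bd' = cell_bounds[OF n']
 have M: "n : M" "n' : M" "g b : M" "g a' : M" using cell_mem[OF n] cell_mem[OF n'] geoD(7)[OF g] bd bd' le by auto
 have one: "betw S n (g b) n'" if n': "cell g l a' b' n'" and le: "b <= a'" for a' b' n'
 using betw_ends M(1) cell_mem n' n cell_def gate_betw cell_gate(1) le betw_sym by metis
 have two: "betw S n (g a') n'" if n: "cell g l a b n" and le: "b <= a'" for a b n
 using betw_ends cell_mem n M(2) n' cell_def gate_betw cell_gate(2) le by metis
 show 1: "betw S n (g b) n'" by (rule one[OF n' le])
 show 2: "betw S n (g a') n'" by (rule two[OF n le])
 have "0 <= b" "b <= l" using bd by auto
 show "betw S (g b) (g a') n'"
 proof (cases "a' = b' & n' = g a'")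
  case True
  thus ?thesis using betw_ends[OF M(3,2)] by simp
 next
  case False
  then obtain P where P: "P : \<P>" "cut_out_by g l a' b' P" "n' : P" using n' unfolding cell_def by blast
  show ?thesis using gate_betw[OF P(1) M(3) P(3)] gate_along(2)[OF P(1,2) \<open>0 <= b\<close> le] by simp
 qed
 from betw_trans(2)[OF betw_sym[OF 1] betw_sym[OF this]] betw_trans_right[OF 1 this]
 show "betw S n (g b) (g a')" by blast
qed

text \<open>Cells are passed in the order of their times, through their first and last points on the geodesic.\<close>
lemma cells_dist:
 assumes n: "cell g l a b n" and n': "cell g l a' b' n'" and le: "b <= a'"
 shows "d n n' = d n (g b) + (a' - b) + d (g a') n'"
proof -
 note b = cells_betw[OF assms] and bd = cell_bounds[OF n] and bd' = cell_bounds[OF n']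
 show ?thesis using geoD(8)[OF g, of b a'] bd bd' le b(1,3) by (simp add: betw_def)
qed

lemma hull_subtree: "subtree S \<P> (hull_of g l)"
proof (rule subtreeI)
 show "hull_of g l <= M" unfolding hull_of_def using cell_mem by blast
 have gin: "g t : hull_of g l" if "0 <= t" "t <= l" for t unfolding hull_of_def using cell_geo[OF that] by blast
 have Pin: "P <= hull_of g l" if "P : \<P>" "cut_out_by g l a b P" for P a b
  unfolding hull_of_def cell_def using that by blast
 have to_x: "sdir y n x" if y: "y : M" "y ~: hull_of g l" and n: "n : hull_of g l" for y n
 proof -
  have line: "sdir y (g t) x" if t: "0 <= t" "t <= l" for t
  proof -
   have "sdir y (g 0) (g t)"
    by (rule same_dir_geo[OF g order_refl t y(1)]) (use gin y(2) t in auto)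
   thus ?thesis using geoD(2)[OF g] same_dir_sym by simp
  qed
  obtain a b where c: "cell g l a b n" using n unfolding hull_of_def by blast
  show ?thesis
  proof (cases "a = b & n = g a")
   case True
   thus ?thesis using line[of a] cell_bounds[OF c] by simp
  next
   case False
   then obtain P where P: "P : \<P>" "cut_out_by g l a b P" "n : P" using c unfolding cell_def by blast
   have "sdir y n (g a)" using Pin[OF P(1,2)] y(2) piece_same_dir[OF P(1,3) cut_out_by_piece(1)[OF g P(1,2)] y(1)] by blast
   moreover have "sdir y (g a) x" using line[of a] cell_bounds[OF c] by simp
   ultimately show ?thesis by (rule same_dir_trans)
  qed
 qed
 show "sdir y n n'" if "y : M" "y ~: hull_of g l" "n : hull_of g l" "n' : hull_of g l" for y n n'
  using same_dir_trans[OF to_x[OF that(1-3)] same_dir_sym[OF to_x[OF that(1,2,4)]]] .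
 have key: "P <= hull_of g l" if P: "P : \<P>" and c: "cell g l a b p" "cell g l a' b' q" and pq: "p : P" "q : P" "p ~= q" and le: "b <= a'"
  for P p q a b a' b'
 proof -
  note bt = cells_betw[OF c le] and bd = cell_bounds[OF c(1)] and bd' = cell_bounds[OF c(2)]
  have in_P: "g b : P" "g a' : P" using piece_convex[OF P pq(1,2)] bt by auto
  show ?thesis
  proof (cases "b < a'")
   case True
   thus ?thesis using two_points_cut[OF g P _ True _ in_P] bd bd' Pin[OF P] by auto
  next
   case False
   hence eq: "b = a'" using le by simp
   show ?thesis
   proof (cases "p = g b")
    case True
    hence "q ~= g a'" using pq(3) eq by simp
    then obtain P' where P': "P' : \<P>" "cut_out_by g l a' b' P'" "q : P'" using c(2) unfolding cell_def by blast
    have "P = P'" by (rule piece_unique[OF P P'(1) in_P(2) cut_out_by_piece(1)[OF g P'(1,2)] pq(2) P'(3)])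
     (use \<open>q ~= g a'\<close> in blast)
    thus ?thesis using Pin[OF P'(1,2)] by simp
   next
    case False
    then obtain P' where P': "P' : \<P>" "cut_out_by g l a b P'" "p : P'" using c(1) unfolding cell_def by blast
    have "P = P'" by (rule piece_unique[OF P P'(1) in_P(1) cut_out_by_piece(2)[OF g P'(1,2)] pq(1) P'(3)])
     (use False in blast)
    thus ?thesis using Pin[OF P'(1,2)] by simp
   qed
  qed
 qed
 show "P <= hull_of g l" if P: "P : \<P>" and p: "p : hull_of g l" "p : P" and q: "q : hull_of g l" "q : P" and ne: "p ~= q" for P p q
 proof -
  obtain a b a' b' where c: "cell g l a b p" "cell g l a' b' q" using p q unfolding hull_of_def by blast
  consider "a = a' & b = b'" | "b <= a'" | "b' <= a" using cells_order[OF c] by blast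
  thus ?thesis
  proof cases
   case 1
   show ?thesis
   proof (cases "a = b")
    case True
    hence "p = g a" "q = g a" using c 1 unfolding cell_def cut_out_by_def by auto
    thus ?thesis using ne by simp
   next
    case False
    then obtain P1 P2 where P1: "P1 : \<P>" "cut_out_by g l a b P1" "p : P1"
     and P2: "P2 : \<P>" "cut_out_by g l a b P2" "q : P2" using c 1 unfolding cell_def by blast
    have "P1 = P2" by (rule cut_out_by_unique[OF g P1(1,2) P2(1,2)])
    thus ?thesis using piece_unique[OF P P1(1) p(2) P1(3) q(2) _ ne] P2(3) Pin[OF P1(1,2)] by simp
   qed
  next
   case 2
   thus ?thesis using key[OF P c p(2) q(2) ne] by simp
  next
   case 3
   thus ?thesis using key[OF P c(2,1) q(2) p(2) ne[symmetric]] by simp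
  qed
 qed
qed

text \<open>Seen from a cell point, every other cell is either before it or after it.\<close>
lemma hull_fresh:
 assumes w: "w : hull_of g l" "w ~= x"
 shows "fresh S \<P> (hull_of g l) w"
proof -
 have ends: "x : M" "z : M" using geoD(4,5)[OF g] .
 obtain a0 b0 where cw: "cell g l a0 b0 w" using w unfolding hull_of_def by blast
 have wM: "w : M" by (rule cell_mem[OF cw])
 show ?thesis
 proof (cases "EX P:\<P>. EX a b. cut_out_by g l a b P & w : P & w ~= g a & w ~= g b")
  case True
  then obtain P a b where P: "P : \<P>" "cut_out_by g l a b P" and wP: "w : P" "w ~= g a" "w ~= g b" by blast
  note cp = cut_out_by_piece[OF g P]
  have gx: "gate S P x ~= w" using cp wP by simp
  show ?thesis
  proof (rule fresh_if_one_dir)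
   fix n assume n: "n : hull_of g l" "n ~= w"
   obtain a' b' where c: "cell g l a' b' n" using n unfolding hull_of_def by blast
   have "cell g l a b w" unfolding cell_def using P wP by blast
   from cells_order[OF this c] consider "a = a' & b = b'" | "b <= a'" | "b' <= a" by blast
   hence "gate S P n ~= w"
   proof cases
    case 1
    then obtain P' where P': "P' : \<P>" "cut_out_by g l a b P'" "n : P'" using c cp(4) unfolding cell_def by auto
    show ?thesis using cut_out_by_unique[OF g P'(1,2) P] gate_self[OF P(1), of n] P'(3) n(2) by simp
   next
    case 2
    thus ?thesis using cell_gate(1)[OF P c] wP by simp
   next
    case 3
    thus ?thesis using cell_gate(2)[OF P c] wP by simp
   qed
   thus "sdir w n x | sdir w n z"
    using same_dirI_piece[OF P(1) wP(1) cell_mem[OF c] ends(1) _ gx] by blast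
  qed
 next
  case no: False
  have "EX t. 0 <= t & t <= l & w = g t"
  proof (cases "a0 = b0 & w = g a0")
   case True
   thus ?thesis using cell_bounds[OF cw] by blast
  next
   case False
   then obtain P where "P : \<P>" "cut_out_by g l a0 b0 P" "w : P" using cw unfolding cell_def by blast
   hence "w = g a0 | w = g b0" using no by blast
   thus ?thesis using cell_bounds[OF cw] by (metis order_trans)
  qed
  then obtain t where t: "0 <= t" "t <= l" "w = g t" by blast
  have t0: "0 < t" using t w(2) geoD(2)[OF g] by (cases "t = 0") auto
  have tU: "t ~: fst (gtype g l)"
  proof
   assume "t : fst (gtype g l)"
   then obtain P a b where P: "P : \<P>" "cut_out_by g l a b P" "a < t" "t < b" unfolding fst_type_iff[OF g] by blast
   note cp = cut_out_by_piece[OF g P(1,2)]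
   have "g t : P" using P(2)[unfolded cut_out_times[OF g]] P(3,4) t by auto
   thus False using no P(1,2) t(3) geo_inj[OF g t(1,2), of a] geo_inj[OF g t(1,2), of b] P(3,4) cp by fastforce
  qed
  have ct: "cell g l t t w" unfolding cell_def using t tU by blast
  show ?thesis
  proof (rule fresh_if_one_dir)
   fix n assume n: "n : hull_of g l" "n ~= w"
   obtain a b where c: "cell g l a b n" using n unfolding hull_of_def by blast
   note bd = cell_bounds[OF c]
   have "(a = t & b = t) | b <= t | t <= a" using cells_order[OF c ct] by blast
   then consider "b < t" | "b = t" "a < b" | "a = b" "a = t" | "t < a" | "t = a" "a < b" using bd by linarith
   thus "sdir w n x | sdir w n z"
   proof cases
    case 1
    have "betw S n (g b) w" by (rule cells_betw(1)[OF c ct]) (use 1 in simp)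
    moreover have "g b ~= w" using geo_inj[OF g, of b t] 1 bd t by auto
    ultimately show ?thesis using same_dirI_betw[of "g b" w n x] betw_sym[of S n "g b" w] betw_sym[of S x "g b" w] geo_betw[OF g, of 0 b t] bd 1 t geoD(2)[OF g] by simp
   next
    case 2
    then obtain P where P: "P : \<P>" "cut_out_by g l a b P" "n : P" using c unfolding cell_def by auto
    note cp = cut_out_by_piece[OF g P(1,2)]
    have "gate S P n ~= w" using gate_self[OF P(1,3)] n by simp
    thus ?thesis using same_dirI_piece[OF P(1) _ cell_mem[OF c] ends(1)] cp(2) 2 t(3) cp(6) geo_inj[OF g, of a t] bd t by auto
   next
    case 3
    hence "n = w" using c t(3) unfolding cell_def cut_out_by_def by auto
    thus ?thesis using n by simp
   next
    case 4
    have "betw S w (g a) z" using geo_betw[OF g, of t a l] bd 4 t geoD(3)[OF g] by simp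
    moreover have "g a ~= w" using geo_inj[OF g, of a t] 4 bd t by auto
    ultimately show ?thesis using same_dirI_betw[of "g a" w n z] cells_betw(2)[OF ct c] 4 by simp
   next
    case 5
    then obtain P where P: "P : \<P>" "cut_out_by g l a b P" "n : P" using c unfolding cell_def by auto
    note cp = cut_out_by_piece[OF g P(1,2)]
    have "gate S P n ~= w" using gate_self[OF P(1,3)] n by simp
    thus ?thesis using same_dirI_piece[OF P(1) _ cell_mem[OF c] ends(2)] cp(1) 5 t(3) cp(7) geo_inj[OF g, of b t] bd t by auto
   qed
  qed
 qed
qed

lemma hull_direction:
 assumes lim: "limit_dir S \<P> x z" and n: "n : hull_of g l" "n ~= x"
 shows "sdir x n z"
proof -
 obtain a b where c: "cell g l a b n" using n unfolding hull_of_def by blast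
 note bd = cell_bounds[OF c]
 have l: "0 < l" using geoD(1-3)[OF g] lim unfolding limit_dir_def by (metis less_eq_real_def)
 have "(fst (gtype g l), snd (gtype g l)) : Q_types R D"
  using limit_type_in_Q_types[OF g lim] by simp
 note qt = Q_typesD[OF this]
 have "0 ~: fst (gtype g l)"
 proof
  assume "0 : fst (gtype g l)"
  then obtain P a b where "cut_out_by g l a b P" "a < 0" unfolding fst_type_iff[OF g] by blast
  thus False unfolding cut_out_by_def by simp
 qed
 hence c0: "cell g l 0 0 x" unfolding cell_def using l geoD(2)[OF g] by auto
 have a: "0 < a"
 proof (cases "a = b & n = g a")
  case True
  thus ?thesis using n(2) geoD(2)[OF g] bd by (cases "a = 0") auto
 next
  case False
  then obtain P where "P : \<P>" "cut_out_by g l a b P" using c unfolding cell_def by blast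
  hence "(a, b) : dom (snd (gtype g l))" using type_dom[OF g] by blast
  thus ?thesis using qt(2) by blast
 qed
 have "betw S x (g a) z" using geo_betw_ends[OF g, of a] bd by simp
 moreover have "g a ~= x" using geo_dist(1)[OF g, of a] a bd geoD(4)[OF g] by auto
 ultimately show ?thesis using same_dirI_betw[of "g a" x n z] cells_betw(2)[OF c0 c] a by simp
qed

end

end

section \<open>Counting directions\<close>

context Q_tree_space
begin

definition dir_class :: "'a => 'a => 'a set" where
 "dir_class x z = {z'. sdir x z z'}"

text \<open>The kind of a direction. In a piece direction the piece is unique, so that its representative in
  \<open>R\<close> is well defined.\<close>
definition dir_inv :: "'a => 'a => 'q metric + 'q qtype set" where
 "dir_inv x z = (if EX P:\<P>. x : P & gate S P z ~= x
   then Inl (SOME Q. Q : R & (EX P:\<P>. x : P & gate S P z ~= x & isometric (submetric S P) Q))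
   else Inr (dir_type x z))"

definition Dirs :: "'a => 'q metric + 'q qtype set => 'a set set" where
 "Dirs x \<kappa> = {\<delta>. EX z:M. z ~= x & \<delta> = dir_class x z & dir_inv x z = \<kappa>}"

definition untouched :: "'a set => 'a => 'q metric + 'q qtype set => 'a set set" where
 "untouched A x \<kappa> = {\<delta> : Dirs x \<kappa>. \<delta> Int A = {}}"

text \<open>A space with one point only has no directions and is excluded.\<close>
definition dir_kinds :: "('q metric + 'q qtype set) set" where
 "dir_kinds = Inl ` {Q : R. EX p:mspace Q. EX q:mspace Q. p ~= q} Un Inr ` type_classes R D"

definition rich :: bool where
 "rich <-> (ALL x:M. ALL \<kappa>:dir_kinds. Dirs x \<kappa> \<approx> (UNIV :: real set))"

lemma dir_class_eq_iff:
 assumes "x : M" "z : M" "z ~= x"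
 shows "dir_class x z = dir_class x z' <-> sdir x z z'"
proof
 assume "dir_class x z = dir_class x z'"
 moreover have "z : dir_class x z" unfolding dir_class_def using same_dir_refl[OF assms] by simp
 ultimately show "sdir x z z'" unfolding dir_class_def using same_dir_sym by blast
next
 assume s: "sdir x z z'"
 show "dir_class x z = dir_class x z'"
  unfolding dir_class_def using same_dir_trans[OF s] same_dir_trans[OF same_dir_sym[OF s]] by blast
qed

lemma dir_inv_piece:
 assumes P: "P : \<P>" "x : P" "gate S P z ~= x" and z: "z : M" and Q: "Q : R" "isometric (submetric S P) Q"
 shows "dir_inv x z = Inl Q"
proof -
 have "(SOME Q. Q : R & (EX P:\<P>. x : P & gate S P z ~= x & isometric (submetric S P) Q)) = Q"
 using P Q piece_dir_unique z isometric_trans isometric_sym Q(2) R_unique Q(1) by blast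
 thus ?thesis unfolding dir_inv_def using P by auto
qed

lemma dir_inv_limit: "limit_dir S \<P> x z ==> dir_inv x z = Inr (dir_type x z)"
 unfolding dir_inv_def limit_dir_def by auto

lemma direction_cases:
 assumes "x : M" "z : M" "z ~= x"
 obtains (limit) "limit_dir S \<P> x z"
 | (piece) P Q where "P : \<P>" "x : P" "gate S P z ~= x" "Q : R" "isometric (submetric S P) Q"
 using assms piece_R unfolding limit_dir_def by metis

lemma dir_inv_same_dir:
 assumes s: "sdir x z z'"
 shows "dir_inv x z = dir_inv x z'"
proof -
 have m: "x : M" "z : M" "z ~= x" "z' : M" "z' ~= x" using same_dir_mem[OF s] by auto
 show ?thesis
 using m(1-3)
 proof (cases rule: direction_cases)
  case limit
  have l': "limit_dir S \<P> x z'" by (rule limit_dir_same_dir[OF limit s])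
  obtain g where g: "geo S g (d x z') x z'" using geodesic_space_geo[OF geodesic_S m(1,4)] by metis
  show ?thesis using dir_type_eq[OF g limit s] dir_type_eq[OF g l' same_dir_refl[OF m(1,4,5)]] dir_inv_limit[OF limit] dir_inv_limit[OF l'] by simp
 next
  case (piece P Q)
  show ?thesis using same_dir_gate_ne[OF same_dir_sym[OF s] piece(1-3)] dir_inv_piece[OF piece(1-3) m(2) piece(4,5)] dir_inv_piece[OF piece(1,2) _ m(4) piece(4,5)] by simp
 qed
qed

lemma dir_inv_kind:
 assumes "x : M" "z : M" "z ~= x"
 shows "dir_inv x z : dir_kinds"
using assms
proof (cases rule: direction_cases)
 case limit
 thus ?thesis unfolding dir_kinds_def using dir_inv_limit dir_type_mem by simp
next
 case (piece P Q)
 obtain f where f: "isometry (submetric S P) Q f" using piece(5) unfolding isometric_def by blast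
 have g: "gate S P z : P" by (rule gate_mem[OF piece(1) assms(2)])
 have "f x ~= f (gate S P z)"
  using isometry_inj[OF f, unfolded mspace_piece[OF piece(1)]] g piece(2,3) unfolding inj_on_def by metis
 hence "Q : {Q : R. EX p:mspace Q. EX q:mspace Q. p ~= q}" using piece(4) isometry_mem[OF f, unfolded mspace_piece[OF piece(1)]] g piece(2) by blast
 thus ?thesis unfolding dir_kinds_def dir_inv_piece[OF piece(1-3) assms(2) piece(4,5)] by blast
qed

lemma Dirs_disjoint:
 assumes "x : M" "\<delta> : Dirs x \<kappa>" "\<delta> : Dirs x \<kappa>'"
 shows "\<kappa> = \<kappa>'"
using assms(2) Dirs_def assms(3) dir_class_eq_iff assms(1) dir_inv_same_dir by auto

lemma Dirs_members_separated:
 assumes "x : M" "\<delta> : Dirs x \<kappa>" "\<delta>' : Dirs x \<kappa>'" "\<delta> ~= \<delta>'" "a : \<delta>" "b : \<delta>'"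
 shows "~ sdir x a b"
proof
 assume s: "sdir x a b"
 obtain z where z: "z : M" "z ~= x" "\<delta> = dir_class x z" using assms(2) unfolding Dirs_def by blast
 obtain z' where z': "z' : M" "z' ~= x" "\<delta>' = dir_class x z'" using assms(3) unfolding Dirs_def by blast
 have "sdir x z a" "sdir x z' b" using assms(5,6) z(3) z'(3) unfolding dir_class_def by auto
 thus False using same_dir_trans s same_dir_sym dir_class_eq_iff[OF assms(1) z(1,2)] z(3) z'(3) assms(4) by meson
qed

lemma Dirs_touched:
 assumes "\<delta> : Dirs x \<kappa>" "a : \<delta>" "x : M"
 shows "\<delta> = dir_class x a" "a : M" "a ~= x" "dir_inv x a = \<kappa>"
proof -
 obtain z where z: "z : M" "z ~= x" "\<delta> = dir_class x z" "dir_inv x z = \<kappa>" using assms(1) unfolding Dirs_def by blast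
 have s: "sdir x z a" using assms(2) z(3) unfolding dir_class_def by simp
 show "a : M" "a ~= x" using same_dir_mem[OF s] by auto
 show "\<delta> = dir_class x a" using dir_class_eq_iff[OF assms(3) z(1,2)] s z(3) by simp
 show "dir_inv x a = \<kappa>" using dir_inv_same_dir[OF s] z(4) by simp
qed

text \<open>A fresh set meets at most two directions at \<open>x\<close>.\<close>
lemma finite_touched:
 assumes fr: "fresh S \<P> A x" and x: "x : M"
 shows "finite (Dirs x \<kappa> - untouched A x \<kappa>)"
proof (rule ccontr)
 assume inf: "infinite (Dirs x \<kappa> - untouched A x \<kappa>)"
 from infinite_arbitrarily_large[OF inf, of 3]
 obtain B where B: "finite B" "card B = 3" "B <= Dirs x \<kappa> - untouched A x \<kappa>" by blast
 obtain \<alpha> \<beta> \<gamma> where abc: "B = {\<alpha>, \<beta>, \<gamma>}" "\<alpha> ~= \<beta>" "\<beta> ~= \<gamma>" "\<alpha> ~= \<gamma>" using B(2) unfolding card_3_iff by blast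
 have rep: "EX a:A. a ~= x & a : \<delta> & \<delta> : Dirs x \<kappa>" if "\<delta> : B" for \<delta>
 using that B(3) untouched_def Dirs_touched(3) x by fastforce
 obtain a where a: "a : A" "a ~= x" "a : \<alpha>" "\<alpha> : Dirs x \<kappa>" using rep[of \<alpha>] abc(1) by blast
 obtain b where b: "b : A" "b ~= x" "b : \<beta>" "\<beta> : Dirs x \<kappa>" using rep[of \<beta>] abc(1) by blast
 obtain c where c: "c : A" "c ~= x" "c : \<gamma>" "\<gamma> : Dirs x \<kappa>" using rep[of \<gamma>] abc(1) by blast
 have "sdir x a b | sdir x a c | sdir x b c"
  using fr a(1,2) b(1,2) c(1,2) unfolding fresh_def by blast
 thus False
  using Dirs_members_separated[OF x a(4) b(4) abc(2) a(3) b(3)] Dirs_members_separated[OF x a(4) c(4) abc(4) a(3) c(3)]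
   Dirs_members_separated[OF x b(4) c(4) abc(3) b(3) c(3)] by blast
qed

lemma Dirs_limit:
 assumes x: "x : M" and \<theta>: "\<theta> : type_classes R D"
 shows "Dirs x (Inr \<theta>) = {C. limit_component_of_type R D S \<P> x \<theta> C}"
proof (intro equalityI subsetI)
 fix \<delta> assume "\<delta> : Dirs x (Inr \<theta>)"
 then obtain z where z: "z : M" "z ~= x" "\<delta> = dir_class x z" "dir_inv x z = Inr \<theta>" unfolding Dirs_def by blast
 have "limit_dir S \<P> x z"
 using x z(1,2)
 proof (cases rule: direction_cases)
  case (piece P Q)
  thus ?thesis using dir_inv_piece[OF piece(1-3) z(1) piece(4,5)] z(4) by simp
 qed
 thus "\<delta> : {C. limit_component_of_type R D S \<P> x \<theta> C}"
  using limit_component_of_type_iff[OF x] dir_inv_limit z(3,4) unfolding dir_class_def by auto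
next
 fix \<delta> assume "\<delta> : {C. limit_component_of_type R D S \<P> x \<theta> C}"
 then obtain y where y: "limit_dir S \<P> x y" "\<delta> = {z. sdir x y z}" "\<theta> = dir_type x y"
  using limit_component_of_type_iff[OF x] by auto
 thus "\<delta> : Dirs x (Inr \<theta>)" unfolding Dirs_def dir_class_def using dir_inv_limit[OF y(1)]
  by (auto simp: limit_dir_def)
qed

lemma piece_at_iff:
 assumes Q: "Q : R" and e: "e : E Q"
 shows "piece_at R E S \<P> Q e x P <-> P : \<P> & x : P & isometric (submetric S P) Q"
proof (cases "P : \<P> & x : P")
 case True
 hence P: "P : \<P>" "x : P" by auto
 have "EX Qi. case Qi of (Q, \<iota>) => Q : R & isometry (submetric S P) Q \<iota> & \<iota> x : E Q"
 proof -
  obtain Q0 f where Q0: "Q0 : R" and f: "isometry (submetric S P) Q0 f"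
   using piece_R[OF P(1)] unfolding isometric_def by blast
  have "f x : mspace Q0" using isometry_mem[OF f, unfolded mspace_piece[OF P(1)], OF P(2)] .
  then obtain g where "isometry Q0 Q0 g" "g (f x) : E Q0" using E_ex[OF Q0] by blast
  thus ?thesis using Q0 isometry_comp[OF f, of Q0 g] by (intro exI[of _ "(Q0, g \<circ> f)"]) simp
 qed
 from someI_ex[OF this] obtain Q1 i where c: "canonical_isometry_point R E S P x = (Q1, i)"
  and i: "Q1 : R" "isometry (submetric S P) Q1 i" "i x : E Q1"
  unfolding canonical_isometry_point_def by (metis (no_types, lifting) case_prodE)
 have pi: "isometric (submetric S P) Q1" unfolding isometric_def using i(2) by blast
 have "piece_at R E S \<P> Q e x P <-> Q1 = Q & i x = e" unfolding piece_at_def c using P by simp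
 also have "\<dots> <-> isometric (submetric S P) Q"
 proof
  assume "isometric (submetric S P) Q"
  hence "isometric Q1 Q" using isometric_trans[OF isometric_sym[OF pi]] by blast
  thus "Q1 = Q & i x = e" using R_unique[OF i(1) Q] E_unique[OF Q _ e] i(3) by simp
 qed (use pi in simp)
 finally show ?thesis using P by simp
qed (auto simp: piece_at_def)

lemma piece_direction_class:
 assumes P: "P : \<P>" "x : P" and z: "z : M" "gate S P z ~= x"
 shows "dir_class x z = {y : M. gate S P y ~= x}"
proof -
 have "sdir x z y <-> y : M & gate S P y ~= x" for y
 using same_dir_gate_ne same_dir_sym P z(2) same_dir_mem same_dirI_piece z(1) by metis
 thus ?thesis unfolding dir_class_def by (intro Collect_cong)
qed

text \<open>A piece through \<open>x\<close> that has another point determines a single direction at \<open>x\<close>,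
  and the piece is recovered from it.\<close>
lemma Dirs_piece:
 assumes x: "x : M" and Q: "Q : R" and nd: "p : mspace Q" "q : mspace Q" "p ~= q"
 shows "{P : \<P>. x : P & isometric (submetric S P) Q} \<approx> Dirs x (Inl Q)"
proof -
 let ?A = "{P : \<P>. x : P & isometric (submetric S P) Q}" and ?f = "%P. {y : M. gate S P y ~= x}"
 have wit: "EX y:P. y ~= x" if P: "P : ?A" for P
 proof -
  have PP: "P : \<P>" using P by blast
  obtain f where f: "isometry (submetric S P) Q f" using P unfolding isometric_def by blast
  obtain u v where "u : P" "v : P" "f u = p" "f v = q" using isometry_image[OF f] mspace_piece[OF PP] nd by (metis imageE)
  thus ?thesis using nd(3) by metis
 qed
 have img: "?f P : Dirs x (Inl Q)" if P: "P : ?A" for P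
 proof -
  have PP: "P : \<P>" "x : P" "isometric (submetric S P) Q" using P by auto
  obtain y where y: "y : P" "y ~= x" using wit[OF P] by blast
  have yM: "y : M" and gy: "gate S P y ~= x" using piece_mem[OF PP(1) y(1)] gate_self[OF PP(1) y(1)] y(2) by auto
  have "?f P = dir_class x y" using piece_direction_class[OF PP(1,2) yM gy] by simp
  thus ?thesis unfolding Dirs_def using yM y(2) dir_inv_piece[OF PP(1,2) gy yM Q PP(3)] by blast
 qed
 have "bij_betw ?f ?A (Dirs x (Inl Q))"
 proof (rule bij_betw_imageI)
  show "inj_on ?f ?A"
  proof (rule inj_onI)
   fix P P' assume P: "P : ?A" and P': "P' : ?A" and eq: "?f P = ?f P'"
   obtain y where y: "y : P" "y ~= x" using wit[OF P] by blast
   have PP: "P : \<P>" "x : P" and PP': "P' : \<P>" "x : P'" using P P' by auto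
   have yM: "y : M" and gy: "gate S P y ~= x" using piece_mem[OF PP(1) y(1)] gate_self[OF PP(1) y(1)] y(2) by auto
   hence "y : ?f P'" using eq by blast
   thus "P = P'" using piece_dir_unique[OF PP gy PP' _ yM] by blast
  qed
  show "?f ` ?A = Dirs x (Inl Q)"
  proof (intro equalityI subsetI)
   fix \<delta> assume "\<delta> : ?f ` ?A" thus "\<delta> : Dirs x (Inl Q)" using img by blast
  next
   fix \<delta> assume "\<delta> : Dirs x (Inl Q)"
   then obtain z where z: "z : M" "z ~= x" "\<delta> = dir_class x z" "dir_inv x z = Inl Q" unfolding Dirs_def by blast
   show "\<delta> : ?f ` ?A"
   using x z(1,2)
 proof (cases rule: direction_cases)
    case limit
    thus ?thesis using dir_inv_limit z(4) by simp
   next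
    case (piece P Q')
    have "P : ?A" using dir_inv_piece[OF piece(1-3) z(1) piece(4,5)] z(4) piece by simp
    thus ?thesis using piece_direction_class[OF piece(1,2) z(1) piece(3)] z(3) by blast
   qed
  qed
 qed
 thus ?thesis unfolding eqpoll_def by blast
qed

text \<open>Limit components of type \<open>\<theta>\<close> are the directions of kind \<open>Inr \<theta>\<close>;
  pieces isometric to \<open>Q\<close> correspond to the directions of kind \<open>Inl Q\<close>, and by
  homogeneity each of them is a \<open>(Q, e)\<close>-piece for the only point \<open>e\<close> of
  \<open>E Q\<close>.\<close>
theorem universal_iff_rich:
 "universal_Q_tree \<Q> R D E S \<P> <-> Q_tree \<Q> S \<P> & mcomplete_of S & rich"
proof -
 have lim: "(ALL s:M. ALL \<theta>:type_classes R D. {C. limit_component_of_type R D S \<P> s \<theta> C} \<approx> (UNIV :: real set)) <->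
  (ALL s:M. ALL \<theta>:type_classes R D. Dirs s (Inr \<theta>) \<approx> (UNIV :: real set))"
  using Dirs_limit by (intro ball_cong refl) simp
 have pc: "(ALL s:M. ALL Q:R. (\<nexists>z. mspace Q = {z}) --> (ALL x:E Q. {P. piece_at R E S \<P> Q x s P} \<approx> (UNIV :: real set))) <->
  (ALL s:M. ALL Q:{Q : R. EX p:mspace Q. EX q:mspace Q. p ~= q}. Dirs s (Inl Q) \<approx> (UNIV :: real set))" (is "?L <-> ?R")
 proof
  assume L: ?L
  show ?R
  proof (intro ballI)
   fix s Q assume s: "s : M" and "Q : {Q : R. EX p:mspace Q. EX q:mspace Q. p ~= q}"
   then obtain p q where Q: "Q : R" "p : mspace Q" "q : mspace Q" "p ~= q" by blast
   obtain e where e: "e : E Q" using E_ex[OF Q(1,2)] by blast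
   have "{P. piece_at R E S \<P> Q e s P} \<approx> (UNIV :: real set)" using Q L s Q(1) e by fastforce
   moreover have "{P. piece_at R E S \<P> Q e s P} = {P : \<P>. s : P & isometric (submetric S P) Q}"
    using piece_at_iff[OF Q(1) e] by simp
   ultimately show "Dirs s (Inl Q) \<approx> (UNIV :: real set)"
    using Dirs_piece[OF s Q] eqpoll_trans eqpoll_sym by metis
  qed
 next
  assume R: ?R
  show ?L
  proof (intro ballI impI)
   fix s Q e assume s: "s : M" and Q: "Q : R" "\<nexists>z. mspace Q = {z}" and e: "e : E Q"
   obtain q where q: "e : mspace Q" "q : mspace Q" "e ~= q" using E_mem[OF Q(1) e] Q(2) by blast
   hence "Dirs s (Inl Q) \<approx> (UNIV :: real set)" using R s Q(1) by blast
   thus "{P. piece_at R E S \<P> Q e s P} \<approx> (UNIV :: real set)" using Dirs_piece[OF s Q(1) q] eqpoll_trans piece_at_iff[OF Q(1) e] by auto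
  qed
 qed
 have rich_eq: "rich <-> (ALL s:M. ALL Q:{Q : R. EX p:mspace Q. EX q:mspace Q. p ~= q}. Dirs s (Inl Q) \<approx> (UNIV :: real set)) &
  (ALL s:M. ALL \<theta>:type_classes R D. Dirs s (Inr \<theta>) \<approx> (UNIV :: real set))"
  unfolding rich_def dir_kinds_def by (simp only: ball_Un ball_simps(9) ball_conj_distrib)
 show ?thesis unfolding universal_Q_tree_def lim pc rich_eq
  by (intro iffI; elim conjE; intro conjI; assumption)
qed

text \<open>Directions are disjoint non-empty sets of points.\<close>
lemma Dirs_lepoll:
 assumes c: "M \<lesssim> (UNIV :: real set)" and x: "x : M"
 shows "Dirs x \<kappa> \<lesssim> (UNIV :: real set)"
proof -
 have "Dirs x \<kappa> <= dir_class x ` M" unfolding Dirs_def by blast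
 hence "Dirs x \<kappa> \<lesssim> M" by (rule subset_image_lepoll)
 thus ?thesis using c by (rule lepoll_trans)
qed

end

lemma Q_tree_space_of_Q_tree:
 assumes "Q_choices \<Q> R D E" "Q_tree \<Q> S \<P>"
 shows "Q_tree_space S \<P> \<Q> R D E"
proof -
 interpret Q_choices \<Q> R D E by (rule assms(1))
 show ?thesis by unfold_locales (use assms(2) in \<open>auto simp: Q_tree_def\<close>)
qed

lemma eqpoll_diff_finite:
 assumes "A \<approx> (UNIV :: real set)" "finite B"
 shows "A - B \<approx> (UNIV :: real set)"
 using assms(2)
proof (induction B rule: finite_induct)
 case empty
 thus ?case using assms(1) by simp
next
 case (insert b B)
 let ?C = "A - B"
 have e: "A - insert b B = ?C - {b}" by blast
 show ?case
 proof (cases "b : ?C")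
  case True
  have "infinite (?C - {b})" using insert.IH eqpoll_finite_iff infinite_UNIV_char_0 by auto
  from infinite_insert_eqpoll[OF this, of b] have "?C \<approx> ?C - {b}" using True by (simp add: insert_absorb)
  thus ?thesis unfolding e using insert.IH eqpoll_sym eqpoll_trans by metis
 next
  case False
  thus ?thesis unfolding e using insert.IH by simp
 qed
qed

section \<open>Partial isometries between two trees\<close>

text \<open>Partial isometries are treated as graphs, since Zorn's lemma is applied to them ordered by inclusion.\<close>
definition iso_graph :: "'a metric => 'b metric => ('a \<times> 'b) set => bool" where
 "iso_graph S T G <-> G <= mspace S \<times> mspace T &
   (ALL x y x' y'. (x, y) : G --> (x', y') : G --> mdist S x x' = mdist T y y')"

lemma iso_graphD:
 assumes "iso_graph S T G"
 shows "(x, y) : G ==> x : mspace S & y : mspace T"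
  "(x, y) : G ==> (x', y') : G ==> mdist S x x' = mdist T y y'"
  "(x, y) : G ==> (x', y') : G ==> x = x' <-> y = y'"
proof -
 show 1: "(x, y) : G ==> x : mspace S & y : mspace T" for x y using assms unfolding iso_graph_def by blast
 show 2: "(x, y) : G ==> (x', y') : G ==> mdist S x x' = mdist T y y'" for x y x' y'
  using assms unfolding iso_graph_def by simp
 show "(x, y) : G ==> (x', y') : G ==> x = x' <-> y = y'"
 proof -
  assume g: "(x, y) : G" "(x', y') : G"
  show "x = x' <-> y = y'" using 1[OF g(1)] 1[OF g(2)] 2[OF g] by auto
 qed
qed

lemma iso_graphI:
 assumes "!!x y. (x, y) : G ==> x : mspace S & y : mspace T"
  and "!!x y x' y'. (x, y) : G ==> (x', y') : G ==> mdist S x x' = mdist T y y'"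
 shows "iso_graph S T G"
 unfolding iso_graph_def
using assms(1) assms(2) by auto

lemma full_mono: "full S \<P> A x ==> A <= B ==> full S \<P> B x"
 unfolding full_def by blast

locale two_Q_trees = S: Q_tree_space S \<P> \<Q> R D E + T: Q_tree_space T \<P>' \<Q> R D E
 for S :: "'a metric" and \<P> :: "'a set set" and T :: "'b metric" and \<P>' :: "'b set set"
  and \<Q> R :: "'q metric set" and D :: "'q metric => ('q \<times> 'q) set" and E :: "'q metric => 'q set"
begin

text \<open>This is what gets glued to a partial isometry at \<open>(x, y)\<close>; it stays in the directions of
  \<open>z\<close> and \<open>z'\<close>, and its other points are fresh so that they can be treated later.\<close>
definition branch :: "'a => 'b => 'a => 'b => ('a \<times> 'b) set => bool" where
 "branch x y z z' N <-> iso_graph S T N & (x, y) : N & subtree S \<P> (Domain N) & subtree T \<P>' (Range N) &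
   (ALL n:Domain N. n ~= x --> S.sdir x z n) & (ALL n:Range N. n ~= y --> T.sdir y z' n) &
   (EX n:Domain N. n ~= x) &
   (ALL (w, w'):N. w ~= x --> fresh S \<P> (Domain N) w & fresh T \<P>' (Range N) w')"

text \<open>The two pieces have a common representative \<open>Q\<close>, and an isometry between them can be made to
  send \<open>x\<close> to \<open>y\<close> because \<open>Q\<close> is homogeneous.\<close>
lemma branch_piece:
 assumes P: "P : \<P>" "x : P" "gate S P z ~= x" "z : S.M"
  and P': "P' : \<P>'" "y : P'" "gate T P' z' ~= y" "z' : T.M"
  and Q: "Q : R" "isometric (submetric S P) Q" "isometric (submetric T P') Q"
 shows "EX N. branch x y z z' N"
proof -
 note mP = S.mspace_piece[OF P(1)] and mP' = T.mspace_piece[OF P'(1)]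
 obtain i where i: "isometry (submetric S P) Q i" using Q(2) unfolding isometric_def by blast
 obtain j where j: "isometry (submetric T P') Q j" using Q(3) unfolding isometric_def by blast
 obtain g where g: "isometry Q Q g" "g (i x) = j y" using isometry_mem[OF i, unfolded mP, OF P(2)] isometry_mem[OF j, unfolded mP', OF P'(2)] S.homogeneous_R[OF Q(1)] by metis
 let ?h = "inv_into P' j \<circ> (g \<circ> i)"
 have h: "isometry (submetric S P) (submetric T P') ?h"
  using isometry_comp[OF isometry_comp[OF i g(1)] isometry_inv[OF j]] unfolding mP' .
 have hx: "?h x = y" using g(2) isometry_inv_apply[OF j, unfolded mP', OF P'(2)] by simp
 have him: "?h ` P = P'" using isometry_image[OF h] unfolding mP mP' .
 have hd: "T.d (?h p) (?h q) = S.d p q" if "p : P" "q : P" for p q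
  using isometry_dist[OF h, unfolded mP, OF that] by simp
 let ?N = "(%p. (p, ?h p)) ` P"
 have dom: "Domain ?N = P" by (simp add: Domain_fst image_image)
 have "Range ?N = ?h ` P" unfolding Range_snd image_image by simp
 hence ran: "Range ?N = P'" unfolding him .
 have xM: "x : S.M" and yM: "y : T.M" using S.piece_mem P T.piece_mem P' by auto
 have "branch x y z z' ?N"
  unfolding branch_def dom ran
 proof (intro conjI ballI impI)
  show "iso_graph S T ?N"
  proof (rule iso_graphI)
   fix a b assume "(a, b) : ?N"
   hence "a : P" "b : P'" using him by auto
   thus "a : S.M & b : T.M" using S.piece_mem[OF P(1)] T.piece_mem[OF P'(1)] by blast
  next
   fix a b a' b' assume "(a, b) : ?N" "(a', b') : ?N"
   hence "a : P" "a' : P" "b = ?h a" "b' = ?h a'" by auto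
   thus "S.d a a' = T.d b b'" using hd by simp
  qed
  show "(x, y) : ?N" by (rule image_eqI[OF _ P(2)]) (use hx in simp)
  show "subtree S \<P> P" by (rule S.subtree_piece[OF P(1)])
  show "subtree T \<P>' P'" by (rule T.subtree_piece[OF P'(1)])
  show "S.sdir x z n" if n: "n : P" "n ~= x" for n
   by (rule S.same_dirI_piece[OF P(1,2,4) S.piece_mem[OF P(1) n(1)] P(3)]) (use S.gate_self[OF P(1) n(1)] n in simp)
  show "T.sdir y z' n" if n: "n : P'" "n ~= y" for n
   by (rule T.same_dirI_piece[OF P'(1,2,4) T.piece_mem[OF P'(1) n(1)] P'(3)]) (use T.gate_self[OF P'(1) n(1)] n in simp)
  show "EX n:P. n ~= x" using S.gate_mem[OF P(1,4)] P(3) by blast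
  fix p assume "p : ?N"
  then obtain w where w: "p = (w, ?h w)" "w : P" by blast
  show "case p of (w, w') => w ~= x --> fresh S \<P> P w & fresh T \<P>' P' w'"
   unfolding w(1) prod.case
  proof (intro impI conjI)
   assume wx: "w ~= x"
   show "fresh S \<P> P w"
   proof (rule S.fresh_if_one_dir[of _ _ x x])
    fix a assume "a : P" "a ~= w"
    hence "S.sdir w a x"
     using S.same_dirI_piece[OF P(1) w(2) S.piece_mem[OF P(1)] xM] S.gate_self[OF P(1)] P(2) wx by auto
    thus "S.sdir w a x | S.sdir w a x" by simp
   qed
   have w'P: "?h w : P'" using him w(2) by blast
   have "inj_on ?h P" using isometry_inj[OF h] unfolding mP .
   hence w'y: "y ~= ?h w" using hx wx w(2) P(2) unfolding inj_on_def by metis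
   show "fresh T \<P>' P' (?h w)"
   proof (rule T.fresh_if_one_dir[of _ _ y y])
    fix a assume a: "a : P'" "a ~= ?h w"
    have "T.sdir (?h w) a y"
     by (rule T.same_dirI_piece[OF P'(1) w'P T.piece_mem[OF P'(1) a(1)] yM])
      (use T.gate_self[OF P'(1) a(1)] T.gate_self[OF P'(1,2)] a(2) w'y in metis)+
    thus "T.sdir (?h w) a y | T.sdir (?h w) a y" by simp
   qed
  qed
 qed
 thus ?thesis by blast
qed

text \<open>Equal entries of two types give an isometry of the crossed pieces that respects the entry and the exit
  point.\<close>
lemma matching_isometry:
 assumes P: "P : \<P>" "u : P" "v : P" "pair_data R D S P u v Q p q"
  and P': "P' : \<P>'" "u' : P'" "v' : P'" "pair_data R D T P' u' v' Q p q"
 shows "EX h. isometry (submetric S P) (submetric T P') h & h u = u' & h v = v'"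
proof -
 note mP' = T.mspace_piece[OF P'(1)]
 obtain i where i: "isometry (submetric S P) Q i" "i u = p" "i v = q" using P(4) unfolding pair_data_def by blast
 obtain j where j: "isometry (submetric T P') Q j" "j u' = p" "j v' = q" using P'(4) unfolding pair_data_def by blast
 let ?h = "inv_into P' j \<circ> i"
 have "isometry (submetric S P) (submetric T P') ?h" using isometry_comp[OF i(1) isometry_inv[OF j(1)]] unfolding mP' .
 moreover have "?h u = u'" "?h v = v'"
  using isometry_inv_apply[OF j(1), unfolded mP', OF P'(2)] isometry_inv_apply[OF j(1), unfolded mP', OF P'(3)] i j by simp_all
 ultimately show ?thesis by blast
qed

text \<open>On each crossed piece take an isometry to the piece crossed at the same time by the other geodesic, and send
  the remaining points of one geodesic to those of the other. The formula for distances between cells is the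
  same on both sides, so this is an isometry of the hulls.\<close>
lemma branch_geodesic:
 assumes g: "geo S g l x z" and g': "geo T g' l y z'"
  and lim: "limit_dir S \<P> x z" and lim': "limit_dir T \<P>' y z'"
  and eq: "S.gtype g l = T.gtype g' l"
 shows "EX N. branch x y z z' N"
proof -
 let ?U = "fst (S.gtype g l)" and ?U' = "fst (T.gtype g' l)"
 have match: "EX P':\<P>'. cut_out_by g' l a b P' & (EX h. isometry (submetric S P) (submetric T P') h & h (g a) = g' a & h (g b) = g' b)"
  if P: "P : \<P>" "cut_out_by g l a b P" for P a b
 proof -
  note cp = S.cut_out_by_piece[OF g P]
  obtain Q p q where f: "snd (S.gtype g l) (a, b) = Some (Q, p, q)"
   using S.type_dom[OF g] P by (metis domD prod_cases3)
  obtain P1 where P1: "P1 : \<P>" "cut_out_by g l a b P1" "pair_data R D S P1 (g a) (g b) Q p q"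
   using S.type_iff[OF g] f by metis
  have pd: "pair_data R D S P (g a) (g b) Q p q" using S.cut_out_by_unique[OF g P1(1,2) P] P1 by simp
  obtain P' where P': "P' : \<P>'" "cut_out_by g' l a b P'" "pair_data R D T P' (g' a) (g' b) Q p q"
   using T.type_iff[OF g'] f eq by metis
  note cp' = T.cut_out_by_piece[OF g' P'(1,2)]
  show ?thesis using matching_isometry[OF P(1) cp(1,2) pd P'(1) cp'(1,2) P'(3)] P' by blast
 qed
 have dom_eq: "(EX P:\<P>. cut_out_by g l a b P) <-> (EX P':\<P>'. cut_out_by g' l a b P')" for a b
  using S.type_dom[OF g, of a b] T.type_dom[OF g', of a b] eq by simp
 define H where "H a b = (SOME h. EX P:\<P>. EX P':\<P>'. cut_out_by g l a b P & cut_out_by g' l a b P' &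
   isometry (submetric S P) (submetric T P') h & h (g a) = g' a & h (g b) = g' b)" for a b
 have H: "isometry (submetric S P) (submetric T P') (H a b) & H a b (g a) = g' a & H a b (g b) = g' b"
  if P: "P : \<P>" "cut_out_by g l a b P" and P': "P' : \<P>'" "cut_out_by g' l a b P'" for P P' a b
 proof -
  have "EX h. EX P:\<P>. EX P':\<P>'. cut_out_by g l a b P & cut_out_by g' l a b P' &
   isometry (submetric S P) (submetric T P') h & h (g a) = g' a & h (g b) = g' b" using match[OF P] P by blast
  from someI_ex[OF this] obtain P1 P1' where 1: "P1 : \<P>" "P1' : \<P>'" "cut_out_by g l a b P1" "cut_out_by g' l a b P1'"
   "isometry (submetric S P1) (submetric T P1') (H a b)" "H a b (g a) = g' a" "H a b (g b) = g' b"
   unfolding H_def by blast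
  show ?thesis using S.cut_out_by_unique[OF g 1(1,3) P] T.cut_out_by_unique[OF g' 1(2,4) P'] 1 by simp
 qed
 define C where "C a b n n' <-> (a = b & 0 <= a & a <= l & a ~: ?U & n = g a & n' = g' a) |
   (EX P:\<P>. EX P':\<P>'. cut_out_by g l a b P & cut_out_by g' l a b P' & n : P & n' = H a b n)" for a b n n'
 have Hmem: "H a b n : P'" if "P : \<P>" "cut_out_by g l a b P" "P' : \<P>'" "cut_out_by g' l a b P'" "n : P" for P P' a b n
  using isometry_mem[OF H[OF that(1-4), THEN conjunct1], unfolded S.mspace_piece[OF that(1)] T.mspace_piece[OF that(3)], OF that(5)] .
 have cell: "S.cell g l a b n" "T.cell g' l a b n'" if c: "C a b n n'" for a b n n'
 proof -
  show "S.cell g l a b n" using c unfolding C_def S.cell_def by blast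
  show "T.cell g' l a b n'"
  proof (cases "a = b & 0 <= a & a <= l & a ~: ?U & n = g a & n' = g' a")
   case True
   thus ?thesis unfolding T.cell_def eq by blast
  next
   case False
   then obtain P P' where "P : \<P>" "P' : \<P>'" "cut_out_by g l a b P" "cut_out_by g' l a b P'" "n : P" "n' = H a b n"
    using c unfolding C_def by blast
   thus ?thesis unfolding T.cell_def using Hmem by blast
  qed
 qed
 have ends: "S.d n (g a) = T.d n' (g' a)" "S.d n (g b) = T.d n' (g' b)" if c: "C a b n n'" for a b n n'
 proof -
  have "S.d n (g a) = T.d n' (g' a) & S.d n (g b) = T.d n' (g' b)"
  proof (cases "a = b & 0 <= a & a <= l & a ~: ?U & n = g a & n' = g' a")
   case True
   thus ?thesis using geoD(7)[OF g, of a] geoD(7)[OF g', of a] by simp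
  next
   case False
   then obtain P P' where P: "P : \<P>" "P' : \<P>'" "cut_out_by g l a b P" "cut_out_by g' l a b P'" "n : P" "n' = H a b n"
    using c unfolding C_def by blast
   note h = H[OF P(1,3,2,4)] and cp = S.cut_out_by_piece[OF g P(1,3)]
   note hd = isometry_dist[OF h[THEN conjunct1], unfolded S.mspace_piece[OF P(1)] mdist_submetric, OF P(5)]
   show ?thesis using hd[OF cp(1)] hd[OF cp(2)] h P(6) by simp
  qed
  thus "S.d n (g a) = T.d n' (g' a)" "S.d n (g b) = T.d n' (g' b)" by auto
 qed
 have ordered: "S.d n m = T.d n' m'" if c: "C a b n n'" "C a' b' m m'" and le: "b <= a'" for a b a' b' n n' m m'
  using S.cells_dist[OF g cell(1)[OF c(1)] cell(1)[OF c(2)] le] T.cells_dist[OF g' cell(2)[OF c(1)] cell(2)[OF c(2)] le]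
   ends(2)[OF c(1)] ends(1)[OF c(2)] mdist_commute[of S m "g a'"] mdist_commute[of T m' "g' a'"] by linarith
 define N where "N = {(n, n'). EX a b. C a b n n'}"
 have iso: "iso_graph S T N"
 proof (rule iso_graphI)
  fix n n' assume "(n, n') : N"
  then obtain a b where "C a b n n'" unfolding N_def by blast
  from cell[OF this] show "n : S.M & n' : T.M" using S.cell_mem[OF g] T.cell_mem[OF g'] by blast
 next
  fix n n' m m' assume "(n, n') : N" "(m, m') : N"
  then obtain a b a' b' where c: "C a b n n'" "C a' b' m m'" unfolding N_def by blast
  consider "a = a' & b = b'" | "b <= a'" | "b' <= a" using S.cells_order[OF g cell(1)[OF c(1)] cell(1)[OF c(2)]] by blast
  thus "S.d n m = T.d n' m'"
  proof cases
   case 1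
   show ?thesis
   proof (cases "a = b")
    case True
    hence "~ cut_out_by g l a b P" for P unfolding cut_out_by_def by simp
    hence "n = g a" "m = g a" "n' = g' a" "m' = g' a" "0 <= a" "a <= l" using c 1 unfolding C_def by auto
    thus ?thesis using geoD(7)[OF g, of a] geoD(7)[OF g', of a] by simp
   next
    case False
    obtain P P' where P: "P : \<P>" "P' : \<P>'" "cut_out_by g l a b P" "cut_out_by g' l a b P'" "n : P" "n' = H a b n"
     using c(1) False unfolding C_def by blast
    obtain P1 where P1: "P1 : \<P>" "cut_out_by g l a b P1" "m : P1" "m' = H a b m"
     using c(2) False 1 unfolding C_def by blast
    have "m : P" using S.cut_out_by_unique[OF g P1(1,2) P(1,3)] P1(3) by simp
    from isometry_dist[OF H[OF P(1,3,2,4), THEN conjunct1], unfolded S.mspace_piece[OF P(1)] mdist_submetric, OF P(5) this]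
    show ?thesis using P(6) P1(4) by simp
   qed
  next
   case 2
   thus ?thesis by (rule ordered[OF c])
  next
   case 3
   hence "S.d m n = T.d m' n'" by (rule ordered[OF c(2,1)])
   thus ?thesis using mdist_commute[of S m n] mdist_commute[of T m' n'] by simp
  qed
 qed
 have dom: "Domain N = S.hull_of g l"
 proof (intro equalityI subsetI)
  fix n assume "n : Domain N"
  thus "n : S.hull_of g l" unfolding N_def S.hull_of_def using cell(1) by blast
 next
  fix n assume "n : S.hull_of g l"
  then obtain a b where c: "S.cell g l a b n" unfolding S.hull_of_def by blast
  have "EX n'. C a b n n'"
  proof (cases "a = b & 0 <= a & a <= l & a ~: ?U & n = g a")
   case True
   thus ?thesis unfolding C_def by blast
  next
   case False
   then obtain P where P: "P : \<P>" "cut_out_by g l a b P" "n : P" using c unfolding S.cell_def by blast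
   then obtain P' where "P' : \<P>'" "cut_out_by g' l a b P'" using dom_eq by blast
   thus ?thesis unfolding C_def using P by blast
  qed
  thus "n : Domain N" unfolding N_def by blast
 qed
 have ran: "Range N = T.hull_of g' l"
 proof (intro equalityI subsetI)
  fix n assume "n : Range N"
  thus "n : T.hull_of g' l" unfolding N_def T.hull_of_def using cell(2) by blast
 next
  fix n' assume "n' : T.hull_of g' l"
  then obtain a b where c: "T.cell g' l a b n'" unfolding T.hull_of_def by blast
  have "EX n. C a b n n'"
  proof (cases "a = b & 0 <= a & a <= l & a ~: ?U' & n' = g' a")
   case True
   thus ?thesis unfolding C_def eq by blast
  next
   case False
   then obtain P' where P': "P' : \<P>'" "cut_out_by g' l a b P'" "n' : P'" using c unfolding T.cell_def by blast
   then obtain P where P: "P : \<P>" "cut_out_by g l a b P" using dom_eq by blast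
   have "H a b ` P = P'"
    using isometry_image[OF H[OF P P'(1,2), THEN conjunct1]] unfolding S.mspace_piece[OF P(1)] T.mspace_piece[OF P'(1)] .
   then obtain n where "n : P" "n' = H a b n" using P'(3) by blast
   thus ?thesis unfolding C_def using P P' by blast
  qed
  thus "n' : Range N" unfolding N_def by blast
 qed
 have l: "0 < l" using geoD(1-3)[OF g] lim unfolding limit_dir_def by (metis less_eq_real_def)
 have zero: "0 ~: ?U"
 proof
  assume "0 : ?U"
  then obtain P a b where "cut_out_by g l a b P" "a < 0" unfolding S.fst_type_iff[OF g] by blast
  thus False unfolding cut_out_by_def by simp
 qed
 have "branch x y z z' N"
  unfolding branch_def dom ran
 proof (intro conjI ballI impI)
  show "iso_graph S T N" by (rule iso)
  have "C 0 0 x y" unfolding C_def using l zero geoD(2)[OF g] geoD(2)[OF g'] by simp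
  thus xy: "(x, y) : N" unfolding N_def by blast
  show "subtree S \<P> (S.hull_of g l)" by (rule S.hull_subtree[OF g])
  show "subtree T \<P>' (T.hull_of g' l)" by (rule T.hull_subtree[OF g'])
  show "S.sdir x z n" if "n : S.hull_of g l" "n ~= x" for n
   by (rule S.same_dir_sym[OF S.hull_direction[OF g lim that]])
  show "T.sdir y z' n" if "n : T.hull_of g' l" "n ~= y" for n
   by (rule T.same_dir_sym[OF T.hull_direction[OF g' lim' that]])
  have "S.cell g l l l z"
   unfolding S.cell_def using l S.end_not_in_type[OF g] geoD(3)[OF g] by simp
  thus "EX n:S.hull_of g l. n ~= x" unfolding S.hull_of_def using lim unfolding limit_dir_def by blast
  fix p assume p: "p : N"
  obtain w w' where pw: "p = (w, w')" by fastforce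
  show "case p of (w, w') => w ~= x --> fresh S \<P> (S.hull_of g l) w & fresh T \<P>' (T.hull_of g' l) w'"
   unfolding pw prod.case
  proof (intro impI conjI)
   assume wx: "w ~= x"
   have "w : Domain N" "w' : Range N" using p pw by auto
   hence w: "w : S.hull_of g l" "w' : T.hull_of g' l" unfolding dom ran by auto
   have "w' ~= y" using iso_graphD(3)[OF iso, of w w' x y] p pw xy wx by simp
   thus "fresh T \<P>' (T.hull_of g' l) w'" by (rule T.hull_fresh[OF g' w(2)])
   show "fresh S \<P> (S.hull_of g l) w" by (rule S.hull_fresh[OF g w(1) wx])
  qed
 qed
 thus ?thesis by blast
qed

text \<open>The time \<open>r\<close> that the equivalence supplies may exceed the lengths. The end of a geodesic is not
  inside a crossing, and below \<open>r\<close> the two types have the same free times, so the smallest of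
  \<open>r\<close> and the two lengths will do.\<close>
lemma common_initial_type:
 assumes g: "geo S g l x z" and g': "geo T g' k y z'" and pos: "0 < l" "0 < k"
  and eqv: "(S.gtype g l, T.gtype g' k) : equivalent_types R D"
 shows "EX r. 0 < r & r <= l & r <= k & S.gtype g r = T.gtype g' r"
proof -
 let ?\<tau> = "S.gtype g l" and ?\<tau>' = "T.gtype g' k"
 obtain r where r: "r > 0" "r ~: fst ?\<tau>" "r ~: fst ?\<tau>'" and ini: "initial_subtype r ?\<tau> = initial_subtype r ?\<tau>'"
  using eqv unfolding equivalent_types_def by auto
 have fi: "fst ?\<tau> Int {0<..<r} = fst ?\<tau>' Int {0<..<r}"
  using ini unfolding initial_subtype_def by (auto split: prod.splits)
 let ?r = "min r (min l k)"
 have lU: "l ~: fst ?\<tau>" by (rule S.end_not_in_type[OF g])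
 have kU: "k ~: fst ?\<tau>'" by (rule T.end_not_in_type[OF g'])
 have trans: "s ~: fst ?\<tau>" "s ~: fst ?\<tau>'" if s: "0 < s" "s < r" "s ~: fst ?\<tau> | s ~: fst ?\<tau>'" for s
 proof -
  show "s ~: fst ?\<tau>" "s ~: fst ?\<tau>'" using fi s(1,2) set_eq_iff s(3) by (auto simp: set_eq_iff)
 qed
 have "?r = r | (?r < r & (?r = l | ?r = k))" by linarith
 hence nU: "?r ~: fst ?\<tau> & ?r ~: fst ?\<tau>'"
 using r trans lU pos kU by metis
 have rr: "0 < ?r" "?r <= l" "?r <= k" "?r <= r" using r pos by auto
 have "S.gtype g ?r = initial_subtype ?r ?\<tau>" by (rule S.type_restrict[OF g rr(1,2)]) (use nU in blast)
 also have "\<dots> = initial_subtype ?r (initial_subtype r ?\<tau>)" by (rule equiv_types_of_map[OF rr(4), symmetric])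
 also have "\<dots> = initial_subtype ?r ?\<tau>'" unfolding ini by (rule equiv_types_of_map[OF rr(4)])
 also have "\<dots> = T.gtype g' ?r" by (rule T.type_restrict[OF g' rr(1,3), symmetric]) (use nU in blast)
 finally have e: "S.gtype g ?r = T.gtype g' ?r" .
 show ?thesis by (intro exI[of _ ?r] conjI rr(1-3) e)
qed

lemma branch_change:
 assumes b: "branch x y u u' N" and s: "S.sdir x z u" "T.sdir y z' u'"
 shows "branch x y z z' N"
proof -
 have "ALL n:Domain N. n ~= x --> S.sdir x u n" "ALL n:Range N. n ~= y --> T.sdir y u' n"
  using b unfolding branch_def by simp_all
 hence "ALL n:Domain N. n ~= x --> S.sdir x z n" "ALL n:Range N. n ~= y --> T.sdir y z' n"
  using S.same_dir_trans[OF s(1)] T.same_dir_trans[OF s(2)] by blast+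
 thus ?thesis using b unfolding branch_def by simp
qed

lemma branch_exists:
 assumes x: "x : S.M" "z : S.M" "z ~= x" and y: "y : T.M" "z' : T.M" "z' ~= y"
  and inv: "S.dir_inv x z = T.dir_inv y z'"
 shows "EX N. branch x y z z' N"
 using x
proof (cases rule: S.direction_cases)
 case (piece P Q)
 have i: "S.dir_inv x z = Inl Q" by (rule S.dir_inv_piece[OF piece(1-3) x(2) piece(4,5)])
 from y show ?thesis
 proof (cases rule: T.direction_cases)
  case limit
  thus ?thesis using T.dir_inv_limit inv i by simp
 next
  case (piece P' Q')
  show ?thesis using T.dir_inv_piece[OF piece(1-3) y(2) piece(4,5)] inv i branch_piece[OF \<open>P : \<P>\<close> \<open>x : P\<close> \<open>gate S P z ~= x\<close> x(2) piece(1-3) y(2) \<open>Q : R\<close>] \<open>isometric (submetric S P) Q\<close> piece(5) by simp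
 qed
next
 case limit
 have i: "S.dir_inv x z = Inr (S.dir_type x z)" by (rule S.dir_inv_limit[OF limit])
 from y show ?thesis
 proof (cases rule: T.direction_cases)
  case (piece P' Q')
  thus ?thesis using T.dir_inv_piece[OF piece(1-3) y(2) piece(4,5)] inv i by simp
 next
  case lim': limit
  obtain g where g: "geo S g (S.d x z) x z" using geodesic_space_geo[OF S.geodesic_S x(1,2)] by metis
  obtain g' where g': "geo T g' (T.d y z') y z'" using geodesic_space_geo[OF T.geodesic_S y(1,2)] by metis
  have t: "S.gtype g (S.d x z) : Q_types R D" "T.gtype g' (T.d y z') : Q_types R D"
   by (rule S.limit_type_in_Q_types[OF g limit], rule T.limit_type_in_Q_types[OF g' lim'])
  have "equivalent_types R D `` {S.gtype g (S.d x z)} = equivalent_types R D `` {T.gtype g' (T.d y z')}" using S.dir_type_eq[OF g limit S.same_dir_refl[OF x]] T.dir_type_eq[OF g' lim' T.same_dir_refl[OF y]] i inv T.dir_inv_limit[OF lim'] by simp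
  hence eqv: "(S.gtype g (S.d x z), T.gtype g' (T.d y z')) : equivalent_types R D"
   by (rule iffD1[OF eq_equiv_class_iff[OF equiv_types t]])
  have pos: "0 < S.d x z" "0 < T.d y z'"
   by (rule mdist_pos[OF x(1,2) x(3)[symmetric]], rule mdist_pos[OF y(1,2) y(3)[symmetric]])
  obtain r where r: "0 < r" "r <= S.d x z" "r <= T.d y z'"
   and tr: "S.gtype g r = T.gtype g' r" using common_initial_type[OF g g' pos eqv] by blast
  have s: "S.sdir x z (g r)" using S.same_dir_on_geo[OF g, of "S.d x z" r] r geoD(3)[OF g] pos by simp
  have s': "T.sdir y z' (g' r)" using T.same_dir_on_geo[OF g', of "T.d y z'" r] r geoD(3)[OF g'] pos by simp
  have gr: "geo S g r x (g r)" by (rule geo_take[OF g]) (use r in auto)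
  have gr': "geo T g' r y (g' r)" by (rule geo_take[OF g']) (use r in auto)
  obtain N where "branch x y (g r) (g' r) N"
   using branch_geodesic[OF gr gr' S.limit_dir_same_dir[OF limit s] T.limit_dir_same_dir[OF lim' s'] tr] by blast
  thus ?thesis using branch_change[OF _ s s'] by blast
 qed
qed

end

section \<open>Extension of partial isometries\<close>

lemma complete_limit:
 assumes c: "mcomplete_of m" and s: "!!n::nat. s n : mspace m"
  and cau: "!!e. e > 0 ==> EX N. ALL i>=N. ALL j>=N. mdist m (s i) (s j) < e"
 shows "EX l:mspace m. ALL e>0. EX N. ALL n>=N. mdist m (s n) l < e"
proof -
 interpret Metric_space "mspace m" "mdist m" by simp
 have "MCauchy s" unfolding MCauchy_def
 proof (intro conjI allI impI)
  show "range s <= mspace m" using s by blast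
  fix e :: real assume "e > 0"
  from cau[OF this] obtain N where "ALL i>=N. ALL j>=N. mdist m (s i) (s j) < e" by blast
  thus "EX N. ALL n n'. N <= n --> N <= n' --> mdist m (s n) (s n') < e" by blast
 qed
 then obtain l where "limitin mtopology s l sequentially"
  using c unfolding mcomplete_of_def mcomplete_def by blast
 hence l: "l : mspace m" "ALL e>0. \<forall>\<^sub>F n in sequentially. s n : mspace m & mdist m (s n) l < e"
  unfolding limitin_metric by auto
 have "EX N. ALL n>=N. mdist m (s n) l < e" if "e > 0" for e
  using l(2) that unfolding eventually_sequentially by blast
 thus ?thesis using l(1) by blast
qed

lemma iso_graph_limit:
 assumes G: "iso_graph S T G" and c: "mcomplete_of T" and x: "x : mspace S"
  and lim: "!!e. e > 0 ==> EX a:Domain G. mdist S x a < e"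
 shows "EX y:mspace T. ALL e>0. EX a b. (a, b) : G & mdist S x a < e & mdist T y b < e"
proof -
 have "EX p. p : G & mdist S x (fst p) < inverse (real (Suc n))" for n
  using lim[of "inverse (real (Suc n))"] by force
 then obtain p where p: "!!n. p n : G & mdist S x (fst (p n)) < inverse (real (Suc n))" by metis
 have pG: "(fst (p n), snd (p n)) : G" for n using p[of n] by simp
 note M = iso_graphD(1)[OF G pG]
 have small: "mdist S (fst (p i)) (fst (p j)) < e" if "inverse (real (Suc N)) < e / 2" "N <= i" "N <= j" for i j N e
 proof -
  have "mdist S (fst (p i)) (fst (p j)) <= mdist S (fst (p i)) x + mdist S x (fst (p j))"
   by (rule mdist_triangle) (use M x in auto)
  moreover have "inverse (real (Suc i)) <= inverse (real (Suc N))" "inverse (real (Suc j)) <= inverse (real (Suc N))"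
   using that by (auto intro!: le_imp_inverse_le)
  ultimately show ?thesis using p[of i] p[of j] that(1) mdist_commute[of S x "fst (p i)"] by linarith
 qed
 have "EX y:mspace T. ALL e>0. EX N. ALL n>=N. mdist T (snd (p n)) y < e"
 proof (rule complete_limit[OF c])
  show "snd (p n) : mspace T" for n using M[of n] by simp
  fix e :: real assume "e > 0"
  then obtain N where N: "inverse (real (Suc N)) < e / 2" using reals_Archimedean[of "e/2"] by auto
  have "mdist T (snd (p i)) (snd (p j)) < e" if "N <= i" "N <= j" for i j
   using iso_graphD(2)[OF G pG pG, of i j] small[OF N that] by simp
  thus "EX N. ALL i>=N. ALL j>=N. mdist T (snd (p i)) (snd (p j)) < e" by blast
 qed
 then obtain y where y: "y : mspace T" and ylim: "ALL e>0. EX N. ALL n>=N. mdist T (snd (p n)) y < e" by blast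
 have "EX a b. (a, b) : G & mdist S x a < e & mdist T y b < e" if e: "e > 0" for e
 proof -
  obtain N where N: "ALL n>=N. mdist T (snd (p n)) y < e" using ylim e by blast
  obtain K where K: "inverse (real (Suc K)) < e" using reals_Archimedean[OF e] by blast
  let ?n = "max N K"
  have "inverse (real (Suc ?n)) <= inverse (real (Suc K))" by (auto intro!: le_imp_inverse_le)
  hence "mdist S x (fst (p ?n)) < e" using p[of ?n] K by linarith
  moreover have "mdist T y (snd (p ?n)) < e" using N mdist_commute[of T y "snd (p ?n)"] by simp
  ultimately show ?thesis using pG by blast
 qed
 thus ?thesis using y by blast
qed

lemma closedin_approx:
 assumes "A <= mspace m" and "!!x. x : mspace m ==> (!!e. e > 0 ==> EX a:A. mdist m x a < e) ==> x : A"
 shows "closedin (mtopology_of m) A"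
proof -
 interpret Metric_space "mspace m" "mdist m" by simp
 have "closedin mtopology A"
  unfolding closedin_metric
 proof (intro conjI allI impI)
  fix x assume x: "x : mspace m - A"
  then obtain e where e: "e > 0" "ALL a:A. ~ mdist m x a < e" using assms(2)[of x] by blast
  have "disjnt A (mball x e)" unfolding disjnt_iff using e(2) by simp
  thus "EX r>0. disjnt A (mball x r)" using e(1) by blast
 qed (rule assms(1))
 thus ?thesis by (simp add: mtopology_of_def)
qed

context two_Q_trees
begin

text \<open>With \<open>onto\<close> the extension is meant to become surjective, so fullness is asked for on both
  sides; otherwise only on the side of the domain.\<close>
definition good :: "bool => ('a \<times> 'b) set => bool" where
 "good onto G <-> iso_graph S T G & subtree S \<P> (Domain G) & subtree T \<P>' (Range G) &
   (ALL x y. (x, y) : G --> (fresh S \<P> (Domain G) x & fresh T \<P>' (Range G) y) |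
    (full S \<P> (Domain G) x & (onto --> full T \<P>' (Range G) y)))"

lemma goodD:
 assumes "good onto G"
 shows "iso_graph S T G" "subtree S \<P> (Domain G)" "subtree T \<P>' (Range G)"
  "!!x y. (x, y) : G ==> (fresh S \<P> (Domain G) x & fresh T \<P>' (Range G) y) |
    (full S \<P> (Domain G) x & (onto --> full T \<P>' (Range G) y))"
 using assms unfolding good_def by simp_all

text \<open>For members in different directions the base point lies between points of their domains, and also between
  points of their ranges, so all distances add up in the same way.\<close>
lemma wedge:
 assumes ne: "\<F> ~= {}"
  and N: "!!N. N : \<F> ==> iso_graph S T N & (x, y) : N & subtree S \<P> (Domain N) & subtree T \<P>' (Range N)"
  and sepS: "!!N N' a b. N : \<F> ==> N' : \<F> ==> N ~= N' ==> a : Domain N ==> a ~= x ==> b : Domain N' ==> b ~= x ==> ~ S.sdir x a b"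
  and sepT: "!!N N' a b. N : \<F> ==> N' : \<F> ==> N ~= N' ==> a : Range N ==> a ~= y ==> b : Range N' ==> b ~= y ==> ~ T.sdir y a b"
 shows "iso_graph S T (\<Union>\<F>)" "subtree S \<P> (Domain (\<Union>\<F>))" "subtree T \<P>' (Range (\<Union>\<F>))"
proof -
 show "iso_graph S T (\<Union>\<F>)"
 proof (rule iso_graphI)
  show "a : S.M & b : T.M" if ab: "(a, b) : \<Union>\<F>" for a b
  using ab iso_graphD(1) N by fastforce
  fix a b a' b' assume "(a, b) : \<Union>\<F>" "(a', b') : \<Union>\<F>"
  then obtain F F' where F: "F : \<F>" "(a, b) : F" and F': "F' : \<F>" "(a', b') : F'" by blast
  have i: "iso_graph S T F" "(x, y) : F" and i': "iso_graph S T F'" "(x, y) : F'" using N F(1) F'(1) by auto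
  have in_same: "S.d a a' = T.d b b'" if "(a, b) : H" "(a', b') : H" "iso_graph S T H" for H
   using iso_graphD(2)[OF that(3,1,2)] .
  have xa: "a = x <-> b = y" using iso_graphD(3)[OF i(1) F(2) i(2)] .
  have xa': "a' = x <-> b' = y" using iso_graphD(3)[OF i'(1) F'(2) i'(2)] .
  show "S.d a a' = T.d b b'"
  proof (cases "F = F' | a = x | a' = x")
   case True
   thus ?thesis using in_same[OF _ _ i(1)] in_same[OF _ _ i'(1)] F(2) F'(2) i(2) i'(2) xa xa' by metis
  next
   case False
   note M = iso_graphD(1)[OF i(1) F(2)] iso_graphD(1)[OF i'(1) F'(2)] iso_graphD(1)[OF i]
   have "~ S.sdir x a a'" by (rule sepS[OF F(1) F'(1)]) (use False F(2) F'(2) in auto)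
   hence "betw S a x a'" using S.betw_if_not_same_dir M by blast
   moreover have "~ T.sdir y b b'" by (rule sepT[OF F(1) F'(1)]) (use False xa xa' F(2) F'(2) in auto)
   hence "betw T b y b'" using T.betw_if_not_same_dir M by blast
   ultimately show ?thesis
    using iso_graphD(2)[OF i(1) F(2) i(2)] iso_graphD(2)[OF i'(1) i'(2) F'(2)] by (simp add: betw_def)
  qed
 qed
 have "subtree S \<P> (\<Union>(Domain ` \<F>))"
 proof (rule S.subtree_Union[of _ x])
  show "subtree S \<P> A" if "A : Domain ` \<F>" for A using that N by blast
  show "x : A" if "A : Domain ` \<F>" for A using that N by blast
  fix A B a b assume A: "A : Domain ` \<F>" "B : Domain ` \<F>" "A ~= B" and ab: "a : A" "a ~= x" "b : B" "b ~= x"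
  then obtain F F' where "F : \<F>" "F' : \<F>" "A = Domain F" "B = Domain F'" by blast
  thus "~ S.sdir x a b" using sepS[of F F' a b] A(3) ab by blast
 qed
 thus "subtree S \<P> (Domain (\<Union>\<F>))" by (simp add: Domain_Union)
 have "subtree T \<P>' (\<Union>(Range ` \<F>))"
 proof (rule T.subtree_Union[of _ y])
  show "subtree T \<P>' A" if "A : Range ` \<F>" for A using that N by blast
  show "y : A" if "A : Range ` \<F>" for A using that N by blast
  fix A B a b assume A: "A : Range ` \<F>" "B : Range ` \<F>" "A ~= B" and ab: "a : A" "a ~= y" "b : B" "b ~= y"
  then obtain F F' where "F : \<F>" "F' : \<F>" "A = Range F" "B = Range F'" by blast
  thus "~ T.sdir y a b" using sepT[of F F' a b] A(3) ab by blast
 qed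
 thus "subtree T \<P>' (Range (\<Union>\<F>))" by (simp add: Range_Union)
qed

text \<open>Finitely many directions are removed from at most, respectively exactly, continuum many.\<close>
lemma match_untouched:
 assumes x: "x : S.M" and y: "y : T.M" and fr: "fresh S \<P> A x" "fresh T \<P>' B y"
  and cS: "S.Dirs x \<kappa> \<lesssim> (UNIV :: real set)" and cS': "onto ==> S.Dirs x \<kappa> \<approx> (UNIV :: real set)"
  and cT: "T.Dirs y \<kappa> \<approx> (UNIV :: real set)"
 shows "EX f. inj_on f (S.untouched A x \<kappa>) & f ` S.untouched A x \<kappa> <= T.untouched B y \<kappa> &
   (onto --> f ` S.untouched A x \<kappa> = T.untouched B y \<kappa>)"
proof -
 have T': "T.untouched B y \<kappa> \<approx> (UNIV :: real set)"
 proof -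
  have "T.Dirs y \<kappa> - (T.Dirs y \<kappa> - T.untouched B y \<kappa>) = T.untouched B y \<kappa>" unfolding T.untouched_def by blast
  thus ?thesis using eqpoll_diff_finite[OF cT T.finite_touched[OF fr(2) y]] by metis
 qed
 show ?thesis
 proof (cases onto)
  case True
  have "S.Dirs x \<kappa> - (S.Dirs x \<kappa> - S.untouched A x \<kappa>) = S.untouched A x \<kappa>" unfolding S.untouched_def by blast
  hence "S.untouched A x \<kappa> \<approx> T.untouched B y \<kappa>" using T' eqpoll_sym eqpoll_trans eqpoll_diff_finite[OF cS'[OF True] S.finite_touched[OF fr(1) x]] by metis
  then obtain f where "bij_betw f (S.untouched A x \<kappa>) (T.untouched B y \<kappa>)" unfolding eqpoll_def by blast
  thus ?thesis unfolding bij_betw_def by blast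
 next
  case False
  have "S.untouched A x \<kappa> <= S.Dirs x \<kappa>" unfolding S.untouched_def by blast
  hence "S.untouched A x \<kappa> \<lesssim> T.untouched B y \<kappa>" using subset_imp_lepoll cS lepoll_trans eqpoll_imp_lepoll[OF eqpoll_sym[OF T']] by metis
  thus ?thesis unfolding lepoll_def using False by blast
 qed
qed

lemma branch_for_directions:
 assumes x: "x : S.M" and y: "y : T.M" and \<delta>: "\<delta> : S.Dirs x \<kappa>" and \<delta>': "\<delta>' : T.Dirs y \<kappa>"
 shows "EX N. iso_graph S T N & (x, y) : N & subtree S \<P> (Domain N) & subtree T \<P>' (Range N) &
   Domain N - {x} <= \<delta> & Range N - {y} <= \<delta>' & (EX n:Domain N. n ~= x) &
   (ALL w w'. (w, w') : N --> w ~= x --> fresh S \<P> (Domain N) w & fresh T \<P>' (Range N) w')"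
proof -
 obtain z where z: "z : S.M" "z ~= x" "\<delta> = S.dir_class x z" "S.dir_inv x z = \<kappa>" using \<delta> unfolding S.Dirs_def by blast
 obtain z' where z': "z' : T.M" "z' ~= y" "\<delta>' = T.dir_class y z'" "T.dir_inv y z' = \<kappa>" using \<delta>' unfolding T.Dirs_def by blast
 obtain N where "branch x y z z' N" using branch_exists[OF x z(1,2) y z'(1,2)] z(4) z'(4) by auto
 thus ?thesis unfolding branch_def z(3) z'(3) S.dir_class_def T.dir_class_def
  by (intro exI[of _ N]) auto
qed

text \<open>If \<open>(x, y)\<close> is fresh, a branch for every matched pair of untouched directions is glued to
  \<open>G\<close>. Points of a branch other than its origin stay fresh, because they see \<open>G\<close> and
  the other branches in the direction of the origin.\<close>
lemma extend_at_point:
 assumes G: "good onto G" and xy: "(x, y) : G"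
  and cS: "!!\<kappa>. S.Dirs x \<kappa> \<lesssim> (UNIV :: real set)"
  and cS': "!!\<kappa>. onto ==> \<kappa> : S.dir_kinds ==> S.Dirs x \<kappa> \<approx> (UNIV :: real set)"
  and cT: "!!\<kappa>. \<kappa> : S.dir_kinds ==> T.Dirs y \<kappa> \<approx> (UNIV :: real set)"
 shows "EX G'. good onto G' & G <= G' & full S \<P> (Domain G') x & (onto --> full T \<P>' (Range G') y)"
proof (cases "full S \<P> (Domain G) x & (onto --> full T \<P>' (Range G) y)")
 case True
 thus ?thesis using G by blast
next
 case False
 note gd = goodD[OF G]
 let ?A = "Domain G" and ?B = "Range G"
 have fr: "fresh S \<P> ?A x" "fresh T \<P>' ?B y" using gd(4)[OF xy] False by auto
 have x: "x : S.M" and y: "y : T.M" using iso_graphD(1)[OF gd(1) xy] by auto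
 have "EX f. inj_on f (S.untouched ?A x \<kappa>) & f ` S.untouched ?A x \<kappa> <= T.untouched ?B y \<kappa> &
   (onto --> f ` S.untouched ?A x \<kappa> = T.untouched ?B y \<kappa>)" if "\<kappa> : S.dir_kinds" for \<kappa>
  by (rule match_untouched[OF x y fr cS cS'[OF _ that] cT[OF that]])
 then obtain f where f: "!!\<kappa>. \<kappa> : S.dir_kinds ==> inj_on (f \<kappa>) (S.untouched ?A x \<kappa>) &
   f \<kappa> ` S.untouched ?A x \<kappa> <= T.untouched ?B y \<kappa> & (onto --> f \<kappa> ` S.untouched ?A x \<kappa> = T.untouched ?B y \<kappa>)"
  by metis
 \<comment> \<open>one branch for each kind and each untouched direction of this kind\<close>
 define J where "J = {(\<kappa>, \<delta>). \<kappa> : S.dir_kinds & \<delta> : S.untouched ?A x \<kappa>}"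
 define ok where "ok p N <-> iso_graph S T N & (x, y) : N & subtree S \<P> (Domain N) & subtree T \<P>' (Range N) &
   Domain N - {x} <= snd p & Range N - {y} <= f (fst p) (snd p) & (EX n:Domain N. n ~= x) &
   (ALL w w'. (w, w') : N --> w ~= x --> fresh S \<P> (Domain N) w & fresh T \<P>' (Range N) w')" for p N
 have Jd: "fst p : S.dir_kinds & snd p : S.Dirs x (fst p) & snd p Int ?A = {} &
   f (fst p) (snd p) : T.Dirs y (fst p) & f (fst p) (snd p) Int ?B = {}" if "p : J" for p
 proof -
  have p: "fst p : S.dir_kinds" "snd p : S.untouched ?A x (fst p)" using that unfolding J_def by auto
  hence "f (fst p) (snd p) : T.untouched ?B y (fst p)" using f[OF p(1)] by blast
  thus ?thesis using p unfolding S.untouched_def T.untouched_def by simp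
 qed
 have "EX N. ok p N" if "p : J" for p
  unfolding ok_def using Jd[OF that] branch_for_directions[OF x y, of "snd p" "fst p" "f (fst p) (snd p)"] by blast
 then obtain N where N: "!!p. p : J ==> ok p (N p)" by metis
 define \<F> where "\<F> = insert G (N ` J)"
 have FN: "iso_graph S T F & (x, y) : F & subtree S \<P> (Domain F) & subtree T \<P>' (Range F)" if "F : \<F>" for F
  using that gd(1-3) xy N unfolding \<F>_def ok_def by blast
 have sub: "a : snd p" if "p : J" "a : Domain (N p)" "a ~= x" for p a using N[OF that(1)] that(2,3) unfolding ok_def by blast
 have sub': "a : f (fst p) (snd p)" if "p : J" "a : Range (N p)" "a ~= y" for p a using N[OF that(1)] that(2,3) unfolding ok_def by blast
 have GS: "~ S.sdir x a b" if p: "p : J" and a: "a : ?A" and b: "b : Domain (N p)" "b ~= x" for p a b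
 using S.Dirs_touched(1) Jd p sub b x S.dir_class_def S.same_dir_sym False a by blast
 have GT: "~ T.sdir y a b" if p: "p : J" and a: "a : ?B" and b: "b : Range (N p)" "b ~= y" for p a b
 using T.Dirs_touched(1) Jd p sub' b y T.dir_class_def T.same_dir_sym False a by blast
 have NS: "~ S.sdir x a b" if p: "p : J" "q : J" "p ~= q" and a: "a : Domain (N p)" "a ~= x" and b: "b : Domain (N q)" "b ~= x" for p q a b
 proof -
  have "snd p ~= snd q"
  proof
   assume e: "snd p = snd q"
   thus False using S.Dirs_disjoint[OF x, of "snd p"] Jd[OF p(1)] Jd[OF p(2)] e p(3) by (simp add: prod_eq_iff)
  qed
  thus ?thesis using S.Dirs_members_separated[OF x] Jd[OF p(1)] Jd[OF p(2)] sub[OF p(1) a] sub[OF p(2) b] by blast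
 qed
 have NT: "~ T.sdir y a b" if p: "p : J" "q : J" "p ~= q" and a: "a : Range (N p)" "a ~= y" and b: "b : Range (N q)" "b ~= y" for p q a b
 proof -
  have "f (fst p) (snd p) ~= f (fst q) (snd q)"
  proof
   assume e: "f (fst p) (snd p) = f (fst q) (snd q)"
   hence k: "fst p = fst q" using T.Dirs_disjoint[OF y, of "f (fst p) (snd p)"] Jd[OF p(1)] Jd[OF p(2)] by simp
   have "snd p : S.untouched ?A x (fst p)" "snd q : S.untouched ?A x (fst p)" using p(1,2) k unfolding J_def by auto
   moreover have "inj_on (f (fst p)) (S.untouched ?A x (fst p))" using f Jd[OF p(1)] by blast
   ultimately have "snd p = snd q" using e k unfolding inj_on_def by simp
   thus False using k p(3) by (simp add: prod_eq_iff)
  qed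
  thus ?thesis using T.Dirs_members_separated[OF y] Jd[OF p(1)] Jd[OF p(2)] sub'[OF p(1) a] sub'[OF p(2) b] by blast
 qed
 have sepS: "~ S.sdir x a b"
  if F: "F : \<F>" "F' : \<F>" "F ~= F'" and a: "a : Domain F" "a ~= x" and b: "b : Domain F'" "b ~= x" for F F' a b
 proof -
  consider p where "F = G" "p : J" "F' = N p" | p where "p : J" "F = N p" "F' = G" | p q where "p : J" "q : J" "F = N p" "F' = N q"
   using F unfolding \<F>_def by blast
  thus ?thesis
  proof cases
   case 1 thus ?thesis using GS[OF 1(2), of a b] a b by blast
  next
   case 2 thus ?thesis using GS[OF 2(1), of b a] a b S.same_dir_sym by blast
  next
   case 3 thus ?thesis using NS[OF 3(1,2), of a b] F(3) a b by blast
  qed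
 qed
 have sepT: "~ T.sdir y a b"
  if F: "F : \<F>" "F' : \<F>" "F ~= F'" and a: "a : Range F" "a ~= y" and b: "b : Range F'" "b ~= y" for F F' a b
 proof -
  consider p where "F = G" "p : J" "F' = N p" | p where "p : J" "F = N p" "F' = G" | p q where "p : J" "q : J" "F = N p" "F' = N q"
   using F unfolding \<F>_def by blast
  thus ?thesis
  proof cases
   case 1 thus ?thesis using GT[OF 1(2), of a b] a b by blast
  next
   case 2 thus ?thesis using GT[OF 2(1), of b a] a b T.same_dir_sym by blast
  next
   case 3 thus ?thesis using NT[OF 3(1,2), of a b] F(3) a b by blast
  qed
 qed
 have ne: "\<F> ~= {}" unfolding \<F>_def by blast
 let ?G = "\<Union>\<F>"
 have w: "iso_graph S T ?G" "subtree S \<P> (Domain ?G)" "subtree T \<P>' (Range ?G)"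
  by (rule wedge[OF ne, of x y]; fact FN sepS sepT)+
 have sub_dom: "Domain F <= Domain ?G" "Range F <= Range ?G" if "F : \<F>" for F using that by auto
 have GF: "G : \<F>" and NF: "!!p. p : J ==> N p : \<F>" unfolding \<F>_def by auto
 have fullS: "full S \<P> (Domain ?G) x" unfolding full_def
 proof (intro ballI impI)
  fix z assume z: "z : S.M" "z ~= x"
  let ?\<delta> = "S.dir_class x z" and ?\<kappa> = "S.dir_inv x z"
  show "EX a:Domain ?G. S.sdir x z a"
  proof (cases "?\<delta> Int ?A = {}")
   case False
   thus ?thesis using sub_dom(1)[OF GF] unfolding S.dir_class_def by blast
  next
   case True
   have "?\<delta> : S.untouched ?A x ?\<kappa>" unfolding S.untouched_def S.Dirs_def using True z by blast
   hence p: "(?\<kappa>, ?\<delta>) : J" unfolding J_def using S.dir_inv_kind[OF x z] by simp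
   obtain n where "n : Domain (N (?\<kappa>, ?\<delta>))" "n ~= x" using N[OF p] unfolding ok_def by blast
   hence "n : ?\<delta>" "n : Domain ?G" using sub[OF p] sub_dom(1)[OF NF[OF p]] by auto
   thus ?thesis unfolding S.dir_class_def by blast
  qed
 qed
 have fullT: "full T \<P>' (Range ?G) y" if onto: onto unfolding full_def
 proof (intro ballI impI)
  fix z assume z: "z : T.M" "z ~= y"
  let ?\<delta> = "T.dir_class y z" and ?\<kappa> = "T.dir_inv y z"
  show "EX a:Range ?G. T.sdir y z a"
  proof (cases "?\<delta> Int ?B = {}")
   case False
   thus ?thesis using sub_dom(2)[OF GF] unfolding T.dir_class_def by blast
  next
   case True
   have u: "?\<delta> : T.untouched ?B y ?\<kappa>" unfolding T.untouched_def T.Dirs_def using True z by blast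
   have k: "?\<kappa> : S.dir_kinds" by (rule T.dir_inv_kind[OF y z])
   have "?\<delta> : f ?\<kappa> ` S.untouched ?A x ?\<kappa>" using f[OF k] onto u by simp
   then obtain \<delta> where d': "?\<delta> = f ?\<kappa> \<delta>" and d: "\<delta> : S.untouched ?A x ?\<kappa>" by (rule imageE)
   have p: "(?\<kappa>, \<delta>) : J" unfolding J_def using d k by simp
   obtain n n' where n: "(n, n') : N (?\<kappa>, \<delta>)" "n ~= x" using N[OF p] unfolding ok_def by blast
   have n'R: "n' : Range (N (?\<kappa>, \<delta>))" using n(1) by blast
   hence "n' : ?\<delta>" using sub'[OF p, of n'] d' iso_graphD(3)[OF _ n(1), of S T x y] FN[OF NF[OF p]] n(2) by simp
   thus ?thesis using sub_dom(2)[OF NF[OF p]] n'R unfolding T.dir_class_def by blast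
  qed
 qed
 have memS: "v : S.M" if F: "F : \<F>" "v : Domain F" for F v
  using F(2) iso_graphD(1)[OF FN[OF F(1), THEN conjunct1]] by (elim DomainE) simp
 have memT: "v : T.M" if F: "F : \<F>" "v : Range F" for F v
  using F(2) iso_graphD(1)[OF FN[OF F(1), THEN conjunct1]] by (elim RangeE) simp
 have base: "x : Domain F" "y : Range F" if "F : \<F>" for F
  using FN[OF that, THEN conjunct2, THEN conjunct1] by auto
 have redS: "fresh S \<P> (Domain ?G) w" if F: "F : \<F>" "w : Domain F" "w ~= x" and fr: "fresh S \<P> (Domain F) w" for F w
 proof (rule S.fresh_reduce[OF fr])
  have wM: "w : S.M" by (rule memS[OF F(1,2)])
  note xF = base(1)[OF F(1)]
  fix b assume b: "b : Domain ?G" "b ~= w"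
  then obtain F' where F': "F' : \<F>" "b : Domain F'" by blast
  have bM: "b : S.M" by (rule memS[OF F'])
  show "EX a:Domain F. S.sdir w b a"
  using S.same_dir_refl wM bM b(2) False F' xF sepS F(1) F'(1) F(2,3) F'(2) S.betw_if_not_same_dir x S.same_dirI_line F(3) S.same_dir_sym by metis
 qed
 have redT: "fresh T \<P>' (Range ?G) w" if F: "F : \<F>" "w : Range F" "w ~= y" and fr: "fresh T \<P>' (Range F) w" for F w
 proof (rule T.fresh_reduce[OF fr])
  have wM: "w : T.M" by (rule memT[OF F(1,2)])
  note yF = base(2)[OF F(1)]
  fix b assume b: "b : Range ?G" "b ~= w"
  then obtain F' where F': "F' : \<F>" "b : Range F'" by blast
  have bM: "b : T.M" by (rule memT[OF F'])
  show "EX a:Range F. T.sdir w b a"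
  using T.same_dir_refl wM bM b(2) False F' yF sepT F(1) F'(1) F(2,3) F'(2) T.betw_if_not_same_dir y T.same_dirI_line F(3) T.same_dir_sym by metis
 qed
 have "(fresh S \<P> (Domain ?G) v & fresh T \<P>' (Range ?G) v') | (full S \<P> (Domain ?G) v & (onto --> full T \<P>' (Range ?G) v'))"
  if vv: "(v, v') : ?G" for v v'
 proof (cases "v = x")
  case True
  have xyG: "(x, y) : ?G" using xy GF by (rule UnionI[rotated])
  thus ?thesis using iso_graphD(3)[OF w(1) vv xyG] True fullS fullT by blast
 next
  case False
  obtain F where F: "F : \<F>" "(v, v') : F" using vv by blast
  have v': "v' ~= y" 
   using iso_graphD(3)[OF FN[OF F(1), THEN conjunct1] F(2) FN[OF F(1), THEN conjunct2, THEN conjunct1]] False by simp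
  have mem: "v : Domain F" "v' : Range F" using F(2) by auto
  consider "fresh S \<P> (Domain F) v & fresh T \<P>' (Range F) v'"
   | "full S \<P> (Domain F) v & (onto --> full T \<P>' (Range F) v')"
  proof (cases "F = G")
   case True
   thus ?thesis using that gd(4)[of v v'] F(2) by blast
  next
   case FG: False
   then obtain p where p: "p : J" "F = N p" using F(1) unfolding \<F>_def by blast
   have "ALL w w'. (w, w') : N p --> w ~= x --> fresh S \<P> (Domain (N p)) w & fresh T \<P>' (Range (N p)) w'"
    using N[OF p(1)] unfolding ok_def by (elim conjE)
   thus ?thesis using that F(2) p(2) False by simp
  qed
  thus ?thesis
  using redS F(1) mem(1) False redT mem(2) v' full_mono sub_dom(1) sub_dom(2) by metis
 qed
 hence "good onto ?G" unfolding good_def using w by blast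
 thus ?thesis using fullS fullT GF by blast
qed

text \<open>At a point outside a subtree all its points lie in one direction, so the new point is fresh.\<close>
lemma good_insert_limit:
 assumes G: "good onto G" and ne: "G ~= {}" and x: "x : S.M" "x ~: Domain G" and y: "y : T.M"
  and lim: "!!e. e > 0 ==> EX a b. (a, b) : G & S.d x a < e & T.d y b < e"
 shows "good onto (insert (x, y) G)"
proof -
 note gd = goodD[OF G]
 let ?G = "insert (x, y) G"
 have dxy: "S.d x a = T.d y b" if ab: "(a, b) : G" for a b
 proof -
  note M = iso_graphD(1)[OF gd(1) ab]
  have "\<bar>S.d x a - T.d y b\<bar> <= e" if e: "e > 0" for e
  proof -
   obtain a' b' where ab': "(a', b') : G" "S.d x a' < e/2" "T.d y b' < e/2" using lim[of "e/2"] e by auto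
   note M' = iso_graphD(1)[OF gd(1) ab'(1)]
   have "S.d x a <= S.d x a' + S.d a' a" "S.d a' a <= S.d a' x + S.d x a"
    "T.d y b <= T.d y b' + T.d b' b" "T.d b' b <= T.d b' y + T.d y b"
    by (rule mdist_triangle, use M M' x y in auto)+
   thus ?thesis using ab'(2,3) mdist_commute[of S x a'] mdist_commute[of T y b'] iso_graphD(2)[OF gd(1) ab'(1) ab] by linarith
  qed
  thus ?thesis using field_le_epsilon[of "\<bar>S.d x a - T.d y b\<bar>" 0] by simp
 qed
 have iso: "iso_graph S T ?G"
 proof (rule iso_graphI)
  show "a : S.M & b : T.M" if "(a, b) : ?G" for a b using that iso_graphD(1)[OF gd(1)] x y by blast
  fix a b a' b' assume m: "(a, b) : ?G" "(a', b') : ?G"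
  show "S.d a a' = T.d b b'"
  proof (cases "(a, b) : G"; cases "(a', b') : G")
   assume "(a, b) : G" "(a', b') : G" thus ?thesis by (rule iso_graphD(2)[OF gd(1)])
  next
   assume c: "(a, b) : G" "(a', b') ~: G"
   thus ?thesis using m dxy[OF c(1)] mdist_commute[of S a x] mdist_commute[of T b y] by simp
  next
   assume c: "(a, b) ~: G" "(a', b') : G"
   thus ?thesis using m dxy[OF c(2)] by simp
  next
   assume c: "(a, b) ~: G" "(a', b') ~: G"
   thus ?thesis using m x y by simp
  qed
 qed
 have limS: "EX a:Domain G. S.d x a < e" if "e > 0" for e using lim[OF that] by blast
 have limT: "EX b:Range G. T.d y b < e" if "e > 0" for e using lim[OF that] by blast
 have dom: "Domain ?G = insert x (Domain G)" and ran: "Range ?G = insert y (Range G)" by auto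
 have sS: "subtree S \<P> (Domain ?G)" unfolding dom by (rule S.subtree_insert_limit[OF gd(2) x(1) limS])
 have sT: "subtree T \<P>' (Range ?G)" unfolding ran by (rule T.subtree_insert_limit[OF gd(3) y limT])
 have AS: "Domain G <= S.M" and BT: "Range G <= T.M" using subtreeD(1)[OF gd(2)] subtreeD(1)[OF gd(3)] .
 have yR: "y ~: Range G"
 using dxy y x(1) iso_graphD(1) gd(1) x(2) by fastforce
 have "(fresh S \<P> (Domain ?G) v & fresh T \<P>' (Range ?G) v') | (full S \<P> (Domain ?G) v & (onto --> full T \<P>' (Range ?G) v'))"
  if vv: "(v, v') : ?G" for v v'
 proof (cases "(v, v') : G")
  case True
  note M = iso_graphD(1)[OF gd(1) True]
  from gd(4)[OF True] show ?thesis
  proof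
   assume "fresh S \<P> (Domain G) v & fresh T \<P>' (Range G) v'"
   hence "fresh S \<P> (Domain ?G) v" "fresh T \<P>' (Range ?G) v'"
    unfolding dom ran using S.fresh_insert_limit[OF _ AS _ x(1) limS] T.fresh_insert_limit[OF _ BT _ y limT] M by auto
   thus ?thesis by blast
  next
   assume f: "full S \<P> (Domain G) v & (onto --> full T \<P>' (Range G) v')"
   have "Domain G <= Domain ?G" "Range G <= Range ?G" by auto
   thus ?thesis using f full_mono by metis
  qed
 next
  case False
  hence v: "v = x" "v' = y" using vv by auto
  obtain a b where ab: "(a, b) : G" using ne by auto
  have "fresh S \<P> (Domain ?G) x"
   by (rule S.fresh_if_one_dir[of _ _ a a]) (use subtreeD(2)[OF gd(2) x] ab in auto)
  moreover have "fresh T \<P>' (Range ?G) y"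
   by (rule T.fresh_if_one_dir[of _ _ b b]) (use subtreeD(2)[OF gd(3) y yR] ab in auto)
  ultimately show ?thesis using v by blast
 qed
 thus ?thesis unfolding good_def using iso sS sT by blast
qed

lemma good_chain_Union:
 assumes ne: "\<C> ~= {}" and g: "!!C. C : \<C> ==> good onto C" and ch: "!!C C'. C : \<C> ==> C' : \<C> ==> C <= C' | C' <= C"
 shows "good onto (\<Union>\<C>)"
proof -
 have two: "EX C:\<C>. p : C & q : C" if pq: "p : \<Union>\<C>" "q : \<Union>\<C>" for p q
 proof -
  obtain C C' where C: "C : \<C>" "p : C" "C' : \<C>" "q : C'" using pq by blast
  thus ?thesis using ch[OF C(1,3)] by blast
 qed
 have four: "EX C:\<C>. p : C & q : C & r : C & s : C" if p: "p : \<Union>\<C>" "q : \<Union>\<C>" "r : \<Union>\<C>" "s : \<Union>\<C>" for p q r s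
 proof -
  obtain C where C: "C : \<C>" "p : C" "q : C" using two[OF p(1,2)] by blast
  obtain C' where C': "C' : \<C>" "r : C'" "s : C'" using two[OF p(3,4)] by blast
  show ?thesis using ch[OF C(1) C'(1)] C C' by blast
 qed
 have iso: "iso_graph S T (\<Union>\<C>)"
 proof (rule iso_graphI)
  show "a : S.M & b : T.M" if ab: "(a, b) : \<Union>\<C>" for a b
  using ab iso_graphD(1) goodD(1) g by fastforce
  fix a b a' b' assume ab: "(a, b) : \<Union>\<C>" "(a', b') : \<Union>\<C>"
  obtain C where C: "C : \<C>" "(a, b) : C" "(a', b') : C" using two[OF ab] by blast
  show "S.d a a' = T.d b b'" by (rule iso_graphD(2)[OF goodD(1)[OF g[OF C(1)]] C(2,3)])
 qed
 have sS: "subtree S \<P> (\<Union>(Domain ` \<C>))"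
 proof (rule S.subtree_chain_Union)
  show "subtree S \<P> A" if A: "A : Domain ` \<C>" for A
  using A goodD(2) g by blast
  fix a b assume "a : \<Union>(Domain ` \<C>)" "b : \<Union>(Domain ` \<C>)"
  then obtain a' b' where ab: "(a, a') : \<Union>\<C>" "(b, b') : \<Union>\<C>" by blast
  from two[OF this] show "EX C:Domain ` \<C>. a : C & b : C" by blast
 qed
 have sT: "subtree T \<P>' (\<Union>(Range ` \<C>))"
 proof (rule T.subtree_chain_Union)
  show "subtree T \<P>' A" if A: "A : Range ` \<C>" for A
  using A goodD(3) g by blast
  fix a b assume "a : \<Union>(Range ` \<C>)" "b : \<Union>(Range ` \<C>)"
  then obtain a' b' where ab: "(a', a) : \<Union>\<C>" "(b', b) : \<Union>\<C>" by blast
  from two[OF this] show "EX C:Range ` \<C>. a : C & b : C" by blast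
 qed
 have "(fresh S \<P> (Domain (\<Union>\<C>)) x & fresh T \<P>' (Range (\<Union>\<C>)) y) |
   (full S \<P> (Domain (\<Union>\<C>)) x & (onto --> full T \<P>' (Range (\<Union>\<C>)) y))" if xy: "(x, y) : \<Union>\<C>" for x y
 proof (cases "EX C:\<C>. full S \<P> (Domain C) x & (onto --> full T \<P>' (Range C) y)")
  case True
  then obtain C where C: "C : \<C>" "full S \<P> (Domain C) x" "onto --> full T \<P>' (Range C) y" by blast
  have "Domain C <= Domain (\<Union>\<C>)" "Range C <= Range (\<Union>\<C>)" using C(1) by auto
  thus ?thesis using C full_mono by metis
 next
  case False
  have fr: "fresh S \<P> (Domain C) x & fresh T \<P>' (Range C) y" if "C : \<C>" "(x, y) : C" for C
   using goodD(4)[OF g[OF that(1)] that(2)] False that(1) by blast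
  have "fresh S \<P> (Domain (\<Union>\<C>)) x" unfolding fresh_def
  proof (intro ballI)
   fix a b c assume abc: "a : Domain (\<Union>\<C>) - {x}" "b : Domain (\<Union>\<C>) - {x}" "c : Domain (\<Union>\<C>) - {x}"
   then obtain a' b' c' where "(a, a') : \<Union>\<C>" "(b, b') : \<Union>\<C>" "(c, c') : \<Union>\<C>" by blast
   from four[OF this xy] obtain C where C: "C : \<C>" "(a, a') : C" "(b, b') : C" "(c, c') : C" "(x, y) : C" by blast
   have m: "a : Domain C - {x}" "b : Domain C - {x}" "c : Domain C - {x}" using C abc by auto
   show "S.sdir x a b | S.sdir x a c | S.sdir x b c"
    by (rule bspec[OF bspec[OF bspec[OF fr[OF C(1,5), THEN conjunct1, unfolded fresh_def] m(1)] m(2)] m(3)])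
  qed
  moreover have "fresh T \<P>' (Range (\<Union>\<C>)) y" unfolding fresh_def
  proof (intro ballI)
   fix a b c assume abc: "a : Range (\<Union>\<C>) - {y}" "b : Range (\<Union>\<C>) - {y}" "c : Range (\<Union>\<C>) - {y}"
   then obtain a' b' c' where "(a', a) : \<Union>\<C>" "(b', b) : \<Union>\<C>" "(c', c) : \<Union>\<C>" by blast
   from four[OF this xy] obtain C where C: "C : \<C>" "(a', a) : C" "(b', b) : C" "(c', c) : C" "(x, y) : C" by blast
   have m: "a : Range C - {y}" "b : Range C - {y}" "c : Range C - {y}" using C abc by auto
   show "T.sdir y a b | T.sdir y a c | T.sdir y b c"
    by (rule bspec[OF bspec[OF bspec[OF fr[OF C(1,5), THEN conjunct2, unfolded fresh_def] m(1)] m(2)] m(3)])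
  qed
  ultimately show ?thesis by blast
 qed
 thus ?thesis unfolding good_def using iso sS sT by (simp add: Domain_Union Range_Union)
qed

lemma good_singleton:
 assumes "s : S.M" "t : T.M"
 shows "good onto {(s, t)}"
 unfolding good_def
proof (intro conjI allI impI)
 show "iso_graph S T {(s, t)}" by (rule iso_graphI) (use assms in auto)
 show "subtree S \<P> (Domain {(s, t)})" using S.subtree_singleton[OF assms(1)] by simp
 show "subtree T \<P>' (Range {(s, t)})" using T.subtree_singleton[OF assms(2)] by simp
 show "(fresh S \<P> (Domain {(s, t)}) x & fresh T \<P>' (Range {(s, t)}) y) |
   (full S \<P> (Domain {(s, t)}) x & (onto --> full T \<P>' (Range {(s, t)}) y))" if "(x, y) : {(s, t)}" for x y
  using that unfolding fresh_def by auto
qed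

text \<open>By Zorn's lemma there is a maximal good graph. It has only full points by \<open>extend_at_point\<close> and
  a closed domain by \<open>good_insert_limit\<close>, so \<open>untouched_direction\<close> shows that its
  domain is everything.\<close>
theorem isometric_extension:
 assumes s0: "s0 : S.M" and t0: "t0 : T.M"
  and thin: "!!x \<kappa>. x : S.M ==> S.Dirs x \<kappa> \<lesssim> (UNIV :: real set)"
  and richT: "T.rich" and richS: "onto ==> S.rich"
 shows "EX G. iso_graph S T G & Domain G = S.M & (onto --> Range G = T.M)"
proof -
 let ?Z = "{G. good onto G & (s0, t0) : G}"
 have "EX M:?Z. ALL X:?Z. M <= X --> X = M"
 proof (rule subset_Zorn_nonempty)
  show "?Z ~= {}" using good_singleton[OF s0 t0] by blast
  fix \<C> assume ne: "\<C> ~= {}" and ch: "subset.chain ?Z \<C>"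
  have c: "\<C> <= ?Z" "!!C C'. C : \<C> ==> C' : \<C> ==> C <= C' | C' <= C"
   using ch unfolding subset_chain_def by auto
  have "good onto (\<Union>\<C>)" by (rule good_chain_Union[OF ne _ c(2)]) (use c(1) in auto)
  thus "\<Union>\<C> : ?Z" using ne c(1) by blast
 qed
 then obtain G where G: "good onto G" "(s0, t0) : G" and max': "ALL X:?Z. G <= X --> X = G" by blast
 have max: "X = G" if "good onto X" "G <= X" for X using max' that G(2) by blast
 note gd = goodD[OF G(1)]
 have fl: "full S \<P> (Domain G) x & (onto --> full T \<P>' (Range G) y)" if xy: "(x, y) : G" for x y
 using iso_graphD(1) gd(1) xy extend_at_point G(1) thin richS S.rich_def richT T.rich_def max by metis
 have clS: "closedin (mtopology_of S) (Domain G)"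
 proof (rule closedin_approx[OF subtreeD(1)[OF gd(2)]], rule ccontr)
  fix x assume x: "x : S.M" and lim: "!!e. e > 0 ==> EX a:Domain G. S.d x a < e" and n: "x ~: Domain G"
  obtain y where y: "y : T.M" "ALL e>0. EX a b. (a, b) : G & S.d x a < e & T.d y b < e"
   using iso_graph_limit[OF gd(1) T.complete_S x lim] by blast
  have "good onto (insert (x, y) G)" by (rule good_insert_limit[OF G(1) _ x n y(1)]) (use y(2) G(2) in auto)
  hence "insert (x, y) G = G" by (rule max) blast
  thus False using n by blast
 qed
 have dom: "Domain G = S.M"
 proof (rule ccontr)
  assume "Domain G ~= S.M"
  then obtain z where z: "z : S.M" "z ~: Domain G" using subtreeD(1)[OF gd(2)] by blast
  have "s0 : Domain G" using G(2) by blast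
  from S.untouched_direction[OF gd(2) clS this z] obtain x where x: "x : Domain G" "ALL a:Domain G. ~ S.sdir x z a" by blast
  then obtain y where "(x, y) : G" by blast
  from fl[OF this] have "full S \<P> (Domain G) x" by blast
  moreover have "z ~= x" using x(1) z(2) by blast
  ultimately show False using x(2) z(1) unfolding full_def by blast
 qed
 have "Range G = T.M" if onto: onto
 proof (rule ccontr)
  have iso': "iso_graph T S (G\<inverse>)"
   by (rule iso_graphI) (use iso_graphD(1)[OF gd(1)] iso_graphD(2)[OF gd(1)] in \<open>simp_all\<close>)
  have clT: "closedin (mtopology_of T) (Range G)"
  proof (rule closedin_approx[OF subtreeD(1)[OF gd(3)]])
   fix y assume y: "y : T.M" and lim: "!!e. e > 0 ==> EX a:Range G. T.d y a < e"
   obtain x where x: "x : S.M" and xlim: "ALL e>0. EX b a. (b, a) : G\<inverse> & T.d y b < e & S.d x a < e"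
    using iso_graph_limit[OF iso' S.complete_S y] lim by auto
   obtain y' where y': "(x, y') : G" using x dom by blast
   have y'T: "y' : T.M" using iso_graphD(1)[OF gd(1) y'] by blast
   have "T.d y y' <= e" if e: "e > 0" for e
   proof -
    obtain a b where ab: "(a, b) : G" "T.d y b < e/2" "S.d x a < e/2" using xlim[rule_format, of "e/2"] e by auto
    have "T.d y y' <= T.d y b + T.d b y'" by (rule mdist_triangle) (use y y'T iso_graphD(1)[OF gd(1) ab(1)] in auto)
    thus ?thesis using ab(2,3) iso_graphD(2)[OF gd(1) ab(1) y'] mdist_commute[of S a x] by linarith
   qed
   hence "y = y'" using field_le_epsilon[of "T.d y y'" 0] mdist_nonneg[of T y y'] antisym y y'T by simp
   thus "y : Range G" using y' by blast
  qed
  assume "Range G ~= T.M"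
  then obtain z where z: "z : T.M" "z ~: Range G" using subtreeD(1)[OF gd(3)] by blast
  have "t0 : Range G" using G(2) by blast
  from T.untouched_direction[OF gd(3) clT this z] obtain y where y: "y : Range G" "ALL a:Range G. ~ T.sdir y z a" by blast
  then obtain x where "(x, y) : G" by blast
  from fl[OF this] have "full T \<P>' (Range G) y" using onto by blast
  moreover have "z ~= y" using y(1) z(2) by blast
  ultimately show False using y(2) z(1) unfolding full_def by blast
 qed
 thus ?thesis using gd(1) dom by blast
qed

end

lemma iso_graph_map:
 assumes G: "iso_graph S T G" and dom: "Domain G = mspace S"
 shows "EX f. isometric_embedding S T f & f ` mspace S = Range G"
proof -
 have "ALL x:mspace S. EX y. (x, y) : G" using dom by blast
 then obtain f where f: "!!x. x : mspace S ==> (x, f x) : G" by metis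
 have "isometric_embedding S T f" unfolding isometric_embedding_def
 proof (intro conjI ballI)
  show "f : mspace S \<rightarrow> mspace T"
  using iso_graphD(1) G f by fastforce
  show "mdist T (f x) (f y) = mdist S x y" if "x : mspace S" "y : mspace S" for x y
   using iso_graphD(2)[OF G f f] that by simp
 qed
 moreover have "f ` mspace S = Range G"
 using f dom iso_graphD(3) G by fastforce
 ultimately show ?thesis by blast
qed

theorem Q_tree_embeds:
 assumes ch: "Q_choices \<Q> R D E" and S: "Q_tree \<Q> S \<P>" and c: "mspace S \<lesssim> (UNIV :: real set)"
  and T: "universal_Q_tree \<Q> R D E T \<P>'"
 shows "EX f. isometric_embedding S T f"
proof -
 have T': "Q_tree \<Q> T \<P>'" using T by (simp add: universal_Q_tree_def)
 interpret S: Q_tree_space S \<P> \<Q> R D E by (rule Q_tree_space_of_Q_tree[OF ch S])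
 interpret T: Q_tree_space T \<P>' \<Q> R D E by (rule Q_tree_space_of_Q_tree[OF ch T'])
 interpret two_Q_trees S \<P> T \<P>' \<Q> R D E by unfold_locales
 obtain s0 t0 where st: "s0 : mspace S" "t0 : mspace T" using S T' unfolding Q_tree_def by blast
 have "T.rich" using T T.universal_iff_rich by blast
 from isometric_extension[OF st S.Dirs_lepoll[OF c] this, of False]
 obtain G where "iso_graph S T G" "Domain G = mspace S" by auto
 thus ?thesis using iso_graph_map by metis
qed

theorem universal_Q_trees_isometric:
 assumes ch: "Q_choices \<Q> R D E" and S: "universal_Q_tree \<Q> R D E S \<P>" and T: "universal_Q_tree \<Q> R D E T \<P>'"
 shows "isometric S T"
proof -
 have S': "Q_tree \<Q> S \<P>" and T': "Q_tree \<Q> T \<P>'" using S T by (simp_all add: universal_Q_tree_def)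
 interpret S: Q_tree_space S \<P> \<Q> R D E by (rule Q_tree_space_of_Q_tree[OF ch S'])
 interpret T: Q_tree_space T \<P>' \<Q> R D E by (rule Q_tree_space_of_Q_tree[OF ch T'])
 interpret two_Q_trees S \<P> T \<P>' \<Q> R D E by unfold_locales
 obtain s0 t0 where st: "s0 : mspace S" "t0 : mspace T" using S' T' unfolding Q_tree_def by blast
 have rT: "T.rich" using T T.universal_iff_rich by blast
 have rS: "S.rich" using S S.universal_iff_rich by blast
 have thin: "S.Dirs x \<kappa> \<lesssim> (UNIV :: real set)" if x: "x : mspace S" for x \<kappa>
 proof (cases "\<kappa> : S.dir_kinds")
  case True
  thus ?thesis using rS x eqpoll_imp_lepoll unfolding S.rich_def by blast
 next
  case False
  hence "S.Dirs x \<kappa> = {}" unfolding S.Dirs_def using S.dir_inv_kind[OF x] by blast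
  thus ?thesis by simp
 qed
 from isometric_extension[OF st thin rT, of True] rS
 obtain G where G: "iso_graph S T G" "Domain G = mspace S" "Range G = mspace T" by auto
 from iso_graph_map[OF G(1,2)] G(3) show ?thesis unfolding isometric_def isometry_def by metis
qed

section \<open>A criterion for being tree-graded\<close>

text \<open>A way to recognize tree-graded spaces: the sets have gates \<open>\<pi> P x\<close>, and at each point there
  is a symmetric and transitive relation \<open>E x\<close> such that unrelated points are separated by
  \<open>x\<close>, while related points are either reached through a common point or both lie beyond one
  piece.\<close>
locale gated_family =
 fixes S :: "'a metric" and \<P> :: "'a set set" and \<pi> :: "'a set => 'a => 'a"
  and E :: "'a => 'a => 'a => bool"
 assumes complete: "mcomplete_of S" and geodesic: "geodesic_space S"
  and sub: "!!P. P : \<P> ==> P <= mspace S & P ~= {}"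
  and unique: "!!P P' x y. P : \<P> ==> P' : \<P> ==> x : P ==> x : P' ==> y : P ==> y : P' ==> x ~= y ==> P = P'"
  and proj_mem: "!!P x. P : \<P> ==> x : mspace S ==> \<pi> P x : P"
  and proj_betw: "!!P x q. P : \<P> ==> x : mspace S ==> q : P ==> betw S x (\<pi> P x) q"
  and proj_differ: "!!P x y. P : \<P> ==> x : mspace S ==> y : mspace S ==> \<pi> P x ~= \<pi> P y ==> betw S x (\<pi> P x) y"
  and E_sym: "!!x y z. E x y z ==> E x z y"
  and E_trans: "!!x y z v. E x y z ==> E x z v ==> E x y v"
  and E_sep: "!!x y z. x : mspace S ==> y : mspace S ==> z : mspace S ==> y ~= x ==> z ~= x ==> ~ E x y z ==> betw S y x z"
  and E_common: "!!x y z. x : mspace S ==> y : mspace S ==> z : mspace S ==> y ~= x ==> z ~= x ==> E x y z ==>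
    (EX w. w ~= x & betw S x w y & betw S x w z) | (EX P:\<P>. x : P & \<pi> P y ~= x & \<pi> P z ~= x)"
begin

abbreviation "M \<equiv> mspace S"
abbreviation "d \<equiv> mdist S"

lemma mem: "P : \<P> ==> x : P ==> x : M"
 using sub by blast

lemma convex:
 assumes P: "P : \<P>" "p : P" "q : P" and b: "betw S p u q"
 shows "u : P"
proof -
 have u: "u : M" using b by (simp add: betw_def)
 let ?g = "\<pi> P u"
 have g: "?g : P" "?g : M" using proj_mem[OF P(1) u] mem[OF P(1)] by auto
 have "betw S u ?g p" "betw S u ?g q" using proj_betw[OF P(1) u] P by auto
 moreover have "d p q <= d p ?g + d ?g q" by (rule mdist_triangle) (use g mem[OF P(1)] P in auto)
 ultimately have "d u ?g = 0"
  using b[unfolded betw_def] mdist_nonneg[of S u ?g] mdist_commute[of S p u] mdist_commute[of S p ?g]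
  unfolding betw_def by linarith
 thus ?thesis using u g by simp
qed

lemma proj_self: "P : \<P> ==> x : P ==> \<pi> P x = x"
 using proj_betw[of P x x] mem[of P x] betw_self[of S x "\<pi> P x"] by blast

lemma piece_closedin:
 assumes P: "P : \<P>"
 shows "closedin (mtopology_of S) P"
proof (rule closedin_approx)
 show "P <= M" using sub[OF P] by simp
 fix x assume x: "x : M" and lim: "!!e. e > 0 ==> EX a:P. d x a < e"
 have g: "\<pi> P x : P" "\<pi> P x : M" using proj_mem[OF P x] mem[OF P] by auto
 have "~ 0 < d x (\<pi> P x)"
 proof
  assume "0 < d x (\<pi> P x)"
  then obtain a where a: "a : P" "d x a < d x (\<pi> P x)" using lim by blast
  show False using proj_betw[OF P x a(1)] betw_def a(2) mdist_nonneg[of S "\<pi> P x" a] by (simp add: betw_def)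
 qed
 thus "x : P" using mdist_pos[OF x g(2)] g(1) by metis
qed

lemma piece_geodesic:
 assumes P: "P : \<P>"
 shows "geodesic_space (submetric S P)"
 unfolding geodesic_space_def
proof (intro ballI)
 fix x y assume "x : mspace (submetric S P)" "y : mspace (submetric S P)"
 hence xy: "x : P" "y : P" "x : M" "y : M" by auto
 obtain g where g: "geo S g (d x y) x y" using geodesic_space_geo[OF geodesic xy(3,4)] by metis
 have in_P: "g t : P" if "0 <= t" "t <= d x y" for t
  by (rule convex[OF P xy(1,2) geo_betw_ends[OF g that]])
 have "geo (submetric S P) g (d x y) x y"
 proof (rule geoI)
  show "0 <= d x y" "g 0 = x" "g (d x y) = y" using geoD(1-3)[OF g] by simp_all
  show "g t : mspace (submetric S P)" if "0 <= t" "t <= d x y" for t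
   using in_P[OF that] geoD(7)[OF g that] by simp
  show "mdist (submetric S P) (g s) (g t) = t - s" if "0 <= s" "s <= t" "t <= d x y" for s t
   using geoD(8)[OF g, of s t] that by simp
 qed
 thus "EX \<gamma> r. geodesic (submetric S P) \<gamma> 0 r & \<gamma> 0 = x & \<gamma> r = y" unfolding geo_def by blast
qed

lemma initial_segment_in_piece:
 assumes P: "P : \<P>" "x : P" and g: "geo S g r x y" and ne: "\<pi> P y ~= x"
 shows "EX e. 0 < e & e <= r & (ALL t. 0 <= t & t <= e --> g t : P)"
proof -
 have M: "x : M" "y : M" using geoD(4,5)[OF g] .
 have r: "0 < r" using ne proj_self[OF P] geoD(6)[OF g] mdist_pos[OF M] by auto
 have "EX t. 0 < t & t <= r & g t : P"
 proof (rule ccontr)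
  assume "~ ?thesis"
  hence out: "g t ~: P" if "0 < t" "t <= r" for t using that by blast
  let ?h = "\<pi> P y"
  have hM: "?h : M" "?h : P" using proj_mem[OF P(1) M(2)] mem[OF P(1)] by auto
  define t where "t = min r (d x ?h / 2)"
  have t: "0 < t" "t <= r" "t < d x ?h" using r mdist_pos[OF M(1) hM(1) ne[symmetric]] by (auto simp: t_def)
  have "\<pi> P (g t) = \<pi> P (g r)"
  proof (rule interval_chain[of t r "%s s'. \<pi> P (g s) = \<pi> P (g s')"])
   fix s assume s: "s : {t..r}"
   have gs: "g s : M" "g s ~: P" using geoD(7)[OF g, of s] out[of s] s t by auto
   have pM: "\<pi> P (g s) : M" using proj_mem[OF P(1) gs(1)] mem[OF P(1)] by blast
   have "g s ~= \<pi> P (g s)" using proj_mem[OF P(1) gs(1)] gs(2) by metis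
   hence pos: "0 < d (g s) (\<pi> P (g s))" by (rule mdist_pos[OF gs(1) pM])
   have "\<pi> P (g s) = \<pi> P (g s')" if s': "s' : {t..r}" "\<bar>s' - s\<bar> < d (g s) (\<pi> P (g s))" for s'
   proof (rule ccontr)
    assume n: "\<pi> P (g s) ~= \<pi> P (g s')"
    have gs': "g s' : M" using geoD(7)[OF g, of s'] s'(1) t by auto
    have "d (g s) (\<pi> P (g s)) + d (\<pi> P (g s)) (g s') = d (g s) (g s')"
     using proj_differ[OF P(1) gs(1) gs' n] by (simp add: betw_def)
    moreover have "d (g s) (g s') = \<bar>s - s'\<bar>" by (rule geoD(8)[OF g]) (use s s'(1) t in auto)
    ultimately show False using s'(2) mdist_nonneg[of S "\<pi> P (g s)" "g s'"] abs_minus_commute[of s s'] by linarith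
   qed
   thus "EX e>0. ALL s':{t..r}. \<bar>s' - s\<bar> < e --> \<pi> P (g s) = \<pi> P (g s')" using pos by blast
  qed (use t in auto)
  hence "\<pi> P (g t) = ?h" using geoD(3)[OF g] by simp
  moreover have gt: "g t : M" using geoD(7)[OF g, of t] t by simp
  ultimately have "d (g t) ?h + d ?h x = d (g t) x" using proj_betw[OF P(1) gt P(2)] by (simp add: betw_def)
  thus False using t(3) mdist_nonneg[of S "g t" ?h] mdist_commute[of S "g t" x] mdist_commute[of S ?h x] geo_dist(1)[OF g, of t] t by linarith
 qed
 then obtain e where e: "0 < e" "e <= r" "g e : P" by blast
 have "g t : P" if "0 <= t" "t <= e" for t
 proof (rule convex[OF P(1,2) e(3)])
  show "betw S x (g t) (g e)" using geo_betw[OF g, of 0 t e] that e geoD(2)[OF g] by simp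
 qed
 thus ?thesis using e by blast
qed

context
 fixes c u v l
 assumes l: "0 < l" and g1: "geodesic S c 0 u" and g2: "geodesic S c u v" and g3: "geodesic S c v l"
  and loop: "c l = c 0" and inj: "inj_on c {0..<l}"
begin

lemma order: "0 <= u" "u <= v" "v <= l"
 using g1 g2 g3 by (auto simp: geodesic_def)

lemma seg_dist: "geodesic S c p q ==> p <= s ==> s <= t ==> t <= q ==> d (c s) (c t) = t - s"
 unfolding geodesic_def by auto

lemma cM: "0 <= t ==> t <= l ==> c t : M"
proof -
 assume t: "0 <= t" "t <= l"
 consider "t : {0..u}" | "t : {u..v}" | "t : {v..l}" using t by fastforce
 thus ?thesis
 proof cases
  case 1 thus ?thesis using g1 unfolding geodesic_def by blast
 next
  case 2 thus ?thesis using g2 unfolding geodesic_def by blast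
 next
  case 3 thus ?thesis using g3 unfolding geodesic_def by blast
 qed
qed

lemma lip_le: "0 <= s ==> s <= t ==> t <= l ==> d (c s) (c t) <= t - s"
proof -
 assume st: "0 <= s" "s <= t" "t <= l"
 note o = order
 have via: "d (c s) (c t) <= d (c s) (c m) + d (c m) (c t)" if "0 <= m" "m <= l" for m
  by (rule mdist_triangle) (use cM st that in auto)
 have A: "d (c s) (c t) <= t - s" if "0 <= s" "s <= t" "t <= v" for s t
 proof -
  consider "t <= u" | "u <= s" | "s <= u" "u <= t" by linarith
  thus ?thesis
  proof cases
   case 1 thus ?thesis using seg_dist[OF g1, of s t] that by simp
  next
   case 2 thus ?thesis using seg_dist[OF g2, of s t] that by simp
  next
   case 3
   have "d (c s) (c t) <= d (c s) (c u) + d (c u) (c t)"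
    by (rule mdist_triangle) (use cM that o in auto)
   thus ?thesis using seg_dist[OF g1, of s u] seg_dist[OF g2, of u t] 3 that o by simp
  qed
 qed
 consider "t <= v" | "v <= s" | "s <= v" "v <= t" by linarith
 thus "d (c s) (c t) <= t - s"
 proof cases
  case 1 thus ?thesis using A st by simp
 next
  case 2 thus ?thesis using seg_dist[OF g3, of s t] st by simp
 next
  case 3
  show ?thesis using o via[of v] A[of s v] seg_dist[OF g3, of v t] 3 st by simp
 qed
qed

lemma lip: "0 <= s ==> s <= l ==> 0 <= t ==> t <= l ==> d (c s) (c t) <= \<bar>t - s\<bar>"
 using lip_le[of s t] lip_le[of t s] mdist_commute[of S "c s" "c t"] by (cases "s <= t") auto

lemma chain_E:
 assumes pq: "0 <= p" "p <= q" "q <= l" and x: "x : M" and ne: "!!r. p <= r ==> r <= q ==> c r ~= x"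
 shows "E x (c p) (c q)"
proof (rule interval_chain[of p q "%s s'. E x (c s) (c s')"])
 fix s assume s: "s : {p..q}"
 have cs: "c s : M" "c s ~= x" using cM[of s] ne[of s] s pq by auto
 have "E x (c s) (c t)" if t: "t : {p..q}" "\<bar>t - s\<bar> < d (c s) x" for t
 proof (rule ccontr)
  assume n: "~ E x (c s) (c t)"
  have ct: "c t : M" "c t ~= x" using cM[of t] ne[of t] t pq by auto
  have "d (c s) x + d x (c t) = d (c s) (c t)" using E_sep[OF x cs(1) ct(1) cs(2) ct(2) n] by (simp add: betw_def)
  moreover have "d (c s) (c t) <= \<bar>t - s\<bar>" by (rule lip) (use s t pq in auto)
  ultimately show False using t(2) mdist_nonneg[of S x "c t"] by linarith
 qed
 thus "EX e>0. ALL t:{p..q}. \<bar>t - s\<bar> < e --> E x (c s) (c t)" using mdist_pos[OF cs(1) x cs(2)] by blast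
next
 show "p <= q" by (rule pq(2))
next
 fix s t assume "E x (c s) (c t)" thus "E x (c t) (c s)" by (rule E_sym)
next
 fix r s t assume "E x (c r) (c s)" "E x (c s) (c t)" thus "E x (c r) (c t)" by (rule E_trans)
qed

lemma c_eq: "0 <= s ==> s <= l ==> 0 < t ==> t < l ==> c s = c t ==> s = t"
proof -
 assume st: "0 <= s" "s <= l" "0 < t" "t < l" "c s = c t"
 show "s = t"
 proof (cases "s = l")
  case True
  hence "c 0 = c t" using st loop by simp
  thus ?thesis using inj_onD[OF inj, of 0 t] st l by simp
 next
  case False
  thus ?thesis using inj_onD[OF inj, of s t] st by simp
 qed
qed

text \<open>Going round the loop the other way avoids \<open>c \<tau>\<close>.\<close>
lemma around:
 assumes "0 <= a" "a < \<tau>" "\<tau> < b" "b <= l"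
 shows "E (c \<tau>) (c a) (c b)"
proof -
 have \<tau>: "0 < \<tau>" "\<tau> < l" "c \<tau> : M" using assms cM[of \<tau>] by auto
 have ne: "c r ~= c \<tau>" if "0 <= r" "r <= l" "r ~= \<tau>" for r using c_eq[of r \<tau>] that \<tau> by blast
 have "E (c \<tau>) (c 0) (c a)"
 proof (rule chain_E[OF order_refl assms(1) _ \<tau>(3)])
  show "a <= l" using assms by simp
  show "c r ~= c \<tau>" if "0 <= r" "r <= a" for r by (rule ne) (use that assms in auto)
 qed
 moreover have "E (c \<tau>) (c b) (c l)"
 proof (rule chain_E[OF _ assms(4) order_refl \<tau>(3)])
  show "0 <= b" using assms by simp
  show "c r ~= c \<tau>" if "b <= r" "r <= l" for r by (rule ne) (use that assms in auto)
 qed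
 ultimately show ?thesis using E_trans[OF E_sym E_sym] loop by metis
qed

text \<open>The two halves of the side are related at \<open>c t\<close>, as the rest of the loop joins them. They have
  no common point other than \<open>c t\<close>, so both start inside one piece.\<close>
lemma interior_point_in_piece:
 assumes g: "geodesic S c p q" and pq: "0 <= p" "q <= l" and t: "p < t" "t < q"
 shows "EX P:\<P>. EX e>0. p <= t - e & t + e <= q & (ALL s. t - e <= s & s <= t + e --> c s : P)"
proof -
 let ?x = "c t"
 have M: "?x : M" "c p : M" "c q : M" using cM pq t by auto
 have dp: "d (c p) ?x = t - p" "d ?x (c q) = q - t" "d (c p) (c q) = q - p" using seg_dist[OF g] t by auto
 have ne: "c p ~= ?x" "c q ~= ?x" using dp M t by auto
 have bx: "betw S (c p) ?x (c q)" using dp M by (simp add: betw_def)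
 have "E ?x (c p) (c q)" by (rule around) (use pq t in auto)
 from E_common[OF M ne this] show ?thesis
 proof
  assume "EX w. w ~= ?x & betw S ?x w (c p) & betw S ?x w (c q)"
  then obtain w where w: "w ~= ?x" "betw S ?x w (c p)" "betw S ?x w (c q)" by blast
  have "w = ?x" using betw_trans(2)[OF bx betw_sym[OF w(2)]] betw_antisym[OF betw_sym[OF w(3)] betw_sym] by blast
  thus ?thesis using w(1) by simp
 next
  assume "EX P:\<P>. ?x : P & \<pi> P (c p) ~= ?x & \<pi> P (c q) ~= ?x"
  then obtain P where P: "P : \<P>" "?x : P" "\<pi> P (c p) ~= ?x" "\<pi> P (c q) ~= ?x" by blast
  have r: "geo S (%s. c (t + s)) (q - t) ?x (c q)"
   by (rule geoI) (use cM pq t seg_dist[OF g] in auto)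
  have lf: "geo S (%s. c (t - s)) (t - p) ?x (c p)"
  proof (rule geoI)
   show "d (c (t - s)) (c (t - s')) = s' - s" if "0 <= s" "s <= s'" "s' <= t - p" for s s'
    using seg_dist[OF g, of "t - s'" "t - s"] that t mdist_commute[of S "c (t - s)" "c (t - s')"] by simp
  qed (use cM pq t in auto)
  obtain e1 where e1: "0 < e1" "e1 <= q - t" "ALL s. 0 <= s & s <= e1 --> c (t + s) : P"
   using initial_segment_in_piece[OF P(1,2) r P(4)] by blast
  obtain e2 where e2: "0 < e2" "e2 <= t - p" "ALL s. 0 <= s & s <= e2 --> c (t - s) : P"
   using initial_segment_in_piece[OF P(1,2) lf P(3)] by blast
  let ?e = "min e1 e2"
  have "c s : P" if "t - ?e <= s" "s <= t + ?e" for s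
  proof (cases "t <= s")
   case True
   hence "c (t + (s - t)) : P" using e1(3)[rule_format, of "s - t"] that by simp
   thus ?thesis by simp
  next
   case False
   hence "c (t - (t - s)) : P" using e2(3)[rule_format, of "t - s"] that by simp
   thus ?thesis by simp
  qed
  thus ?thesis using P(1) e1 e2 by (intro bexI[of _ P] exI[of _ ?e]) auto
 qed
qed

text \<open>Pieces found at neighbouring interior points have more than one point in common, so a single piece contains
  the interior of the side, and it is closed.\<close>
lemma side_in_piece:
 assumes g: "geodesic S c p q" and pq: "0 <= p" "p < q" "q <= l"
 shows "EX P:\<P>. ALL t. p <= t & t <= q --> c t : P"
proof -
 define nb where "nb P t <-> (EX e>0. p <= t - e & t + e <= q & (ALL s. t - e <= s & s <= t + e --> c s : P))" for P t
 have ex: "EX P:\<P>. nb P t" if "p < t" "t < q" for t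
  using interior_point_in_piece[OF g pq(1,3) that] unfolding nb_def .
 have nb_unique: "P = P'" if P: "P : \<P>" "nb P t" and P': "P' : \<P>" "nb P' t" for P P' t
 proof -
  obtain e where e: "e > 0" "p <= t - e" "t + e <= q" "ALL s. t - e <= s & s <= t + e --> c s : P" using P(2) unfolding nb_def by blast
  obtain e' where e': "e' > 0" "ALL s. t - e' <= s & s <= t + e' --> c s : P'" using P'(2) unfolding nb_def by blast
  let ?s = "t + min e e'"
  have s: "c t : P" "c t : P'" "c ?s : P" "c ?s : P'" using e e' by auto
  have "d (c t) (c ?s) = ?s - t" by (rule seg_dist[OF g]) (use e e' in auto)
  hence "d (c t) (c ?s) ~= 0" using e(1) e'(1) by simp
  thus ?thesis using mem[OF P(1) s(1)] unique[OF P(1) P'(1) s] by fastforce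
 qed
 let ?m = "(p + q) / 2"
 have m: "p < ?m" "?m < q" using pq by auto
 obtain P where P: "P : \<P>" "nb P ?m" using ex[OF m] by blast
 have all: "nb P t" if t: "p < t" "t < q" for t
 proof -
  let ?R = "%s s'. EX P:\<P>. nb P s & nb P s'"
  have ch: "?R a b" if ab: "p < a" "a <= b" "b < q" for a b
  proof (rule interval_chain[of a b ?R])
   show "a <= b" by (rule ab(2))
   show "?R s' s" if "?R s s'" for s s' using that by blast
   show "?R r s'" if "?R r s" "?R s s'" for r s s' using that nb_unique by metis
   fix s assume s: "s : {a..b}"
   obtain P e where P: "P : \<P>" and e: "e > 0" "p <= s - e" "s + e <= q" "ALL r. s - e <= r & r <= s + e --> c r : P"
    using ex[of s] s ab unfolding nb_def by auto
   have nbs: "nb P s" unfolding nb_def using e by blast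
   have "nb P s'" if s': "\<bar>s' - s\<bar> < e" for s'
    unfolding nb_def
   proof (intro exI[of _ "e - \<bar>s' - s\<bar>"] conjI allI impI)
    show "0 < e - \<bar>s' - s\<bar>" "p <= s' - (e - \<bar>s' - s\<bar>)" "s' + (e - \<bar>s' - s\<bar>) <= q" using s' e by linarith+
    fix r assume "s' - (e - \<bar>s' - s\<bar>) <= r & r <= s' + (e - \<bar>s' - s\<bar>)"
    thus "c r : P" by (intro e(4)[rule_format]) linarith
   qed
   thus "EX e>0. ALL t:{a..b}. \<bar>t - s\<bar> < e --> ?R s t" using e(1) P nbs by blast
  qed
  have "?R ?m t"
  proof (cases "?m <= t")
   case True
   show ?thesis by (rule ch[OF m(1) True t(2)])
  next
   case False
   hence "?R t ?m" using ch[OF t(1) _ m(2)] by simp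
   thus ?thesis by blast
  qed
  then obtain P' where P': "P' : \<P>" "nb P' ?m" "nb P' t" by blast
  show ?thesis using nb_unique[OF P'(1,2) P] P'(3) by simp
 qed
 have inner: "c t : P" if t: "p < t" "t < q" for t
 proof -
  obtain e where "e > 0" "ALL s. t - e <= s & s <= t + e --> c s : P" using all[OF t] unfolding nb_def by blast
  thus ?thesis by simp
 qed
 have lim: "c t : P" if t: "t = p | t = q" for t
 proof (rule ccontr)
  assume n: "c t ~: P"
  have ct: "c t : M" using cM[of t] t pq by auto
  have pM: "\<pi> P (c t) : M" "\<pi> P (c t) : P" using proj_mem[OF P(1) ct] mem[OF P(1)] by auto
  have pos: "0 < d (c t) (\<pi> P (c t))" by (rule mdist_pos[OF ct pM(1)]) (use n pM(2) in metis)
  define e where "e = min ((q - p) / 2) (d (c t) (\<pi> P (c t)) / 2)"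
  have e: "0 < e" "e < q - p" "e < d (c t) (\<pi> P (c t))" using pos pq by (auto simp: e_def min_less_iff_disj)
  define s where "s = (if t = p then p + e else q - e)"
  have s: "p < s" "s < q" "\<bar>s - t\<bar> = e" using t e pq by (auto simp: s_def)
  have "d (c t) (\<pi> P (c t)) + d (\<pi> P (c t)) (c s) = d (c t) (c s)"
   using proj_betw[OF P(1) ct inner[OF s(1,2)]] by (simp add: betw_def)
  moreover have "d (c t) (c s) <= \<bar>s - t\<bar>" by (rule lip) (use t s pq in auto)
  ultimately show False using e(3) s(3) mdist_nonneg[of S "\<pi> P (c t)" "c s"] by linarith
 qed
 have "c t : P" if "p <= t" "t <= q" for t
  using inner[of t] lim[of t] that by fastforce
 thus ?thesis using P(1) by blast
qed

text \<open>Going round the loop, the points \<open>c p\<close> and \<open>c q\<close> are related at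
  \<open>c \<tau>\<close>. A point shared by geodesics to both of them would be in \<open>P1\<close> and
  \<open>P2\<close>, and so would, by convexity, a set beyond which both of them lie have two points in common
  with each of these.\<close>
lemma join_sides:
 assumes P: "P1 : \<P>" "P2 : \<P>" and t: "0 <= p" "p < \<tau>" "\<tau> < q" "q <= l"
  and 1: "!!s. p <= s ==> s <= \<tau> ==> c s : P1" and 2: "!!s. \<tau> <= s ==> s <= q ==> c s : P2"
 shows "P1 = P2"
proof -
 let ?x = "c \<tau>"
 have in_P: "c p : P1" "?x : P1" "?x : P2" "c q : P2" using 1 2 t by auto
 have M: "?x : M" "c p : M" "c q : M" using cM t by auto
 have ne: "c p ~= ?x" "c q ~= ?x" using c_eq[of p \<tau>] c_eq[of q \<tau>] t by auto
 from E_common[OF M ne around[OF t]] show ?thesis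
 proof
  assume "EX w. w ~= ?x & betw S ?x w (c p) & betw S ?x w (c q)"
  then obtain w where w: "w ~= ?x" "betw S ?x w (c p)" "betw S ?x w (c q)" by blast
  have "w : P2" by (rule convex[OF P(2) in_P(3,4) w(3)])
  thus ?thesis using unique[OF P _ _ in_P(2,3) w(1)] convex[OF P(1) in_P(2,1) w(2)] by blast
 next
  assume "EX P:\<P>. ?x : P & \<pi> P (c p) ~= ?x & \<pi> P (c q) ~= ?x"
  then obtain Q where Q: "Q : \<P>" "?x : Q" "\<pi> Q (c p) ~= ?x" "\<pi> Q (c q) ~= ?x" by blast
  have "Q = P1" using convex[OF P(1) in_P(1,2) proj_betw[OF Q(1) M(2) Q(2)]] unique[OF Q(1) P(1) proj_mem[OF Q(1) M(2)] _ Q(2) in_P(2) Q(3)] by blast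
  moreover have "\<pi> Q (c q) : P2" by (rule convex[OF P(2) in_P(4,3) proj_betw[OF Q(1) M(3) Q(2)]])
  hence "Q = P2" using unique[OF Q(1) P(2) proj_mem[OF Q(1) M(3)] _ Q(2) in_P(3) Q(4)] by blast
  ultimately show ?thesis by simp
 qed
qed

lemma two_sides:
 assumes g: "geodesic S c p q" and h: "geodesic S c q r" and o: "0 <= p" "p < q" "q < r" "r <= l"
 shows "EX P:\<P>. ALL t. p <= t & t <= r --> c t : P"
proof -
 obtain P1 where P1: "P1 : \<P>" "ALL t. p <= t & t <= q --> c t : P1" using side_in_piece[OF g o(1,2)] o by auto
 obtain P2 where P2: "P2 : \<P>" "ALL t. q <= t & t <= r --> c t : P2" using side_in_piece[OF h _ o(3,4)] o by auto
 have "P1 = P2" by (rule join_sides[OF P1(1) P2(1) o]) (use P1(2) P2(2) in simp_all)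
 hence "c t : P1" if "p <= t" "t <= r" for t using P1(2) P2(2) that by (cases "t <= q") auto
 thus ?thesis using P1(1) by blast
qed

lemma loop_in_piece: "EX P:\<P>. c ` {0..l} <= P"
proof -
 note o = order
 have not_one: "~ geodesic S c 0 l"
 proof
  assume "geodesic S c 0 l"
  hence "d (c 0) (c l) = l - 0" using l by (intro seg_dist) auto
  thus False using loop l cM[of 0] by simp
 qed
 have "EX P:\<P>. ALL t. 0 <= t & t <= l --> c t : P"
 proof (cases "u = 0 | u = v | v = l")
  case True
  then obtain q where q: "geodesic S c 0 q" "geodesic S c q l" "0 <= q" "q <= l" using g1 g2 g3 o by metis
  show ?thesis using q not_one two_sides[OF q(1,2)] q(3,4) by fastforce
 next
  case False
  hence lt: "0 < u" "u < v" "v < l" using o by auto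
  obtain P1 where P1: "P1 : \<P>" "ALL t. 0 <= t & t <= v --> c t : P1" using two_sides[OF g1 g2] lt by auto
  obtain P2 where P2: "P2 : \<P>" "ALL t. u <= t & t <= l --> c t : P2" using two_sides[OF g2 g3] lt by auto
  have "P1 = P2" by (rule join_sides[of _ _ 0 u l]) (use P1 P2 lt in auto)
  hence "c t : P1" if "0 <= t" "t <= l" for t using P1(2) P2(2) that lt by (cases "t <= v") auto
  thus ?thesis using P1(1) by blast
 qed
 then obtain P where P: "P : \<P>" "ALL t. 0 <= t & t <= l --> c t : P" by blast
 have "c ` {0..l} <= P" by (rule image_subsetI) (use P(2) in simp)
 thus ?thesis using P(1) by blast
qed

end

theorem is_tree_graded: "tree_graded S \<P>"
 unfolding tree_graded_def
proof (intro conjI ballI allI impI)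
 show "mcomplete_of S" "geodesic_space S" by (rule complete, rule geodesic)
 show "closedin (mtopology_of S) P" "geodesic_space (submetric S P)" "P ~= {}" if "P : \<P>" for P
  using piece_closedin piece_geodesic sub that by auto
 show "x = y" if "P : \<P>" "P' : \<P>" "P ~= P'" "x : P Int P'" "y : P Int P'" for P P' x y
  using unique[OF that(1,2), of x y] that(3-5) by blast
 fix T assume "nontrivial_simple_geodesic_triangle S T"
 then obtain c u v l where c: "0 < l" "geodesic S c 0 u" "geodesic S c u v" "geodesic S c v l"
  "c l = c 0" "inj_on c {0..<l}" "T = c ` {0..l}" unfolding nontrivial_simple_geodesic_triangle_def by blast
 show "EX P:\<P>. T <= P" unfolding c(7) by (rule loop_in_piece[OF c(1-6)])
qed

end

section \<open>Words\<close>

type_synonym 'q label = "real \<times> 'q \<times> 'q metric"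

text \<open>An entry is encoded as a list, so that the points of the model are sets of lists of labels. The first
  element only holds the time.\<close>
definition entry :: "real => 'q label => 'q label list" where
 "entry t l = [(t, undefined, undefined), l]"

definition tm :: "'q label list => real" where
 "tm e = fst (hd e)"

text \<open>The empty metric space is not the space of a piece label, so plain labels and piece labels are different.\<close>
definition plain :: "real => 'q label" where
 "plain c = (c, undefined, metric ({}, %_ _. 0))"

lemma entry_eq_iff [simp]: "entry t l = entry t' l' <-> t = t' & l = l'"
 by (simp add: entry_def)

lemma tm_entry [simp]: "tm (entry t l) = t"
 by (simp add: entry_def tm_def)

lemma plain_eq_iff [simp]: "plain c = plain c' <-> c = c'"
 by (simp add: plain_def)

context Q_choices
begin

definition origin :: "'q metric => 'q" where
 "origin Q = (SOME e. e : mspace Q)"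

definition piece_label :: "'q label => bool" where
 "piece_label l <-> snd (snd l) : R & fst (snd l) : mspace (snd (snd l)) & fst (snd l) ~= origin (snd (snd l))"

definition len :: "'q label => real" where
 "len l = (if piece_label l then mdist (snd (snd l)) (origin (snd (snd l))) (fst (snd l)) else 0)"

definition label_ok :: "'q label => bool" where
 "label_ok l <-> piece_label l | (EX c. l = plain c)"

abbreviation "rad Q \<equiv> mdist Q (origin Q)"

lemma origin_mem: "y : mspace Q ==> origin Q : mspace Q"
 unfolding origin_def by (rule someI)

lemma not_piece_plain [simp]: "~ piece_label (plain c)"
proof -
 interpret Metric_space "{}" "%_ _. 0" by unfold_locales auto
 show ?thesis unfolding piece_label_def plain_def by (simp add: mspace_metric)
qed

lemma len_plain [simp]: "len (plain c) = 0"
 by (simp add: len_def)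

lemma piece_labelD:
 "piece_label (c, y, Q) ==> Q : R & y : mspace Q & y ~= origin Q & origin Q : mspace Q"
 unfolding piece_label_def using origin_mem by auto

lemma len_piece: "piece_label (c, y, Q) ==> len (c, y, Q) = rad Q y"
 by (simp add: len_def)

lemma len_pos: "piece_label l ==> 0 < len l"
proof -
 assume l: "piece_label l"
 obtain c y Q where e: "l = (c, y, Q)" using prod_cases3 by blast
 note p = piece_labelD[OF l[unfolded e]]
 have "0 < rad Q y" by (rule mdist_pos) (use p in auto)
 thus ?thesis using l unfolding e by (simp add: len_piece)
qed

text \<open>The entries tile \<open>[0, \<rho>)\<close>: a piece entry takes up the time interval of its length, a plain
  entry a single moment.\<close>
definition tiles :: "'q tree_point => real => bool" where
 "tiles w \<rho> <-> 0 <= \<rho> &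
   (ALL e:w. EX t l. e = entry t l & label_ok l & 0 <= t & t < \<rho> & t + len l <= \<rho>) &
   (ALL t l t' l'. entry t l : w --> entry t' l' : w --> t <= t' --> (t = t' & l = l') | (t < t' & t + len l <= t')) &
   (ALL s. 0 <= s --> s < \<rho> --> (EX t l. entry t l : w & t <= s & (s = t | s < t + len l)))"

text \<open>A pair \<open>(p, q)\<close> is moved so that \<open>p\<close> becomes the origin of \<open>Q\<close>. The
  representative \<open>y\<close> need not be unique, and one is fixed for each pair.\<close>
definition exit_point :: "'q metric => 'q => 'q => 'q" where
 "exit_point Q p q = (SOME y. EX g. isometry Q Q g & g p = origin Q & g q = y)"

text \<open>The walk that a type \<open>f\<close> prescribes from time \<open>t\<close>: piece entries during the
  intervals of the type and plain entries at all other times.\<close>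
definition continuation :: "real => real => (real \<times> real \<rightharpoonup> 'q metric \<times> 'q \<times> 'q) => 'q tree_point" where
 "continuation t c f =
   {entry (t + u) (plain c) | u. 0 <= u & (ALL a b. (a, b) : dom f --> ~ (a <= u & u < b))} Un
   {entry (t + a) (c, exit_point Q p q, Q) | a b Q p q. f (a, b) = Some (Q, p, q)}"

text \<open>Shortly after a plain entry the word is determined by a type and the number of that entry. Without this
  condition arbitrary changes of the numbers at plain entries would produce too many directions.\<close>
definition tame :: "'q tree_point => bool" where
 "tame w <-> (ALL t c. entry t (plain c) : w --> (EX U f. (U, f) : Q_types R D &
   (EX \<epsilon>>0. ALL s l. t <= s --> s < t + \<epsilon> --> (entry s l : w <-> entry s l : continuation t c f))))"

definition word :: "'q tree_point => bool" where
 "word w <-> (EX \<rho>. tiles w \<rho>) & tame w"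

definition ht :: "'q tree_point => real" where
 "ht w = (THE \<rho>. tiles w \<rho>)"

definition cut :: "'q tree_point => real => 'q tree_point" where
 "cut w t = {e : w. tm e < t}"

text \<open>Times at which the word is not in the middle of a piece.\<close>
definition bd :: "'q tree_point => real => bool" where
 "bd w t <-> t = ht w | (EX l. entry t l : w)"

lemma tilesD:
 assumes "tiles w \<rho>"
 shows "0 <= \<rho>" "e : w ==> EX t l. e = entry t l"
  "entry t l : w ==> label_ok l & 0 <= t & t < \<rho> & t + len l <= \<rho>"
  "entry t l : w ==> entry t' l' : w ==> t <= t' ==> (t = t' & l = l') | (t < t' & t + len l <= t')"
  "0 <= s ==> s < \<rho> ==> EX t l. entry t l : w & t <= s & (s = t | s < t + len l)"
proof -
 note a = assms[unfolded tiles_def]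
 show "0 <= \<rho>" using a by (elim conjE)
 have 2: "EX t l. e = entry t l & label_ok l & 0 <= t & t < \<rho> & t + len l <= \<rho>" if "e : w" for e
  using a[THEN conjunct2, THEN conjunct1, rule_format, OF that] .
 show "e : w ==> EX t l. e = entry t l" using 2[of e] by blast
 show "entry t l : w ==> label_ok l & 0 <= t & t < \<rho> & t + len l <= \<rho>" using 2[of "entry t l"] by auto
 show "entry t l : w ==> entry t' l' : w ==> t <= t' ==> (t = t' & l = l') | (t < t' & t + len l <= t')"
  using a[THEN conjunct2, THEN conjunct2, THEN conjunct1, rule_format, of t l t' l'] .
 show "0 <= s ==> s < \<rho> ==> EX t l. entry t l : w & t <= s & (s = t | s < t + len l)"
  using a[THEN conjunct2, THEN conjunct2, THEN conjunct2, rule_format, of s] .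
qed

lemma tiles_le:
 assumes "tiles w \<rho>" "tiles w \<rho>'"
 shows "\<rho>' <= \<rho>"
proof (rule ccontr)
 assume "~ \<rho>' <= \<rho>"
 then obtain t l where e: "entry t l : w" "t <= \<rho>" "\<rho> = t | \<rho> < t + len l"
  using tilesD(5)[OF assms(2), of \<rho>] tilesD(1)[OF assms(1)] by auto
 thus False using tilesD(3)[OF assms(1) e(1)] by auto
qed

lemma ht_eq: "tiles w \<rho> ==> ht w = \<rho>"
 unfolding ht_def by (rule the_equality) (auto intro: antisym tiles_le)

lemma word_tiles: "word w ==> tiles w (ht w)"
 unfolding word_def using ht_eq by blast

lemmas wordD = tilesD[OF word_tiles]

lemma word_tame: "word w ==> tame w"
 by (simp add: word_def)

lemma entry_unique: "word w ==> entry t l : w ==> entry t l' : w ==> l = l'"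
 using wordD(4)[of w t l t l'] by auto

lemma entry_gap:
 assumes "word w" "entry t l : w" "entry t' l' : w" "t < t'"
 shows "t + len l <= t'"
 using wordD(4)[OF assms(1-3)] assms(4) by auto

lemma bd_le: "word w ==> bd w t ==> 0 <= t & t <= ht w"
 unfolding bd_def using wordD(1)[of w] wordD(3)[of w t] by (elim disjE exE) fastforce+

lemma bd_entry: "word w ==> bd w t ==> t < ht w ==> EX l. entry t l : w"
 unfolding bd_def by auto

lemma word_empty: "word {}" and ht_empty: "ht {} = 0"
using tiles_def word_def tame_def ht_eq by auto

lemma cut_mem: "entry t l : cut w s <-> entry t l : w & t < s"
 by (simp add: cut_def)

lemma cut_subset: "cut w s <= w"
 by (auto simp: cut_def)

text \<open>The type that governs \<open>w\<close> after a plain entry governs the part of \<open>w\<close> before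
  \<open>s\<close> too, up to \<open>s\<close>.\<close>
lemma tame_cut:
 assumes "tame w"
 shows "tame (cut w s)"
 unfolding tame_def
proof (intro allI impI)
 fix t c assume e: "entry t (plain c) : cut w s"
 hence e': "entry t (plain c) : w" "t < s" by (auto simp: cut_mem)
 obtain U f \<epsilon> where f: "(U, f) : Q_types R D" "\<epsilon> > 0"
  "ALL s l. t <= s --> s < t + \<epsilon> --> (entry s l : w <-> entry s l : continuation t c f)"
  using assms e'(1) unfolding tame_def by blast
 have "ALL r l. t <= r --> r < t + min \<epsilon> (s - t) --> (entry r l : cut w s <-> entry r l : continuation t c f)"
  using f(3) by (auto simp: cut_mem)
 moreover have "0 < min \<epsilon> (s - t)" using f(2) e'(2) by simp
 ultimately show "EX U f. (U, f) : Q_types R D & (EX \<epsilon>>0. ALL r l. t <= r --> r < t + \<epsilon> -->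
   (entry r l : cut w s <-> entry r l : continuation t c f))" using f(1) by blast
qed

lemma tiles_cut:
 assumes w: "word w" and t: "bd w t"
 shows "tiles (cut w t) t"
 unfolding tiles_def
proof (intro conjI ballI allI impI)
 show "0 <= t" using bd_le[OF w t] by simp
 show "EX s l. e = entry s l & label_ok l & 0 <= s & s < t & s + len l <= t" if e: "e : cut w t" for e
 proof -
  have ew: "e : w" "tm e < t" using e by (auto simp: cut_def)
  obtain s l where sl: "e = entry s l" using wordD(2)[OF w ew(1)] by blast
  have sw: "entry s l : w" "s < t" using ew sl by auto
  note b = wordD(3)[OF w sw(1)]
  have "s + len l <= t"
  using t bd_def entry_gap w sw(1) sw(2) b by metis
  thus ?thesis using sl b sw(2) by blast
 qed
 show "(s = s' & l = l') | (s < s' & s + len l <= s')" if "entry s l : cut w t" "entry s' l' : cut w t" "s <= s'" for s l s' l'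
  using wordD(4)[OF w, of s l s' l'] that by (simp add: cut_mem)
 show "EX t' l. entry t' l : cut w t & t' <= s & (s = t' | s < t' + len l)" if "0 <= s" "s < t" for s
 using that bd_le w t wordD(5) that(1) that(2) cut_mem by fastforce
qed

lemma word_cut:
 assumes "word w" "bd w t"
 shows "word (cut w t)" "ht (cut w t) = t"
 using tiles_cut[OF assms] tame_cut[OF word_tame[OF assms(1)]] ht_eq unfolding word_def by blast+

lemma sub_entry:
 assumes x: "word x" and y: "word y" and xy: "x <= y" and e: "entry t l : y" "t < ht x"
 shows "entry t l : x"
proof -
 have "0 <= t" using wordD(3)[OF y e(1)] by simp
 from wordD(5)[OF x this e(2)] obtain t1 l1 where 1: "entry t1 l1 : x" "t1 <= t" "t = t1 | t < t1 + len l1" by blast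
 have "entry t1 l1 : y" using 1(1) xy by blast
 from wordD(4)[OF y this e(1) 1(2)] have "t1 = t & l1 = l" using 1(3) by auto
 thus ?thesis using 1(1) by simp
qed

lemma sub_ht:
 assumes x: "word x" and y: "word y" and xy: "x <= y"
 shows "ht x <= ht y"
proof (rule ccontr)
 assume "~ ht x <= ht y"
 then obtain t l where e: "entry t l : x" "t <= ht y" "ht y = t | ht y < t + len l"
  using wordD(5)[OF x wordD(1)[OF y]] by auto
 thus False using xy wordD(3)[OF y] e by fastforce
qed

lemma sub_bd:
 assumes x: "word x" and y: "word y" and xy: "x <= y"
 shows "bd y (ht x)"
proof (cases "ht x = ht y")
 case False
 hence "ht x < ht y" using sub_ht[OF assms] by simp
 from wordD(5)[OF y wordD(1)[OF x] this]
 obtain t l where e: "entry t l : y" "t <= ht x" "ht x = t | ht x < t + len l" by blast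
 have "~ t < ht x"
 proof
  assume "t < ht x"
  thus False using sub_entry[OF x y xy e(1)] wordD(3)[OF x] e(3) by fastforce
 qed
 hence "t = ht x" using e(2) by simp
 thus ?thesis unfolding bd_def using e(1) by blast
qed (simp add: bd_def)

lemma sub_cut:
 assumes x: "word x" and y: "word y" and xy: "x <= y"
 shows "x = cut y (ht x)"
proof (intro equalityI subsetI)
 fix e assume e: "e : x"
 then obtain t l where t: "e = entry t l" using wordD(2)[OF x] by blast
 thus "e : cut y (ht x)" using e xy wordD(3)[OF x, of t l] by (auto simp: cut_mem)
next
 fix e assume e: "e : cut y (ht x)"
 hence "e : y" "tm e < ht x" by (auto simp: cut_def)
 moreover obtain t l where "e = entry t l" using wordD(2)[OF y] \<open>e : y\<close> by blast
 ultimately show "e : x" using sub_entry[OF x y xy] by simp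
qed

lemma cut_ht: "word w ==> cut w (ht w) = w"
 using sub_cut[of w w] by simp

lemma sub_antisym_ht: "word x ==> word y ==> x <= y ==> ht x = ht y ==> x = y"
 using sub_cut[of x y] cut_ht[of y] by simp

lemma sub_ht_less: "word x ==> word y ==> x <= y ==> x ~= y ==> ht x < ht y"
 using sub_antisym_ht[of x y] sub_ht[of x y] by fastforce

lemma word_subsetI:
 assumes x: "word x" and "!!t l. entry t l : x ==> entry t l : y"
 shows "x <= y"
using wordD(2) x assms(2) by blast

section \<open>Branching of words\<close>

text \<open>The first time at which the words disagree.\<close>
definition sep :: "'q tree_point => 'q tree_point => real" where
 "sep x y = Inf (tm ` ((x - y) Un (y - x)))"

lemma sep_sym: "sep x y = sep y x"
 unfolding sep_def by (simp add: Un_commute)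

context
 fixes x y assumes x: "word x" and y: "word y" and ne: "x ~= y"
begin

lemma diff_times:
 assumes "e : (x - y) Un (y - x)"
 shows "EX t l. e = entry t l & 0 <= t"
 using assms wordD(2)[OF x, of e] wordD(2)[OF y, of e] wordD(3)[OF x] wordD(3)[OF y] by blast

lemma diff_nonempty: "tm ` ((x - y) Un (y - x)) ~= {}"
 using ne by blast

lemma diff_bdd: "bdd_below (tm ` ((x - y) Un (y - x)))"
using diff_times by fastforce

lemma sep_agree: "t < sep x y ==> entry t l : x <-> entry t l : y"
proof (rule ccontr)
 assume t: "t < sep x y" and n: "~ (entry t l : x <-> entry t l : y)"
 hence "t : tm ` ((x - y) Un (y - x))" by (intro image_eqI[of _ _ "entry t l"]) auto
 hence "sep x y <= t" unfolding sep_def by (rule cInf_lower[OF _ diff_bdd])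
 thus False using t by simp
qed

lemma sep_differ: "sep x y < r ==> EX t l. sep x y <= t & t < r & (entry t l : x <-> entry t l ~: y)"
proof -
 assume "sep x y < r"
 then obtain t where "t : tm ` ((x - y) Un (y - x))" "t < r"
  unfolding sep_def using cInf_less_iff[OF diff_nonempty diff_bdd] by blast
 then obtain e where e: "e : (x - y) Un (y - x)" "tm e < r" by blast
 obtain t l where tl: "e = entry t l" using diff_times[OF e(1)] by blast
 have d: "entry t l : x <-> entry t l ~: y" using e(1) tl by blast
 hence "sep x y <= t" using sep_agree[of t l] by (cases "t < sep x y") auto
 thus ?thesis using d e(2) tl by fastforce
qed

lemma le_sepI: "(!!t l. t < r ==> entry t l : x <-> entry t l : y) ==> r <= sep x y"
 using sep_differ[of r] by (cases "sep x y < r") force+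

lemma sep_nonneg: "0 <= sep x y"
 by (rule le_sepI) (use wordD(3)[OF x] wordD(3)[OF y] in force)

lemma sep_bd_left: "bd x (sep x y)"
proof -
 let ?s = "sep x y"
 have le: "?s <= ht x"
 proof (rule ccontr)
  assume n: "~ ?s <= ht x"
  have xy: "x <= y"
  proof (rule word_subsetI[OF x])
   fix t l assume e: "entry t l : x"
   hence "t < ?s" using wordD(3)[OF x e] n by simp
   thus "entry t l : y" using sep_agree e by blast
  qed
  hence "ht x < ht y" using sub_ht_less[OF x y] ne by blast
  from wordD(5)[OF y wordD(1)[OF x] this]
  obtain t l where e: "entry t l : y" "t <= ht x" "ht x = t | ht x < t + len l" by blast
  thus False using sep_agree[of t l] n wordD(3)[OF x] e by fastforce
 qed
 show ?thesis
 proof (cases "?s = ht x")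
  case False
  then obtain t l where e: "entry t l : x" "t <= ?s" "?s = t | ?s < t + len l"
   using wordD(5)[OF x sep_nonneg] le by auto
  show ?thesis
  proof (cases "t = ?s")
   case True
   thus ?thesis unfolding bd_def using e(1) by blast
  next
   case n: False
   hence ts: "t < ?s" "?s < t + len l" using e by auto
   hence ey: "entry t l : y" using sep_agree e(1) by blast
   obtain t' l' where d: "?s <= t'" "t' < t + len l" "entry t' l' : x <-> entry t' l' ~: y"
    using sep_differ[OF ts(2)] by blast
   have "t < t'" using ts d by simp
   hence "t + len l <= t'" using entry_gap[OF x e(1)] entry_gap[OF y ey] d(3) by blast
   thus ?thesis using d(2) by simp
  qed
 qed (simp add: bd_def)
qed

end

text \<open>A time in the middle of a piece entry of one word cannot be the first time of disagreement: that entry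
  starts earlier, so it belongs to both words.\<close>
lemma sep_bd: "word x ==> word y ==> x ~= y ==> bd x (sep x y) & bd y (sep x y)"
 using sep_bd_left[of x y] sep_bd_left[of y x] sep_sym[of x y] by auto

lemma sep_le: "word x ==> word y ==> x ~= y ==> sep x y <= ht x & sep x y <= ht y"
 using sep_bd[of x y] bd_le by blast

lemma sep_sub:
 assumes x: "word x" and y: "word y" and xy: "x <= y" and ne: "x ~= y"
 shows "sep x y = ht x"
proof (rule antisym)
 show "sep x y <= ht x" using sep_le[OF x y ne] by simp
 show "ht x <= sep x y"
  by (rule le_sepI[OF x y ne]) (use xy sub_entry[OF x y xy] in blast)
qed

lemma sep_ge_sub:
 assumes x: "word x" and y: "word y" and ne: "x ~= y" and s: "ht x <= sep x y"
 shows "x <= y"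
proof (rule word_subsetI[OF x])
 fix t l assume e: "entry t l : x"
 hence "t < sep x y" using wordD(3)[OF x e] s by simp
 thus "entry t l : y" using sep_agree[OF x y ne] e by blast
qed

text \<open>Agreement up to a given time is transitive.\<close>
lemma sep_ultra:
 assumes w: "word x" "word y" "word z" and ne: "x ~= y" "y ~= z" "x ~= z"
 shows "min (sep x y) (sep y z) <= sep x z"
 by (rule le_sepI[OF w(1,3) ne(3)]) (use sep_agree[OF w(1,2) ne(1)] sep_agree[OF w(2,3) ne(2)] in auto)

lemma sep_less:
 assumes w: "word x" "word y" "word z" and ne: "x ~= y" "y ~= z" and l: "sep x y < sep y z"
 shows "x ~= z" "sep x z = sep x y" "entry (sep x y) l : y <-> entry (sep x y) l : z"
proof -
 show xz: "x ~= z" using l sep_sym[of x y] by auto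
 have "sep x y <= sep x z" using sep_ultra[OF w ne xz] l by simp
 moreover have "sep x z <= sep x y"
 proof (rule ccontr)
  assume "~ sep x z <= sep x y"
  moreover have "min (sep x z) (sep z y) <= sep x y" by (rule sep_ultra[OF w(1,3,2) xz ne(2)[symmetric] ne(1)])
  ultimately show False using l sep_sym[of y z] by simp
 qed
 ultimately show "sep x z = sep x y" by simp
 show "entry (sep x y) l : y <-> entry (sep x y) l : z" by (rule sep_agree[OF w(2,3) ne(2) l])
qed

lemma cut_sep: "word x ==> word y ==> x ~= y ==> cut x (sep x y) = cut y (sep x y)"
proof -
 assume w: "word x" "word y" "x ~= y"
 have "word (cut x (sep x y))" "word (cut y (sep x y))" using word_cut(1) w sep_bd[OF w] by blast+
 have a: "entry t l : x & t < sep x y <-> entry t l : y & t < sep x y" for t l using sep_agree[OF w, of t l] by blast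
 have "cut x (sep x y) <= cut y (sep x y)"
  by (rule word_subsetI[OF \<open>word (cut x (sep x y))\<close>]) (unfold cut_mem a)
 moreover have "cut y (sep x y) <= cut x (sep x y)"
  by (rule word_subsetI[OF \<open>word (cut y (sep x y))\<close>]) (unfold cut_mem a)
 ultimately show ?thesis by blast
qed

text \<open>The words separate while crossing the same piece, towards different points of it.\<close>
definition shared :: "'q tree_point => 'q tree_point => real => real => 'q metric => 'q => 'q => bool" where
 "shared x y s c Q p q <-> entry s (c, p, Q) : x & entry s (c, q, Q) : y & piece_label (c, p, Q) & piece_label (c, q, Q)"

text \<open>Twice the Gromov product of two words with respect to the empty word.\<close>

definition gp :: "'q tree_point => 'q tree_point => real" where
 "gp x y = (if x = y then 2 * ht x
   else if EX c Q p q. shared x y (sep x y) c Q p q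
   then (SOME r. EX c Q p q. shared x y (sep x y) c Q p q &
      r = 2 * sep x y + rad Q p + rad Q q - mdist Q p q)
   else 2 * sep x y)"

definition wdist :: "'q tree_point => 'q tree_point => real" where
 "wdist x y = ht x + ht y - gp x y"

lemma shared_unique:
 assumes "word x" "word y" "shared x y s c Q p q" "shared x y s c' Q' p' q'"
 shows "c = c' & Q = Q' & p = p' & q = q'"
 using assms entry_unique[of x s "(c, p, Q)" "(c', p', Q')"] entry_unique[of y s "(c, q, Q)" "(c', q', Q')"]
 unfolding shared_def by simp

lemma gp_shared:
 assumes w: "word x" "word y" "x ~= y" and s: "shared x y (sep x y) c Q p q"
 shows "gp x y = 2 * sep x y + rad Q p + rad Q q - mdist Q p q"
proof -
 have "(SOME r. EX c Q p q. shared x y (sep x y) c Q p q &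
      r = 2 * sep x y + rad Q p + rad Q q - mdist Q p q) =
   2 * sep x y + rad Q p + rad Q q - mdist Q p q"
 using s shared_unique w(1,2) by blast
 moreover have "EX c Q p q. shared x y (sep x y) c Q p q" using s by blast
 ultimately show ?thesis using w(3) unfolding gp_def by simp
qed

lemma gp_not_shared: "x ~= y ==> \<nexists>c Q p q. shared x y (sep x y) c Q p q ==> gp x y = 2 * sep x y"
 unfolding gp_def by (simp only: if_False)

lemma shared_sym: "shared x y s c Q p q ==> shared y x s c Q q p"
 unfolding shared_def by blast

lemma gp_sym:
 assumes w: "word x" "word y"
 shows "gp x y = gp y x"
proof (cases "x = y")
 case ne: False
 show ?thesis
 proof (cases "EX c Q p q. shared x y (sep x y) c Q p q")
  case True
  then obtain c Q p q where s: "shared x y (sep x y) c Q p q" by blast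
  hence "shared y x (sep y x) c Q q p" using shared_sym sep_sym[of x y] by simp
  from gp_shared[OF w(2,1) ne[symmetric] this] gp_shared[OF w ne s]
  show ?thesis using sep_sym[of x y] mdist_commute[of Q p q] by simp
 next
  case False
  hence "\<nexists>c Q p q. shared y x (sep y x) c Q p q" using shared_sym sep_sym[of x y] by metis
  thus ?thesis using gp_not_shared[OF ne False] gp_not_shared[OF ne[symmetric]] sep_sym[of x y] by simp
 qed
qed simp

lemma shared_bounds:
 assumes w: "word x" "word y" and s: "shared x y s c Q p q"
 shows "s + rad Q p <= ht x" "s + rad Q q <= ht y"
  "rad Q p <= rad Q q + mdist Q p q"
  "rad Q q <= rad Q p + mdist Q p q"
  "mdist Q p q <= rad Q p + rad Q q"
  "p : mspace Q" "q : mspace Q" "origin Q : mspace Q"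
proof -
 have l: "piece_label (c, p, Q)" "piece_label (c, q, Q)" "entry s (c, p, Q) : x" "entry s (c, q, Q) : y"
  using s unfolding shared_def by auto
 show m: "p : mspace Q" "q : mspace Q" "origin Q : mspace Q" using piece_labelD l by auto
 show "s + rad Q p <= ht x" "s + rad Q q <= ht y"
  using wordD(3)[OF w(1) l(3)] wordD(3)[OF w(2) l(4)] len_piece[OF l(1)] len_piece[OF l(2)] by auto
 show "rad Q p <= rad Q q + mdist Q p q" using mdist_triangle[OF m(3,2,1)] by (simp add: mdist_commute[of Q q p])
 show "rad Q q <= rad Q p + mdist Q p q" by (rule mdist_triangle[OF m(3,1,2)])
 show "mdist Q p q <= rad Q p + rad Q q" using mdist_triangle[OF m(1,3,2)] by (simp add: mdist_commute[of Q p "origin Q"])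
qed

lemma gp_bounds:
 assumes w: "word x" "word y" and ne: "x ~= y"
 shows "2 * sep x y <= gp x y" "gp x y <= 2 * ht x" "gp x y <= 2 * ht y"
proof -
 have "2 * sep x y <= gp x y & gp x y <= 2 * ht x & gp x y <= 2 * ht y"
 proof (cases "EX c Q p q. shared x y (sep x y) c Q p q")
  case True
  then obtain c Q p q where s: "shared x y (sep x y) c Q p q" by blast
  show ?thesis using shared_bounds[OF w s] gp_shared[OF w ne s] by linarith
 next
  case False
  thus ?thesis using gp_not_shared[OF ne False] sep_le[OF w ne] by simp
 qed
 thus "2 * sep x y <= gp x y" "gp x y <= 2 * ht x" "gp x y <= 2 * ht y" by auto
qed

lemma shared_ne:
 assumes w: "word x" "word y" and ne: "x ~= y" and s: "shared x y (sep x y) c Q p q"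
 shows "p ~= q"
proof
 assume "p = q"
 hence e: "entry (sep x y) (c, p, Q) : x" "entry (sep x y) (c, p, Q) : y" "piece_label (c, p, Q)"
  using s unfolding shared_def by auto
 have "sep x y < sep x y + len (c, p, Q)" using len_pos[OF e(3)] by simp
 from sep_differ[OF w ne this] obtain t l where t: "sep x y <= t" "t < sep x y + len (c, p, Q)"
  "entry t l : x <-> entry t l ~: y" by blast
 show False
 proof (cases "t = sep x y")
  case True
  thus ?thesis using t(3) entry_unique[OF w(1) e(1), of l] entry_unique[OF w(2) e(2), of l] e by metis
 next
  case False
  hence "sep x y < t" using t(1) by simp
  hence "sep x y + len (c, p, Q) <= t" using entry_gap[OF w(1) e(1)] entry_gap[OF w(2) e(2)] t(3) by blast
  thus ?thesis using t(2) by simp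
 qed
qed

lemma wdist_pos:
 assumes w: "word x" "word y" and ne: "x ~= y"
 shows "0 < wdist x y"
proof (cases "EX c Q p q. shared x y (sep x y) c Q p q")
 case True
 then obtain c Q p q where s: "shared x y (sep x y) c Q p q" by blast
 note b = shared_bounds[OF w s]
 have "0 < mdist Q p q" by (rule mdist_pos[OF b(6,7) shared_ne[OF w ne s]])
 thus ?thesis unfolding wdist_def using b(1,2) gp_shared[OF w ne s] by linarith
next
 case False
 have "~ (sep x y = ht x & sep x y = ht y)"
 using cut_ht w False cut_sep ne by metis
 thus ?thesis unfolding wdist_def using gp_not_shared[OF ne False] sep_le[OF w ne] by linarith
qed

text \<open>Up to a time beyond \<open>sep x y\<close>, the words \<open>y\<close> and \<open>z\<close> are the same.\<close>
lemma gp_left_less: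
 assumes w: "word x" "word y" "word z" and ne: "x ~= y" "y ~= z" and l: "sep x y < sep y z"
 shows "gp x z = gp x y"
proof -
 note sl = sep_less[OF w ne l]
 have sh: "shared x y (sep x y) c Q p q <-> shared x z (sep x z) c Q p q" for c Q p q
  unfolding shared_def sl(2) using sl(3) by blast
 show ?thesis
 using sh gp_shared w(1,2) ne(1) w(1,3) sl(1) sl(2) gp_not_shared by metis
qed

text \<open>If two of the separation times differ, the smaller one is also the third and two of the products are equal.
  If all three are equal, what remains is an inequality between heights or the triangle inequality in a shared
  piece.\<close>
lemma gp_triangle:
 assumes w: "word x" "word y" "word z"
 shows "gp x y + gp y z <= gp x z + 2 * ht y"
proof -
 consider "x = y" | "y = z" | "x = z" "x ~= y" | "x ~= y" "y ~= z" "x ~= z" by blast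
 thus ?thesis
 proof cases
  case 1 thus ?thesis by (simp add: gp_def)
 next
  case 2 thus ?thesis by (simp add: gp_def)
 next
  case 3
  show ?thesis using gp_def gp_bounds[OF w(1,2) 3(2)] gp_sym[OF w(2,1)] 3(1) by simp
 next
  case ne: 4
  consider "sep x y < sep y z" | "sep y z < sep x y" | "sep x y = sep y z" by linarith
  thus ?thesis
  proof cases
   case 1
   thus ?thesis using gp_left_less[OF w ne(1,2) 1] gp_bounds(2)[OF w(2,3) ne(2)] by simp
  next
   case 2
   hence "sep z y < sep y x" using sep_sym[of y z] sep_sym[of x y] by simp
   thus ?thesis using gp_left_less[OF w(3,2,1) ne(2)[symmetric] ne(1)[symmetric]] gp_sym[OF w(3,1)] gp_sym[OF w(3,2)] gp_bounds(3)[OF w(1,2) ne(1)] by simp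
  next
   case eq: 3
   show ?thesis
   proof (cases "EX c Q p q. shared x y (sep x y) c Q p q")
    case False
    hence 1: "gp x y = 2 * sep x y" by (rule gp_not_shared[OF ne(1)])
    show ?thesis using sep_ultra[OF w ne] eq 1 gp_bounds[OF w(2,3) ne(2)] gp_bounds(1)[OF w(1,3) ne(3)] by linarith
   next
    case True
    then obtain c Q p q where s: "shared x y (sep x y) c Q p q" by blast
    note g1 = gp_shared[OF w(1,2) ne(1) s] and b1 = shared_bounds[OF w(1,2) s]
    have sz: "sep x y <= sep x z" using sep_ultra[OF w ne] eq by simp
    show ?thesis
    proof (cases "EX c Q p q. shared y z (sep y z) c Q p q")
     case False
     hence 2: "gp y z = 2 * sep y z" by (rule gp_not_shared[OF ne(2)])
     thus ?thesis using sz eq gp_bounds(3)[OF w(1,2) ne(1)] gp_bounds(1)[OF w(1,3) ne(3)] by linarith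
    next
     case True
     then obtain c' Q' q' r where s': "shared y z (sep y z) c' Q' q' r" by blast
     have "(c, q, Q) = (c', q', Q')"
      by (rule entry_unique[OF w(2), of "sep x y"]) (use s s' eq in \<open>auto simp: shared_def\<close>)
     hence s2: "shared y z (sep y z) c Q q r" using s' by simp
     note g2 = gp_shared[OF w(2,3) ne(2) s2] and b2 = shared_bounds[OF w(2,3) s2]
     show ?thesis
     proof (cases "sep x z = sep x y")
      case True
      hence "shared x z (sep x z) c Q p r" using s s2 eq unfolding shared_def by simp
      from gp_shared[OF w(1,3) ne(3) this] have g3: "gp x z = 2 * sep x z + rad Q p + rad Q r - mdist Q p r" .
      show ?thesis using mdist_triangle[OF b1(6,7) b2(7)] g1 g2 g3 b1(2) eq True by linarith
     next
      case False
      hence lt: "sep x y < sep x z" using sz by simp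
      have ex: "entry (sep x y) (c, p, Q) : x" "entry (sep x y) (c, r, Q) : z"
       using s s2 eq unfolding shared_def by auto
      hence pr: "p = r" using sep_agree[OF w(1,3) ne(3) lt] entry_unique[OF w(1) ex(1), of "(c, r, Q)"] by simp
      have "sep x y + len (c, p, Q) <= sep x z"
      using True wordD(3) w(1) ex(1) False sep_bd w(1,3) ne(3) bd_def entry_gap lt by metis
      hence "sep x y + rad Q p <= sep x z"
       using s len_piece[of c p Q] unfolding shared_def by simp
      thus ?thesis using g1 g2[folded pr] eq gp_bounds(1)[OF w(1,3) ne(3)] b1(2) mdist_commute[of Q p q] mdist_nonneg[of Q p q]
       by linarith
     qed
    qed
   qed
  qed
 qed
qed

abbreviation "Words \<equiv> {w. word w}"

definition WT :: "'q tree_point metric" where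
 "WT = metric (Words, %x y. if word x & word y then wdist x y else 0)"

lemma wdist_sym: "word x ==> word y ==> wdist x y = wdist y x"
 using gp_sym by (simp add: wdist_def)

lemma wdist_self [simp]: "wdist x x = 0"
 by (simp add: wdist_def gp_def)

lemma Metric_words: "Metric_space Words (%x y. if word x & word y then wdist x y else 0)"
proof
 fix x y z
 show "0 <= (if word x & word y then wdist x y else 0)"
  using wdist_pos[of x y] by (cases "x = y") auto
 show "(if word x & word y then wdist x y else 0) = (if word y & word x then wdist y x else 0)"
  using wdist_sym by simp
 show "((if word x & word y then wdist x y else 0) = 0) = (x = y)" if "x : Words" "y : Words"
  using wdist_pos[of x y] that by (cases "x = y") auto
 show "(if word x & word z then wdist x z else 0) <=
   (if word x & word y then wdist x y else 0) + (if word y & word z then wdist y z else 0)"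
  if "x : Words" "y : Words" "z : Words"
  using gp_triangle[of x y z] that unfolding wdist_def by simp
qed

lemma mspace_WT [simp]: "mspace WT = Words"
 and mdist_WT: "word x ==> word y ==> mdist WT x y = wdist x y"
proof -
 interpret W: Metric_space Words "%x y. if word x & word y then wdist x y else 0" by (rule Metric_words)
 show "mspace WT = Words" unfolding WT_def by (rule W.mspace_metric)
 show "word x ==> word y ==> mdist WT x y = wdist x y" unfolding WT_def W.mdist_metric by simp
qed

end

section \<open>Pieces of the model\<close>

context Q_choices
begin

lemma wdist_ht: "word x ==> word y ==> \<bar>ht x - ht y\<bar> <= wdist x y"
 using gp_bounds[of x y] by (cases "x = y") (auto simp: wdist_def gp_def)

lemma wdist_triangle: "word x ==> word y ==> word z ==> wdist x z <= wdist x y + wdist y z"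
 using gp_triangle[of x y z] unfolding wdist_def by simp

lemma not_shared_ht: "word x ==> ~ shared x y (ht x) c Q p q"
 unfolding shared_def using wordD(3)[of x "ht x" "(c, p, Q)"] by auto

lemma wdist_sub:
 assumes "word x" "word y" "x <= y"
 shows "wdist x y = ht y - ht x"
proof (cases "x = y")
 case False
 show ?thesis using gp_not_shared[OF False] not_shared_ht[OF assms(1)] sep_sub[OF assms False] by (simp add: wdist_def)
qed simp

text \<open>Both \<open>x\<close> and \<open>y\<close> separate from \<open>z\<close> at the same time, which is before
  the end of \<open>x\<close>.\<close>
lemma wdist_down:
 assumes w: "word x" "word y" "word z" and xy: "x <= y" and xz: "~ x <= z"
 shows "wdist y z = wdist y x + wdist x z"
proof (cases "y = x")
 case False
 have ne: "z ~= x" using xz by blast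
 have "sep z x < sep x y"
  using sep_ge_sub[OF w(1,3) ne[symmetric]] xz sep_sub[OF w(1,2) xy] False sep_sym[of x z] by fastforce
 hence "gp z y = gp z x" by (rule gp_left_less[OF w(3,1,2) ne False[symmetric]])
 thus ?thesis
  using wdist_sub[OF w(1,2) xy] wdist_sym[OF w(1,2)] gp_sym[OF w(3,1)] gp_sym[OF w(3,2)] unfolding wdist_def by simp
qed simp

lemma sep_eqI:
 assumes w: "word x" "word y" "word v" and v: "v <= x" "v <= y" and l: "entry (ht v) l : x" "entry (ht v) l ~: y"
 shows "sep x y = ht v"
proof -
 have ne: "x ~= y" using l by blast
 have "ht v <= sep x y"
  by (rule le_sepI[OF w(1,2) ne]) (use v sub_entry[OF w(3,1) v(1)] sub_entry[OF w(3,2) v(2)] in blast)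
 moreover have "~ ht v < sep x y" using sep_agree[OF w(1,2) ne] l by blast
 ultimately show ?thesis by simp
qed

lemma tame_local:
 assumes "!!t c. entry t (plain c) : w ==> EX v r. tame v & t < r & (ALL s l. t <= s --> s < r --> (entry s l : w <-> entry s l : v))"
 shows "tame w"
 unfolding tame_def
proof (intro allI impI)
 fix t c assume e: "entry t (plain c) : w"
 from assms[OF this] obtain v r where v: "tame v" "t < r" "ALL s l. t <= s --> s < r --> (entry s l : w <-> entry s l : v)" by blast
 hence "entry t (plain c) : v" using e by blast
 then obtain U f \<epsilon> where f: "(U, f) : Q_types R D" "\<epsilon> > 0"
  "ALL s l. t <= s --> s < t + \<epsilon> --> (entry s l : v <-> entry s l : continuation t c f)"
  using v(1) unfolding tame_def by blast
 have "ALL s l. t <= s --> s < t + min \<epsilon> (r - t) --> (entry s l : w <-> entry s l : continuation t c f)"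
 using f(3) v(3) by auto
 moreover have "0 < min \<epsilon> (r - t)" using f(2) v(2) by simp
 ultimately show "EX U f. (U, f) : Q_types R D & (EX \<epsilon>>0. ALL s l. t <= s --> s < t + \<epsilon> -->
   (entry s l : w <-> entry s l : continuation t c f))" using f(1) by blast
qed

text \<open>The copy of \<open>Q\<close> with number \<open>c\<close> that is attached to \<open>v\<close>: its origin
  is \<open>v\<close>, and its other points are \<open>v\<close> followed by one piece entry.\<close>
definition pt :: "'q tree_point => real => 'q metric => 'q => 'q tree_point" where
 "pt v c Q q = (if q = origin Q then v else insert (entry (ht v) (c, q, Q)) v)"

text \<open>The coordinate in \<open>Q\<close> of the gate of \<open>x\<close> in the copy of \<open>Q\<close> at
  \<open>v\<close> with number \<open>c\<close>.\<close>
definition coord :: "'q tree_point => real => 'q metric => 'q tree_point => 'q" where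
 "coord v c Q x = (if v <= x & (EX q. piece_label (c, q, Q) & entry (ht v) (c, q, Q) : x)
   then (SOME q. piece_label (c, q, Q) & entry (ht v) (c, q, Q) : x) else origin Q)"

lemma pt_origin [simp]: "pt v c Q (origin Q) = v"
 by (simp add: pt_def)

lemma tiles_insert:
 assumes v: "word v" and l: "piece_label l"
 shows "tiles (insert (entry (ht v) l) v) (ht v + len l)"
 unfolding tiles_def
proof (intro conjI ballI allI impI)
 note V = wordD[OF v] and lp = len_pos[OF l]
 show "0 <= ht v + len l" using V(1) lp by simp
 show "EX t l'. e = entry t l' & label_ok l' & 0 <= t & t < ht v + len l & t + len l' <= ht v + len l"
  if e: "e : insert (entry (ht v) l) v" for e
 proof (cases "e = entry (ht v) l")
  case True
  thus ?thesis using V(1) lp l by (intro exI[of _ "ht v"] exI[of _ l]) (simp add: label_ok_def)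
 next
  case False
  hence ev: "e : v" using e by simp
  obtain t l' where tl: "e = entry t l'" using V(2)[OF ev] by blast
  thus ?thesis using V(3)[of t l'] ev lp by (intro exI[of _ t] exI[of _ l']) auto
 qed
 show "(s = s' & m = m') | (s < s' & s + len m <= s')"
  if "entry s m : insert (entry (ht v) l) v" "entry s' m' : insert (entry (ht v) l) v" "s <= s'" for s m s' m'
  using that V(3)[of s m] V(3)[of s' m'] V(4)[of s m s' m'] by auto
 show "EX t m. entry t m : insert (entry (ht v) l) v & t <= s & (s = t | s < t + len m)"
  if s: "0 <= s" "s < ht v + len l" for s
 proof (cases "s < ht v")
  case True
  from V(5)[OF s(1) this] show ?thesis by blast
 next
  case False
  thus ?thesis using s(2) by (intro exI[of _ "ht v"] exI[of _ l]) simp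
 qed
qed

context
 fixes v and c :: real and Q assumes v: "word v" and Q: "Q : R"
begin

lemma piece_labelI: "q : mspace Q ==> q ~= origin Q ==> piece_label (c, q, Q)"
 using Q by (simp add: piece_label_def)

lemma pt_word:
 assumes q: "q : mspace Q"
 shows "word (pt v c Q q)" "ht (pt v c Q q) = ht v + rad Q q" "v <= pt v c Q q"
proof -
 have "word (pt v c Q q) & ht (pt v c Q q) = ht v + rad Q q"
 proof (cases "q = origin Q")
  case True
  thus ?thesis using v q by simp
 next
  case False
  hence l: "piece_label (c, q, Q)" using piece_labelI[OF q] by simp
  note t = tiles_insert[OF v l]
  have "tame (insert (entry (ht v) (c, q, Q)) v)"
  proof (rule tame_local)
   fix t k assume "entry t (plain k) : insert (entry (ht v) (c, q, Q)) v"
   moreover have "plain k ~= (c, q, Q)" using l not_piece_plain[of k] by metis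
   ultimately have "entry t (plain k) : v" by simp
   hence "t < ht v" using wordD(3)[OF v] by blast
   thus "EX w r. tame w & t < r & (ALL s m. t <= s --> s < r --> (entry s m : insert (entry (ht v) (c, q, Q)) v <-> entry s m : w))"
    using word_tame[OF v] by (intro exI[of _ v] exI[of _ "ht v"]) auto
  qed
  thus ?thesis using t ht_eq[OF t] len_piece[OF l] False unfolding word_def pt_def by auto
 qed
 thus "word (pt v c Q q)" "ht (pt v c Q q) = ht v + rad Q q" by auto
 show "v <= pt v c Q q" by (auto simp: pt_def)
qed

lemma coord_eq:
 assumes x: "word x" "v <= x" and e: "entry (ht v) (c, q, Q) : x" "piece_label (c, q, Q)"
 shows "coord v c Q x = q"
using entry_unique x(1) e(1) e coord_def x(2) by auto

lemma coord_ne_origin: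
 assumes x: "word x" and q: "coord v c Q x ~= origin Q"
 shows "v <= x" "entry (ht v) (c, coord v c Q x, Q) : x" "piece_label (c, coord v c Q x, Q)" "pt v c Q (coord v c Q x) <= x"
proof -
 have a: "v <= x & (EX q. piece_label (c, q, Q) & entry (ht v) (c, q, Q) : x)"
  using q unfolding coord_def by (auto split: if_splits)
 then obtain q where e: "entry (ht v) (c, q, Q) : x" "piece_label (c, q, Q)" by blast
 hence c: "coord v c Q x = q" using coord_eq[OF x] a by blast
 show 1: "v <= x" using a by (rule conjunct1)
 show 2: "entry (ht v) (c, coord v c Q x, Q) : x" unfolding c by (rule e(1))
 show "piece_label (c, coord v c Q x, Q)" unfolding c by (rule e(2))
 show "pt v c Q (coord v c Q x) <= x" unfolding pt_def using 1 2 by simp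
qed

lemma coord_mem:
 assumes "word x" "mspace Q ~= {}"
 shows "coord v c Q x : mspace Q"
using assms(2) origin_mem piece_labelD coord_ne_origin(3) assms(1) by fastforce

lemma coord_pt: "q : mspace Q ==> coord v c Q (pt v c Q q) = q"
proof (cases "q = origin Q")
 case True
 have "entry (ht v) l ~: v" for l using wordD(3)[OF v, of "ht v" l] by auto
 hence "\<nexists>q. piece_label (c, q, Q) & entry (ht v) (c, q, Q) : v" by simp
 hence "coord v c Q v = origin Q" unfolding coord_def by (intro if_not_P) blast
 thus ?thesis using True by simp
next
 case False
 assume q: "q : mspace Q"
 show ?thesis by (rule coord_eq) (use pt_word[OF q] piece_labelI[OF q False] False in \<open>auto simp: pt_def\<close>)
qed

lemma coord_origin_down: "word x ==> ~ v <= x ==> coord v c Q x = origin Q"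
 by (auto simp: coord_def)

lemma wdist_coord_origin:
 assumes w: "word x" "word y" and p: "coord v c Q x ~= origin Q" and q: "coord v c Q y = origin Q"
 shows "wdist x y = wdist x v + wdist v y"
proof (cases "v <= y")
 case False
 show ?thesis by (rule wdist_down[OF v w coord_ne_origin(1)[OF w(1) p] False])
next
 case True
 note a = coord_ne_origin[OF w(1) p]
 have ny: "entry (ht v) (c, q, Q) ~: y" if "piece_label (c, q, Q)" for q
  using coord_eq[OF w(2) True _ that] that q piece_labelD[OF that] by auto
 have s: "sep x y = ht v" by (rule sep_eqI[OF w v a(1) True a(2) ny[OF a(3)]])
 have ne: "x ~= y" using p q by blast
 have "~ shared x y (sep x y) c' Q' p' q'" for c' Q' p' q'
 proof
  assume sh: "shared x y (sep x y) c' Q' p' q'"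
  hence "(c', p', Q') = (c, coord v c Q x, Q)"
   by (intro entry_unique[OF w(1) a(2), symmetric]) (use s in \<open>simp add: shared_def\<close>)
  thus False using sh s ny[of q'] unfolding shared_def by simp
 qed
 hence "gp x y = 2 * ht v" using gp_not_shared[OF ne] s by simp
 thus ?thesis using wdist_sub[OF v w(1) a(1)] wdist_sub[OF v w(2) True] wdist_sym[OF v w(1)] unfolding wdist_def by simp
qed

text \<open>Either both words run through the copy of \<open>Q\<close> and separate there, or one of them passes through
  \<open>v\<close> only.\<close>
lemma wdist_coord_differ:
 assumes w: "word x" "word y" and ne: "coord v c Q x ~= coord v c Q y" and Qn: "mspace Q ~= {}"
 shows "wdist x y = wdist x (pt v c Q (coord v c Q x)) + mdist Q (coord v c Q x) (coord v c Q y)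
   + wdist (pt v c Q (coord v c Q y)) y"
proof -
 have to: "wdist x (pt v c Q (coord v c Q x)) = ht x - ht v - rad Q (coord v c Q x)"
  if w: "word x" and p: "coord v c Q x ~= origin Q" for x
 proof -
  have "coord v c Q x : mspace Q" by (rule coord_mem[OF w Qn])
  note P = pt_word[OF this]
  show ?thesis using wdist_sub[OF P(1) w coord_ne_origin(4)[OF w p]] wdist_sym[OF w P(1)] P(2) by simp
 qed
 have half: "wdist x y = wdist x (pt v c Q (coord v c Q x)) + rad Q (coord v c Q x) + wdist v y"
  if "word x" "word y" "coord v c Q x ~= origin Q" "coord v c Q y = origin Q" for x y
  using wdist_coord_origin[OF that(1-4)] to[OF that(1,3)] wdist_sub[OF v that(1) coord_ne_origin(1)[OF that(1,3)]]
   wdist_sym[OF v that(1)] by simp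
 consider "coord v c Q x ~= origin Q" "coord v c Q y = origin Q" | "coord v c Q x = origin Q" "coord v c Q y ~= origin Q"
  | "coord v c Q x ~= origin Q" "coord v c Q y ~= origin Q" using ne by metis
 thus ?thesis
 proof cases
  case 1
  thus ?thesis using half[OF w 1] mdist_commute[of Q "coord v c Q x" "origin Q"] by simp
 next
  case 2
  have P: "word (pt v c Q (coord v c Q y))" by (rule pt_word(1)[OF coord_mem[OF w(2) Qn]])
  show ?thesis using half[OF w(2,1) 2(2,1)] 2 wdist_sym[OF w] wdist_sym[OF v w(1)] wdist_sym[OF w(2) P] by simp
 next
  case 3
  note a = coord_ne_origin[OF w(1) 3(1)] and b = coord_ne_origin[OF w(2) 3(2)]
  have "entry (ht v) (c, coord v c Q x, Q) ~: y" using entry_unique[OF w(2) b(2), of "(c, coord v c Q x, Q)"] ne by auto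
  hence s: "sep x y = ht v" by (rule sep_eqI[OF w v a(1) b(1) a(2)])
  have xy: "x ~= y" using ne by blast
  have "shared x y (sep x y) c Q (coord v c Q x) (coord v c Q y)" unfolding shared_def s using a b by simp
  from gp_shared[OF w xy this] show ?thesis
   using to[OF w(1) 3(1)] to[OF w(2) 3(2)] s
    wdist_sym[OF w(2) pt_word(1)[OF coord_mem[OF w(2) Qn]]] unfolding wdist_def[of x y] by simp
 qed
qed

lemma wdist_pt:
 assumes w: "word x" and q: "q : mspace Q"
 shows "wdist x (pt v c Q q) = wdist x (pt v c Q (coord v c Q x)) + mdist Q (coord v c Q x) q"
using q wdist_coord_differ w pt_word(1) coord_pt by fastforce

lemma wdist_pt_pt: "p : mspace Q ==> q : mspace Q ==> wdist (pt v c Q p) (pt v c Q q) = mdist Q p q"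
 using wdist_pt[OF pt_word(1), of p q] coord_pt[of p] by simp

end

definition site :: "'q tree_point => real => 'q metric => 'q tree_point set" where
 "site v c Q = pt v c Q ` mspace Q"

definition sites :: "'q tree_point set set" where
 "sites = {site v c Q | v c Q. word v & Q : R & mspace Q ~= {}}"

lemma siteE:
 assumes "P : sites"
 obtains v c Q where "word v" "Q : R" "mspace Q ~= {}" "P = site v c Q"
 using assms unfolding sites_def by blast

lemma betw_WT: "betw WT x u y <-> word x & word u & word y & wdist x u + wdist u y = wdist x y"
 unfolding betw_def by (auto simp: mdist_WT)

lemma sep_pt:
 assumes v: "word v" and Q: "Q : R" and pq: "p : mspace Q" "q : mspace Q" "p ~= q"
 shows "sep (pt v c Q p) (pt v c Q q) = ht v"
proof -
 note P = pt_word[OF v Q pq(1), of c] and R = pt_word[OF v Q pq(2), of c]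
 have nv: "entry (ht v) l ~: v" for l using wordD(3)[OF v, of "ht v" l] by auto
 consider "p ~= origin Q" | "q ~= origin Q" using pq(3) by blast
 thus ?thesis
 proof cases
  case 1
  have "entry (ht v) (c, p, Q) : pt v c Q p" "entry (ht v) (c, p, Q) ~: pt v c Q q" using 1 pq(3) nv by (auto simp: pt_def)
  thus ?thesis by (rule sep_eqI[OF P(1) R(1) v P(3) R(3)])
 next
  case 2
  show ?thesis using 2 pq(3) nv pt_def sep_eqI[OF R(1) P(1) v R(3) P(3)] sep_sym by (auto simp: pt_def)
 qed
qed

text \<open>Two different points of a copy of \<open>Q\<close> separate exactly at the height of the word it is attached
  to, and one of them has an entry there which tells \<open>c\<close> and \<open>Q\<close>.\<close>
lemma sites_unique:
 assumes P: "P : sites" and P': "P' : sites" and x: "x : P" "x : P'" and y: "y : P" "y : P'" and ne: "x ~= y"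
 shows "P = P'"
proof -
 have det: "ht v = sep x y & v = cut x (sep x y) & (EX q. piece_label (c, q, Q) & (entry (ht v) (c, q, Q) : x | entry (ht v) (c, q, Q) : y))"
  if v: "word v" "Q : R" and x: "x : site v c Q" and y: "y : site v c Q" for v c Q
 proof -
  obtain p q where p: "p : mspace Q" "x = pt v c Q p" and q: "q : mspace Q" "y = pt v c Q q" using x y unfolding site_def by blast
  have pq: "p ~= q" using ne p q by blast
  have s: "sep x y = ht v" using sep_pt[OF v p(1) q(1) pq] p q by simp
  have "EX q. piece_label (c, q, Q) & (entry (ht v) (c, q, Q) : x | entry (ht v) (c, q, Q) : y)"
   using pq p q piece_labelI[OF v p(1)] piece_labelI[OF v q(1)] by (cases "p = origin Q") (auto simp: pt_def)
  thus ?thesis using s sub_cut[OF v(1) pt_word(1,3)[OF v p(1)]] p(2) by simp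
 qed
 obtain v c Q where a: "word v" "Q : R" "P = site v c Q" using siteE[OF P] by metis
 obtain v' c' Q' where a': "word v'" "Q' : R" "P' = site v' c' Q'" using siteE[OF P'] by metis
 note d = det[OF a(1,2), of c, folded a(3), OF x(1) y(1)] and d' = det[OF a'(1,2), of c', folded a'(3), OF x(2) y(2)]
 have v: "v' = v" using d d' by simp
 have w: "word x" "word y"
  using x(1) y(1) pt_word(1)[OF a(1,2)] unfolding a(3) site_def by blast+
 obtain q where q: "piece_label (c, q, Q)" "entry (ht v) (c, q, Q) : x | entry (ht v) (c, q, Q) : y" using d by blast
 obtain q' where q': "piece_label (c', q', Q')" "entry (ht v) (c', q', Q') : x | entry (ht v) (c', q', Q') : y" using d' v by blast
 have form: "fst k = c & snd (snd k) = Q" if e: "entry (ht v) k : z" and z: "z : P" for k z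
 proof -
  obtain r where r: "z = pt v c Q r" using z unfolding a(3) site_def by blast
  have "entry (ht v) k ~: v" using wordD(3)[OF a(1), of "ht v" k] by auto
  hence "k = (c, r, Q)" using e unfolding r pt_def by (auto split: if_splits)
  thus ?thesis by simp
 qed
 show ?thesis using q'(2) form[of "(c', q', Q')"] x(1) y(1) v a(3) a'(3) by auto
qed

end

section \<open>Directions and geodesics in the model\<close>

context Q_choices
begin

lemma gate_site:
 assumes v: "word v" and Q: "Q : R" "mspace Q ~= {}" and x: "word x"
 shows "gate WT (site v c Q) x = pt v c Q (coord v c Q x)"
proof (rule gate_eqI)
 have m: "coord v c Q x : mspace Q" by (rule coord_mem[OF v Q(1) x Q(2)])
 show "pt v c Q (coord v c Q x) : site v c Q" unfolding site_def using m by blast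
 show "betw WT x (pt v c Q (coord v c Q x)) q" if "q : site v c Q" for q
 proof -
  obtain r where r: "r : mspace Q" "q = pt v c Q r" using \<open>q : site v c Q\<close> unfolding site_def by blast
  show ?thesis unfolding betw_WT r(2) wdist_pt[OF v Q(1) x r(1)] wdist_pt_pt[OF v Q(1) m r(1)]
   using x pt_word(1)[OF v Q(1)] m r(1) by simp
 qed
qed

definition upward :: "real => 'q tree_point => 'q tree_point => bool" where
 "upward t y z <-> (EX c Q p q. shared y z t c Q p q) |
   (EX \<epsilon>>0. ALL s l. t <= s --> s < t + \<epsilon> --> (entry s l : y <-> entry s l : z))"

text \<open>One direction at \<open>x\<close> leads down towards the base; the others are the ways in which a word can
  go on after \<open>x\<close>.\<close>
definition same_way :: "'q tree_point => 'q tree_point => 'q tree_point => bool" where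
 "same_way x y z <-> word y & word z & ((~ x <= y & ~ x <= z) | (x <= y & x <= z & upward (ht x) y z))"

lemma upward_sym: "upward t y z ==> upward t z y"
 unfolding upward_def using shared_sym by blast

lemma upward_trans:
 assumes w: "word y" "word z" "word u" and yz: "upward t y z" and zu: "upward t z u"
 shows "upward t y u"
proof -
 have germ: "EX c Q p q. shared y u t c Q p q"
  if s: "shared y z t c Q p q" and g: "\<epsilon> > 0" "ALL s l. t <= s --> s < t + \<epsilon> --> (entry s l : z <-> entry s l : u)"
  for y z u c Q p q \<epsilon>
 using g(2) g(1) s shared_def by auto
 consider (ss) c Q p q c' Q' p' q' where "shared y z t c Q p q" "shared z u t c' Q' p' q'"
  | (sg) c Q p q \<epsilon> where "shared y z t c Q p q" "\<epsilon> > 0" "ALL s l. t <= s --> s < t + \<epsilon> --> (entry s l : z <-> entry s l : u)"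
  | (gs) c Q p q \<epsilon> where "shared z u t c Q p q" "\<epsilon> > 0" "ALL s l. t <= s --> s < t + \<epsilon> --> (entry s l : y <-> entry s l : z)"
  | (gg) \<delta> \<epsilon> where "\<delta> > 0" "ALL s l. t <= s --> s < t + \<delta> --> (entry s l : y <-> entry s l : z)"
    "\<epsilon> > 0" "ALL s l. t <= s --> s < t + \<epsilon> --> (entry s l : z <-> entry s l : u)"
  using yz zu unfolding upward_def by (elim disjE exE conjE) meson+
 thus ?thesis
 proof cases
  case ss
  have "(c, q, Q) = (c', p', Q')"
   by (rule entry_unique[OF w(2)]) (use ss in \<open>auto simp: shared_def\<close>)
  hence "shared y u t c Q p q'" using ss unfolding shared_def by simp
  thus ?thesis unfolding upward_def by blast
 next
  case sg
  show ?thesis unfolding upward_def using germ[OF sg] by (rule disjI1)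
 next
  case gs
  have "ALL s l. t <= s --> s < t + \<epsilon> --> (entry s l : z <-> entry s l : y)" using gs(3) by simp
  from germ[OF shared_sym[OF gs(1)] gs(2) this] obtain d D a b where "shared u y t d D a b" by (elim exE)
  from shared_sym[OF this] show ?thesis unfolding upward_def by blast
 next
  case gg
  have "ALL s l. t <= s --> s < t + min \<delta> \<epsilon> --> (entry s l : y <-> entry s l : u)"
  proof (intro allI impI)
   fix s l assume "t <= s" "s < t + min \<delta> \<epsilon>"
   thus "entry s l : y <-> entry s l : u" using gg(2)[rule_format, of s l] gg(4)[rule_format, of s l] by simp
  qed
  moreover have "0 < min \<delta> \<epsilon>" using gg(1,3) by simp
  ultimately show ?thesis unfolding upward_def by blast
 qed
qed

lemma same_way_sym: "same_way x y z ==> same_way x z y"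
 unfolding same_way_def using upward_sym by blast

lemma same_way_trans: "same_way x y z ==> same_way x z u ==> same_way x y u"
 unfolding same_way_def using upward_trans by blast

lemma ht_le_sep:
 assumes w: "word x" "word y" "word z" and ne: "y ~= z" and s: "x <= y" "x <= z"
 shows "ht x <= sep y z"
 by (rule le_sepI[OF w(2,3) ne]) (use s sub_entry[OF w(1,2) s(1)] sub_entry[OF w(1,3) s(2)] in blast)

lemma upward_iff:
 assumes w: "word x" "word y" "word z" and ne: "y ~= z" and s: "x <= y" "x <= z"
 shows "upward (ht x) y z <-> (EX c Q p q. shared y z (ht x) c Q p q) | ht x < sep y z"
proof
 assume "upward (ht x) y z"
 then consider "EX c Q p q. shared y z (ht x) c Q p q"
  | \<epsilon> where "\<epsilon> > 0" "ALL s l. ht x <= s --> s < ht x + \<epsilon> --> (entry s l : y <-> entry s l : z)" unfolding upward_def by blast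
 thus "(EX c Q p q. shared y z (ht x) c Q p q) | ht x < sep y z"
 proof cases
  case 2
  have "ht x + \<epsilon> <= sep y z"
  proof (rule le_sepI[OF w(2,3) ne])
   fix t l assume t: "t < ht x + \<epsilon>"
   show "entry t l : y <-> entry t l : z"
   proof (cases "t < ht x")
    case True
    thus ?thesis using s sub_entry[OF w(1,2) s(1)] sub_entry[OF w(1,3) s(2)] by blast
   qed (use 2(2)[rule_format, of t l] t in simp)
  qed
  thus ?thesis using 2(1) by simp
 qed simp
next
 assume "(EX c Q p q. shared y z (ht x) c Q p q) | ht x < sep y z"
 thus "upward (ht x) y z"
 proof
  assume l: "ht x < sep y z"
  have "ALL s l. ht x <= s --> s < ht x + (sep y z - ht x) --> (entry s l : y <-> entry s l : z)"
   using sep_agree[OF w(2,3) ne] by simp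
  moreover have "0 < sep y z - ht x" using l by simp
  ultimately show ?thesis unfolding upward_def by blast
 qed (simp add: upward_def)
qed

lemma not_same_way_betw:
 assumes w: "word x" "word y" "word z" and n: "~ same_way x y z"
 shows "betw WT y x z"
proof -
 consider "x <= y" "~ x <= z" | "x <= z" "~ x <= y" | "x <= y" "x <= z" "~ upward (ht x) y z"
  using n w unfolding same_way_def by blast
 hence "wdist y x + wdist x z = wdist y z"
 proof cases
  case 1
  thus ?thesis using wdist_down[OF w] by simp
 next
  case 2
  thus ?thesis using wdist_down[OF w(1,3,2)] wdist_sym[OF w(1,2)] wdist_sym[OF w(1,3)] wdist_sym[OF w(2,3)] by simp
 next
  case 3
  have "(ALL s l. ht x <= s --> s < ht x + 1 --> (entry s l : y <-> entry s l : y))" by simp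
  hence ne: "y ~= z" using 3(3) unfolding upward_def by (metis zero_less_one)
  have u: "\<nexists>c Q p q. shared y z (ht x) c Q p q" "~ ht x < sep y z" using upward_iff[OF w ne 3(1,2)] 3(3) by auto
  hence s: "sep y z = ht x" using ht_le_sep[OF w ne 3(1,2)] by simp
  have "gp y z = 2 * ht x" using gp_not_shared[OF ne] u(1) s by simp
  thus ?thesis using wdist_sub[OF w(1,2) 3(1)] wdist_sub[OF w(1,3) 3(2)] wdist_sym[OF w(1,2)] unfolding wdist_def[of y z] by simp
 qed
 thus ?thesis unfolding betw_WT using w by simp
qed

text \<open>After the last time before its end at which \<open>x\<close> is not in the middle of a piece, the word
  crosses a single piece.\<close>
lemma last_entry:
 assumes x: "word x" and s: "bd x s" "s < ht x" and n: "!!t. bd x t ==> s < t ==> t < ht x ==> False"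
 shows "EX c Q p. piece_label (c, p, Q) & x = pt (cut x s) c Q p"
proof -
 obtain l where l: "entry s l : x" using bd_entry[OF x s] by blast
 have only: "t < s | (t = s & k = l)" if "entry t k : x" for t k
 proof -
  have "~ s < t" using n[of t] wordD(3)[OF x that] that unfolding bd_def by blast
  thus ?thesis using entry_unique[OF x l, of k] that by fastforce
 qed
 obtain m where m: "s < m" "m < ht x" using dense[OF s(2)] by blast
 have "0 <= m" using bd_le[OF x s(1)] m by simp
 from wordD(5)[OF x this m(2)] obtain t k where t: "entry t k : x" "t <= m" "m = t | m < t + len k" by blast
 have "piece_label l"
 proof (rule ccontr)
  assume np: "~ piece_label l"
  show False using only[OF t(1)]
  proof
   assume "t < s"
   thus False using entry_gap[OF x t(1) l] t m(1) by simp
  qed (use t m(1) np in \<open>auto simp: len_def\<close>)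
 qed
 moreover obtain c p Q where e: "l = (c, p, Q)" using prod_cases3 by blast
 ultimately have lab: "piece_label (c, p, Q)" by simp
 have "x = insert (entry s l) (cut x s)"
 proof (intro equalityI subsetI)
  fix u assume u: "u : x"
  then obtain t k where "u = entry t k" using wordD(2)[OF x] by blast
  thus "u : insert (entry s l) (cut x s)" using only[of t k] u by (auto simp: cut_mem)
 qed (use l cut_subset in blast)
 hence "x = pt (cut x s) c Q p" unfolding pt_def word_cut(2)[OF x s(1)] using piece_labelD[OF lab] e by simp
 thus ?thesis using lab by blast
qed

text \<open>Downwards, \<open>x\<close> either ends with a piece entry, which gives the piece, or has boundary times
  close to its end, and cutting there gives the common point. Upwards the same distinction is made by what the
  words share after \<open>x\<close>.\<close>
lemma same_way_common:
 assumes w: "word x" "word y" "word z" and ne: "y ~= x" "z ~= x" and E: "same_way x y z"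
 shows "(EX u. u ~= x & betw WT x u y & betw WT x u z) | (EX P:sites. x : P & gate WT P y ~= x & gate WT P z ~= x)"
proof -
 consider (eq) "y = z" | (down) "~ x <= y" "~ x <= z" | (up) "y ~= z" "x <= y" "x <= z" "upward (ht x) y z"
  using E unfolding same_way_def by blast
 thus ?thesis
 proof cases
  case eq
  have "betw WT x y y" unfolding betw_WT using w by simp
  thus ?thesis using eq ne by blast
 next
  case down
  define s where "s = max (sep x y) (sep x z)"
  have s: "bd x s" "s < ht x" unfolding s_def
   using sep_bd[OF w(1,2)] sep_bd[OF w(1,3)] ne sep_ge_sub[OF w(1,2)] sep_ge_sub[OF w(1,3)] down
   by (auto simp: max_def not_le[symmetric])
  show ?thesis
  proof (cases "EX t. bd x t & s < t & t < ht x")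
   case True
   then obtain t where t: "bd x t" "s < t" "t < ht x" by blast
   note u = word_cut[OF w(1) t(1)]
   have b: "betw WT x (cut x t) y'" if y': "word y'" "y' ~= x" "sep x y' < t" for y'
   proof -
    have "~ cut x t <= y'"
    proof
     assume "cut x t <= y'"
     thus False using ht_le_sep[OF u(1) w(1) y'(1) y'(2)[symmetric] cut_subset] u(2) y'(3) by simp
    qed
    from wdist_down[OF u(1) w(1) y'(1) cut_subset this] show ?thesis unfolding betw_WT using u(1) w(1) y'(1) by simp
   qed
   have "cut x t ~= x" using u(2) t(3) by auto
   moreover have "sep x y < t" "sep x z < t" using t(2) unfolding s_def by auto
   ultimately show ?thesis using b[OF w(2) ne(1)] b[OF w(3) ne(2)] by blast
  next
   case False
   from last_entry[OF w(1) s] False obtain c Q p where l: "piece_label (c, p, Q)" and x: "x = pt (cut x s) c Q p" by blast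
   note v = word_cut(1)[OF w(1) s(1)] and L = piece_labelD[OF l]
   have Q: "Q : R" "mspace Q ~= {}" using L by auto
   have g: "gate WT (site (cut x s) c Q) y' ~= x" if y': "word y'" "~ x <= y'" for y'
   proof
    assume "gate WT (site (cut x s) c Q) y' = x"
    hence e: "pt (cut x s) c Q (coord (cut x s) c Q y') = x" using gate_site[OF v Q y'(1)] by simp
    have "coord (cut x s) c Q y' ~= origin Q"
    using e False word_cut(2) w(1) s(1) s(2) by fastforce
    from coord_ne_origin(4)[OF v Q(1) y'(1) this] show False using e y'(2) by simp
   qed
   have "site (cut x s) c Q : sites" unfolding sites_def using v Q by blast
   moreover have "x : site (cut x s) c Q" unfolding site_def using x L by blast
   ultimately show ?thesis using g[OF w(2) down(1)] g[OF w(3) down(2)] by blast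
  qed
 next
  case up
  show ?thesis
  proof (cases "ht x < sep y z")
   case True
   have b: "bd y (sep y z)" "bd z (sep y z)" using sep_bd[OF w(2,3) up(1)] by auto
   let ?u = "cut y (sep y z)"
   note u = word_cut[OF w(2) b(1)]
   have uz: "?u <= z" using cut_sep[OF w(2,3) up(1)] cut_subset by simp
   have xu: "x <= ?u"
   proof (rule word_subsetI[OF w(1)])
    fix t l assume e: "entry t l : x"
    thus "entry t l : ?u" using wordD(3)[OF w(1) e] True up(2) by (auto simp: cut_mem)
   qed
   have "?u ~= x" using u(2) True by auto
   moreover have "betw WT x ?u y" "betw WT x ?u z" unfolding betw_WT
    using w u(1) wdist_sub[OF w(1) u(1) xu] wdist_sub[OF u(1) w(2) cut_subset] wdist_sub[OF u(1) w(3) uz]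
     wdist_sub[OF w(1,2) up(2)] wdist_sub[OF w(1,3) up(3)] by auto
   ultimately show ?thesis by blast
  next
   case False
   then obtain c Q p q where sh: "shared y z (ht x) c Q p q" using upward_iff[OF w up(1-3)] up(4) by blast
   hence l: "piece_label (c, p, Q)" "piece_label (c, q, Q)" "entry (ht x) (c, p, Q) : y" "entry (ht x) (c, q, Q) : z"
    unfolding shared_def by auto
   have Q: "Q : R" "mspace Q ~= {}" using piece_labelD[OF l(1)] by auto
   have g: "gate WT (site x c Q) y' ~= x" if y': "word y'" "x <= y'" "entry (ht x) (c, p', Q) : y'" "piece_label (c, p', Q)" for y' p'
   proof -
    have "entry (ht x) (c, p', Q) ~: x" using wordD(3)[OF w(1), of "ht x" "(c, p', Q)"] by auto
    thus ?thesis using gate_site[OF w(1) Q y'(1)] coord_eq[OF w(1) Q(1) y'] piece_labelD[OF y'(4)] pt_def by auto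
   qed
   have "site x c Q : sites" unfolding sites_def using w(1) Q by blast
   moreover have "x : site x c Q" unfolding site_def using pt_origin[of x c Q] piece_labelD[OF l(1)] by (metis imageI)
   ultimately show ?thesis using g[OF w(2) up(2) l(3,1)] g[OF w(3) up(3) l(4,2)] by blast
  qed
 qed
qed

text \<open>The point of height \<open>t\<close> on a geodesic from the empty word to a given word.\<close>

definition way :: "'q tree_point => real => 'q tree_point" where
 "way x t = (if bd x t then cut x t else
   (SOME u. EX a c q Q g. entry a (c, q, Q) : x & a < t & t < a + len (c, q, Q) & u = pt (cut x a) c Q (g (t - a)) &
    g = (SOME g. geo Q g (rad Q q) (origin Q) q)))"

lemma tile_cases:
 assumes x: "word x" and t: "0 <= t" "t <= ht x" "~ bd x t"
 obtains a c q Q where "entry a (c, q, Q) : x" "a < t" "t < a + len (c, q, Q)" "piece_label (c, q, Q)"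
proof -
 have "t < ht x" using t unfolding bd_def by fastforce
 from wordD(5)[OF x t(1) this] obtain a l where a: "entry a l : x" "a <= t" "t = a | t < a + len l" by blast
 have ne: "t ~= a" using t(3) a(1) unfolding bd_def by blast
 hence l: "a < t" "t < a + len l" using a by auto
 hence "piece_label l" unfolding len_def by (auto split: if_splits)
 moreover obtain c q Q where "l = (c, q, Q)" using prod_cases3 by blast
 ultimately show ?thesis using that a(1) l by blast
qed

lemma cut_mono: "s <= t ==> cut w s <= cut w t"
 unfolding cut_def by auto

lemma way_bd: "bd x t ==> way x t = cut x t"
 by (simp add: way_def)

text \<open>During a piece entry the path follows a fixed geodesic of \<open>Q\<close> from the origin.\<close>
lemma way_tile:
 assumes x: "word x" and e: "entry a (c, q, Q) : x" and l: "piece_label (c, q, Q)"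
 obtains g where "geo Q g (rad Q q) (origin Q) q"
  "!!t. a <= t ==> t <= a + rad Q q ==> way x t = pt (cut x a) c Q (g (t - a))"
proof -
 define g where "g = (SOME g. geo Q g (rad Q q) (origin Q) q)"
 note L = piece_labelD[OF l]
 have "EX g. geo Q g (rad Q q) (origin Q) q"
  using geodesic_space_geo[of Q "origin Q" q] Q_spaces[of Q] R_subset L by blast
 hence g: "geo Q g (rad Q q) (origin Q) q" unfolding g_def by (rule someI_ex)
 have ba: "bd x a" unfolding bd_def using e by blast
 note va = word_cut[OF x ba]
 show ?thesis
 proof (rule that[OF g])
  fix t assume t: "a <= t" "t <= a + rad Q q"
  have in_tile: "t' = a & k = (c, q, Q)" if k: "entry t' k : x" "t' < a + len (c, q, Q)" "a <= t'" for t' k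
   using entry_gap[OF x e k(1)] entry_unique[OF x e, of k] k by fastforce
  consider (l) "t = a" | (r) "t = a + rad Q q" "a < t" | (m) "a < t" "t < a + rad Q q" using t by linarith
  thus "way x t = pt (cut x a) c Q (g (t - a))"
  proof cases
   case l
   thus ?thesis using way_bd[OF ba] geoD(2)[OF g] by simp
  next
   case r
   have lt: "a + len (c, q, Q) = t" using r(1) len_piece[OF l] by simp
   have "pt (cut x a) c Q q = cut x t"
   proof -
    have "u : insert (entry a (c, q, Q)) (cut x a) <-> u : cut x t" for u
    proof (cases "u : x")
     case True
     obtain t' k where tk: "u = entry t' k" using wordD(2)[OF x True] by blast
     show ?thesis unfolding tk insert_iff cut_mem entry_eq_iff
      using True tk in_tile[of t' k] lt r(2) e by fastforce
    next
     case False
     thus ?thesis using e cut_subset[of x a] cut_subset[of x t] by blast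
    qed
    thus ?thesis using L va(2) by (simp add: pt_def set_eq_iff)
   qed
   moreover have "bd x t"
   proof (cases "t = ht x")
    case False
    hence "t < ht x" using wordD(3)[OF x e] lt by simp
    moreover have "0 <= t" using wordD(3)[OF x e] r(2) by simp
    ultimately obtain b k where b: "entry b k : x" "b <= t" "t = b | t < b + len k" using wordD(5)[OF x] by blast
    have "t = b"
    proof (rule ccontr)
     assume n: "t ~= b"
     hence bt: "b < t" "t < b + len k" using b by auto
     show False using in_tile[OF b(1)] bt lt entry_gap[OF x b(1) e] r(2) by fastforce
    qed
    thus ?thesis using b(1) unfolding bd_def by blast
   qed (simp add: bd_def)
   ultimately show ?thesis using way_bd r geoD(3)[OF g] by simp
  next
   case m
   have lt: "t < a + len (c, q, Q)" using m(2) len_piece[OF l] by simp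
   have nb: "~ bd x t" unfolding bd_def using in_tile[of t] m lt wordD(3)[OF x e] by auto
   have "(SOME u. EX a c q Q g. entry a (c, q, Q) : x & a < t & t < a + len (c, q, Q) & u = pt (cut x a) c Q (g (t - a)) &
    g = (SOME g. geo Q g (rad Q q) (origin Q) q)) = pt (cut x a) c Q (g (t - a))"
   proof (rule some_equality)
    show "EX a' c' q' Q' g'. entry a' (c', q', Q') : x & a' < t & t < a' + len (c', q', Q') &
      pt (cut x a) c Q (g (t - a)) = pt (cut x a') c' Q' (g' (t - a')) & g' = (SOME g. geo Q' g (mdist Q' (origin Q') q') (origin Q') q')"
     using e m(1) lt g_def by blast
    fix u assume "EX a c q Q g. entry a (c, q, Q) : x & a < t & t < a + len (c, q, Q) & u = pt (cut x a) c Q (g (t - a)) &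
      g = (SOME g. geo Q g (rad Q q) (origin Q) q)"
    then obtain a' c' q' Q' where u: "entry a' (c', q', Q') : x" "a' < t" "t < a' + len (c', q', Q')"
     "u = pt (cut x a') c' Q' ((SOME g. geo Q' g (mdist Q' (origin Q') q') (origin Q') q') (t - a'))" by blast
    have "~ a' < a" using entry_gap[OF x u(1) e] u(3) m(1) by auto
    thus "u = pt (cut x a) c Q (g (t - a))" using in_tile[OF u(1)] u lt u(4) g_def by simp
   qed
   thus ?thesis unfolding way_def using nb by simp
  qed
 qed
qed

lemma way_word:
 assumes x: "word x" and t: "0 <= t" "t <= ht x"
 shows "word (way x t)" "ht (way x t) = t"
proof -
 have "word (way x t) & ht (way x t) = t"
 proof (cases "bd x t")
  case True
  thus ?thesis using way_bd word_cut[OF x True] by simp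
 next
  case False
  obtain a c q Q where a: "entry a (c, q, Q) : x" "a < t" "t < a + len (c, q, Q)" "piece_label (c, q, Q)"
   by (rule tile_cases[OF x t False])
  obtain g where g: "geo Q g (rad Q q) (origin Q) q"
   "!!t. a <= t ==> t <= a + rad Q q ==> way x t = pt (cut x a) c Q (g (t - a))" by (rule way_tile[OF x a(1,4)]) blast
  have ta: "0 <= t - a" "t - a <= rad Q q" using a(2,3) len_piece[OF a(4)] by auto
  have w: "way x t = pt (cut x a) c Q (g (t - a))" by (rule g(2)) (use ta in auto)
  have ba: "bd x a" unfolding bd_def using a(1) by blast
  have m: "g (t - a) : mspace Q" by (rule geoD(7)[OF g(1) ta])
  have "rad Q (g (t - a)) = t - a" using geoD(8)[OF g(1), of 0 "t - a"] geoD(2)[OF g(1)] ta by simp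
  thus ?thesis unfolding w using pt_word(1,2)[OF word_cut(1)[OF x ba] _ m, of c] word_cut(2)[OF x ba] piece_labelD[OF a(4)] by simp
 qed
 thus "word (way x t)" "ht (way x t) = t" by auto
qed

lemma wdist_way_bd:
 assumes x: "word x" and b: "bd x b" and t: "0 <= t" "t <= b"
 shows "wdist (way x t) (cut x b) = b - t"
proof (cases "bd x t")
 case True
 have "cut x t <= cut x b" using t(2) unfolding cut_def by auto
 thus ?thesis using wdist_sub word_cut[OF x True] word_cut[OF x b] way_bd[OF True] by simp
next
 case False
 have th: "t <= ht x" using bd_le[OF x b] t by simp
 obtain a c q Q where a: "entry a (c, q, Q) : x" "a < t" "t < a + len (c, q, Q)" "piece_label (c, q, Q)"
  by (rule tile_cases[OF x t(1) th False])
 obtain g where g: "geo Q g (rad Q q) (origin Q) q"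
  "!!t. a <= t ==> t <= a + rad Q q ==> way x t = pt (cut x a) c Q (g (t - a))" by (rule way_tile[OF x a(1,4)]) blast
 have ta: "0 <= t - a" "t - a <= rad Q q" using a(2,3) len_piece[OF a(4)] by auto
 have w: "way x t = pt (cut x a) c Q (g (t - a))" by (rule g(2)) (use ta in auto)
 have ba: "bd x a" unfolding bd_def using a(1) by blast
 note va = word_cut[OF x ba] and vb = word_cut[OF x b] and Q = piece_labelD[OF a(4)]
 have m: "g (t - a) : mspace Q" by (rule geoD(7)[OF g(1) ta])
 have ab: "a < b" using a(2) t(2) by simp
 have e: "entry a (c, q, Q) : cut x b" using a(1) ab by (simp add: cut_mem)
 have sub: "cut x a <= cut x b" using ab unfolding cut_def by auto
 have co: "coord (cut x a) c Q (cut x b) = q"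
  by (rule coord_eq[OF va(1) _ vb(1) sub _ a(4)]) (use Q e va(2) in simp_all)
 have pw: "pt (cut x a) c Q q <= cut x b" using sub e va(2) by (simp add: pt_def)
 have "mdist Q q (g (t - a)) = rad Q q - (t - a)"
  using geoD(8)[OF g(1), of "rad Q q" "t - a"] geoD(3)[OF g(1)] geoD(1)[OF g(1)] ta by simp
 hence "wdist (cut x b) (way x t) = b - t" using wdist_pt[OF va(1) _ vb(1) m, of c] co w Q wdist_sub[OF pt_word(1)[OF va(1)] vb(1) pw] wdist_sym[OF vb(1) pt_word(1)[OF va(1)]] pt_word(2)[OF va(1)] va(2) vb(2) by simp
 thus ?thesis using wdist_sym[OF vb(1) way_word(1)[OF x t(1) th]] by simp
qed

lemma wdist_way:
 assumes x: "word x" and t: "0 <= s" "s <= t" "t <= ht x"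
 shows "wdist (way x s) (way x t) = t - s"
proof -
 note S = way_word[OF x t(1)] and T = way_word[OF x _ t(3)]
 have w: "word (way x s)" "word (way x t)" "ht (way x s) = s" "ht (way x t) = t" using S T t by auto
 show ?thesis
 proof (cases "EX b. bd x b & s <= b & b <= t")
  case True
  then obtain b where b: "bd x b" "s <= b" "b <= t" by blast
  have sub: "cut x b <= way x t"
  proof (cases "bd x t")
   case True
   show ?thesis unfolding way_bd[OF True] by (rule cut_mono[OF b(3)])
  next
   case False
   have t0: "0 <= t" using t by simp
   obtain a c q Q where a: "entry a (c, q, Q) : x" "a < t" "t < a + len (c, q, Q)" "piece_label (c, q, Q)"
    by (rule tile_cases[OF x t0 t(3) False])
   obtain g where g: "geo Q g (rad Q q) (origin Q) q"
    "!!t. a <= t ==> t <= a + rad Q q ==> way x t = pt (cut x a) c Q (g (t - a))" by (rule way_tile[OF x a(1,4)]) blast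
   have "way x t = pt (cut x a) c Q (g (t - a))" by (rule g(2)) (use a len_piece[OF a(4)] in auto)
   moreover have "b <= a"
   proof (cases "b = ht x")
    case True
    thus ?thesis using b(3) a(3) wordD(3)[OF x a(1)] by simp
   next
    case False
    then obtain k where "entry b k : x" using b(1) unfolding bd_def by blast
    thus ?thesis using entry_gap[OF x a(1), of b k] a(3) b(3) by fastforce
   qed
   hence "cut x b <= cut x a" by (rule cut_mono)
   ultimately show ?thesis unfolding pt_def by auto
  qed
  note vb = word_cut[OF x b(1)]
  show ?thesis using wdist_triangle[OF w(1) vb(1) w(2)] wdist_way_bd[OF x b(1) t(1) b(2)] wdist_sub[OF vb(1) w(2) sub] vb(2) w(4) wdist_ht[OF w(1,2)] w(3,4) t(2) by simp
 next
  case False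
  have nb: "~ bd x s" using False t by auto
  have sh: "s <= ht x" using t by simp
  obtain a c q Q where a: "entry a (c, q, Q) : x" "a < s" "s < a + len (c, q, Q)" "piece_label (c, q, Q)"
   by (rule tile_cases[OF x t(1) sh nb])
  obtain g where g: "geo Q g (rad Q q) (origin Q) q"
   "!!t. a <= t ==> t <= a + rad Q q ==> way x t = pt (cut x a) c Q (g (t - a))" by (rule way_tile[OF x a(1,4)]) blast
  have ba: "bd x a" unfolding bd_def using a(1) by blast
  have nbt: "~ bd x t" and t0: "0 <= t" using False t by auto
  obtain a' c' q' Q' where a': "entry a' (c', q', Q') : x" "a' < t" "t < a' + len (c', q', Q')"
   by (rule tile_cases[OF x t0 t(3) nbt])
  have "bd x a'" unfolding bd_def using a'(1) by blast
  hence "a' < s" using False a'(2) by fastforce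
  hence "~ a < a'" "~ a' < a" using entry_gap[OF x a(1) a'(1)] entry_gap[OF x a'(1) a(1)] a a' t(2) by auto
  hence "(c', q', Q') = (c, q, Q)" using entry_unique[OF x a'(1), of "(c, q, Q)"] a(1) by simp
  hence te: "t < a + rad Q q" using a'(3) \<open>~ a < a'\<close> \<open>~ a' < a\<close> len_piece[OF a(4)] by auto
  have ws: "way x s = pt (cut x a) c Q (g (s - a))" and wt: "way x t = pt (cut x a) c Q (g (t - a))"
   using g(2)[of s] g(2)[of t] a(2) te t(2) by auto
  have m: "g (s - a) : mspace Q" "g (t - a) : mspace Q" using geoD(7)[OF g(1)] a(2) te t(2) by auto
  have "mdist Q (g (s - a)) (g (t - a)) = t - s" using geoD(8)[OF g(1), of "s - a" "t - a"] a(2) te t(2) by simp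
  thus ?thesis unfolding ws wt using wdist_pt_pt[OF word_cut(1)[OF x ba] _ m, of c] piece_labelD[OF a(4)] by simp
 qed
qed

lemma way_end: "word x ==> way x (ht x) = x"
 using way_bd[of x "ht x"] cut_ht by (simp add: bd_def)

lemma geo_sub_word:
 assumes w: "word v" "word x" "v <= x"
 shows "geo WT (%t. way x (ht v + t)) (ht x - ht v) v x"
proof (rule geoI)
 have h: "0 <= ht v" "ht v <= ht x" using wordD(1)[OF w(1)] sub_ht[OF w] by auto
 show "0 <= ht x - ht v" using h by simp
 show "way x (ht v + 0) = v" using way_bd[OF sub_bd[OF w]] sub_cut[OF w] by simp
 show "way x (ht v + (ht x - ht v)) = x" using way_end[OF w(2)] by simp
 show "way x (ht v + t) : mspace WT" if "0 <= t" "t <= ht x - ht v" for t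
  using way_word(1)[OF w(2), of "ht v + t"] that h by simp
 show "mdist WT (way x (ht v + s)) (way x (ht v + t)) = t - s" if "0 <= s" "s <= t" "t <= ht x - ht v" for s t
  using way_word(1)[OF w(2), of "ht v + t"] way_word(1)[OF w(2), of "ht v + s"] wdist_way[OF w(2), of "ht v + s" "ht v + t"] that h
  by (simp add: mdist_WT)
qed

text \<open>From one word go down to the place where the two separate and then up to the other; if they separate inside
  a shared piece, cross it by a geodesic of \<open>Q\<close>.\<close>
lemma geodesic_WT: "geodesic_space WT"
 unfolding geodesic_space_def
proof (intro ballI)
 fix x y assume "x : mspace WT" "y : mspace WT"
 hence w: "word x" "word y" by auto
 have "EX g l. geo WT g l x y"
 proof (cases "x = y")
  case True
  thus ?thesis using geo_sub_word[OF w(1) w(2)] by blast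
 next
  case ne: False
  have b: "bd x (sep x y)" "bd y (sep x y)" using sep_bd[OF w ne] by auto
  let ?v = "cut x (sep x y)"
  have v: "word ?v" "ht ?v = sep x y" "?v <= x" "?v <= y"
   using word_cut[OF w(1) b(1)] cut_subset cut_sep[OF w ne] by auto
  show ?thesis
  proof (cases "EX c Q p q. shared x y (sep x y) c Q p q")
   case False
   have "betw WT x ?v y" unfolding betw_WT using w v gp_not_shared[OF ne False]
     wdist_sub[OF v(1) w(1) v(3)] wdist_sub[OF v(1) w(2) v(4)] wdist_sym[OF w(1) v(1)] unfolding wdist_def[of x y] by simp
   from geo_concat[OF geo_rev[OF geo_sub_word[OF v(1) w(1) v(3)]] geo_sub_word[OF v(1) w(2) v(4)] this]
   show ?thesis by blast
  next
   case True
   then obtain c Q p q where sh: "shared x y (sep x y) c Q p q" by blast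
   hence l: "piece_label (c, p, Q)" "piece_label (c, q, Q)" "entry (ht ?v) (c, p, Q) : x" "entry (ht ?v) (c, q, Q) : y"
    unfolding shared_def v(2) by auto
   note P = piece_labelD[OF l(1)] and Q' = piece_labelD[OF l(2)]
   have Q: "Q : R" "p : mspace Q" "q : mspace Q" "mspace Q ~= {}" using P Q' by auto
   have co: "coord ?v c Q x = p" "coord ?v c Q y = q"
    using coord_eq[OF v(1) Q(1) w(1) v(3) l(3,1)] coord_eq[OF v(1) Q(1) w(2) v(4) l(4,2)] by auto
   let ?p = "pt ?v c Q p" and ?q = "pt ?v c Q q"
   have pw: "word ?p" "word ?q" using pt_word(1)[OF v(1) Q(1)] Q by auto
   have sub: "?p <= x" "?q <= y" unfolding pt_def using v l by auto
   have D: "wdist x y = wdist x ?p + mdist Q p q + wdist ?q y" using wdist_coord_differ[OF v(1) Q(1) w _ Q(4), of c] co shared_ne[OF w ne sh] by simp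
   have pp: "wdist ?p ?q = mdist Q p q" by (rule wdist_pt_pt[OF v(1) Q(1-3)])
   have dxq: "wdist x ?q = wdist x ?p + mdist Q p q" using wdist_pt[OF v(1) Q(1) w(1) Q(3), of c] co by simp
   obtain g where g: "geo Q g (mdist Q p q) p q" using geodesic_space_geo[of Q p q] Q_spaces[of Q] R_subset Q by blast
   have G: "geo WT (%t. pt ?v c Q (g t)) (mdist Q p q) ?p ?q"
   proof (rule geoI)
    show "0 <= mdist Q p q" "pt ?v c Q (g 0) = ?p" "pt ?v c Q (g (mdist Q p q)) = ?q" using geoD(2,3)[OF g] by auto
    show "pt ?v c Q (g t) : mspace WT" if "0 <= t" "t <= mdist Q p q" for t
     using pt_word(1)[OF v(1) Q(1) geoD(7)[OF g that]] by simp
    show "mdist WT (pt ?v c Q (g s)) (pt ?v c Q (g t)) = t - s" if st: "0 <= s" "s <= t" "t <= mdist Q p q" for s t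
    proof -
     show ?thesis using geoD(7)[OF g] st wdist_pt_pt[OF v(1) Q(1)] pt_word(1)[OF v(1) Q(1)] geoD(8)[OF g, of s t] by (simp add: mdist_WT)
    qed
   qed
   have "betw WT x ?p ?q" "betw WT x ?q y" unfolding betw_WT using w pw D pp dxq by auto
   from geo_concat[OF geo_concat[OF geo_rev[OF geo_sub_word[OF pw(1) w(1) sub(1)]] G this(1)] geo_sub_word[OF pw(2) w(2) sub(2)] this(2)]
   show ?thesis by blast
  qed
 qed
 thus "EX \<gamma> r. geodesic WT \<gamma> 0 r & \<gamma> 0 = x & \<gamma> r = y" unfolding geo_def by blast
qed

end

section \<open>Completeness of the model\<close>

context Q_choices
begin

lemma wdist_nonneg: "word x ==> word y ==> 0 <= wdist x y"
 using wdist_pos[of x y] by (cases "x = y") auto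

text \<open>A chain of words is consistent. Tameness concerns the times shortly after an entry and is inherited from the
  members of the chain.\<close>
lemma word_Union:
 assumes ne: "V ~= {}" and w: "!!v. v : V ==> word v" and ch: "!!v v'. v : V ==> v' : V ==> v <= v' | v' <= v"
  and bdd: "bdd_above (ht ` V)"
 shows "word (\<Union>V)" "ht (\<Union>V) = Sup (ht ` V)"
proof -
 let ?s = "Sup (ht ` V)"
 have le: "ht v <= ?s" if "v : V" for v by (rule cSup_upper[OF imageI[OF that] bdd])
 obtain v0 where v0: "v0 : V" using ne by blast
 have t: "tiles (\<Union>V) ?s"
  unfolding tiles_def
 proof (intro conjI ballI allI impI)
  show "0 <= ?s" using wordD(1)[OF w[OF v0]] le[OF v0] by simp
  show "EX t l. e = entry t l & label_ok l & 0 <= t & t < ?s & t + len l <= ?s" if eV: "e : \<Union>V" for e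
  proof -
   obtain v where v: "v : V" "e : v" using eV by blast
   obtain t l where e: "e = entry t l" using wordD(2)[OF w[OF v(1)] v(2)] by blast
   thus ?thesis using wordD(3)[OF w[OF v(1)], of t l] v(2) le[OF v(1)] by (intro exI[of _ t] exI[of _ l]) auto
  qed
  show "(t = t' & l = l') | (t < t' & t + len l <= t')"
   if e: "entry t l : \<Union>V" "entry t' l' : \<Union>V" "t <= t'" for t l t' l'
  proof -
   obtain v v' where v: "v : V" "entry t l : v" "v' : V" "entry t' l' : v'" using e by blast
   obtain u where "u : V" "entry t l : u" "entry t' l' : u" using ch[OF v(1,3)] v by blast
   thus ?thesis using wordD(4)[OF w, of u t l t' l'] e(3) by blast
  qed
  show "EX t l. entry t l : \<Union>V & t <= s & (s = t | s < t + len l)" if s: "0 <= s" "s < ?s" for s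
  proof -
   obtain v where v: "v : V" "s < ht v" using less_cSup_iff[OF _ bdd, of s] ne s(2) by auto
   from wordD(5)[OF w[OF v(1)] s(1) v(2)] v(1) show ?thesis by blast
  qed
 qed
 thus "ht (\<Union>V) = ?s" by (rule ht_eq)
 have "tame (\<Union>V)"
 proof (rule tame_local)
  fix t c assume "entry t (plain c) : \<Union>V"
  then obtain v where v: "v : V" "entry t (plain c) : v" by blast
  note vw = w[OF v(1)]
  have "ALL s l. s < ht v --> (entry s l : \<Union>V <-> entry s l : v)"
  proof (intro allI impI iffI)
   fix s l assume s: "s < ht v" and "entry s l : \<Union>V"
   then obtain v' where v': "v' : V" "entry s l : v'" by blast
   from ch[OF v(1) v'(1)] show "entry s l : v" using sub_entry[OF vw w[OF v'(1)] _ v'(2) s] v'(2) by blast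
  qed (use v(1) in blast)
  moreover have "t < ht v" using wordD(3)[OF vw v(2)] by simp
  ultimately show "EX v r. tame v & t < r & (ALL s l. t <= s --> s < r --> (entry s l : \<Union>V <-> entry s l : v))"
   using word_tame[OF vw] by blast
 qed
 thus "word (\<Union>V)" unfolding word_def using t by blast
qed

lemma gp_le_bd:
 assumes w: "word x" "word y" and ne: "x ~= y" and b: "bd x b" "sep x y < b"
 shows "gp x y <= 2 * b"
proof (cases "EX c Q p q. shared x y (sep x y) c Q p q")
 case True
 then obtain c Q p q where s: "shared x y (sep x y) c Q p q" by blast
 hence e: "entry (sep x y) (c, p, Q) : x" "piece_label (c, p, Q)" unfolding shared_def by auto
 have "sep x y + len (c, p, Q) <= b"
  using b(1) wordD(3)[OF w(1) e(1)] entry_gap[OF w(1) e(1) _ b(2)] unfolding bd_def by blast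
 thus ?thesis using gp_shared[OF w ne s] shared_bounds(4)[OF w s] len_piece[OF e(2)] by simp
next
 case False
 thus ?thesis using gp_not_shared[OF ne] b(2) by simp
qed

lemma cut_sub_sep:
 assumes w: "word x" "word y" and ne: "x ~= y" and b: "bd x b" "b <= sep x y"
 shows "cut x b <= y"
 by (rule word_subsetI[OF word_cut(1)[OF w(1) b(1)]]) (use sep_agree[OF w ne] b(2) in \<open>auto simp: cut_mem\<close>)

context
 fixes X :: "nat => 'q tree_point"
 assumes X: "!!n. word (X n)" and cauchy: "!!e. e > 0 ==> EX N. ALL m>=N. ALL n>=N. wdist (X m) (X n) < e"
begin

definition stable :: "'q tree_point set" where
 "stable = {v. word v & (EX N. ALL n>=N. v <= X n)}"

lemma heights_converge: "EX \<rho>. (%n. ht (X n)) \<longlonglongrightarrow> \<rho>"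
proof -
 have "Cauchy (%n. ht (X n))"
 proof (rule metric_CauchyI)
  fix e :: real assume "e > 0"
  then obtain N where N: "ALL m>=N. ALL n>=N. wdist (X m) (X n) < e" using cauchy by blast
  have "dist (ht (X m)) (ht (X n)) < e" if "N <= m" "N <= n" for m n
   using wdist_ht[OF X X, of m n] N that unfolding dist_real_def by fastforce
  thus "EX M. ALL m>=M. ALL n>=M. dist (ht (X m)) (ht (X n)) < e" by blast
 qed
 thus ?thesis using Cauchy_convergent_iff convergent_def by blast
qed

context
 fixes \<rho> assumes \<rho>: "(%n. ht (X n)) \<longlonglongrightarrow> \<rho>"
begin

lemma stable_le: "v : stable ==> ht v <= \<rho>"
proof -
 assume "v : stable"
 then obtain N where N: "word v" "ALL n>=N. v <= X n" unfolding stable_def by blast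
 thus ?thesis by (intro LIMSEQ_le_const[OF \<rho>]) (use sub_ht[OF N(1) X] in blast)
qed

lemma stable_Union: "word (\<Union>stable)" "ht (\<Union>stable) = Sup (ht ` stable)" "v : stable ==> ht v <= ht (\<Union>stable)"
 "ht (\<Union>stable) <= \<rho>"
proof -
 have ne: "stable ~= {}" unfolding stable_def using word_empty by blast
 have w: "word v" if "v : stable" for v using that unfolding stable_def by simp
 have bdd: "bdd_above (ht ` stable)" using stable_le by (intro bdd_aboveI2[of _ _ \<rho>])
 have ch: "v <= v' | v' <= v" if "v : stable" "v' : stable" for v v'
 proof -
  obtain N N' where N: "ALL n>=N. v <= X n" "ALL n>=N'. v' <= X n" using \<open>v : stable\<close> \<open>v' : stable\<close> unfolding stable_def by blast
  have "v <= X (max N N')" "v' <= X (max N N')" using N by auto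
  thus ?thesis using sub_cut w that X cut_mono[of "ht v" "ht v'"] cut_mono[of "ht v'" "ht v"] by (metis linear)
 qed
 show "word (\<Union>stable)" and eq: "ht (\<Union>stable) = Sup (ht ` stable)" using word_Union[OF ne w ch bdd] by auto
 show "v : stable ==> ht v <= ht (\<Union>stable)" unfolding eq by (rule cSup_upper[OF imageI bdd])
 show "ht (\<Union>stable) <= \<rho>" unfolding eq using ne stable_le by (intro cSUP_least)
qed

text \<open>If the stable words reach the limit of the heights, their union is the limit.\<close>
lemma converge_to_Union:
 assumes "\<rho> <= ht (\<Union>stable)" and e: "e > 0"
 shows "EX N. ALL n>=N. wdist (X n) (\<Union>stable) < e"
proof -
 have h: "ht (\<Union>stable) = \<rho>" using assms(1) stable_Union(4) by simp
 have ne: "ht ` stable ~= {}" unfolding stable_def using word_empty by blast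
 have bdd: "bdd_above (ht ` stable)" using stable_le by (intro bdd_aboveI2[of _ _ \<rho>])
 have "\<rho> - e/3 < Sup (ht ` stable)" using h stable_Union(2) e by simp
 then obtain v where v: "v : stable" "\<rho> - e/3 < ht v" using less_cSup_iff[OF ne bdd] by blast
 obtain N where N: "word v" "ALL n>=N. v <= X n" using v(1) unfolding stable_def by blast
 have "EX N. ALL n>=N. norm (ht (X n) - \<rho>) < e/3" by (rule LIMSEQ_D[OF \<rho>]) (use e in simp)
 then obtain N' where N': "ALL n>=N'. norm (ht (X n) - \<rho>) < e/3" by blast
 have vu: "v <= \<Union>stable" using v(1) by blast
 have "wdist (X n) (\<Union>stable) < e" if n: "max N N' <= n" for n
 proof -
  have "wdist (X n) (\<Union>stable) <= (ht (X n) - ht v) + (\<rho> - ht v)" using N(2) n wdist_triangle[OF X N(1) stable_Union(1), of n] wdist_sub[OF N(1) X, of n] wdist_sym[OF N(1) X, of n] wdist_sub[OF N(1) stable_Union(1) vu] h by simp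
  moreover have "\<bar>ht (X n) - \<rho>\<bar> < e/3" using N' n by simp
  ultimately show ?thesis using v(2) by arith
 qed
 thus ?thesis by blast
qed

context
 assumes low: "ht (\<Union>stable) < \<rho>"
begin

lemma tail:
 obtains N \<delta> where "0 < \<delta>" "ht (\<Union>stable) + 4 * \<delta> = \<rho>" "!!n. N <= n ==> ht (\<Union>stable) + 3 * \<delta> < ht (X n)"
  "!!m n. N <= m ==> N <= n ==> 2 * (ht (\<Union>stable) + 2 * \<delta>) < gp (X m) (X n)"
proof -
 define \<delta> where "\<delta> = (\<rho> - ht (\<Union>stable)) / 4"
 have d: "0 < \<delta>" "ht (\<Union>stable) + 4 * \<delta> = \<rho>" using low unfolding \<delta>_def by (simp_all add: field_simps)
 obtain N1 where N1: "ALL m>=N1. ALL n>=N1. wdist (X m) (X n) < \<delta>" using cauchy[OF d(1)] by blast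
 obtain N2 where N2: "ALL n>=N2. norm (ht (X n) - \<rho>) < \<delta>" using LIMSEQ_D[OF \<rho> d(1)] by blast
 have h: "\<rho> - \<delta> < ht (X n)" if "max N1 N2 <= n" for n using N2[rule_format, of n] that by auto
 show ?thesis
 proof (rule that[OF d, of "max N1 N2"])
  show "ht (\<Union>stable) + 3 * \<delta> < ht (X n)" if "max N1 N2 <= n" for n using h[OF that] d(2) by simp
  show "2 * (ht (\<Union>stable) + 2 * \<delta>) < gp (X m) (X n)" if mn: "max N1 N2 <= m" "max N1 N2 <= n" for m n
  proof -
   have "ht (X m) + ht (X n) - gp (X m) (X n) < \<delta>" using N1 mn by (simp add: wdist_def)
   thus ?thesis using h[OF mn(1)] h[OF mn(2)] d(1) d(2) by simp
  qed
 qed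
qed

text \<open>Beyond the height up to which the words stabilise they all run inside one piece, and their
 gates to this piece never become constant.\<close>

lemma moving_in_piece:
 obtains v c Q N where "word v" "Q : R" "mspace Q ~= {}" "!!n. N <= n ==> EX m>=n. coord v c Q (X m) ~= coord v c Q (X n)"
proof -
 obtain N \<delta> where d: "0 < \<delta>" "ht (\<Union>stable) + 4 * \<delta> = \<rho>" and h: "!!n. N <= n ==> ht (\<Union>stable) + 3 * \<delta> < ht (X n)"
  and g: "!!m n. N <= m ==> N <= n ==> 2 * (ht (\<Union>stable) + 2 * \<delta>) < gp (X m) (X n)" by (rule tail) blast
 let ?\<sigma> = "ht (\<Union>stable)"
 have K: "b <= sep (X n) (X m)" if "N <= n" "N <= m" "bd (X n) b" "b <= ?\<sigma> + 2 * \<delta>" "X n ~= X m" for n m b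
 using gp_le_bd X that(5,3) that(4) g that(1,2) by fastforce
 have no_bd: "b <= ?\<sigma>" if b: "N <= n" "bd (X n) b" "b <= ?\<sigma> + 2 * \<delta>" for n b
 proof -
  have "cut (X n) b <= X m" if m: "N <= m" for m
  using cut_sub_sep X b(2) K b(1) m b(2,3) cut_subset by metis
  hence "cut (X n) b : stable" unfolding stable_def using word_cut(1)[OF X b(2)] by blast
  from stable_Union(3)[OF this] show ?thesis using word_cut(2)[OF X b(2)] by simp
 qed
 have \<sigma>0: "0 <= ?\<sigma>" by (rule wordD(1)[OF stable_Union(1)])
 have t: "0 <= ?\<sigma> + \<delta>" "?\<sigma> + \<delta> <= ht (X N)" "~ bd (X N) (?\<sigma> + \<delta>)"
  using \<sigma>0 d(1) h[of N] no_bd[of N "?\<sigma> + \<delta>"] by auto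
 obtain a c p Q where a: "entry a (c, p, Q) : X N" "a < ?\<sigma> + \<delta>" "?\<sigma> + \<delta> < a + len (c, p, Q)" "piece_label (c, p, Q)"
  by (rule tile_cases[OF X t])
 have ba: "bd (X N) a" unfolding bd_def using a(1) by blast
 have as: "a <= ?\<sigma>" by (rule no_bd[OF _ ba]) (use a(2) d(1) in auto)
 define v where "v = cut (X N) a"
 have v: "word v" "ht v = a" unfolding v_def using word_cut[OF X ba] by auto
 note Q = piece_labelD[OF a(4)]
 have Qn: "Q : R" "mspace Q ~= {}" using Q by auto
 have in_piece: "v <= X m & (EX q. piece_label (c, q, Q) & entry (ht v) (c, q, Q) : X m)" if m: "N <= m" for m
 proof (cases "X N = X m")
  case True
  thus ?thesis using a v(2) cut_subset[of "X N" a] unfolding v_def by auto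
 next
  case False
  have s: "a <= sep (X N) (X m)" by (rule K[OF _ m ba _ False]) (use as d(1) in auto)
  have "v <= X m" unfolding v_def by (rule cut_sub_sep[OF X X False ba s])
  moreover have "EX q. piece_label (c, q, Q) & entry a (c, q, Q) : X m"
  proof (cases "a = sep (X N) (X m)")
   case True
   have "EX c Q p q. shared (X N) (X m) a c Q p q"
   proof (rule ccontr)
    assume "\<nexists>c Q p q. shared (X N) (X m) a c Q p q"
    thus False using gp_not_shared[OF False] True g[OF _ m, of N] as d(1) by simp
   qed
   then obtain c' Q' p' q where sh: "shared (X N) (X m) a c' Q' p' q" by blast
   hence "(c, p, Q) = (c', p', Q')" by (intro entry_unique[OF X a(1)]) (simp add: shared_def)
   thus ?thesis using sh unfolding shared_def by blast
  next
   case n: False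
   hence "entry a (c, p, Q) : X m" using sep_agree[OF X X False, of a] s a(1) by simp
   thus ?thesis using a(4) by blast
  qed
  ultimately show ?thesis using v(2) by simp
 qed
 show ?thesis
 proof (rule that[OF v(1) Qn], rule ccontr)
  fix n assume n: "N <= n" and "~ (EX m>=n. coord v c Q (X m) ~= coord v c Q (X n))"
  hence const: "coord v c Q (X m) = coord v c Q (X n)" if "n <= m" for m using that by blast
  have ne: "coord v c Q (X m) ~= origin Q" if m: "N <= m" for m
  using in_piece m coord_eq v(1) Qn(1) X piece_labelD by metis
  let ?q = "coord v c Q (X n)" let ?p = "pt v c Q ?q"
  note P = pt_word[OF v(1) Qn(1) coord_mem[OF v(1) Qn(1) X[of n] Qn(2), of c], of c]
  have sub: "?p <= X m" if m: "n <= m" for m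
  using n m coord_ne_origin(4) v(1) Qn(1) X ne const by metis
  have "?p : stable" unfolding stable_def using P(1) sub by blast
  hence le: "ht ?p <= ?\<sigma>" by (rule stable_Union(3))
  note C = coord_ne_origin(2,3)[OF v(1) Qn(1) X ne[OF n]]
  have "entry a (c, ?q, Q) : X N"
  proof (cases "X n = X N")
   case True
   thus ?thesis using C(1) v(2) by simp
  next
   case False
   have "bd (X n) (ht ?p)" by (rule sub_bd[OF P(1) X sub]) simp
   hence "ht ?p <= sep (X n) (X N)" using K[OF n _ _ _ False] le d(1) by simp
   thus ?thesis using P(2) v(2) len_pos[OF C(2)] len_piece[OF C(2)] sep_agree[OF X X False] C(1) by simp
  qed
  hence "(c, ?q, Q) = (c, p, Q)" using entry_unique[OF X a(1)] by metis
  thus False using P(2) v(2) len_piece[OF a(4)] le a(3) d(1) by simp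
 qed
qed

text \<open>The coordinates form a Cauchy sequence in the complete space \<open>Q\<close>, and the words converge to the
  point of the piece with the limit coordinate.\<close>
lemma converge_in_piece: "EX u. word u & (ALL e>0. EX N. ALL n>=N. wdist (X n) u < e)"
proof -
 obtain v c Q N where v: "word v" "Q : R" "mspace Q ~= {}"
  and mv: "!!n. N <= n ==> EX m>=n. coord v c Q (X m) ~= coord v c Q (X n)" by (rule moving_in_piece) blast
 let ?q = "%n. coord v c Q (X n)" let ?g = "%n. pt v c Q (?q n)"
 have qm: "?q n : mspace Q" for n by (rule coord_mem[OF v(1,2) X v(3)])
 have gw: "word (?g n)" for n by (rule pt_word(1)[OF v(1,2) qm])
 have split: "wdist (X n) (?g n) <= wdist (X n) (X m) & mdist Q (?q n) (?q m) <= wdist (X n) (X m)" if "?q n ~= ?q m" for n m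
  using wdist_coord_differ[OF v(1,2) X X that v(3)] wdist_nonneg[OF X gw, of n n] wdist_nonneg[OF gw X, of m m]
   mdist_nonneg[of Q "?q n" "?q m"] by simp
 have "EX z:mspace Q. ALL e>0. EX N. ALL n>=N. mdist Q (?q n) z < e"
 proof (rule complete_limit)
  show "mcomplete_of Q" using Q_spaces[of Q] v(2) R_subset by blast
  show "?q n : mspace Q" for n by (rule qm)
  fix e :: real assume e: "e > 0"
  obtain N where N: "ALL m>=N. ALL n>=N. wdist (X m) (X n) < e" using cauchy[OF e] by blast
  have "mdist Q (?q i) (?q j) < e" if ij: "N <= i" "N <= j" for i j
  proof (cases "?q i = ?q j")
   case False
   show ?thesis using N ij split[OF False] by fastforce
  qed (use qm e in simp)
  thus "EX N. ALL i>=N. ALL j>=N. mdist Q (?q i) (?q j) < e" by blast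
 qed
 then obtain z where z: "z : mspace Q" "ALL e>0. EX N. ALL n>=N. mdist Q (?q n) z < e" by blast
 have "EX N. ALL n>=N. wdist (X n) (pt v c Q z) < e" if e: "e > 0" for e
 proof -
  obtain N1 where N1: "ALL m>=N1. ALL n>=N1. wdist (X m) (X n) < e/2" using cauchy[of "e/2"] e by auto
  obtain N2 where N2: "ALL n>=N2. mdist Q (?q n) z < e/2" using z(2) e half_gt_zero by blast
  have "wdist (X n) (pt v c Q z) < e" if n: "max N (max N1 N2) <= n" for n
  proof -
   have n': "N <= n" "N1 <= n" "N2 <= n" using n by auto
   obtain m where m: "m >= n" "?q m ~= ?q n" using mv[OF n'(1)] by blast
   have "wdist (X n) (X m) < e/2" using N1 n'(2) m(1) by simp
   moreover have "mdist Q (?q n) z < e/2" using N2 n'(3) by simp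
   ultimately show ?thesis using wdist_pt[OF v(1,2) X[of n] z(1), of c] split[OF m(2)[symmetric]] by simp
  qed
  thus ?thesis by blast
 qed
 thus ?thesis using pt_word(1)[OF v(1,2) z(1)] by blast
qed

end

lemma limit_exists: "EX u. word u & (ALL e>0. EX N. ALL n>=N. wdist (X n) u < e)"
proof (cases "ht (\<Union>stable) < \<rho>")
 case True
 thus ?thesis by (rule converge_in_piece)
next
 case False
 thus ?thesis using converge_to_Union stable_Union(1) by (meson not_less)
qed

end

end

lemma complete_WT: "mcomplete_of WT"
proof -
 interpret Metric_space "mspace WT" "mdist WT" by (rule Metric_space_mspace_mdist)
 have "EX u. limitin mtopology X u sequentially" if c: "MCauchy X" for X
 proof -
  have X: "word (X n)" for n using c unfolding MCauchy_def by auto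
  have ca: "EX N. ALL m>=N. ALL n>=N. wdist (X m) (X n) < e" if e: "e > 0" for e
  proof -
   obtain N where N: "ALL m n. N <= m --> N <= n --> mdist WT (X m) (X n) < e"
    using c[unfolded MCauchy_def, THEN conjunct2, rule_format, OF e] by (elim exE)
   have "wdist (X m) (X n) < e" if "N <= m" "N <= n" for m n
    using N[rule_format, OF that] mdist_WT[OF X X, of m n] by simp
   thus ?thesis by (intro exI[of _ N]) simp
  qed
  have "EX \<rho>. (%n. ht (X n)) \<longlonglongrightarrow> \<rho>" by (rule heights_converge[OF X]) (rule ca)
  then obtain \<rho> where \<rho>: "(%n. ht (X n)) \<longlonglongrightarrow> \<rho>" by (elim exE)
  have "EX u. word u & (ALL e>0. EX N. ALL n>=N. wdist (X n) u < e)" by (rule limit_exists[OF X _ \<rho>]) (rule ca)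
  then obtain u where u: "word u" "ALL e>0. EX N. ALL n>=N. wdist (X n) u < e" by (elim exE conjE)
  have "limitin mtopology X u sequentially" unfolding limit_metric_sequentially
   using u X by (simp add: mdist_WT)
  thus ?thesis by blast
 qed
 thus ?thesis unfolding mcomplete_of_def mcomplete_def by blast
qed

lemma gated_WT: "gated_family WT sites (gate WT) same_way"
proof
 show "mcomplete_of WT" by (rule complete_WT)
 show "geodesic_space WT" by (rule geodesic_WT)
 fix P assume P: "P : sites"
 obtain v c Q where s: "word v" "Q : R" "mspace Q ~= {}" "P = site v c Q" by (rule siteE[OF P])
 show "P <= mspace WT & P ~= {}" unfolding s(4) site_def using pt_word(1)[OF s(1,2)] s(3) by auto
 have m: "coord v c Q x : mspace Q" if "word x" for x by (rule coord_mem[OF s(1,2) that s(3)])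
 have g: "gate WT P x = pt v c Q (coord v c Q x)" if "word x" for x unfolding s(4) by (rule gate_site[OF s(1-3) that])
 show "gate WT P x : P" if "x : mspace WT" for x using that g m unfolding s(4) site_def by simp
 show "betw WT x (gate WT P x) q" if "x : mspace WT" "q : P" for x q
 proof -
  have x: "word x" using \<open>x : mspace WT\<close> by simp
  obtain r where r: "r : mspace Q" "q = pt v c Q r" using \<open>q : P\<close> unfolding s(4) site_def by blast
  show ?thesis unfolding g[OF x] betw_WT r(2) wdist_pt[OF s(1,2) x r(1)] wdist_pt_pt[OF s(1,2) m[OF x] r(1)]
   using x pt_word(1)[OF s(1,2)] m[OF x] r(1) by simp
 qed
 show "betw WT x (gate WT P x) y" if "x : mspace WT" "y : mspace WT" "gate WT P x ~= gate WT P y" for x y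
 proof -
  have w: "word x" "word y" using \<open>x : mspace WT\<close> \<open>y : mspace WT\<close> by auto
  have ne: "coord v c Q y ~= coord v c Q x" using that(3) g w by metis
  have pw: "word (pt v c Q (coord v c Q x))" using pt_word(1)[OF s(1,2) m[OF w(1)]] .
  show ?thesis unfolding g[OF w(1)] betw_WT
   using w pw wdist_coord_differ[OF s(1,2) w(2,1) ne s(3)] wdist_pt[OF s(1,2) w(2) m[OF w(1)], of c]
    wdist_sym[OF w] wdist_sym[OF w(1) pw] wdist_sym[OF w(2) pw] by simp
 qed
next
 show "P = P'" if "P : sites" "P' : sites" "x : P" "x : P'" "y : P" "y : P'" "x ~= y" for P P' x y
  using sites_unique that by blast
 show "same_way x z y" if "same_way x y z" for x y z by (rule same_way_sym[OF that])
 show "same_way x y u" if "same_way x y z" "same_way x z u" for x y z u by (rule same_way_trans[OF that])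
 show "betw WT y x z" if "x : mspace WT" "y : mspace WT" "z : mspace WT" "~ same_way x y z" for x y z
  using not_same_way_betw that by simp
 show "(EX w. w ~= x & betw WT x w y & betw WT x w z) | (EX P:sites. x : P & gate WT P y ~= x & gate WT P z ~= x)"
  if "x : mspace WT" "y : mspace WT" "z : mspace WT" "y ~= x" "z ~= x" "same_way x y z" for x y z
  using same_way_common that by simp
qed

lemma site_isometry:
 assumes v: "word v" "Q : R"
 shows "isometry Q (submetric WT (site v c Q)) (pt v c Q)"
proof (rule isometryI)
 have sub: "site v c Q <= mspace WT" unfolding site_def using pt_word(1)[OF v] by auto
 show "pt v c Q ` mspace Q = mspace (submetric WT (site v c Q))" using sub by (auto simp: site_def)
 show "mdist (submetric WT (site v c Q)) (pt v c Q p) (pt v c Q q) = mdist Q p q" if "p : mspace Q" "q : mspace Q" for p q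
  using wdist_pt_pt[OF v that] pt_word(1)[OF v] that by (simp add: mdist_WT)
qed

lemma site_isometric:
 assumes "word v" "Q : R"
 shows "isometric (submetric WT (site v c Q)) Q"
 using isometric_sym[of Q "submetric WT (site v c Q)"] site_isometry[OF assms] unfolding isometric_def[of Q] by blast

theorem Q_tree_WT: "Q_tree \<Q> WT sites"
 unfolding Q_tree_def
proof (intro conjI ballI)
 show "mspace WT ~= {}" using word_empty by auto
 show "geodesic_space WT" by (rule geodesic_WT)
 show "tree_graded WT sites" by (rule gated_family.is_tree_graded[OF gated_WT])
 fix P assume "P : sites"
 then obtain v c Q where "word v" "Q : R" "P = site v c Q" using siteE by metis
 thus "EX Q:\<Q>. isometric (submetric WT P) Q" using site_isometric R_subset by blast
qed

end

section \<open>The model is universal\<close>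

text \<open>One additional element does not change the cardinality of the continuum; here it is the direction towards
  the base.\<close>
lemma eqpoll_real_insert:
 fixes f :: "real => 'a"
 assumes "inj f" "range f <= A" "A <= insert p (range f)"
 shows "A \<approx> (UNIV :: real set)"
proof -
 have r: "range f \<approx> (UNIV :: real set)" using inj_on_image_eqpoll_self[OF assms(1)] .
 have "infinite (range f)" using assms(1) finite_imageD infinite_UNIV_char_0 by blast
 hence "insert p (range f) \<approx> range f" by (rule infinite_insert_eqpoll)
 moreover have "A = range f | A = insert p (range f)" using assms(2,3) by blast
 ultimately show ?thesis using r eqpoll_trans by blast
qed

context Q_choices
begin

interpretation T: Q_tree_space WT sites \<Q> R D E
 by (rule Q_tree_space_of_Q_tree[OF Q_choices_axioms Q_tree_WT])

lemma mem_site_iff: "x : site v c Q <-> (EX q:mspace Q. x = pt v c Q q)"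
 unfolding site_def by blast

text \<open>The copies of \<open>Q\<close> attached to \<open>x\<close> are indexed by real numbers; at most one further
  piece contains \<open>x\<close>, namely one in which \<open>x\<close> is not the origin.\<close>
lemma pieces_at_eqpoll:
 assumes x: "word x" and Q: "Q : R" and nd: "q0 : mspace Q" "q0 ~= origin Q"
 shows "{P : sites. x : P & isometric (submetric WT P) Q} \<approx> (UNIV :: real set)"
proof -
 let ?A = "{P : sites. x : P & isometric (submetric WT P) Q}"
 have ne: "mspace Q ~= {}" using nd by blast
 have inj: "inj (%c. site x c Q)"
 proof (rule injI)
  fix c c' assume eq: "site x c Q = site x c' Q"
  obtain q where q: "pt x c Q q0 = pt x c' Q q" using nd(1) eq mem_site_iff by metis
  have "entry (ht x) l ~: x" for l using wordD(3)[OF x, of "ht x" l] by auto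
  moreover have "entry (ht x) (c, q0, Q) : pt x c' Q q" unfolding q[symmetric] using nd(2) by (simp add: pt_def)
  ultimately show "c = c'" by (auto simp: pt_def split: if_splits)
 qed
 have sub: "range (%c. site x c Q) <= ?A"
 proof (rule image_subsetI)
  fix c
  have "x : site x c Q" unfolding mem_site_iff using origin_mem[OF nd(1)] by (intro bexI[of _ "origin Q"]) auto
  moreover have "site x c Q : sites" unfolding sites_def using x Q ne by blast
  ultimately show "site x c Q : ?A" using site_isometric[OF x Q] by simp
 qed
 have down: "EX v c q. word v & entry (ht v) (c, q, Q) : x & piece_label (c, q, Q) & ht v + len (c, q, Q) = ht x & v = cut x (ht v) & P = site v c Q"
  if P: "P : ?A" and n: "P ~: range (%c. site x c Q)" for P
 proof -
  have PS: "P : sites" using P by simp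
  obtain v c Q' where s: "word v" "Q' : R" "mspace Q' ~= {}" "P = site v c Q'" by (rule siteE[OF PS])
  have "isometric (submetric WT P) Q'" "isometric (submetric WT P) Q" using site_isometric[OF s(1,2), of c] P s(4) by auto
  hence "isometric Q' Q" by (rule isometric_trans[OF isometric_sym])
  hence [simp]: "Q' = Q" by (rule R_unique[OF s(2) Q])
  obtain q where q: "q : mspace Q" "x = pt v c Q q" using P s(4) mem_site_iff by auto
  have "q ~= origin Q"
  using q(2) s(4) n by auto
  hence e: "entry (ht v) (c, q, Q) : x" "piece_label (c, q, Q)" using q(2) piece_labelI[OF s(1) Q q(1)] by (auto simp: pt_def)
  have "ht v + len (c, q, Q) = ht x" using pt_word(2)[OF s(1) Q q(1), of c] q(2) len_piece[OF e(2)] by simp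
  moreover have "v = cut x (ht v)" using sub_cut[OF s(1) x] pt_word(3)[OF s(1) Q q(1), of c] q(2) by simp
  ultimately show ?thesis using s e by auto
 qed
 have one: "P = P'" if P: "P : ?A" "P ~: range (%c. site x c Q)" and P': "P' : ?A" "P' ~: range (%c. site x c Q)" for P P'
 proof -
  obtain v c q where a: "word v" "entry (ht v) (c, q, Q) : x" "piece_label (c, q, Q)" "ht v + len (c, q, Q) = ht x"
   "v = cut x (ht v)" "P = site v c Q" using down[OF P] by (elim exE conjE)
  obtain v' c' q' where a': "word v'" "entry (ht v') (c', q', Q) : x" "piece_label (c', q', Q)" "ht v' + len (c', q', Q) = ht x"
   "v' = cut x (ht v')" "P' = site v' c' Q" using down[OF P'] by (elim exE conjE)
  have h: "ht v = ht v'" using entry_gap[OF x a(2) a'(2)] entry_gap[OF x a'(2) a(2)] a(4) a'(4) len_pos[OF a(3)] len_pos[OF a'(3)] by fastforce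
  have "v = v'" using a(5) a'(5) h by simp
  thus ?thesis using a(6) a'(6) entry_unique[OF x a(2), of "(c', q', Q)"] a'(2) h by simp
 qed
 obtain p where "?A <= insert p (range (%c. site x c Q))"
 proof (cases "?A <= range (%c. site x c Q)")
  case True
  thus ?thesis using that[of "{}"] by blast
 next
  case False
  then obtain p where p: "p : ?A" "p ~: range (%c. site x c Q)" by blast
  show ?thesis by (rule that[of p]) (use one[OF p] in blast)
 qed
 thus ?thesis by (rule eqpoll_real_insert[OF inj sub])
qed

lemma exit_point:
 assumes t: "(U, f) : Q_types R D" and f: "f (a, b) = Some (Q, p, q)"
 shows "piece_label (c, exit_point Q p q, Q)" "len (c, exit_point Q p q, Q) = b - a"
  "EX g. isometry Q Q g & g p = origin Q & g q = exit_point Q p q"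
proof -
 have Q: "Q : R" "(p, q) : D Q" "mdist Q p q = b - a" and ab: "a < b" using Q_typesD(3)[OF t f] Q_typesD(2)[OF t, of a b] f by auto
 have m: "p : mspace Q" "q : mspace Q" "origin Q : mspace Q" using D_mem[OF Q(1,2)] origin_mem by auto
 obtain g where "isometry Q Q g" "g p = origin Q" by (rule homogeneous_R[OF Q(1) m(1,3)])
 hence "EX y g. isometry Q Q g & g p = origin Q & g q = y" by blast
 from someI_ex[OF this] show ex: "EX g. isometry Q Q g & g p = origin Q & g q = exit_point Q p q" unfolding exit_point_def .
 then obtain g where g: "isometry Q Q g" "g p = origin Q" "g q = exit_point Q p q" by blast
 have d: "rad Q (exit_point Q p q) = b - a" using isometry_dist[OF g(1) m(1,2)] g Q(3) by simp
 hence "exit_point Q p q ~= origin Q" using ab m(3) by auto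
 thus l: "piece_label (c, exit_point Q p q, Q)" using Q(1) isometry_mem[OF g(1) m(2)] g(3) by (simp add: piece_label_def)
 show "len (c, exit_point Q p q, Q) = b - a" using len_piece[OF l] d by simp
qed

lemma continuation_iff:
 "entry s l : continuation t c f <->
   (l = plain c & t <= s & (ALL a b. (a, b) : dom f --> ~ (a <= s - t & s - t < b))) |
   (EX a b Q p q. s = t + a & l = (c, exit_point Q p q, Q) & f (a, b) = Some (Q, p, q))"
proof -
 have "(EX u. entry s l = entry (t + u) (plain c) & 0 <= u & (ALL a b. (a, b) : dom f --> ~ (a <= u & u < b))) <->
   l = plain c & t <= s & (ALL a b. (a, b) : dom f --> ~ (a <= s - t & s - t < b))" (is "(EX u. ?P u) <-> ?R")
 proof
  assume ?R hence "?P (s - t)" by simp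
  thus "EX u. ?P u" by blast
 next
  assume "EX u. ?P u"
  then obtain u where "?P u" by blast
  thus ?R by simp
 qed
 thus ?thesis unfolding continuation_def by auto
qed

lemma interval_below:
 assumes t: "(U, f) : Q_types R D" and r: "r ~: U" and ab: "(a, b) : dom f" "a < r"
 shows "b <= r"
 using r ab unfolding Q_typesD(1)[OF t] mem_UN_intervals by (meson not_le)

lemma continuation_covers:
 assumes t: "(U, f) : Q_types R D" and u: "0 <= u"
 obtains (plain) "entry (t + u) (plain c) : continuation t c f"
 | (tile) a b Q p q where "f (a, b) = Some (Q, p, q)" "a <= u" "u < b" "entry (t + a) (c, exit_point Q p q, Q) : continuation t c f"
proof (cases "EX a b. (a, b) : dom f & a <= u & u < b")
 case True
 then obtain a b Q p q where "f (a, b) = Some (Q, p, q)" "a <= u" "u < b" by auto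
 thus ?thesis by (intro tile) (auto simp: continuation_iff)
next
 case False
 thus ?thesis by (intro plain) (use u in \<open>simp add: continuation_iff\<close>)
qed

lemma disjoint_intervals:
 assumes t: "(U, f) : Q_types R D" and ab: "(a, b) : dom f" "(a', b') : dom f" "a <= a'"
 shows "(a = a' & b = b') | (a < a' & b <= a')"
proof (rule ccontr)
 assume n: "~ ((a = a' & b = b') | (a < a' & b <= a'))"
 have "a' < min b b'" using n ab(3) Q_typesD(2)[OF t] ab by auto
 then obtain m where m: "a' < m" "m < min b b'" using dense by blast
 have "a = a' & b = b'" by (rule Q_typesD(4)[OF t ab(1,2), of m]) (use m ab(3) in auto)
 thus False using n by simp
qed

lemma continuation_pair:
 assumes t: "(U, f) : Q_types R D" and e: "entry s l : continuation h c f" "entry s' l' : continuation h c f" "s <= s'"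
 shows "(s = s' & l = l') | (s < s' & s + len l <= s')"
proof -
 consider (pp) "l = plain c" "l' = plain c"
  | (pt) a b Q p q where "l = plain c" "s' = h + a" "f (a, b) = Some (Q, p, q)" "ALL a b. (a, b) : dom f --> ~ (a <= s - h & s - h < b)"
  | (tp) a b Q p q where "s = h + a" "l = (c, exit_point Q p q, Q)" "f (a, b) = Some (Q, p, q)" "ALL a b. (a, b) : dom f --> ~ (a <= s' - h & s' - h < b)"
  | (tt) a b Q p q a' b' Q' p' q' where "s = h + a" "l = (c, exit_point Q p q, Q)" "f (a, b) = Some (Q, p, q)"
    "s' = h + a'" "l' = (c, exit_point Q' p' q', Q')" "f (a', b') = Some (Q', p', q')"
  using e(1,2) unfolding continuation_iff by (elim disjE exE conjE) metis+
 thus ?thesis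
 proof cases
  case pp
  thus ?thesis using e(3) by auto
 next
  case pt
  have ab: "(a, b) : dom f" using pt(3) by auto
  show ?thesis using pt(2) pt(4)[rule_format, OF ab] Q_typesD(2)[OF t ab] e(3) pt(1) by simp
 next
  case tp
  have ab: "(a, b) : dom f" using tp(3) by auto
  show ?thesis using tp(1) tp(4)[rule_format, OF ab] e(3) exit_point(2)[OF t tp(3), of c] Q_typesD(2)[OF t ab] tp(1,2) by simp
 next
  case tt
  have ab: "(a, b) : dom f" "(a', b') : dom f" "a <= a'" using tt e(3) by auto
  from disjoint_intervals[OF t ab] show ?thesis
   using exit_point(2)[OF t tt(3), of c] tt by auto
 qed
qed

text \<open>A type may be restarted at a free time \<open>u\<close>; intervals that lie before \<open>u\<close> get a
  negative left end and are dropped by \<open>0 < a\<close>.\<close>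
lemma shift_type:
 assumes t: "(U, f) : Q_types R D" and u: "0 <= u" "ALL a b. (a, b) : dom f --> ~ (a <= u & u < b)"
 defines "f' \<equiv> %(a, b). if 0 < a then f (u + a, u + b) else None"
 shows "((\<Union>(a, b)\<in>dom f'. {a<..<b}), f') : Q_types R D"
  "u <= s - h ==> entry s l : continuation h c f <-> entry s l : continuation (h + u) c f'"
proof -
 have fD: "f' (a, b) = Some y <-> 0 < a & f (u + a, u + b) = Some y" for a b y by (simp add: f'_def)
 have dD: "(a, b) : dom f' <-> 0 < a & (u + a, u + b) : dom f" for a b unfolding f'_def dom_def by simp
 have "disjoint_family_on (%(a, b). {a<..<b}) (dom f')"
  unfolding disjoint_family_on_def
 proof (intro ballI impI)
  fix i j assume ij: "i : dom f'" "j : dom f'" "i ~= j"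
  obtain a b a' b' where e: "i = (a, b)" "j = (a', b')" by fastforce
  have "a = a' & b = b'" if "a < m" "m < b" "a' < m" "m < b'" for m using ij dD e Q_typesD(4)[OF t, of "u + a" "u + b" "u + a'" "u + b'" "u + m"] that by simp
  thus "(case i of (a, b) => {a<..<b}) Int (case j of (a, b) => {a<..<b}) = {}" using ij(3) e by fastforce
 qed
 moreover have "ALL (a, b):dom f'. 0 < a & a < b"
 proof (rule ballI)
  fix i assume i: "i : dom f'"
  obtain a b where e: "i = (a, b)" by fastforce
  show "case i of (a, b) => 0 < a & a < b" using i dD[of a b] e Q_typesD(2)[OF t, of "u + a" "u + b"] by simp
 qed
 moreover have "ALL a b Q p q. f' (a, b) = Some (Q, p, q) --> Q : R & (p, q) : D Q & mdist Q p q = b - a"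
 using fD Q_typesD(3) t by fastforce
 ultimately show "((\<Union>(a, b)\<in>dom f'. {a<..<b}), f') : Q_types R D" unfolding Q_types_def by blast
 have pos: "0 < a - u" if "(a, b) : dom f" "u < b" for a b using u(2) that by fastforce
 assume s: "u <= s - h"
 have 1: "(ALL a b. (a, b) : dom f --> ~ (a <= s - h & s - h < b)) <->
   (ALL a b. (a, b) : dom f' --> ~ (a <= s - (h + u) & s - (h + u) < b))" (is "?L <-> ?R")
 proof
  assume L: ?L
  show ?R
  proof (intro allI impI)
   fix a b assume "(a, b) : dom f'"
   hence "~ (u + a <= s - h & s - h < u + b)" using L dD by blast
   thus "~ (a <= s - (h + u) & s - (h + u) < b)" by auto
  qed
 next
  assume R: ?R
  show ?L
  proof (intro allI impI notI)
   fix a b assume ab: "(a, b) : dom f" "a <= s - h & s - h < b"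
   hence "(a - u, b - u) : dom f'" using dD pos[OF ab(1)] s by simp
   thus False using R ab(2) by fastforce
  qed
 qed
 have 2: "(EX a b Q p q. s = h + a & l = (c, exit_point Q p q, Q) & f (a, b) = Some (Q, p, q)) <->
   (EX a b Q p q. s = h + u + a & l = (c, exit_point Q p q, Q) & f' (a, b) = Some (Q, p, q))" (is "?L <-> ?R")
 proof
  assume ?L
  then obtain a b Q p q where a: "s = h + a" "l = (c, exit_point Q p q, Q)" "f (a, b) = Some (Q, p, q)" by blast
  have ab: "(a, b) : dom f" using a(3) by auto
  have "f' (a - u, b - u) = Some (Q, p, q)" using a(1) s Q_typesD(2)[OF t ab] pos[OF ab] a(3) by (simp add: fD)
  thus ?R using a by (intro exI[of _ "a - u"] exI[of _ "b - u"] exI[of _ Q] exI[of _ p] exI[of _ q]) simp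
 next
  assume ?R
  then obtain a b Q p q where a: "s = h + u + a" "l = (c, exit_point Q p q, Q)" "f' (a, b) = Some (Q, p, q)" by blast
  thus ?L by (intro exI[of _ "u + a"] exI[of _ "u + b"] exI[of _ Q] exI[of _ p] exI[of _ q]) (simp add: fD)
 qed
 have "h <= s <-> h + u <= s" using s u(1) by auto
 thus "entry s l : continuation h c f <-> entry s l : continuation (h + u) c f'"
  unfolding continuation_iff 1 2 by simp
qed

text \<open>After each of its plain entries a continuation is the continuation of a restarted type.\<close>
lemma tame_continuation:
 assumes t: "(U, f) : Q_types R D"
 shows "tame (continuation h c f)"
 unfolding tame_def
proof (intro allI impI)
 fix s d assume e: "entry s (plain d) : continuation h c f"
 have np: "plain d ~= (c, exit_point Q p q, Q)" if "f (a, b) = Some (Q, p, q)" for a b Q p q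
  using exit_point(1)[OF t that, of c] not_piece_plain by metis
 have pl: "d = c" "h <= s" "ALL a b. (a, b) : dom f --> ~ (a <= s - h & s - h < b)"
 proof -
  have "d = c & h <= s & (ALL a b. (a, b) : dom f --> ~ (a <= s - h & s - h < b))"
   using e unfolding continuation_iff
  using plain_eq_iff np by metis
  thus "d = c" "h <= s" "ALL a b. (a, b) : dom f --> ~ (a <= s - h & s - h < b)" by blast+
 qed
 have u: "0 <= s - h" using pl(2) by simp
 note sh = shift_type[OF t u pl(3)]
 let ?f = "%(a, b). if 0 < a then f (s - h + a, s - h + b) else None"
 have "ALL s' l. s <= s' --> s' < s + 1 --> (entry s' l : continuation h c f <-> entry s' l : continuation s d ?f)"
 using sh(2) pl(1) by auto
 show "EX U f'. (U, f') : Q_types R D & (EX \<epsilon>>0. ALL s' l. s <= s' --> s' < s + \<epsilon> -->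
   (entry s' l : continuation h c f <-> entry s' l : continuation s d f'))"
  by (intro exI conjI) (rule sh(1), rule zero_less_one, fact)
qed

definition extend :: "'q tree_point => real => (real \<times> real \<rightharpoonup> 'q metric \<times> 'q \<times> 'q) => real => 'q tree_point" where
 "extend x c f r = x Un {e : continuation (ht x) c f. tm e < ht x + r}"

lemma extend_iff:
 assumes x: "word x" and t: "(U, f) : Q_types R D"
 shows "entry s l : extend x c f r <-> (if s < ht x then entry s l : x else entry s l : continuation (ht x) c f & s < ht x + r)"
proof -
 have 1: "s < ht x" if "entry s l : x" using wordD(3)[OF x that] by simp
 have "ht x <= s" if "entry s l : continuation (ht x) c f"
 proof -
  have "0 <= a" if "f (a, b) = Some y" for a b y using Q_typesD(2)[OF t, of a b] that by fastforce
  thus ?thesis using \<open>entry s l : continuation (ht x) c f\<close> unfolding continuation_iff by auto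
 qed
 thus ?thesis unfolding extend_def using 1 by auto
qed

lemma extend_word:
 assumes x: "word x" and t: "(U, f) : Q_types R D" and r: "0 < r" "r ~: U"
 shows "word (extend x c f r)" "ht (extend x c f r) = ht x + r" "x <= extend x c f r"
proof -
 let ?y = "extend x c f r" and ?C = "continuation (ht x) c f"
 note iff = extend_iff[OF x t]
 have tl: "tiles ?y (ht x + r)"
  unfolding tiles_def
 proof (intro conjI ballI allI impI)
  show "0 <= ht x + r" using wordD(1)[OF x] r by simp
  show "EX s l. e = entry s l & label_ok l & 0 <= s & s < ht x + r & s + len l <= ht x + r" if e: "e : ?y" for e
  proof (cases "e : x")
   case True
   obtain s l where "e = entry s l" using wordD(2)[OF x True] by blast
   thus ?thesis using wordD(3)[OF x, of s l] True r(1) by (intro exI[of _ s] exI[of _ l]) auto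
  next
   case False
   hence eC: "e : ?C" "tm e < ht x + r" using e by (auto simp: extend_def)
   obtain s l where sl: "e = entry s l" using eC(1) unfolding continuation_def by blast
   have "ht x <= s & label_ok l & s + len l <= ht x + r"
    using eC[unfolded sl continuation_iff]
   proof (elim disjE conjE exE)
    fix a b Q p q assume "tm (entry s l) < ht x + r" and a: "s = ht x + a" "l = (c, exit_point Q p q, Q)" "f (a, b) = Some (Q, p, q)"
    hence "a < r" by simp
    moreover have ab: "(a, b) : dom f" using a(3) by auto
    ultimately have "b <= r" by (intro interval_below[OF t r(2)])
    thus ?thesis using exit_point(1,2)[OF t a(3), of c] a(1,2) Q_typesD(2)[OF t ab] by (simp add: label_ok_def)
   qed (auto simp: label_ok_def)
   thus ?thesis using sl eC(2) wordD(1)[OF x] by (intro exI[of _ s] exI[of _ l]) auto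
  qed
  show "(s = s' & l = l') | (s < s' & s + len l <= s')" if e: "entry s l : ?y" "entry s' l' : ?y" "s <= s'" for s l s' l'
  proof -
   consider "entry s l : x" "entry s' l' : x" | "entry s l : x" "ht x <= s'" | "entry s l : ?C" "entry s' l' : ?C"
    using e unfolding iff by (auto split: if_splits)
   thus ?thesis
   proof cases
    case 1 thus ?thesis using wordD(4)[OF x 1 e(3)] by simp
   next
    case 2 thus ?thesis using wordD(3)[OF x 2(1)] by auto
   next
    case 3 thus ?thesis using continuation_pair[OF t 3 e(3)] by simp
   qed
  qed
  show "EX s' l. entry s' l : ?y & s' <= s & (s = s' | s < s' + len l)" if s: "0 <= s" "s < ht x + r" for s
  proof (cases "s < ht x")
   case True
   from wordD(5)[OF x s(1) True] show ?thesis unfolding extend_def by blast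
  next
   case False
   hence u: "0 <= s - ht x" by simp
   show ?thesis
   using t u
   proof (cases rule: continuation_covers[where t = "ht x" and c = c])
    case plain
    hence "entry s (plain c) : ?y" unfolding iff using False s(2) by simp
    thus ?thesis by (intro exI[of _ s] exI[of _ "plain c"]) simp
   next
    case (tile a b Q p q)
    have "(a, b) : dom f" using tile(1) by auto
    hence "entry (ht x + a) (c, exit_point Q p q, Q) : ?y"
     unfolding iff using tile(2,4) s(2) Q_typesD(2)[OF t, of a b] by simp
    thus ?thesis using exit_point(2)[OF t tile(1), of c] tile(2,3)
     by (intro exI[of _ "ht x + a"] exI[of _ "(c, exit_point Q p q, Q)"]) simp
   qed
  qed
 qed
 thus "ht ?y = ht x + r" by (rule ht_eq)
 have "tame ?y"
 proof (rule tame_local)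
  fix s d assume e: "entry s (plain d) : ?y"
  show "EX v r. tame v & s < r & (ALL s' l. s <= s' --> s' < r --> (entry s' l : ?y <-> entry s' l : v))"
  proof (cases "s < ht x")
   case True
   have "ALL s' l. s <= s' --> s' < ht x --> (entry s' l : ?y <-> entry s' l : x)" unfolding iff by simp
   thus ?thesis using True word_tame[OF x] by blast
  next
   case False
   have "ALL s' l. s <= s' --> s' < ht x + r --> (entry s' l : ?y <-> entry s' l : ?C)" unfolding iff using False by simp
   moreover have "s < ht x + r" using e False unfolding iff by simp
   ultimately show ?thesis using tame_continuation[OF t] by blast
  qed
 qed
 thus "word ?y" unfolding word_def using tl by blast
 show "x <= ?y" by (simp add: extend_def)
qed

text \<open>A piece through \<open>x\<close> is left at \<open>x\<close> by a plain entry, so the gate of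
  \<open>z\<close> is \<open>x\<close>.\<close>
lemma plain_limit_dir:
 assumes x: "word x" and z: "word z" and xz: "x <= z" and e: "entry (ht x) (plain c) : z"
 shows "limit_dir WT sites x z"
 unfolding limit_dir_def
proof (intro conjI ballI impI)
 show "x : mspace WT" "z : mspace WT" using x z by auto
 show "z ~= x" using e wordD(3)[OF x, of "ht x" "plain c"] by auto
 fix P assume P: "P : sites" "x : P"
 obtain v d Q where s: "word v" "Q : R" "mspace Q ~= {}" "P = site v d Q" by (rule siteE[OF P(1)])
 obtain q where q: "q : mspace Q" "x = pt v d Q q" using P(2) s(4) mem_site_iff by blast
 have "coord v d Q z = q"
 proof (cases "q = origin Q")
  case True
  show ?thesis
  proof (rule ccontr)
   assume "coord v d Q z ~= q"
   hence "coord v d Q z ~= origin Q" using True by simp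
   note C = coord_ne_origin(2,3)[OF s(1,2) z this]
   have "plain c = (d, coord v d Q z, Q)" by (rule entry_unique[OF z e]) (use C(1) q(2) True in simp)
   thus False using C(2) not_piece_plain[of c] by simp
  qed
 next
  case False
  show ?thesis
   by (rule coord_eq[OF s(1,2) z]) (use False q xz piece_labelI[OF s(1,2) q(1) False] in \<open>auto simp: pt_def\<close>)
 qed
 thus "gate WT P z = x" unfolding s(4) using gate_site[OF s(1-3) z] q(2) by simp
qed

context
 fixes x z c U f r
 assumes x: "word x" and z: "word z" and xz: "x <= z" and t: "(U, f) : Q_types R D" and r: "0 < r" "r ~: U"
  and hz: "ht z = ht x + r"
  and germ: "!!s l. ht x <= s ==> s < ht x + r ==> entry s l : z <-> entry s l : continuation (ht x) c f"
begin

abbreviation (input) "\<gamma> \<equiv> %u. way z (ht x + u)"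

lemma germ_geo: "geo WT \<gamma> r x z"
 using geo_sub_word[OF x z xz] hz by simp

lemma germ_plain:
 assumes u: "0 <= u" "u < r" "!!a b. (a, b) : dom f ==> ~ (a <= u & u < b)"
 shows "entry (ht x + u) (plain c) : z"
 using germ[of "ht x + u" "plain c"] u by (simp add: continuation_iff)

lemma germ_limit: "limit_dir WT sites x z"
proof (rule plain_limit_dir[OF x z xz])
 show "entry (ht x) (plain c) : z" using germ_plain[of 0] r(1) Q_typesD(2)[OF t] by fastforce
qed

text \<open>The crossed piece is the copy of \<open>Q\<close> at the word reached at time \<open>a\<close>; by the
  choice of \<open>exit_point\<close> an isometry of \<open>Q\<close> carries its end points to
  \<open>p\<close> and \<open>q\<close>.\<close>
lemma germ_tile:
 assumes f: "f (a, b) = Some (Q, p, q)" "b <= r"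
 shows "EX P:sites. cut_out_by \<gamma> r a b P & pair_data R D WT P (\<gamma> a) (\<gamma> b) Q p q"
proof -
 let ?y = "exit_point Q p q" and ?v = "cut z (ht x + a)"
 have ab: "0 < a" "a < b" using Q_typesD(2)[OF t, of a b] f(1) by auto
 have Q: "Q : R" "(p, q) : D Q" using Q_typesD(3)[OF t f(1)] by auto
 have pq: "p : mspace Q" "q : mspace Q" using D_mem[OF Q] by auto
 have Qn: "mspace Q ~= {}" using pq by blast
 note l = exit_point(1)[OF t f(1), of c] and ln = exit_point(2)[OF t f(1), of c]
 note y = piece_labelD[OF l]
 have "entry (ht x + a) (c, ?y, Q) : continuation (ht x) c f" unfolding continuation_iff using f(1) by blast
 hence e: "entry (ht x + a) (c, ?y, Q) : z" using germ[of "ht x + a"] ab f(2) by simp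
 have ba: "bd z (ht x + a)" unfolding bd_def using e by blast
 note v = word_cut[OF z ba]
 let ?P = "site ?v c Q"
 have P: "?P : sites" unfolding sites_def using v(1) Q(1) Qn by blast
 have cz: "coord ?v c Q z = ?y"
  by (rule coord_eq[OF v(1) Q(1) z cut_subset _ l]) (use e v(2) in simp)
 have cx: "coord ?v c Q x = origin Q"
 proof (rule coord_origin_down[OF v(1) Q(1) x])
  show "~ ?v <= x" using sub_ht[OF v(1) x] v(2) ab(1) by auto
 qed
 have g: "gate WT ?P x = ?v" "gate WT ?P z = pt ?v c Q ?y"
  using gate_site[OF v(1) Q(1) Qn] x z cx cz by auto
 have ym: "?y : mspace Q" using y by simp
 note pw = pt_word[OF v(1) Q(1) ym, of c]
 have sub: "x <= ?v" using cut_mono[of "ht x" "ht x + a" z] sub_cut[OF x z xz] ab(1) by simp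
 have dx: "wdist x ?v = a" "wdist x (pt ?v c Q ?y) = b"
  using wdist_sub[OF x v(1) sub] wdist_sub[OF x pw(1)] sub pw(2,3) v(2) len_piece[OF l] ln by auto
 have "?v ~= pt ?v c Q ?y" using pw(2) len_piece[OF l] ln ab(2) by auto
 hence cut: "cut_out_by \<gamma> r a b ?P"
  unfolding T.cut_out_by_iff[OF germ_geo P] g using dx x v(1) pw(1) by (simp add: mdist_WT)
 have ends: "\<gamma> a = ?v" "\<gamma> b = pt ?v c Q ?y" using T.cut_out_by_piece(6,7)[OF germ_geo P cut] g by auto
 note si = site_isometry[OF v(1) Q(1), of c]
 obtain h where h: "isometry Q Q h" "h p = origin Q" "h q = ?y" using exit_point(3)[OF t f(1)] by blast
 let ?i = "inv_into (mspace Q) h \<circ> inv_into (mspace Q) (pt ?v c Q)"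
 have "isometry (submetric WT ?P) Q ?i" by (rule isometry_comp[OF isometry_inv[OF si] isometry_inv[OF h(1)]])
 moreover have "?i ?v = p"
  using isometry_inv_apply[OF si, of "origin Q"] isometry_inv_apply[OF h(1) pq(1)] h(2) y by simp
 moreover have "?i (pt ?v c Q ?y) = q"
  using isometry_inv_apply[OF si ym] isometry_inv_apply[OF h(1) pq(2)] h(3) by simp
 ultimately have "pair_data R D WT ?P (\<gamma> a) (\<gamma> b) Q p q" unfolding pair_data_def ends using Q by blast
 thus ?thesis using P cut by blast
qed

text \<open>A crossing that meets no interval of the type would contain a stretch of plain entries, and two points of
  such a stretch are in no common piece; otherwise the crossed piece shares two points with the piece of such
  an interval.\<close>
lemma germ_cut_dom:
 assumes P: "P : sites" and cut: "cut_out_by \<gamma> r a b P"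
 shows "(a, b) : dom f"
proof -
 have ct: "0 <= a" "a < b" "b <= r" and inP: "!!t. 0 <= t ==> t <= r ==> \<gamma> t : P <-> a <= t & t <= b"
  using cut unfolding cut_out_times[OF germ_geo] by auto
 show ?thesis
 proof (cases "EX u. a < u & u < b & u : U")
  case True
  then obtain u a' b' where u: "a < u" "u < b" "(a', b') : dom f" "a' < u" "u < b'"
   unfolding Q_typesD(1)[OF t] mem_UN_intervals by blast
  have br: "b' <= r" by (rule interval_below[OF t r(2) u(3)]) (use u(2,4) ct(3) in simp)
  obtain Q p q where "f (a', b') = Some (Q, p, q)" using u(3) by auto
  from germ_tile[OF this br] obtain P' where P': "P' : sites" "cut_out_by \<gamma> r a' b' P'" by blast
  have inP': "!!t. 0 <= t ==> t <= r ==> \<gamma> t : P' <-> a' <= t & t <= b'" and a': "0 <= a'"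
   using P'(2) unfolding cut_out_times[OF germ_geo] by auto
  let ?m = "max a a'"
  have m: "0 <= ?m" "?m < u" "u <= r" using ct u by auto
  have "\<gamma> ?m ~= \<gamma> u" using geo_inj[OF germ_geo, of ?m u] m by auto
  hence "P = P'" using sites_unique[OF P P'(1)] inP[of ?m] inP[of u] inP'[of ?m] inP'[of u] m u by auto
  hence "cut_out_by \<gamma> r a' b' P" using P'(2) by simp
  note this[unfolded T.cut_out_by_iff[OF germ_geo P]] cut[unfolded T.cut_out_by_iff[OF germ_geo P]]
  hence "a = a' & b = b'" by simp
  thus ?thesis using u(3) by simp
 next
  case False
  have bdu: "bd z (ht x + u)" if u: "a < u" "u < b" for u
  proof -
   have "entry (ht x + u) (plain c) : z"
   proof (rule germ_plain)
    show "0 <= u" "u < r" using u ct by auto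
    show "~ (a' <= u & u < b')" if ab': "(a', b') : dom f" for a' b'
    proof
     assume n: "a' <= u & u < b'"
     then obtain m where m: "u < m" "m < min b b'" using dense[of u "min b b'"] u(2) by auto
     hence "m : U" unfolding Q_typesD(1)[OF t] mem_UN_intervals using ab' n by (intro exI[of _ a'] exI[of _ b']) auto
     thus False using False m u(1) by auto
    qed
   qed
   thus ?thesis unfolding bd_def by blast
  qed
  obtain u1 where u1: "a < u1" "u1 < b" using dense[OF ct(2)] by blast
  obtain u2 where u2: "u1 < u2" "u2 < b" using dense[OF u1(2)] by blast
  obtain u3 where u3: "u2 < u3" "u3 < b" using dense[OF u2(2)] by blast
  obtain v k Q where s: "word v" "Q : R" "mspace Q ~= {}" "P = site v k Q" by (rule siteE[OF P])
  have key: "ht x + u = ht v" if u: "a < u" "u < u3" for u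
  proof -
   have b: "bd z (ht x + u)" "bd z (ht x + u3)" using bdu u u1 u2 u3 by auto
   note w = word_cut[OF z b(1)] and w3 = word_cut[OF z b(2)]
   have ne: "cut z (ht x + u) ~= cut z (ht x + u3)" using w(2) w3(2) u(2) by auto
   have "cut z (ht x + u) <= cut z (ht x + u3)" by (rule cut_mono) (use u(2) in simp)
   hence 1: "sep (cut z (ht x + u)) (cut z (ht x + u3)) = ht x + u" using sep_sub[OF w(1) w3(1) _ ne] w(2) by simp
   have "\<gamma> u : P" "\<gamma> u3 : P" using inP[of u] inP[of u3] u u1 u2 u3 ct by auto
   then obtain p q where "p : mspace Q" "cut z (ht x + u) = pt v k Q p" "q : mspace Q" "cut z (ht x + u3) = pt v k Q q"
    unfolding way_bd[OF b(1)] way_bd[OF b(2)] s(4) mem_site_iff by blast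
   hence "sep (cut z (ht x + u)) (cut z (ht x + u3)) = ht v" using sep_pt[OF s(1,2), of p q k] ne by metis
   thus ?thesis using 1 by simp
  qed
  show ?thesis using key[of u1] key[of u2] u1 u2 u3 by simp
 qed
qed

text \<open>By \<open>germ_tile\<close> and \<open>germ_cut_dom\<close> the crossings of the path to \<open>z\<close>
  are the intervals of the type.\<close>
lemma germ_type: "T.dir_type x z = equivalent_types R D `` {(U, f)}"
proof -
 let ?\<tau> = "geodesic_type R D WT sites \<gamma> r"
 obtain V F where VF: "?\<tau> = (V, F)" by fastforce
 have tt: "(V, F) : Q_types R D" using T.limit_type_in_Q_types[OF germ_geo germ_limit] VF by simp
 have rV: "r ~: V" using T.end_not_in_type[OF germ_geo] VF by simp
 have F: "F (a, b) = Some (Q, p, q) <-> (EX P:sites. cut_out_by \<gamma> r a b P & pair_data R D WT P (\<gamma> a) (\<gamma> b) Q p q)" for a b Q p q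
  using T.type_iff[OF germ_geo, of a b Q p q] VF by simp
 have eq: "F (a, b) = Some (Q, p, q) <-> f (a, b) = Some (Q, p, q)" if b: "b <= r" for a b Q p q
 proof
  assume "f (a, b) = Some (Q, p, q)"
  thus "F (a, b) = Some (Q, p, q)" unfolding F using germ_tile b by blast
 next
  assume "F (a, b) = Some (Q, p, q)"
  then obtain P where P: "P : sites" "cut_out_by \<gamma> r a b P" "pair_data R D WT P (\<gamma> a) (\<gamma> b) Q p q" unfolding F by blast
  obtain Q' p' q' where f': "f (a, b) = Some (Q', p', q')" using germ_cut_dom[OF P(1,2)] by auto
  then obtain P' where P': "P' : sites" "cut_out_by \<gamma> r a b P'" "pair_data R D WT P' (\<gamma> a) (\<gamma> b) Q' p' q'" using germ_tile b by blast
  show "f (a, b) = Some (Q, p, q)" using T.cut_out_by_unique[OF germ_geo P'(1,2) P(1,2)] T.pair_data_unique[OF P(1) T.cut_out_by_piece(1,2)[OF germ_geo P(1,2)] P(3)] P'(3) f' by blast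
 qed
 have maps: "F |` {(a, b). b <= r} = f |` {(a, b). b <= r}"
 proof (rule T.map_eqI)
  fix a b Q p q
  show "(F |` {(a, b). b <= r}) (a, b) = Some (Q, p, q) <-> (f |` {(a, b). b <= r}) (a, b) = Some (Q, p, q)"
   using eq[of b a Q p q] by (cases "b <= r") auto
 qed
 have dom: "(a, b) : dom g & b <= r <-> (a, b) : dom (g |` {(a, b). b <= r})" for a b and g :: "real \<times> real \<rightharpoonup> 'q metric \<times> 'q \<times> 'q"
  by (auto simp: restrict_map_def split: if_splits)
 have U: "W Int {0<..<r} = (\<Union>(a, b)\<in>dom (g |` {(a, b). b <= r}). {a<..<b})" if g: "(W, g) : Q_types R D" "r ~: W" for W g
 proof (intro equalityI subsetI)
  fix u assume u: "u : W Int {0<..<r}"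
  obtain a b where ab: "(a, b) : dom g" "a < u" "u < b"
   using u[THEN IntD1, unfolded Q_typesD(1)[OF g(1)] mem_UN_intervals] by (elim exE conjE)
  have "b <= r" by (rule interval_below[OF g ab(1)]) (use ab(2) u in simp)
  thus "u : (\<Union>(a, b)\<in>dom (g |` {(a, b). b <= r}). {a<..<b})" unfolding mem_UN_intervals using ab dom[of a b g] by blast
 next
  fix u assume "u : (\<Union>(a, b)\<in>dom (g |` {(a, b). b <= r}). {a<..<b})"
  then obtain a b where ab: "(a, b) : dom g" "b <= r" "a < u" "u < b" unfolding mem_UN_intervals using dom[of _ _ g] by blast
  have "u : W" unfolding Q_typesD(1)[OF g(1)] mem_UN_intervals using ab by blast
  thus "u : W Int {0<..<r}" using Q_typesD(2)[OF g(1) ab(1)] ab by simp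
 qed
 have "initial_subtype r (V, F) = initial_subtype r (U, f)"
  unfolding initial_subtype_def split_conv U[OF tt rV] U[OF t r(2)] maps ..
 hence "((V, F), (U, f)) : equivalent_types R D" unfolding equivalent_types_def using tt t r rV by auto
 hence "equivalent_types R D `` {(V, F)} = equivalent_types R D `` {(U, f)}" by (rule equiv_class_eq[OF equiv_types])
 moreover have "equivalent_types R D `` {?\<tau>} = T.dir_type x z"
  by (rule T.dir_type_eq[OF germ_geo germ_limit T.same_dir_refl]) (use x z germ_limit in \<open>auto simp: limit_dir_def\<close>)
 ultimately show ?thesis unfolding VF by simp
qed

end

text \<open>Equivalent types prescribe the same walk for a while, so the directions depend on the class of the type
  only.\<close>
lemma continuation_agree:
 assumes t: "(U, f) : Q_types R D" "(U', f') : Q_types R D" and r: "r ~: U" "r ~: U'"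
  and eq: "initial_subtype r (U, f) = initial_subtype r (U', f')" and s: "s < h + r"
 shows "entry s l : continuation h c f <-> entry s l : continuation h c f'"
proof -
 have half: "f' (a, b) = f (a, b)" if t: "(U, f) : Q_types R D" and r: "r ~: U"
   and eq: "initial_subtype r (U, f) = initial_subtype r (U', f')" and ab: "(a, b) : dom f" "a < r" for U f U' f' a b
 proof -
  have "(f |` {(a, b). b <= r}) (a, b) = (f' |` {(a, b). b <= r}) (a, b)" using eq by (simp add: initial_subtype_def)
  thus ?thesis using interval_below[OF t r ab] by simp
 qed
 have imp: "entry s l : continuation h c f'"
  if t: "(U, f) : Q_types R D" "(U', f') : Q_types R D" and r: "r ~: U" "r ~: U'"
   and eq: "initial_subtype r (U, f) = initial_subtype r (U', f')" and e: "entry s l : continuation h c f" for U f U' f'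
  using e unfolding continuation_iff[of s l h c f]
 proof (elim disjE exE conjE)
  assume p: "l = plain c" "h <= s" "ALL a b. (a, b) : dom f --> ~ (a <= s - h & s - h < b)"
  have "~ (a <= s - h & s - h < b)" if ab: "(a, b) : dom f'" for a b
  proof
   assume n: "a <= s - h & s - h < b"
   hence "f (a, b) = f' (a, b)" using half[OF t(2) r(2) eq[symmetric] ab] s by simp
   thus False using ab domIff p(3) n by metis
  qed
  thus ?thesis using p unfolding continuation_iff by blast
 next
  fix a b Q p q assume a: "s = h + a" "l = (c, exit_point Q p q, Q)" "f (a, b) = Some (Q, p, q)"
  have "f' (a, b) = Some (Q, p, q)" using half[OF t(1) r(1) eq, of a b] a s by auto
  thus ?thesis using a unfolding continuation_iff by blast
 qed
 show ?thesis using imp[OF t r eq] imp[OF t(2,1) r(2,1) eq[symmetric]] by blast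
qed

lemma same_way_same_dir: "word x ==> y ~= x ==> z ~= x ==> same_way x y z ==> same_dir WT sites x y z"
 using same_way_common[of x y z] unfolding same_dir_def same_way_def by simp

text \<open>Otherwise \<open>x\<close> would be between \<open>y\<close> and \<open>z\<close>, while in a limit
  direction geodesics to them share a point other than \<open>x\<close>.\<close>
lemma limit_same_dir_way:
 assumes w: "word x" "word y" "word z" and l: "limit_dir WT sites x y" and s: "same_dir WT sites x y z"
 shows "same_way x y z"
proof (rule ccontr)
 assume "~ same_way x y z"
 hence b: "betw WT y x z" by (rule not_same_way_betw[OF w])
 obtain u where u: "u ~= x" "betw WT x u y" "betw WT x u z"
  using s l unfolding same_dir_def limit_dir_def by blast
 have uw: "word u" using u(2) unfolding betw_WT by simp
 have "wdist y z <= wdist y u + wdist u z" by (rule wdist_triangle[OF w(2) uw w(3)])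
 thus False using b u(2,3) wdist_pos[OF w(1) uw] u(1) wdist_sym[OF w(2,1)] wdist_sym[OF w(2) uw] unfolding betw_WT by simp
qed

text \<open>For each real \<open>c\<close> extending \<open>x\<close> by a representative of \<open>\<theta>\<close>
  with the number \<open>c\<close> gives one direction of type \<open>\<theta>\<close>; tameness shows that
  there are no others except possibly the one towards the base.\<close>
lemma Dirs_limit_eqpoll:
 assumes x: "word x" and \<theta>: "\<theta> : type_classes R D"
 shows "T.Dirs x (Inr \<theta>) \<approx> (UNIV :: real set)"
proof -
 obtain U f where t: "(U, f) : Q_types R D" and th: "\<theta> = equivalent_types R D `` {(U, f)}"
  using \<theta> unfolding type_classes_def quotient_def by auto
 obtain r where r: "0 < r" "r ~: U" using Q_types_free[OF t, of 1] by auto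
 let ?y = "%c. extend x c f r"
 note y = extend_word[OF x t r]
 have xM: "x : mspace WT" using x by simp
 have germ: "entry s l : ?y c <-> entry s l : continuation (ht x) c f" if "ht x <= s" "s < ht x + r" for s l c
  using extend_iff[OF x t, of s l c r] that by simp
 have lim: "limit_dir WT sites x (?y c)" and ty: "T.dir_type x (?y c) = \<theta>" for c
  using germ_limit[OF x y(1) y(3) t r y(2) germ] germ_type[OF x y(1) y(3) t r y(2) germ] th by auto
 have yM: "?y c : mspace WT" "?y c ~= x" for c using lim[of c] unfolding limit_dir_def by auto
 have p0: "entry (ht x) (plain c) : ?y c" for c
 proof -
  have "entry (ht x) (plain c) : continuation (ht x) c f"
   unfolding continuation_iff using Q_typesD(2)[OF t] by fastforce
  thus ?thesis using germ[of "ht x" "plain c" c] r(1) by simp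
 qed
 have inj: "inj (%c. T.dir_class x (?y c))"
 proof (rule injI)
  fix c c' assume "T.dir_class x (?y c) = T.dir_class x (?y c')"
  hence "same_dir WT sites x (?y c) (?y c')" using T.dir_class_eq_iff[OF xM yM] by blast
  hence sw: "same_way x (?y c) (?y c')" by (rule limit_same_dir_way[OF x y(1) y(1) lim])
  hence "upward (ht x) (?y c) (?y c')" unfolding same_way_def using y(3) by blast
  thus "c = c'" unfolding upward_def
  proof (elim disjE exE conjE)
   fix d Q p q assume "shared (?y c) (?y c') (ht x) d Q p q"
   hence s: "entry (ht x) (d, p, Q) : ?y c" "piece_label (d, p, Q)" unfolding shared_def by auto
   show ?thesis using entry_unique[OF y(1) p0 s(1)] s(2) not_piece_plain[of c] by simp
  next
   fix \<epsilon> :: real assume "\<epsilon> > 0" "ALL s l. ht x <= s --> s < ht x + \<epsilon> --> (entry s l : ?y c <-> entry s l : ?y c')"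
   note e = this
   have "entry (ht x) (plain c) : ?y c'" using e(2)[rule_format, of "ht x" "plain c"] e(1) p0[of c] by simp
   from entry_unique[OF y(1) p0 this] show ?thesis by simp
  qed
 qed
 have sub: "range (%c. T.dir_class x (?y c)) <= T.Dirs x (Inr \<theta>)"
 proof (rule image_subsetI)
  fix c
  have "T.dir_inv x (?y c) = Inr \<theta>" using T.dir_inv_limit[OF lim[of c]] ty[of c] by simp
  thus "T.dir_class x (?y c) : T.Dirs x (Inr \<theta>)" unfolding T.Dirs_def using yM[of c] by blast
 qed
 have up: "EX c. same_dir WT sites x z (?y c)" if z: "word z" "z ~= x" "x <= z" "T.dir_inv x z = Inr \<theta>" for z
 proof -
  have zM: "z : mspace WT" using z(1) by simp
  have zl: "limit_dir WT sites x z"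
   using xM zM z(2)
  proof (cases rule: T.direction_cases)
   case (piece P Q)
   thus ?thesis using T.dir_inv_piece[OF piece(1-3) zM piece(4,5)] z(4) by simp
  qed
  have hlt: "ht x < ht z" using sub_ht_less[OF x z(1,3)] z(2) by simp
  obtain l where l: "entry (ht x) l : z" using bd_entry[OF z(1) sub_bd[OF x z(1,3)] hlt] by blast
  have "~ piece_label l"
  proof
   assume pl: "piece_label l"
   obtain c q Q where e: "l = (c, q, Q)" using prod_cases3 by blast
   note q = piece_labelD[OF pl[unfolded e]]
   have Q: "Q : R" "mspace Q ~= {}" using q by auto
   have "site x c Q : sites" unfolding sites_def using x Q by blast
   moreover have "x : site x c Q" unfolding mem_site_iff using q by (intro bexI[of _ "origin Q"]) auto
   ultimately have "gate WT (site x c Q) z = x" using zl unfolding limit_dir_def by blast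
   hence "pt x c Q q = x"
    using gate_site[OF x Q z(1)] coord_eq[OF x Q(1) z(1,3) l[unfolded e] pl[unfolded e]] by simp
   thus False using pt_word(2)[OF x Q(1), of q c] q len_pos[OF pl] len_piece[OF pl[unfolded e]] e by simp
  qed
  then obtain c where lc: "l = plain c" using wordD(3)[OF z(1) l] unfolding label_ok_def by blast
  obtain U' f' \<epsilon> where t': "(U', f') : Q_types R D" and \<epsilon>: "\<epsilon> > 0"
   "ALL s l. ht x <= s --> s < ht x + \<epsilon> --> (entry s l : z <-> entry s l : continuation (ht x) c f')"
   using word_tame[OF z(1)] l unfolding tame_def lc by blast
  have "0 < min (\<epsilon>/2) (ht z - ht x)" using \<epsilon>(1) hlt by simp
  from Q_types_free[OF t' this] obtain r' where r': "0 < r'" "r' < \<epsilon>" "r' <= ht z - ht x" "r' ~: U'" using \<epsilon>(1) by auto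
  have bd: "bd z (ht x + r')"
  proof -
   have "EX l. entry (ht x + r') l : continuation (ht x) c f'"
    using t' less_imp_le[OF r'(1)]
   proof (cases rule: continuation_covers[where t = "ht x" and c = c])
    case (tile a b Q p q)
    have "a = r'"
    using interval_below t' r'(4) tile tile(3) by fastforce
    thus ?thesis using tile(4) by blast
   qed blast
   then obtain k where "entry (ht x + r') k : z" using \<epsilon>(2) r'(1,2) by auto
   thus ?thesis unfolding bd_def by blast
  qed
  define w where "w = cut z (ht x + r')"
  have w: "word w" "ht w = ht x + r'" "w <= z" unfolding w_def using word_cut[OF z(1) bd] cut_subset by auto
  have xw: "x <= w" using cut_mono[of "ht x" "ht x + r'" z] sub_cut[OF x z(1,3)] r'(1) unfolding w_def by simp
  have g': "entry s l : w <-> entry s l : continuation (ht x) c f'" if "ht x <= s" "s < ht x + r'" for s l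
   unfolding w_def cut_mem using \<epsilon>(2)[rule_format, of s l] that r'(2) by simp
  have wl: "limit_dir WT sites x w" and wt: "T.dir_type x w = equivalent_types R D `` {(U', f')}"
   using germ_limit[OF x w(1) xw t' r'(1,4) w(2) g'] germ_type[OF x w(1) xw t' r'(1,4) w(2) g'] by auto
  have wx: "w ~= x" using wl unfolding limit_dir_def by blast
  have "betw WT x w w" "betw WT x w z" unfolding betw_WT
   using x w(1) z(1) wdist_sub[OF x w(1) xw] wdist_sub[OF w(1) z(1) w(3)] wdist_sub[OF x z(1,3)] by auto
  hence wz: "same_dir WT sites x w z" unfolding same_dir_def using xM zM w(1) wx z(2) by auto
  have "Inr \<theta> = (Inr (T.dir_type x w) :: 'q metric + 'q qtype set)"
   using T.dir_inv_same_dir[OF wz] z(4) T.dir_inv_limit[OF wl] by simp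
  hence "((U, f), (U', f')) : equivalent_types R D" using th wt eq_equiv_class_iff[OF equiv_types t t'] by blast
  then obtain r1 where r1: "r1 > 0" "r1 ~: U" "r1 ~: U'" "initial_subtype r1 (U, f) = initial_subtype r1 (U', f')"
   unfolding equivalent_types_def by auto
  have "ALL s l. ht x <= s --> s < ht x + min r1 (min r r') --> (entry s l : w <-> entry s l : ?y c)"
  proof (intro allI impI)
   fix s l assume s: "ht x <= s" "s < ht x + min r1 (min r r')"
   thus "entry s l : w <-> entry s l : ?y c"
    using germ[of s l c] g'[of s l] continuation_agree[OF t t' r1(2,3,4), of s "ht x" l c] by simp
  qed
  moreover have "0 < min r1 (min r r')" using r1(1) r(1) r'(1) by simp
  ultimately have "upward (ht x) w (?y c)" unfolding upward_def by blast
  hence "same_way x w (?y c)" unfolding same_way_def using w(1) y(1,3) xw by blast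
  thus ?thesis using same_way_same_dir[OF x wx yM(2)] T.same_dir_trans[OF T.same_dir_sym[OF wz]] by blast
 qed
 have cls: "T.dir_class x z : range (%c. T.dir_class x (?y c))"
  if z: "word z" "z ~= x" "x <= z" "T.dir_inv x z = Inr \<theta>" for z
 proof -
  obtain c where "same_dir WT sites x z (?y c)" using up[OF z] by blast
  hence "T.dir_class x z = T.dir_class x (?y c)" using T.dir_class_eq_iff[OF xM _ z(2)] z(1) by simp
  thus ?thesis by blast
 qed
 have dn: "T.dir_class x z = T.dir_class x z'" if z: "word z" "~ x <= z" and z': "word z'" "~ x <= z'" for z z'
 proof -
  have ne: "z ~= x" "z' ~= x" using z z' by auto
  have "same_way x z z'" unfolding same_way_def using z z' by blast
  hence "same_dir WT sites x z z'" by (rule same_way_same_dir[OF x ne])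
  thus ?thesis using T.dir_class_eq_iff[OF xM _ ne(1)] z(1) by simp
 qed
 obtain p where "T.Dirs x (Inr \<theta>) <= insert p (range (%c. T.dir_class x (?y c)))"
 proof (cases "EX z. word z & ~ x <= z")
  case True
  then obtain z0 where z0: "word z0" "~ x <= z0" by blast
  have "T.Dirs x (Inr \<theta>) <= insert (T.dir_class x z0) (range (%c. T.dir_class x (?y c)))"
  proof
   fix \<delta> assume "\<delta> : T.Dirs x (Inr \<theta>)"
   then obtain z where z: "word z" "z ~= x" "\<delta> = T.dir_class x z" "T.dir_inv x z = Inr \<theta>" unfolding T.Dirs_def by auto
   show "\<delta> : insert (T.dir_class x z0) (range (%c. T.dir_class x (?y c)))"
    using cls[OF z(1,2) _ z(4)] dn[OF z(1) _ z0] z(3) by blast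
  qed
  thus ?thesis by (rule that)
 next
  case False
  have "T.Dirs x (Inr \<theta>) <= range (%c. T.dir_class x (?y c))"
  proof
   fix \<delta> assume "\<delta> : T.Dirs x (Inr \<theta>)"
   then obtain z where z: "word z" "z ~= x" "\<delta> = T.dir_class x z" "T.dir_inv x z = Inr \<theta>" unfolding T.Dirs_def by auto
   have "x <= z" using False z(1) by blast
   thus "\<delta> : range (%c. T.dir_class x (?y c))" using cls[OF z(1,2) _ z(4)] z(3) by simp
  qed
  thus ?thesis using that[of "{}"] by blast
 qed
 thus ?thesis by (rule eqpoll_real_insert[OF inj sub])
qed

theorem universal_WT: "universal_Q_tree \<Q> R D E WT sites"
 unfolding T.universal_iff_rich T.rich_def
proof (intro conjI ballI)
 show "Q_tree \<Q> WT sites" by (rule Q_tree_WT)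
 show "mcomplete_of WT" by (rule complete_WT)
 fix x \<kappa> assume "x : mspace WT" and \<kappa>: "\<kappa> : T.dir_kinds"
 hence x: "word x" by simp
 from \<kappa> show "T.Dirs x \<kappa> \<approx> (UNIV :: real set)" unfolding T.dir_kinds_def
 proof (elim UnE imageE)
  fix Q assume k: "\<kappa> = Inl Q" and "Q : {Q : R. EX p:mspace Q. EX q:mspace Q. p ~= q}"
  then obtain p q where Q: "Q : R" "p : mspace Q" "q : mspace Q" "p ~= q" by blast
  obtain q0 where q0: "q0 : mspace Q" "q0 ~= origin Q" using Q by (cases "p = origin Q") auto
  have xM: "x : mspace WT" using x by simp
  show ?thesis unfolding k
   by (rule eqpoll_trans[OF eqpoll_sym[OF T.Dirs_piece[OF xM Q]] pieces_at_eqpoll[OF x Q(1) q0]])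
 next
  fix \<theta> assume "\<kappa> = Inr \<theta>" "\<theta> : type_classes R D"
  thus ?thesis using Dirs_limit_eqpoll[OF x] by simp
 qed
qed

end

section \<open>Universal trees\<close>

theorem theorem1p2:
  fixes \<Q> R :: "'q metric set"
    and D :: "'q metric \<Rightarrow> ('q \<times> 'q) set"
    and E :: "'q metric \<Rightarrow> 'q set"
  assumes "\<And>Q. Q \<in> \<Q> \<Longrightarrow>
      homogeneous Q \<and> mcomplete_of Q \<and> geodesic_space Q \<and> mspace Q \<lesssim> (UNIV :: real set)"
    and "canonical_choices \<Q> R D E"
  shows
    "(\<exists>(T :: 'q tree_point metric) \<P>. universal_Q_tree \<Q> R D E T \<P>) \<and>
     (\<forall>(S :: 's metric) \<P>.
        Q_tree \<Q> S \<P> \<and> mspace S \<lesssim> (UNIV :: real set) \<longrightarrow>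
        (\<exists>(T :: 'q tree_point metric) \<P>' f.
           universal_Q_tree \<Q> R D E T \<P>' \<and> isometric_embedding S T f)) \<and>
     (\<forall>(S1 :: 'a metric) \<P>1 (S2 :: 'b metric) \<P>2.
        universal_Q_tree \<Q> R D E S1 \<P>1 \<and> universal_Q_tree \<Q> R D E S2 \<P>2 \<longrightarrow>
        isometric S1 S2)"
proof -
 have ch: "Q_choices \<Q> R D E" by unfold_locales (use assms in auto)
 note W = Q_choices.universal_WT[OF ch]
 show ?thesis using W Q_tree_embeds[OF ch _ _ W] universal_Q_trees_isometric[OF ch] by blast
qed

end
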